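(* Let $\epsilon,\delta$ be constants with $0\le\delta<2\epsilon<1$. Then $\mathsf{BP}_{\epsilon}\mathsf{CL}_{\delta}\mathsf{P}=\mathsf{CL}$.
   Context: A catalytic Turing machine has a read-only input tape, a write-only output tape, a read-write work tape and a read-write catalytic tape which initially holds an arbitrary string $\tau$; an (errorless) catalytic machine must, for every input and every initial $\tau$, halt with exactly $\tau$ on the catalytic tape. $\mathsf{CL}$ is the class of languages decided by deterministic catalytic machines with $O(\log n)$ work space and $n^{O(1)}$ catalytic space (i.e. $\bigcup_k$ of work space $k\log n$, catalytic space $n^k$). A randomized catalytic machine with $c$ catalytic bits additionally has read-only, read-once access to a uniformly random string $r\in\{0,1\}^{2^c}$. For $0\le\delta<1$, $0<\epsilon\le\frac12$, $\mathsf{BP}_{\epsilon}\mathsf{CL}_{\delta}\mathsf{P}$ is the class of languages $L$ for which there is a constant $k$ and a randomized catalytic machine $M$ with $k\log n$ work bits and $n^k$ catalytic bits that always halts within $n^k$ steps and, for every input $x$ and every initial catalytic content $\tau$, outputs $L(x)$ with probability at least $\frac12+\epsilon$ over $r$ and halts with exactly $\tau$ on its catalytic tape with probability at least $1-\delta$ over $r$. *)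

theory Defs
  imports Complex_Main
begin

text \<open>Tapes hold bits. Every tape of length m has endmarker cells at positions 0 and m+1;
  cells 1..m hold the contents. Reading an endmarker yields None, writing to it has no effect,
  and heads never leave the range 0..m+1.\<close>

datatype move = MLeft | MStay | MRight

fun mv :: "move \<Rightarrow> nat \<Rightarrow> nat \<Rightarrow> nat" where
  "mv MLeft i b = i - 1"
| "mv MStay i b = i"
| "mv MRight i b = min (Suc i) b"

definition read_tape :: "bool list \<Rightarrow> nat \<Rightarrow> bool option" where
  "read_tape l i = (if 1 \<le> i \<and> i \<le> length l then Some (l ! (i - 1)) else None)"

definition write_tape :: "bool list \<Rightarrow> nat \<Rightarrow> bool \<Rightarrow> bool list" where
  "write_tape l i b = (if 1 \<le> i \<and> i \<le> length l then l[i - 1 := b] else l)"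

text \<open>Reading the (read-once, one-way) random tape; outside the string it reads False.\<close>
definition read_rand :: "bool list \<Rightarrow> nat \<Rightarrow> bool" where
  "read_rand r i = (if i < length r then r ! i else False)"

record action =
  nxt :: nat
  imove :: move
  wwrite :: bool
  wmove :: move
  cwrite :: bool
  cmove :: move
  radv :: bool

text \<open>Arguments of the transition function: state, input symbol, work symbol,
  catalytic symbol, current random bit. The machine decides: it halts in state
  acc (output 1) or rej (output 0).\<close>
record cmachine =
  nstates :: nat
  start :: nat
  acc :: nat
  rej :: nat
  trans :: "nat \<Rightarrow> bool option \<Rightarrow> bool option \<Rightarrow> bool option \<Rightarrow> bool \<Rightarrow> action"

definition wf_machine :: "cmachine \<Rightarrow> bool" where
  "wf_machine M \<longleftrightarrow> start M < nstates M \<and> acc M < nstates M \<and> rej M < nstates M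
     \<and> acc M \<noteq> rej M
     \<and> (\<forall>q a w c b. nxt (trans M q a w c b) < nstates M)"

definition deterministic :: "cmachine \<Rightarrow> bool" where
  "deterministic M \<longleftrightarrow> (\<forall>q a w c. trans M q a w c True = trans M q a w c False
                                  \<and> \<not> radv (trans M q a w c False))"

record config =
  st :: nat
  ih :: nat
  wt :: "bool list"
  wh :: nat
  ct :: "bool list"
  ch :: nat
  rh :: nat

definition halted :: "cmachine \<Rightarrow> config \<Rightarrow> bool" where
  "halted M c \<longleftrightarrow> st c = acc M \<or> st c = rej M"

definition step :: "cmachine \<Rightarrow> bool list \<Rightarrow> bool list \<Rightarrow> config \<Rightarrow> config" where
  "step M x r c =
    (if halted M c then c else
     (let a = trans M (st c) (read_tape x (ih c)) (read_tape (wt c) (wh c))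
                (read_tape (ct c) (ch c)) (read_rand r (rh c))
      in \<lparr> st = nxt a,
           ih = mv (imove a) (ih c) (Suc (length x)),
           wt = write_tape (wt c) (wh c) (wwrite a),
           wh = mv (wmove a) (wh c) (Suc (length (wt c))),
           ct = write_tape (ct c) (ch c) (cwrite a),
           ch = mv (cmove a) (ch c) (Suc (length (ct c))),
           rh = (if radv a then Suc (rh c) else rh c) \<rparr>))"

definition init :: "cmachine \<Rightarrow> nat \<Rightarrow> bool list \<Rightarrow> config" where
  "init M s tau = \<lparr> st = start M, ih = 0, wt = replicate s False, wh = 0,
                    ct = tau, ch = 0, rh = 0 \<rparr>"

definition run :: "cmachine \<Rightarrow> bool list \<Rightarrow> bool list \<Rightarrow> nat \<Rightarrow> bool list \<Rightarrow> nat \<Rightarrow> config" where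
  "run M x r s tau t = (step M x r ^^ t) (init M s tau)"

text \<open>Resource bounds, with n replaced by n+2 to avoid degenerate small n
  (k log n work bits, n^k catalytic bits, n^k steps).\<close>
definition work_bound :: "nat \<Rightarrow> nat \<Rightarrow> nat" where
  "work_bound k n = k * nat \<lceil>log 2 (real n + 2)\<rceil>"

definition poly_bound :: "nat \<Rightarrow> nat \<Rightarrow> nat" where
  "poly_bound k n = (n + 2) ^ k"

definition prob_rand :: "nat \<Rightarrow> (bool list \<Rightarrow> bool) \<Rightarrow> real" where
  "prob_rand m P = real (card {r. length r = m \<and> P r}) / 2 ^ m"

definition CL :: "bool list set set" where
  "CL = {L. \<exists>k M. wf_machine M \<and> deterministic M \<and>
     (\<forall>x tau. length tau = poly_bound k (length x) \<longrightarrow>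
        (\<exists>t. let c = run M x [] (work_bound k (length x)) tau t in
              halted M c \<and> ct c = tau \<and> (st c = acc M \<longleftrightarrow> x \<in> L)))}"

definition BPCLP :: "real \<Rightarrow> real \<Rightarrow> bool list set set" where
  "BPCLP eps delta = {L. \<exists>k M. wf_machine M \<and>
     (\<forall>x tau. length tau = poly_bound k (length x) \<longrightarrow>
        (let n = length x; s = work_bound k n; T = poly_bound k n;
             m = 2 ^ length tau in
          (\<forall>r. length r = m \<longrightarrow> halted M (run M x r s tau T)) \<and>
          prob_rand m (\<lambda>r. st (run M x r s tau T) = acc M \<longleftrightarrow> x \<in> L) \<ge> 1/2 + eps \<and>
          prob_rand m (\<lambda>r. ct (run M x r s tau T) = tau) \<ge> 1 - delta))}"

end

theory Submission imports Defs
begin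

text \<open>
 Fix a machine with gap \<open>2 * eps - delta\<close> between the probability of ending with the right answer and a
 restored tape, and that of the wrong answer and a restored tape. A block of the catalytic tape is read as a
 tape \<open>tau\<close> for that machine together with rows \<open>a 0, a 1, \<dots>\<close>; a short seed \<open>y\<close> yields the random
 bits \<open>\<langle>a i, y\<rangle>\<close>. For all seeds at once, the configurations leading to a halting configuration with tape
 \<open>tau\<close> are enumerated by a reversible Euler tour of the configuration trees. If a tour is too long, then
 \<open>tau\<close> can be replaced by an inner position of its tour, which has a shorter description; if a row is unbalanced
 on a class of seeds met by the tours, then it can be replaced by its rank among the few unbalanced rows.
 If neither happens, then the block is good: a hybrid argument shows that counting seeds approximates the
 acceptance probability, hence decides the language.

 If no block of the tape is good, then every block is compressible, and each compression frees one bit.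
 The free bits form a virtual block. A deterministic machine runs through its values until it is good, a
 randomized one fills it with random bits, which makes it good with high probability. Finally the
 blocks are decompressed. This one algorithm gives both inclusions: a deterministic catalytic
 machine is the case of no random bits and gap 1.
\<close>

text \<open>Two requirements shape the blocks. A compression has to be undone from what it leaves,
  so row \<open>j\<close> is judged at level \<open>Suc j\<close>, by the part of the trees that
  uses only later bits: this part is unchanged after row \<open>j\<close> has been overwritten. And
  the freed bit has to sit at a fixed place, bit 0 of the block; so the header is displaced into the
  shortened field, and shortening must save all \<open>H\<close> bits of the header. The parameters
  look circular. The number of tour positions grows with the number \<open>2 ^ b\<close> of seeds,
  the tolerated imbalance \<open>D\<close> grows with the number of positions, and
  \<open>2 ^ b\<close> has to dominate \<open>D\<close>. The second moment of an inner product
  resolves this: \<open>D\<close> need only be of the order of the square root of the number of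
  positions, up to a factor that does not depend on the seed length. Hence \<open>2 ^ b\<close> wins
  for a seed length logarithmic in the input length, and all counts stay polynomial. Replacing a
  content by a tour position loses nothing because a tour can be walked back to its start: tours of
  different contents never share a position.\<close>

section \<open>A register language with time and register bounds\<close>

datatype tst = NZ nat | CT | IT | INN | RB

datatype com = Skip | Inc nat | Dec nat | CMv move | CWr bool | IMv move
 | Sq com com (infixr ";;" 60) | Ite tst com com | Wh tst com

record pst =
 regs :: "nat \<Rightarrow> nat"
 tape :: "bool list"
 chd :: nat
 ihd :: nat
 rhd :: nat

fun tval :: "bool list \<Rightarrow> bool list \<Rightarrow> tst \<Rightarrow> pst \<Rightarrow> bool" where
 "tval x r (NZ i) s = (regs s i \<noteq> 0)"
| "tval x r CT s = (read_tape (tape s) (chd s) = Some True)"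
| "tval x r IT s = (read_tape x (ihd s) = Some True)"
| "tval x r INN s = (read_tape x (ihd s) \<noteq> None)"
| "tval x r RB s = read_rand r (rhd s)"

text \<open>The random tape is read once, so testing \<open>RB\<close> consumes the bit that it
  looks at.\<close>

definition tadv :: "tst \<Rightarrow> pst \<Rightarrow> pst" where
 "tadv t s = (if t = RB then s\<lparr>rhd := Suc (rhd s)\<rparr> else s)"

lemma tadv_sel [simp]: "regs (tadv t s) = regs s" "tape (tadv t s) = tape s"
 "chd (tadv t s) = chd s" "ihd (tadv t s) = ihd s"
 by (simp_all add: tadv_def)

text \<open>The number is the running time. \<open>B\<close> bounds what an increment may produce,
  so every register fits into the bits of \<open>B\<close>; an increment beyond \<open>B\<close> and
  a decrement of 0 have no derivation.\<close>

inductive bs :: "nat \<Rightarrow> bool list \<Rightarrow> bool list \<Rightarrow> com \<Rightarrow> pst \<Rightarrow> nat \<Rightarrow> pst \<Rightarrow> bool"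
 for B :: nat and x r :: "bool list" where
 bs_Skip: "bs B x r Skip s 1 s"
| bs_Inc: "regs s i < B ==> bs B x r (Inc i) s 1 (s\<lparr>regs := (regs s)(i := Suc (regs s i))\<rparr>)"
| bs_Dec: "regs s i > 0 ==> bs B x r (Dec i) s 1 (s\<lparr>regs := (regs s)(i := regs s i - 1)\<rparr>)"
| bs_CMv: "bs B x r (CMv d) s 1 (s\<lparr>chd := mv d (chd s) (Suc (length (tape s)))\<rparr>)"
| bs_CWr: "bs B x r (CWr v) s 1 (s\<lparr>tape := write_tape (tape s) (chd s) v\<rparr>)"
| bs_IMv: "bs B x r (IMv d) s 1 (s\<lparr>ihd := mv d (ihd s) (Suc (length x))\<rparr>)"
| bs_Sq: "bs B x r a s t1 s1 ==> bs B x r b s1 t2 s2 ==> bs B x r (a ;; b) s (Suc (t1 + t2)) s2"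
| bs_IteT: "tval x r t s ==> bs B x r a (tadv t s) t1 s1 ==> bs B x r (Ite t a b) s (Suc t1) s1"
| bs_IteF: "\<not> tval x r t s ==> bs B x r b (tadv t s) t1 s1 ==> bs B x r (Ite t a b) s (Suc t1) s1"
| bs_WhT: "tval x r t s ==> bs B x r a (tadv t s) t1 s1 ==> bs B x r (Wh t a) s1 t2 s2
  ==> bs B x r (Wh t a) s (Suc (t1 + t2)) s2"
| bs_WhF: "\<not> tval x r t s ==> bs B x r (Wh t a) s 1 (tadv t s)"

fun tst_below :: "nat \<Rightarrow> tst \<Rightarrow> bool" where
 "tst_below m (NZ i) = (i < m)"
| "tst_below m _ = True"

fun com_below :: "nat \<Rightarrow> com \<Rightarrow> bool" where
 "com_below m (Inc i) = (i < m)"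
| "com_below m (Dec i) = (i < m)"
| "com_below m (a ;; b) = (com_below m a \<and> com_below m b)"
| "com_below m (Ite t a b) = (tst_below m t \<and> com_below m a \<and> com_below m b)"
| "com_below m (Wh t a) = (tst_below m t \<and> com_below m a)"
| "com_below m _ = True"

fun no_rand :: "com \<Rightarrow> bool" where
 "no_rand (a ;; b) = (no_rand a \<and> no_rand b)"
| "no_rand (Ite t a b) = (t \<noteq> RB \<and> no_rand a \<and> no_rand b)"
| "no_rand (Wh t a) = (t \<noteq> RB \<and> no_rand a)"
| "no_rand _ = True"

lemma tst_below_mono: "tst_below m t ==> m \<le> m' ==> tst_below m' t"
 by (cases t) auto

lemma com_below_mono: "com_below m c ==> m \<le> m' ==> com_below m' c"
 by (induction c) (auto intro: tst_below_mono)

lemma com_below_ex: "\<exists>m. com_below m c"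
proof (induction c)
 case (Inc i) show ?case by (rule exI[of _ "Suc i"]) simp
next
 case (Dec i) show ?case by (rule exI[of _ "Suc i"]) simp
next
 case (Sq a b)
 then obtain m m' where "com_below m a" "com_below m' b" by blast
 then have "com_below (max m m') (Sq a b)" by (auto intro: com_below_mono)
 then show ?case by blast
next
 case (Ite t a b)
 then obtain m m' where "com_below m a" "com_below m' b" by blast
 moreover obtain k where "tst_below k t" by (cases t) (auto intro: that[of "Suc _"])
 ultimately have "com_below (max k (max m m')) (Ite t a b)"
  by (auto intro: com_below_mono tst_below_mono)
 then show ?case by blast
next
 case (Wh t a)
 then obtain m where "com_below m a" by blast
 moreover obtain k where "tst_below k t" by (cases t) (auto intro: that[of "Suc _"])
 ultimately have "com_below (max k m) (Wh t a)"
  by (auto intro: com_below_mono tst_below_mono)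
 then show ?case by blast
qed simp_all

section \<open>Compilation of programs into catalytic machines\<close>

text \<open>\<open>Go j\<close> counts the cells still to be skipped before the next bit of the
  scanned register, and \<open>Back f\<close> carries the outcome of a scan to the left end of the
  work tape.\<close>

datatype phase = Ready | Go nat | Back bool | Acc | Rej

type_synonym cstate = "phase \<times> com list"

text \<open>Register operations are scans of the bits of one register from the low end: while the bit
 equals the first flag it is passed over, and every visited bit is flipped if the second flag is
 set. The empty stack decides by testing register 0.\<close>

fun scn :: "com list \<Rightarrow> (nat \<times> bool \<times> bool) option" where
 "scn [] = Some (0, False, False)"
| "scn (Inc i # _) = Some (i, True, True)"
| "scn (Dec i # _) = Some (i, False, True)"
| "scn (Ite (NZ i) _ _ # _) = Some (i, False, False)"
| "scn (Wh (NZ i) _ # _) = Some (i, False, False)"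
| "scn _ = None"

fun aft :: "bool \<Rightarrow> com list \<Rightarrow> cstate" where
 "aft f [] = (if f then Acc else Rej, [])"
| "aft f ((a ;; b) # ks) = (Ready, a # b # ks)"
| "aft f (Ite t a b # ks) = (Ready, (if f then a else b) # ks)"
| "aft f (Wh t a # ks) = (Ready, if f then a # Wh t a # ks else ks)"
| "aft f (_ # ks) = (Ready, ks)"

fun tsym :: "com list \<Rightarrow> bool option \<Rightarrow> bool option \<Rightarrow> bool \<Rightarrow> bool" where
 "tsym (Ite CT _ _ # _) a c b = (c = Some True)"
| "tsym (Wh CT _ # _) a c b = (c = Some True)"
| "tsym (Ite IT _ _ # _) a c b = (a = Some True)"
| "tsym (Wh IT _ # _) a c b = (a = Some True)"
| "tsym (Ite INN _ _ # _) a c b = (a \<noteq> None)"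
| "tsym (Wh INN _ # _) a c b = (a \<noteq> None)"
| "tsym (Ite RB _ _ # _) a c b = b"
| "tsym (Wh RB _ # _) a c b = b"
| "tsym _ a c b = False"

text \<open>A machine step always writes, so a cell is left alone by writing back what was read. On
  an endmarker writing has no effect and the default is harmless.\<close>

definition kb :: "bool option \<Rightarrow> bool" where "kb w = (w = Some True)"

text \<open>Between commands the work head rests on the left endmarker. Bit \<open>j\<close> of
  register \<open>i\<close> is in cell \<open>i + m * j + 1\<close>: one move and
  \<open>Go i\<close> reach its lowest bit, one move and \<open>Go (m - 1)\<close> the next bit.
  Meeting the right endmarker means that all bits were passed over.\<close>

fun tact :: "nat \<Rightarrow> cstate \<Rightarrow> bool option \<Rightarrow> bool option \<Rightarrow> bool option \<Rightarrow> bool \<Rightarrow>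
  cstate \<times> move \<times> bool \<times> move \<times> bool \<times> move \<times> bool" where
 "tact m (Ready, ks) a w c b = (case scn ks of
   Some (i, _) \<Rightarrow> ((Go i, ks), MStay, kb w, MRight, kb c, MStay, False)
  | None \<Rightarrow> (aft (tsym ks a c b) ks,
    (case ks of IMv d # _ \<Rightarrow> d | _ \<Rightarrow> MStay), kb w, MStay,
    (case ks of CWr v # _ \<Rightarrow> v | _ \<Rightarrow> kb c),
    (case ks of CMv d # _ \<Rightarrow> d | _ \<Rightarrow> MStay),
    (case ks of Ite RB _ _ # _ \<Rightarrow> True | Wh RB _ # _ \<Rightarrow> True | _ \<Rightarrow> False)))"
| "tact m (Go (Suc j), ks) a w c b = ((Go j, ks), MStay, kb w, MRight, kb c, MStay, False)"
| "tact m (Go 0, ks) a w c b = (case w of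
   None \<Rightarrow> ((Back False, ks), MStay, False, MLeft, kb c, MStay, False)
  | Some v \<Rightarrow> (case scn ks of
    Some (i, cb, fl) \<Rightarrow> (if v = cb then ((Go (m - 1), ks), MStay, v \<noteq> fl, MRight, kb c, MStay, False)
     else ((Back True, ks), MStay, v \<noteq> fl, MStay, kb c, MStay, False))
   | None \<Rightarrow> ((Back False, ks), MStay, v, MStay, kb c, MStay, False)))"
| "tact m (Back f, ks) a w c b = (case w of
   None \<Rightarrow> (aft f ks, MStay, False, MStay, kb c, MStay, False)
  | Some v \<Rightarrow> ((Back f, ks), MStay, v, MLeft, kb c, MStay, False))"
| "tact m (Acc, ks) a w c b = ((Acc, ks), MStay, kb w, MStay, kb c, MStay, False)"
| "tact m (Rej, ks) a w c b = ((Rej, ks), MStay, kb w, MStay, kb c, MStay, False)"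

type_synonym acfg = "cstate \<times> nat \<times> bool list \<times> nat \<times> bool list \<times> nat \<times> nat"

fun astep :: "nat \<Rightarrow> bool list \<Rightarrow> bool list \<Rightarrow> acfg \<Rightarrow> acfg" where
 "astep m x r (\<sigma>, i, W, p, T, q, k) =
  (case tact m \<sigma> (read_tape x i) (read_tape W p) (read_tape T q) (read_rand r k) of
   (\<sigma>', im, ww, wm, cw, cm, ra) \<Rightarrow>
    (\<sigma>', mv im i (Suc (length x)), write_tape W p ww, mv wm p (Suc (length W)),
     write_tape T q cw, mv cm q (Suc (length T)), if ra then Suc k else k))"

lemma kb_Some [simp]: "kb (Some b) = b"
 by (simp add: kb_def)

lemma write_kb [simp]: "write_tape W p (kb (read_tape W p)) = W"
 by (auto simp: write_tape_def read_tape_def kb_def)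

text \<open>The stacks that can occur while \<open>c\<close> runs on top of \<open>ks\<close>. A
  loop body is pushed onto its own loop instead of being unfolded, which keeps the set finite; it
  becomes the finite control.\<close>

fun reach :: "com \<Rightarrow> com list \<Rightarrow> com list set" where
 "reach (a ;; b) ks = insert ((a ;; b) # ks) (reach a (b # ks) \<union> reach b ks)"
| "reach (Ite t a b) ks = insert (Ite t a b # ks) (reach a ks \<union> reach b ks)"
| "reach (Wh t a) ks = insert (Wh t a # ks) (reach a (Wh t a # ks))"
| "reach c ks = {c # ks}"

lemma reach_self: "c # ks \<in> reach c ks"
 by (cases c) auto

lemma finite_reach: "finite (reach c ks)"
 by (induction c arbitrary: ks) auto

lemma reach_aft: "ls \<in> reach c ks ==> snd (aft f ls) \<in> insert ks (reach c ks)"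
proof (induction c arbitrary: ks)
 case (Sq a b)
 then show ?case using reach_self[of a "b # ks"] reach_self[of b ks]
  by (auto dest!: Sq.IH)
next
 case (Ite t a b)
 then show ?case using reach_self[of a ks] reach_self[of b ks]
  by (auto dest!: Ite.IH)
next
 case (Wh t a)
 then show ?case using reach_self[of a "Wh t a # ks"]
  by (cases "ls = Wh t a # ks") (auto dest!: Wh.IH)
qed auto

lemma reach_below: "ls \<in> reach c ks ==> com_below m c ==> list_all (com_below m) ks
  ==> list_all (com_below m) ls"
 by (induction c arbitrary: ks) fastforce+

lemma reach_no_rand: "ls \<in> reach c ks ==> no_rand c ==> list_all no_rand ks
  ==> list_all no_rand ls"
 by (induction c arbitrary: ks) fastforce+

definition stacks :: "com \<Rightarrow> com list set" where
 "stacks P = insert [] (reach P [])"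

definition cstates :: "nat \<Rightarrow> com \<Rightarrow> cstate set" where
 "cstates m P = ({Ready, Acc, Rej} \<union> range Back \<union> Go ` {..m}) \<times> stacks P"

lemma finite_cstates: "finite (cstates m P)"
 by (simp add: cstates_def stacks_def finite_reach)

lemma aft_stacks: "ls \<in> stacks P ==> aft f ls \<in> cstates m P"
proof -
 assume a: "ls \<in> stacks P"
 have "fst (aft f ls) \<in> {Ready, Acc, Rej}" by (induction f ls rule: aft.induct) auto
 moreover have "snd (aft f ls) \<in> stacks P"
  using a reach_aft[of ls P "[]" f] by (cases "ls = []") (auto simp: stacks_def)
 ultimately show ?thesis by (cases "aft f ls") (auto simp: cstates_def)
qed

lemma scn_below: "ls \<in> stacks P ==> com_below m P ==> 0 < m ==> scn ls = Some (i, z) ==> i < m"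
proof -
 assume a: "ls \<in> stacks P" "com_below m P" "0 < m" "scn ls = Some (i, z)"
 have "list_all (com_below m) ls" using a reach_below[of ls P "[]" m] by (auto simp: stacks_def)
 then show "i < m" using a(3,4) by (induction ls rule: scn.induct) auto
qed

lemma tact_closed:
 assumes "\<sigma> \<in> cstates m P" "com_below m P" "0 < m"
 shows "fst (tact m \<sigma> a w c b) \<in> cstates m P"
proof -
 obtain p ls where \<sigma>: "\<sigma> = (p, ls)" "ls \<in> stacks P" using assms(1) by (auto simp: cstates_def)
 show ?thesis
 proof (cases p)
  case Ready
  then show ?thesis using \<sigma> assms scn_below[OF \<sigma>(2) assms(2,3)] aft_stacks[OF \<sigma>(2)]
   by (auto split: option.splits simp: less_imp_le) (auto simp: cstates_def less_imp_le)
 next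
  case (Go j)
  then show ?thesis using \<sigma> assms
   by (cases j) (auto split: option.splits simp: cstates_def)
 next
  case (Back f)
  then show ?thesis using \<sigma> assms aft_stacks[OF \<sigma>(2)]
   by (auto split: option.splits simp: cstates_def)
 qed (use \<sigma> assms in \<open>auto simp: cstates_def\<close>)
qed

lemma tact_det:
 assumes "\<sigma> \<in> cstates m P" "no_rand P"
 shows "tact m \<sigma> a w c True = tact m \<sigma> a w c False"
  "\<not> snd (snd (snd (snd (snd (snd (tact m \<sigma> a w c b))))))"
proof -
 obtain p ls where \<sigma>: "\<sigma> = (p, ls)" "ls \<in> stacks P" using assms(1) by (auto simp: cstates_def)
 have nr: "list_all no_rand ls" using \<sigma>(2) assms(2) reach_no_rand[of ls P "[]"] by (auto simp: stacks_def)
 then have "tsym ls a c True = tsym ls a c False"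
  by (induction ls a c True rule: tsym.induct) auto
 then show "tact m \<sigma> a w c True = tact m \<sigma> a w c False"
  using \<sigma> by (induction m \<sigma> a w c True rule: tact.induct) (auto split: option.splits)
 have "\<not> (case ls of Ite RB _ _ # _ \<Rightarrow> True | Wh RB _ # _ \<Rightarrow> True | _ \<Rightarrow> False)"
  using nr by (auto split: list.splits com.splits tst.splits)
 then show "\<not> snd (snd (snd (snd (snd (snd (tact m \<sigma> a w c b))))))"
  using \<sigma> by (induction m \<sigma> a w c b rule: tact.induct) (auto split: option.splits if_splits)
qed

text \<open>\<open>wf_machine\<close> speaks of every number as a state. Numbers that code no
  control state are sent to the accepting state only to keep \<open>nxt\<close> in range.\<close>

definition mk_machine :: "nat \<Rightarrow> com \<Rightarrow> (cstate \<Rightarrow> nat) \<Rightarrow> cmachine" where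
 "mk_machine m P f = \<lparr> nstates = card (cstates m P), start = f (Ready, [P]),
   acc = f (Acc, []), rej = f (Rej, []),
   trans = (\<lambda>q a w c b. if q < card (cstates m P) then
     (case tact m (inv_into (cstates m P) f q) a w c b of
      (\<sigma>, im, ww, wm, cw, cm, ra) \<Rightarrow>
       \<lparr> nxt = f \<sigma>, imove = im, wwrite = ww, wmove = wm, cwrite = cw, cmove = cm, radv = ra \<rparr>)
    else \<lparr> nxt = f (Acc, []), imove = MStay, wwrite = False, wmove = MStay, cwrite = False,
       cmove = MStay, radv = False \<rparr>) \<rparr>"

fun cfg :: "(cstate \<Rightarrow> nat) \<Rightarrow> acfg \<Rightarrow> config" where
 "cfg f (\<sigma>, i, W, p, T, q, k) = \<lparr> st = f \<sigma>, ih = i, wt = W, wh = p, ct = T, ch = q, rh = k \<rparr>"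

locale compiled =
 fixes m :: nat and P :: com and f :: "cstate \<Rightarrow> nat"
 assumes below: "com_below m P" and mpos: "0 < m"
  and bij: "bij_betw f (cstates m P) {0..<card (cstates m P)}"
begin

lemma f_less: "\<sigma> \<in> cstates m P ==> f \<sigma> < card (cstates m P)"
 using bij by (auto dest: bij_betwE)

lemma inv_f: "\<sigma> \<in> cstates m P ==> inv_into (cstates m P) f (f \<sigma>) = \<sigma>"
 using bij by (simp add: bij_betw_inv_into_left)

lemma f_eq: "\<sigma> \<in> cstates m P ==> \<sigma>' \<in> cstates m P ==> f \<sigma> = f \<sigma>' \<longleftrightarrow> \<sigma> = \<sigma>'"
 using bij by (auto simp: bij_betw_def inj_on_def)

lemma final_in: "(Acc, []) \<in> cstates m P" "(Rej, []) \<in> cstates m P" "(Ready, [P]) \<in> cstates m P"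
 by (auto simp: cstates_def stacks_def reach_self)

lemma wf_mk: "wf_machine (mk_machine m P f)"
proof -
 have "f (fst (tact m (inv_into (cstates m P) f q) a w c b)) < card (cstates m P)"
  if "q < card (cstates m P)" for q a w c b
 proof -
  have "inv_into (cstates m P) f q \<in> cstates m P"
   using that bij by (intro inv_into_into) (auto simp: bij_betw_def)
  then show ?thesis using below mpos by (intro f_less tact_closed)
 qed
 then show ?thesis using f_less final_in f_eq[OF final_in(1,2)]
  by (auto simp: wf_machine_def mk_machine_def split: prod.split) (metis fst_conv)
qed

lemma det_mk:
 assumes "no_rand P"
 shows "deterministic (mk_machine m P f)"
proof -
 have in_S: "inv_into (cstates m P) f q \<in> cstates m P" if "q < card (cstates m P)" for q
  using that bij by (intro inv_into_into) (auto simp: bij_betw_def)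
 show ?thesis unfolding deterministic_def
 proof (intro allI conjI)
  fix q a w c
  show "trans (mk_machine m P f) q a w c True = trans (mk_machine m P f) q a w c False"
   using tact_det(1)[OF in_S assms] by (simp add: mk_machine_def)
  show "\<not> radv (trans (mk_machine m P f) q a w c False)"
   using tact_det(2)[OF in_S assms, of q a w c False]
   by (auto simp: mk_machine_def split: prod.split)
 qed
qed

lemma halted_cfg:
 assumes "\<sigma> \<in> cstates m P"
 shows "halted (mk_machine m P f) (cfg f (\<sigma>, z)) \<longleftrightarrow> \<sigma> = (Acc, []) \<or> \<sigma> = (Rej, [])"
 using assms final_in f_eq by (cases z) (auto simp: halted_def mk_machine_def)

lemma step_cfg:
 assumes "\<sigma> \<in> cstates m P"
 shows "step (mk_machine m P f) x r (cfg f (\<sigma>, z)) = cfg f (astep m x r (\<sigma>, z))"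
proof (cases "\<sigma> = (Acc, []) \<or> \<sigma> = (Rej, [])")
 case True
 then have "halted (mk_machine m P f) (cfg f (\<sigma>, z))" using halted_cfg[OF assms] by simp
 then show ?thesis using True by (cases z) (auto simp: step_def)
next
 case False
 then have "\<not> halted (mk_machine m P f) (cfg f (\<sigma>, z))" using halted_cfg[OF assms] by simp
 then show ?thesis using assms f_less[OF assms] inv_f[OF assms]
  by (cases z) (auto simp: step_def Let_def mk_machine_def split: prod.split)
qed

lemma astep_closed:
 assumes "\<sigma> \<in> cstates m P"
 shows "fst (astep m x r (\<sigma>, z)) \<in> cstates m P"
 using tact_closed[OF assms below mpos] by (cases z) (auto split: prod.split, metis fst_conv)

lemma steps_cfg:
 assumes "fst s \<in> cstates m P"
 shows "(step (mk_machine m P f) x r ^^ n) (cfg f s) = cfg f ((astep m x r ^^ n) s)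
  \<and> fst ((astep m x r ^^ n) s) \<in> cstates m P"
proof (induction n)
 case (Suc n)
 then show ?case using step_cfg[of "fst ((astep m x r ^^ n) s)" x r "snd ((astep m x r ^^ n) s)"]
   astep_closed[of "fst ((astep m x r ^^ n) s)" x r "snd ((astep m x r ^^ n) s)"] by simp
qed (use assms in simp)

end

section \<open>Binary registers interleaved on the work tape\<close>

text \<open>A carry turns the low ones into zeros and the first zero into a one: this is the scan
  that passes over ones and flips all that it visits.\<close>

lemma inc_bits:
 "\<forall>i<j. bit v i ==> \<not> bit v j ==>
  bit (Suc v) i = (if i < j then False else if i = j then True else bit (v::nat) i)"
proof (induction j arbitrary: v i)
 case 0
 then have "even v" by (simp add: bit_0)
 then show ?case by (cases i) (auto simp: bit_0 bit_Suc)
next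
 case (Suc j)
 have o: "odd v" using Suc.prems(1) by (auto simp: bit_0 dest: spec[of _ 0])
 then have d: "Suc v div 2 = Suc (v div 2)" by presburger
 have "bit (Suc (v div 2)) i' = (if i' < j then False else if i' = j then True else bit (v div 2) i')" for i'
  using Suc.prems by (intro Suc.IH) (auto simp: bit_Suc)
 then show ?case using o d by (cases i) (auto simp: bit_0 bit_Suc)
qed

lemma dec_bits:
 "\<forall>i<j. \<not> bit v i ==> bit v j ==>
  bit (v - Suc 0) i = (if i < j then True else if i = j then False else bit (v::nat) i)"
proof (induction j arbitrary: v i)
 case 0
 then have "odd v" by (simp add: bit_0)
 then show ?case by (cases i) (auto simp: bit_0 bit_Suc elim!: oddE)
next
 case (Suc j)
 have o: "even v" using Suc.prems(1) by (auto simp: bit_0 dest: spec[of _ 0])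
 have "v \<noteq> 0" using Suc.prems(2) by (cases "v = 0") auto
 with o have d: "(v - Suc 0) div 2 = v div 2 - Suc 0" "odd (v - Suc 0)" by presburger+
 have "bit (v div 2 - Suc 0) i' = (if i' < j then True else if i' = j then False else bit (v div 2) i')" for i'
  using Suc.prems by (intro Suc.IH) (auto simp: bit_Suc)
 then show ?case using o d by (cases i) (auto simp: bit_0 bit_Suc)
qed

lemma bit_less_pow: "bit (v::nat) j ==> v < 2 ^ w ==> j < w"
 by (metis bit_take_bit_iff take_bit_nat_eq_self)

lemma nz_bit: "(v::nat) < 2 ^ w ==> v \<noteq> 0 \<longleftrightarrow> (\<exists>j<w. bit v j)"
 using bit_less_pow[of v _ w] by (metis bit_0_eq bit_eqI bot_apply bot_bool_def)

lemma zero_bit: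
 assumes "Suc v < 2 ^ w" shows "\<exists>j<w. \<not> bit (v::nat) j"
proof (rule ccontr)
 assume "\<not> ?thesis"
 then have "v = mask w"
  using bit_less_pow[of v _ w] assms by (intro bit_eqI) (auto simp: bit_mask_iff)
 then show False using assms by (simp add: mask_eq_exp_minus_1)
qed

text \<open>The work tape after a scan of register \<open>i\<close> has visited its \<open>j\<close>
  lowest bits.\<close>

definition flips :: "bool list \<Rightarrow> nat \<Rightarrow> nat \<Rightarrow> nat \<Rightarrow> bool \<Rightarrow> bool list" where
 "flips W i m j fl = map (\<lambda>p. if fl \<and> (\<exists>j'<j. p = i + m * j') then \<not> W ! p else W ! p) [0..<length W]"

lemma length_flips [simp]: "length (flips W i m j fl) = length W"
 by (simp add: flips_def)

lemma flips_0 [simp]: "flips W i m 0 fl = W"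
 by (auto simp: flips_def intro: nth_equalityI)

lemma idx_eq:
 assumes "(i::nat) < m" "i' < m" shows "i + m * j = i' + m * j' \<longleftrightarrow> i = i' \<and> j = j'"
proof
 assume a: "i + m * j = i' + m * j'"
 then have "(i + m * j) mod m = (i' + m * j') mod m" "(i + m * j) div m = (i' + m * j') div m" by auto
 then show "i = i' \<and> j = j'" using assms by auto
qed auto

lemma idx_less: "(i::nat) < m ==> j < w ==> i + m * j < m * w"
proof -
 assume "i < m" "j < w"
 then have "i + m * j < m * Suc j" by simp
 also have "\<dots> \<le> m * w" using \<open>j < w\<close> by (intro mult_le_mono2) simp
 finally show ?thesis .
qed

lemma flips_Suc:
 assumes "i < m" "i + m * j < length W"
 shows "flips W i m (Suc j) fl = (flips W i m j fl)[i + m * j := (W ! (i + m * j) \<noteq> fl)]"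
 using assms by (intro nth_equalityI) (auto simp: flips_def nth_list_update less_Suc_eq idx_eq)

lemma nth_flips:
 assumes "i < m" "i' < m" "i' + m * j' < length W"
 shows "flips W i m j fl ! (i' + m * j') = (if fl \<and> i' = i \<and> j' < j then \<not> W ! (i' + m * j') else W ! (i' + m * j'))"
 using assms by (auto simp: flips_def idx_eq)

lemma funpow_trans: "(f ^^ a) s = s1 ==> (f ^^ b) s1 = s2 ==> (f ^^ (a + b)) s = s2"
 by (simp add: funpow_add add.commute[of a b])

lemma go_steps:
 "p \<le> Suc (length W) ==>
  (astep m x r ^^ j) ((Go j, ks), a, W, p, T, q, k) = ((Go 0, ks), a, W, min (p + j) (Suc (length W)), T, q, k)"
proof (induction j arbitrary: p)
 case (Suc j)
 have "astep m x r ((Go (Suc j), ks), a, W, p, T, q, k) = ((Go j, ks), a, W, min (Suc p) (Suc (length W)), T, q, k)"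
  by simp
 then show ?case using Suc by (simp add: funpow_Suc_right del: funpow.simps astep.simps)
qed auto

lemma back_steps:
 "p \<le> length W ==>
  (astep m x r ^^ Suc p) ((Back f, ks), a, W, p, T, q, k) = (aft f ks, a, W, 0, T, q, k)"
proof (induction p)
 case 0
 then show ?case by (auto simp: read_tape_def write_tape_def)
next
 case (Suc p)
 have "astep m x r ((Back f, ks), a, W, Suc p, T, q, k) = ((Back f, ks), a, W, p, T, q, k)"
  using Suc.prems by (auto simp: read_tape_def write_tape_def)
 then show ?case using Suc by (simp add: funpow_Suc_right del: funpow.simps astep.simps)
qed

lemma scan_loop:
 assumes "scn ks = Some (i, cb, fl)" "i < m" "length W = m * w" "0 < w"
 shows "j \<le> w ==> \<forall>j'<j. W ! (i + m * j') = cb ==>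
  (astep m x r ^^ (m * j)) ((Go 0, ks), a, W, Suc i, T, q, k)
   = ((Go 0, ks), a, flips W i m j fl, min (Suc i + m * j) (Suc (length W)), T, q, k)"
proof (induction j)
 case 0
 have "m * 1 \<le> m * w" using assms(4) by (intro mult_le_mono2) simp
 then have "i < m * w" using assms(2) by linarith
 then show ?case using assms by simp
next
 case (Suc j)
 let ?W = "flips W i m j fl"
 have l: "i + m * j < length W" using idx_less[of i m j w] assms Suc.prems by simp
 have v: "?W ! (i + m * j) = cb" using Suc.prems nth_flips[of i m i j W j fl] assms l by simp
 have v': "W ! (i + m * j) = cb" using Suc.prems by simp
 have IH: "(astep m x r ^^ (m * j)) ((Go 0, ks), a, W, Suc i, T, q, k)
   = ((Go 0, ks), a, ?W, Suc i + m * j, T, q, k)"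
  using Suc l by simp
 have 1: "astep m x r ((Go 0, ks), a, ?W, Suc i + m * j, T, q, k)
  = ((Go (m - 1), ks), a, flips W i m (Suc j) fl, Suc (Suc i + m * j), T, q, k)"
  using l v v' assms flips_Suc[OF assms(2) l, of fl] by (simp add: read_tape_def write_tape_def)
 have "(astep m x r ^^ (m * Suc j)) ((Go 0, ks), a, W, Suc i, T, q, k)
   = (astep m x r ^^ m) ((Go 0, ks), a, ?W, Suc i + m * j, T, q, k)"
  using IH by (simp add: funpow_add del: astep.simps)
 also have "\<dots> = (astep m x r ^^ (m - 1)) (astep m x r ((Go 0, ks), a, ?W, Suc i + m * j, T, q, k))"
  using assms(2) by (cases m) (simp_all add: funpow_Suc_right del: funpow.simps astep.simps)
 also have "\<dots> = ((Go 0, ks), a, flips W i m (Suc j) fl, min (Suc (Suc i + m * j) + (m - 1)) (Suc (length W)), T, q, k)"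
  unfolding 1 using l by (subst go_steps) auto
 finally show ?case using assms(2) by (simp add: algebra_simps)
qed

lemma scan_start:
 assumes "scn ks = Some (i, cb, fl)" "i < m" "length W = m * w" "j \<le> w" "\<forall>j'<j. W ! (i + m * j') = cb"
 shows "(astep m x r ^^ Suc (i + m * j)) ((Ready, ks), a, W, 0, T, q, k)
   = ((Go 0, ks), a, flips W i m j fl, min (Suc i + m * j) (Suc (length W)), T, q, k)"
proof (cases "w = 0")
 case False
 then have "m \<le> m * w" by simp
 then have il: "i < length W" using assms(2,3) by linarith
 have "astep m x r ((Ready, ks), a, W, 0, T, q, k) = ((Go i, ks), a, W, 1, T, q, k)"
  using assms(1) by simp
 then have "(astep m x r ^^ Suc i) ((Ready, ks), a, W, 0, T, q, k) = ((Go 0, ks), a, W, Suc i, T, q, k)"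
  using go_steps[of 1 W i m x r ks a T q k] il by (simp add: funpow_Suc_right del: funpow.simps astep.simps)
 from funpow_trans[OF this scan_loop[OF assms(1-3) _ assms(4,5)]] show ?thesis
  using False by (simp add: algebra_simps del: funpow.simps astep.simps)
next
 case True
 then have W: "W = []" "j = 0" using assms by auto
 have "astep m x r ((Ready, ks), a, W, 0, T, q, k) = ((Go i, ks), a, W, 1, T, q, k)"
  using assms(1) by simp
 then show ?thesis using go_steps[of 1 W i m x r ks a T q k] W
  by (simp add: funpow_Suc_right del: funpow.simps astep.simps)
qed

text \<open>The way out and the way back over \<open>m * w\<close> cells, with up to
  \<open>m\<close> further steps of a count that runs into the right end.\<close>

definition scan_cost :: "nat \<Rightarrow> nat \<Rightarrow> nat" where "scan_cost m w = 2 * (m * w) + 2 * m + 4"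

lemma scan_found:
 assumes "scn ks = Some (i, cb, fl)" "i < m" "length W = m * w" "j < w"
  "\<forall>j'<j. W ! (i + m * j') = cb" "W ! (i + m * j) \<noteq> cb"
 shows "\<exists>n\<le>scan_cost m w. (astep m x r ^^ n) ((Ready, ks), a, W, 0, T, q, k)
   = (aft True ks, a, flips W i m (Suc j) fl, 0, T, q, k)"
proof -
 let ?W = "flips W i m j fl"
 have l: "i + m * j < length W" using idx_less[of i m j w] assms by simp
 have v: "?W ! (i + m * j) \<noteq> cb" using nth_flips[of i m i j W j fl] assms l by simp
 have v2: "?W ! (i + m * j) = W ! (i + m * j)" using nth_flips[of i m i j W j fl] assms l by simp
 have 1: "(astep m x r ^^ Suc (i + m * j)) ((Ready, ks), a, W, 0, T, q, k)
   = ((Go 0, ks), a, ?W, Suc i + m * j, T, q, k)"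
  using scan_start[OF assms(1-3) _ assms(5), of x r a T q k] assms(4) l by simp
 have 2: "astep m x r ((Go 0, ks), a, ?W, Suc i + m * j, T, q, k)
  = ((Back True, ks), a, flips W i m (Suc j) fl, Suc i + m * j, T, q, k)"
  using l v v2 assms flips_Suc[OF assms(2) l, of fl] by (simp add: read_tape_def write_tape_def)
 have 3: "(astep m x r ^^ Suc (Suc i + m * j)) ((Back True, ks), a, flips W i m (Suc j) fl, Suc i + m * j, T, q, k)
  = (aft True ks, a, flips W i m (Suc j) fl, 0, T, q, k)"
  using l by (intro back_steps) simp
 have one: "astep m x r ^^ 1 = astep m x r" by (simp add: fun_eq_iff)
 let ?n = "Suc (Suc i + m * j) + (1 + Suc (i + m * j))"
 have "(astep m x r ^^ ?n) ((Ready, ks), a, W, 0, T, q, k) = (aft True ks, a, flips W i m (Suc j) fl, 0, T, q, k)"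
  unfolding funpow_add comp_apply 1 one 2 3 ..
 moreover have "?n \<le> scan_cost m w" using l assms unfolding scan_cost_def by simp
 ultimately show ?thesis by blast
qed

lemma scan_none:
 assumes "scn ks = Some (i, cb, fl)" "i < m" "length W = m * w" "\<forall>j'<w. W ! (i + m * j') = cb"
 shows "\<exists>n\<le>scan_cost m w. (astep m x r ^^ n) ((Ready, ks), a, W, 0, T, q, k)
   = (aft False ks, a, flips W i m w fl, 0, T, q, k)"
proof -
 let ?W = "flips W i m w fl"
 have 1: "(astep m x r ^^ Suc (i + m * w)) ((Ready, ks), a, W, 0, T, q, k)
   = ((Go 0, ks), a, ?W, Suc (length W), T, q, k)"
  using scan_start[OF assms(1-3) le_refl assms(4), of x r a T q k] assms(3) by simp
 have 2: "astep m x r ((Go 0, ks), a, ?W, Suc (length W), T, q, k)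
  = ((Back False, ks), a, ?W, length W, T, q, k)"
  by (simp add: read_tape_def write_tape_def)
 have 3: "(astep m x r ^^ Suc (length W)) ((Back False, ks), a, ?W, length W, T, q, k)
  = (aft False ks, a, ?W, 0, T, q, k)"
  by (intro back_steps) simp
 have one: "astep m x r ^^ 1 = astep m x r" by (simp add: fun_eq_iff)
 let ?n = "Suc (length W) + (1 + Suc (i + m * w))"
 have "(astep m x r ^^ ?n) ((Ready, ks), a, W, 0, T, q, k) = (aft False ks, a, ?W, 0, T, q, k)"
  unfolding funpow_add comp_apply 1 one 2 3 ..
 moreover have "?n \<le> scan_cost m w" using assms unfolding scan_cost_def by simp
 ultimately show ?thesis by blast
qed

definition rep :: "nat \<Rightarrow> nat \<Rightarrow> bool list \<Rightarrow> (nat \<Rightarrow> nat) \<Rightarrow> bool" where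
 "rep m w W R \<longleftrightarrow> length W = m * w \<and> (\<forall>i<m. R i < 2 ^ w \<and> (\<forall>j<w. W ! (i + m * j) = bit (R i) j))"

lemma rep_flips:
 assumes "rep m w W R" "i < m" "v < 2 ^ w"
  "\<And>j'. j' < w ==> bit v j' = (if j' < j then \<not> bit (R i) j' else bit (R i) j')"
 shows "rep m w (flips W i m j True) (R(i := v))"
 using assms idx_less by (auto simp: rep_def nth_flips)

lemma scan_inc:
 assumes "rep m w W R" "i < m" "scn ks = Some (i, True, True)" "Suc (R i) < 2 ^ w"
 shows "\<exists>n\<le>scan_cost m w. \<exists>W'. rep m w W' (R(i := Suc (R i))) \<and>
  (astep m x r ^^ n) ((Ready, ks), a, W, 0, T, q, k) = (aft True ks, a, W', 0, T, q, k)"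
proof -
 \<comment> \<open>The scan stops at the lowest zero. It lies below \<open>w\<close> because the
   successor still fits into \<open>w\<close> bits.\<close>
 define j where "j = (LEAST j. \<not> bit (R i) j)"
 obtain j0 where j0: "j0 < w" "\<not> bit (R i) j0" using zero_bit[OF assms(4)] by blast
 have j: "\<not> bit (R i) j" "j < w" using LeastI[of "\<lambda>j. \<not> bit (R i) j", OF j0(2)] Least_le[of "\<lambda>j. \<not> bit (R i) j", OF j0(2)] j0(1)
  unfolding j_def by auto
 have lo: "\<forall>j'<j. bit (R i) j'" unfolding j_def using not_less_Least by blast
 have "rep m w (flips W i m (Suc j) True) (R(i := Suc (R i)))"
  using inc_bits[OF lo j(1)] lo j(1) assms by (intro rep_flips) (auto simp: less_Suc_eq)
 moreover have "\<exists>n\<le>scan_cost m w. (astep m x r ^^ n) ((Ready, ks), a, W, 0, T, q, k)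
   = (aft True ks, a, flips W i m (Suc j) True, 0, T, q, k)"
  using assms lo j by (intro scan_found) (auto simp: rep_def)
 ultimately show ?thesis by blast
qed

lemma scan_dec:
 assumes "rep m w W R" "i < m" "scn ks = Some (i, False, True)" "0 < R i"
 shows "\<exists>n\<le>scan_cost m w. \<exists>W'. rep m w W' (R(i := R i - 1)) \<and>
  (astep m x r ^^ n) ((Ready, ks), a, W, 0, T, q, k) = (aft True ks, a, W', 0, T, q, k)"
proof -
 define j where "j = (LEAST j. bit (R i) j)"
 have "R i < 2 ^ w" using assms by (simp add: rep_def)
 then obtain j0 where j0: "j0 < w" "bit (R i) j0" using nz_bit[of "R i" w] assms(4) by auto
 have j: "bit (R i) j" "j < w" using LeastI[of "\<lambda>j. bit (R i) j", OF j0(2)] Least_le[of "\<lambda>j. bit (R i) j", OF j0(2)] j0(1)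
  unfolding j_def by auto
 have lo: "\<forall>j'<j. \<not> bit (R i) j'" unfolding j_def using not_less_Least by blast
 have "rep m w (flips W i m (Suc j) True) (R(i := R i - 1))"
  using dec_bits[OF lo j(1)] lo j(1) assms \<open>R i < 2 ^ w\<close> by (intro rep_flips) (auto simp: less_Suc_eq)
 moreover have "\<exists>n\<le>scan_cost m w. (astep m x r ^^ n) ((Ready, ks), a, W, 0, T, q, k)
   = (aft True ks, a, flips W i m (Suc j) True, 0, T, q, k)"
  using assms lo j by (intro scan_found) (auto simp: rep_def)
 ultimately show ?thesis by blast
qed

lemma flips_False [simp]: "flips W i m j False = W"
 by (auto simp: flips_def intro: nth_equalityI)

lemma scan_nz:
 assumes "rep m w W R" "i < m" "scn ks = Some (i, False, False)"
 shows "\<exists>n\<le>scan_cost m w.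
  (astep m x r ^^ n) ((Ready, ks), a, W, 0, T, q, k) = (aft (R i \<noteq> 0) ks, a, W, 0, T, q, k)"
proof (cases "R i = 0")
 case True
 then show ?thesis using scan_none[OF assms(3,2), of W w x r a T q k] assms(1,2) by (auto simp: rep_def)
next
 case False
 define j where "j = (LEAST j. bit (R i) j)"
 have "R i < 2 ^ w" using assms by (simp add: rep_def)
 then obtain j0 where j0: "j0 < w" "bit (R i) j0" using nz_bit[of "R i" w] False by auto
 have j: "bit (R i) j" "j < w" using LeastI[of "\<lambda>j. bit (R i) j", OF j0(2)] Least_le[of "\<lambda>j. bit (R i) j", OF j0(2)] j0(1)
  unfolding j_def by auto
 have lo: "\<forall>j'<j. \<not> bit (R i) j'" unfolding j_def using not_less_Least by blast
 show ?thesis using scan_found[OF assms(3,2) _ j(2), of W x r a T q k] assms(1,2) lo j False by (auto simp: rep_def)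
qed

section \<open>Simulation of programs by the compiled machine\<close>

lemma bs_regs_le: "bs B x r c s t s' ==> \<forall>i. regs s i \<le> B ==> \<forall>i. regs s' i \<le> B"
 by (induction rule: bs.induct) (auto simp: tadv_def le_diff_conv intro: le_trans)

abbreviation acfg_of :: "com list \<Rightarrow> bool list \<Rightarrow> pst \<Rightarrow> acfg" where
 "acfg_of ks W s \<equiv> ((Ready, ks), ihd s, W, 0, tape s, chd s, rhd s)"

lemma scan_cost_pos: "1 \<le> scan_cost m w"
 by (simp add: scan_cost_def)

lemma test_sim:
 assumes "rep m w W (regs s)" "tst_below m t" "ks = Ite t a b # ls \<or> ks = Wh t a # ls"
 shows "\<exists>n\<le>scan_cost m w. (astep m x r ^^ n) (acfg_of ks W s)
  = (aft (tval x r t s) ks, ihd s, W, 0, tape s, chd s, rhd (tadv t s))"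
proof (cases t)
 case (NZ i)
 then show ?thesis using scan_nz[OF assms(1), of i ks x r "ihd s" "tape s" "chd s" "rhd s"] assms
  by (auto simp: tadv_def)
next
 case CT
 then show ?thesis using assms(3) scan_cost_pos[of m w]
  by (intro exI[of _ 1]) (auto simp: tadv_def)
next
 case IT
 then show ?thesis using assms(3) scan_cost_pos[of m w]
  by (intro exI[of _ 1]) (auto simp: tadv_def)
next
 case INN
 then show ?thesis using assms(3) scan_cost_pos[of m w]
  by (intro exI[of _ 1]) (auto simp: tadv_def)
next
 case RB
 then show ?thesis using assms(3) scan_cost_pos[of m w]
  by (intro exI[of _ 1]) (auto simp: tadv_def)
qed

text \<open>Induction on the derivation: sequencing only rearranges the stack in one move, and every
  other command or test costs at most one scan. Hence the running times differ by the factor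
  \<open>scan_cost m w\<close>.\<close>

lemma bs_sim:
 assumes "bs B x r c s t s'" "com_below m c" "B < 2 ^ w" "\<forall>i. regs s i \<le> B" "rep m w W (regs s)"
 shows "\<exists>n\<le>scan_cost m w * t. \<exists>W'. rep m w W' (regs s') \<and>
  (astep m x r ^^ n) (acfg_of (c # ks) W s) = acfg_of ks W' s'"
 using assms
proof (induction arbitrary: W ks rule: bs.induct)
 case (bs_Inc s i)
 have "Suc (regs s i) < 2 ^ w" using bs_Inc by simp
 from scan_inc[OF bs_Inc(5) _ _ this, of "Inc i # ks" x r "ihd s" "tape s" "chd s" "rhd s"] show ?case
  using bs_Inc by (simp add: fun_upd_def)
next
 case (bs_Dec s i)
 from scan_dec[OF bs_Dec(5) _ _ bs_Dec(1), of "Dec i # ks" x r "ihd s" "tape s" "chd s" "rhd s"] show ?case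
  using bs_Dec by (simp add: fun_upd_def)
next
 case (bs_Sq a s t1 s1 b t2 s2)
 have 0: "(astep m x r ^^ 1) (acfg_of ((a ;; b) # ks) W s) = acfg_of (a # b # ks) W s" by simp
 obtain n1 W1 where 1: "n1 \<le> scan_cost m w * t1" "rep m w W1 (regs s1)"
  "(astep m x r ^^ n1) (acfg_of (a # b # ks) W s) = acfg_of (b # ks) W1 s1"
  using bs_Sq.IH(1)[of W "b # ks"] bs_Sq.prems by auto
 obtain n2 W2 where 2: "n2 \<le> scan_cost m w * t2" "rep m w W2 (regs s2)"
  "(astep m x r ^^ n2) (acfg_of (b # ks) W1 s1) = acfg_of ks W2 s2"
  using bs_Sq.IH(2)[of W1 ks] bs_Sq.prems 1(2) bs_regs_le[OF bs_Sq.hyps(1)] by auto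
 from funpow_trans[OF funpow_trans[OF 0 1(3)] 2(3)]
 have "(astep m x r ^^ (1 + n1 + n2)) (acfg_of ((a ;; b) # ks) W s) = acfg_of ks W2 s2" .
 moreover have "1 + n1 + n2 \<le> scan_cost m w * Suc (t1 + t2)"
  using 1(1) 2(1) scan_cost_pos[of m w] by (simp add: algebra_simps)
 ultimately show ?case using 2(2) by blast
next
 case (bs_IteT t s a t1 s1 b)
 obtain n0 where 0: "n0 \<le> scan_cost m w" "(astep m x r ^^ n0) (acfg_of (Ite t a b # ks) W s)
  = acfg_of (a # ks) W (tadv t s)"
  using test_sim[OF bs_IteT.prems(4), of t "Ite t a b # ks" a b ks x r] bs_IteT by auto
 obtain n1 W1 where 1: "n1 \<le> scan_cost m w * t1" "rep m w W1 (regs s1)"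
  "(astep m x r ^^ n1) (acfg_of (a # ks) W (tadv t s)) = acfg_of ks W1 s1"
  using bs_IteT.IH[of W ks] bs_IteT.prems by auto
 have "n0 + n1 \<le> scan_cost m w * Suc t1" using 0(1) 1(1) by simp
 then show ?case using funpow_trans[OF 0(2) 1(3)] 1(2) by blast
next
 case (bs_IteF t s b t1 s1 a)
 obtain n0 where 0: "n0 \<le> scan_cost m w" "(astep m x r ^^ n0) (acfg_of (Ite t a b # ks) W s)
  = acfg_of (b # ks) W (tadv t s)"
  using test_sim[OF bs_IteF.prems(4), of t "Ite t a b # ks" a b ks x r] bs_IteF by auto
 obtain n1 W1 where 1: "n1 \<le> scan_cost m w * t1" "rep m w W1 (regs s1)"
  "(astep m x r ^^ n1) (acfg_of (b # ks) W (tadv t s)) = acfg_of ks W1 s1"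
  using bs_IteF.IH[of W ks] bs_IteF.prems by auto
 have "n0 + n1 \<le> scan_cost m w * Suc t1" using 0(1) 1(1) by simp
 then show ?case using funpow_trans[OF 0(2) 1(3)] 1(2) by blast
next
 case (bs_WhT t s a t1 s1 t2 s2)
 obtain n0 where 0: "n0 \<le> scan_cost m w" "(astep m x r ^^ n0) (acfg_of (Wh t a # ks) W s)
  = acfg_of (a # Wh t a # ks) W (tadv t s)"
  using test_sim[OF bs_WhT.prems(4), of t "Wh t a # ks" a _ ks x r] bs_WhT by auto
 obtain n1 W1 where 1: "n1 \<le> scan_cost m w * t1" "rep m w W1 (regs s1)"
  "(astep m x r ^^ n1) (acfg_of (a # Wh t a # ks) W (tadv t s)) = acfg_of (Wh t a # ks) W1 s1"
  using bs_WhT.IH(1)[of W "Wh t a # ks"] bs_WhT.prems by auto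
 have "\<forall>i. regs s1 i \<le> B" using bs_regs_le[OF bs_WhT.hyps(2)] bs_WhT.prems by auto
 then obtain n2 W2 where 2: "n2 \<le> scan_cost m w * t2" "rep m w W2 (regs s2)"
  "(astep m x r ^^ n2) (acfg_of (Wh t a # ks) W1 s1) = acfg_of ks W2 s2"
  using bs_WhT.IH(2)[of W1 ks] bs_WhT.prems 1(2) by auto
 have "n0 + n1 + n2 \<le> scan_cost m w * Suc (t1 + t2)"
  using 0(1) 1(1) 2(1) by (simp add: algebra_simps)
 then show ?case using funpow_trans[OF funpow_trans[OF 0(2) 1(3)] 2(3)] 2(2) by blast
next
 case (bs_WhF t s a)
 then show ?case using test_sim[OF bs_WhF.prems(4), of t "Wh t a # ks" a _ ks x r] by auto
qed (intro exI[of _ 1], use scan_cost_pos[of m w] in auto)+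

lemma rep_zero: "rep m w (replicate (m * w) False) (\<lambda>_. 0)"
 using idx_less by (auto simp: rep_def)

definition pinit :: "bool list \<Rightarrow> pst" where
 "pinit T = \<lparr>regs = (\<lambda>_. 0), tape = T, chd = 0, ihd = 0, rhd = 0\<rparr>"

text \<open>After the program, the empty stack tests register 0 and halts; this is the extra scan in
  \<open>Suc t\<close>. A halted machine stays put, so the conclusion holds at all later times, as
  the fixed time bound of the randomized class demands.\<close>

theorem compile:
 assumes "com_below m P" "0 < m"
 shows "\<exists>M. wf_machine M \<and> (no_rand P \<longrightarrow> deterministic M) \<and>
  (\<forall>B x r w T t s'. bs B x r P (pinit T) t s' \<longrightarrow> B < 2 ^ w \<longrightarrow>
   (\<forall>t'\<ge>scan_cost m w * Suc t. halted M (run M x r (m * w) T t') \<and> ct (run M x r (m * w) T t') = tape s' \<and>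
    (st (run M x r (m * w) T t') = acc M \<longleftrightarrow> regs s' 0 \<noteq> 0)))"
proof -
 obtain f where "bij_betw f (cstates m P) {0..<card (cstates m P)}"
  using finite_cstates ex_bij_betw_finite_nat by blast
 then interpret compiled m P f using assms by unfold_locales
 let ?M = "mk_machine m P f"
 have "halted ?M (run ?M x r (m * w) T t') \<and> ct (run ?M x r (m * w) T t') = tape s' \<and>
    (st (run ?M x r (m * w) T t') = acc ?M \<longleftrightarrow> regs s' 0 \<noteq> 0)"
  if *: "bs B x r P (pinit T) t s'" "B < 2 ^ w" "t' \<ge> scan_cost m w * Suc t" for B x r w T t s' t'
 proof -
  let ?W = "replicate (m * w) False"
  obtain n W where 1: "n \<le> scan_cost m w * t" "rep m w W (regs s')"
   "(astep m x r ^^ n) (acfg_of [P] ?W (pinit T)) = acfg_of [] W s'"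
   using bs_sim[OF *(1) assms(1) *(2), of ?W "[]"] rep_zero by (auto simp: pinit_def)
  obtain n2 where 2: "n2 \<le> scan_cost m w" "(astep m x r ^^ n2) (acfg_of [] W s')
    = (aft (regs s' 0 \<noteq> 0) [], ihd s', W, 0, tape s', chd s', rhd s')"
   using scan_nz[OF 1(2) assms(2), of "[]" x r "ihd s'" "tape s'" "chd s'" "rhd s'"] by auto
  have stay: "(astep m x r ^^ j) ((\<phi>, []), z) = ((\<phi>, []), z)" if "\<phi> = Acc \<or> \<phi> = Rej" for j \<phi> z
   using that by (induction j) (cases z, auto)+
  have "n + n2 \<le> t'" using 1(1) 2(1) *(3) by simp
  then have "(astep m x r ^^ t') (acfg_of [P] ?W (pinit T))
    = (aft (regs s' 0 \<noteq> 0) [], ihd s', W, 0, tape s', chd s', rhd s')"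
   using funpow_trans[OF funpow_trans[OF 1(3) 2(2)], of "t' - (n + n2)"]
    stay[of "if regs s' 0 \<noteq> 0 then Acc else Rej" "t' - (n + n2)"] by simp
  moreover have "init ?M (m * w) T = cfg f (acfg_of [P] ?W (pinit T))"
   by (simp add: init_def mk_machine_def pinit_def)
  ultimately have "run ?M x r (m * w) T t' = cfg f (aft (regs s' 0 \<noteq> 0) [], ihd s', W, 0, tape s', chd s', rhd s')"
   using steps_cfg[of "acfg_of [P] ?W (pinit T)" t' x r] final_in by (simp add: run_def)
  then show ?thesis using final_in f_eq[OF final_in(1,2)]
   by (auto simp: halted_def mk_machine_def)
 qed
 then show ?thesis using wf_mk det_mk by blast
qed

section \<open>Polynomial bounds and rules for running programs\<close>

text \<open>Environments are de Bruijn stacks: index 0 is the variable bound last.\<close>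

definition push :: "nat \<Rightarrow> (nat \<Rightarrow> nat) \<Rightarrow> nat \<Rightarrow> nat" (infixr "##" 65) where
 "v ## e = case_nat v e"

lemma push_simps [simp]: "(v ## e) 0 = v" "(v ## e) (Suc i) = e i" "(v ## e) (numeral w) = e (pred_numeral w)"
 "(v ## e) 1 = e 0"
 by (simp_all add: push_def numeral_eq_Suc)

lemma push_shift [simp]: "(\<lambda>i. (v ## e) (Suc i)) = e"
 by simp

text \<open>The base is at least 2 for every input, so constants, sums and products are all absorbed
  by raising the exponent.\<close>

definition pb :: "nat \<Rightarrow> bool list \<Rightarrow> nat" where "pb K x = (length x + 2) ^ K"

definition pol :: "(bool list \<Rightarrow> nat) \<Rightarrow> bool" where "pol f \<longleftrightarrow> (\<exists>K. \<forall>x. f x \<le> pb K x)"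

lemma pb_mono: "K \<le> K' ==> pb K x \<le> pb K' x"
 by (simp add: pb_def power_increasing)

lemma pb_ge1: "1 \<le> pb K x"
 by (simp add: pb_def)

lemma pb_mult: "pb K x * pb K' x = pb (K + K') x"
 by (simp add: pb_def power_add)

lemma pol_pb: "pol (pb K)"
 unfolding pol_def by blast

lemma le_pb_const: "c \<le> pb c x"
proof -
 have "c \<le> 2 ^ c" by (simp add: less_imp_le)
 also have "\<dots> \<le> pb c x" unfolding pb_def by (intro power_mono) auto
 finally show ?thesis .
qed

lemma pol_const: "pol (\<lambda>_. c)"
 unfolding pol_def using le_pb_const by blast

lemma pol_add: "pol f ==> pol g ==> pol (\<lambda>x. f x + g x)"
proof -
 assume "pol f" "pol g"
 then obtain K K' where K: "\<And>x. f x \<le> pb K x" "\<And>x. g x \<le> pb K' x" unfolding pol_def by blast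
 have "f x + g x \<le> pb (max K K' + 1) x" for x
 proof -
  have "f x + g x \<le> pb (max K K') x + pb (max K K') x"
   using K[of x] pb_mono[of K "max K K'" x] pb_mono[of K' "max K K'" x] by linarith
  also have "\<dots> \<le> pb (max K K' + 1) x" by (simp add: pb_def)
  finally show ?thesis .
 qed
 then show ?thesis unfolding pol_def by blast
qed

lemma pol_mult: "pol f ==> pol g ==> pol (\<lambda>x. f x * g x)"
 unfolding pol_def by (metis mult_le_mono pb_mult)

lemma pol_Suc: "pol f ==> pol (\<lambda>x. Suc (f x))"
 using pol_add[of f "\<lambda>_. 1"] pol_const by simp

lemma pol_power: "pol f ==> pol (\<lambda>x. f x ^ k)"
 by (induction k) (simp_all add: pol_const pol_mult)

lemma pol_length: "pol length"
 unfolding pol_def by (rule exI[of _ 1]) (simp add: pb_def)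

lemmas pol_intros = pol_pb pol_const pol_add pol_mult pol_Suc pol_power pol_length

definition bt :: "nat \<Rightarrow> bool list \<Rightarrow> bool list \<Rightarrow> com \<Rightarrow> pst \<Rightarrow> nat \<Rightarrow> pst \<Rightarrow> bool" where
 "bt B x r c s n s' \<longleftrightarrow> (\<exists>t\<le>n. bs B x r c s t s')"

lemmas bs_intros = bs.intros[unfolded One_nat_def]

lemma bs_mono: "bs B x r c s t s' ==> B \<le> B' ==> bs B' x r c s t s'"
 by (induction rule: bs.induct) (auto intro: bs_intros)

lemma bt_mono: "bt B x r c s n s' ==> B \<le> B' ==> n \<le> n' ==> bt B' x r c s n' s'"
 unfolding bt_def using bs_mono by (meson order_trans)

lemma bt_Sq: "bt B x r a s n1 s1 ==> bt B x r b s1 n2 s2 ==> bt B x r (a ;; b) s (n1 + n2 + 1) s2"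
 unfolding bt_def by (metis Suc_eq_plus1 Suc_le_mono add_le_mono bs_Sq)

lemma bt_Ite: "t \<noteq> RB ==> (tval x r t s ==> bt B x r a s n s') ==> (\<not> tval x r t s ==> bt B x r b s n s')
  ==> bt B x r (Ite t a b) s (n + 1) s'"
proof -
 assume "t \<noteq> RB" and a: "tval x r t s ==> bt B x r a s n s'" and b: "\<not> tval x r t s ==> bt B x r b s n s'"
 then have [simp]: "tadv t s = s" by (simp add: tadv_def)
 show ?thesis
 proof (cases "tval x r t s")
  case True
  then show ?thesis using a bs_IteT[of x r t s B a _ s' b] unfolding bt_def by fastforce
 next
  case False
  then show ?thesis using b bs_IteF[of x r t s B b _ s' a] unfolding bt_def by fastforce
 qed
qed

text \<open>In place of an invariant the rule takes the whole trajectory: \<open>f j\<close> is the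
  state before round \<open>j\<close>. For the counting loops below it is always explicit.\<close>

lemma bt_loop:
 assumes "\<And>j. j < N ==> regs (f j) i \<noteq> 0" "\<And>j. j < N ==> bt B x r c (f j) n (f (Suc j))"
  "regs (f N) i = 0"
 shows "bt B x r (Wh (NZ i) c) (f 0) (N * (n + 1) + 1) (f N)"
proof -
 have "bt B x r (Wh (NZ i) c) (f (N - j)) (j * (n + 1) + 1) (f N)" if "j \<le> N" for j
  using that
 proof (induction j)
  case 0
  then show ?case using bs_WhF[of x r "NZ i" "f N" B c] assms(3) by (auto simp: bt_def tadv_def)
 next
  case (Suc j)
  let ?p = "N - Suc j"
  have p: "?p < N" "Suc ?p = N - j" using Suc.prems by auto
  obtain t1 where t1: "t1 \<le> n" "bs B x r c (f ?p) t1 (f (N - j))"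
   using assms(2)[OF p(1)] p(2) by (auto simp: bt_def)
  obtain t2 where t2: "t2 \<le> j * (n + 1) + 1" "bs B x r (Wh (NZ i) c) (f (N - j)) t2 (f N)"
   using Suc by (auto simp: bt_def)
  have "bs B x r (Wh (NZ i) c) (f ?p) (Suc (t1 + t2)) (f N)"
   using assms(1)[OF p(1)] t1(2) t2(2) by (intro bs_WhT) (auto simp: tadv_def)
  then show ?case using t1(1) t2(1) unfolding bt_def by (intro exI[of _ "Suc (t1 + t2)"]) auto
 qed
 from this[of N] show ?thesis by simp
qed

fun eff :: "bool list \<Rightarrow> com \<Rightarrow> pst \<Rightarrow> pst" where
 "eff x (Inc i) s = s\<lparr>regs := (regs s)(i := Suc (regs s i))\<rparr>"
| "eff x (Dec i) s = s\<lparr>regs := (regs s)(i := regs s i - 1)\<rparr>"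
| "eff x (CMv d) s = s\<lparr>chd := mv d (chd s) (Suc (length (tape s)))\<rparr>"
| "eff x (CWr v) s = s\<lparr>tape := write_tape (tape s) (chd s) v\<rparr>"
| "eff x (IMv d) s = s\<lparr>ihd := mv d (ihd s) (Suc (length x))\<rparr>"
| "eff x (a ;; b) s = eff x b (eff x a s)"
| "eff x _ s = s"

fun line :: "nat \<Rightarrow> bool list \<Rightarrow> com \<Rightarrow> pst \<Rightarrow> bool" where
 "line B x (Inc i) s = (regs s i < B)"
| "line B x (Dec i) s = (0 < regs s i)"
| "line B x (a ;; b) s = (line B x a s \<and> line B x b (eff x a s))"
| "line B x (Ite _ _ _) s = False"
| "line B x (Wh _ _) s = False"
| "line B x _ s = True"

fun lcost :: "com \<Rightarrow> nat" where
 "lcost (a ;; b) = lcost a + lcost b + 1"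
| "lcost _ = 1"

lemma bt_line: "line B x c s ==> bt B x r c s (lcost c) (eff x c s)"
proof (induction c arbitrary: s)
 case (Sq a b)
 then show ?case using bt_Sq[of B x r a s "lcost a" "eff x a s" b] by simp
qed (auto simp: bt_def intro: bs_intros)

lemma bt_line': "line B x c s ==> eff x c s = s' ==> lcost c \<le> n ==> bt B x r c s n s'"
 using bt_line bt_mono by blast

lemma pst_eqI: "regs s = regs s' ==> tape s = tape s' ==> chd s = chd s' ==> ihd s = ihd s' ==> rhd s = rhd s'
  ==> s = (s'::pst)"
 by (cases s; cases s') simp

definition clr :: "nat \<Rightarrow> com" where "clr i = Wh (NZ i) (Dec i)"
definition mov :: "nat \<Rightarrow> nat \<Rightarrow> com" where "mov a b = Wh (NZ a) (Dec a ;; Inc b)"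
text \<open>A register can only be read by draining it. The scratch register \<open>c\<close>
  receives a second copy, from which \<open>a\<close> is rebuilt.\<close>

definition cpy :: "nat \<Rightarrow> nat \<Rightarrow> nat \<Rightarrow> com" where
 "cpy a b c = Wh (NZ a) (Dec a ;; Inc b ;; Inc c) ;; mov c a"

lemma bt_clr: "bt B x r (clr i) s (2 * regs s i + 1) (s\<lparr>regs := (regs s)(i := 0)\<rparr>)"
proof -
 let ?f = "\<lambda>j. s\<lparr>regs := (regs s)(i := regs s i - j)\<rparr>"
 have "bt B x r (Wh (NZ i) (Dec i)) (?f 0) (regs s i * (1 + 1) + 1) (?f (regs s i))"
  by (rule bt_loop) (auto intro!: bt_line' pst_eqI simp: fun_eq_iff)
 then have "bt B x r (clr i) s (regs s i * (1 + 1) + 1) (s\<lparr>regs := (regs s)(i := 0)\<rparr>)"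
  by (simp add: clr_def)
 then show ?thesis by (rule bt_mono) auto
qed

lemma bt_mov:
 assumes "a \<noteq> b" "regs s a + regs s b \<le> B"
 shows "bt B x r (mov a b) s (4 * regs s a + 1) (s\<lparr>regs := (regs s)(a := 0, b := regs s a + regs s b)\<rparr>)"
proof -
 let ?f = "\<lambda>j. s\<lparr>regs := (regs s)(a := regs s a - j, b := j + regs s b)\<rparr>"
 have "bt B x r (Wh (NZ a) (Dec a ;; Inc b)) (?f 0) (regs s a * (3 + 1) + 1) (?f (regs s a))"
  using assms by (intro bt_loop) (auto intro!: bt_line' pst_eqI simp: fun_eq_iff)
 moreover have "?f 0 = s" by (rule pst_eqI) (auto simp: fun_eq_iff)
 ultimately show ?thesis by (simp add: mov_def mult.commute)
qed

lemma bt_cpy: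
 assumes "a \<noteq> b" "a \<noteq> c" "b \<noteq> c" "regs s c = 0" "regs s a + regs s b \<le> B"
 shows "bt B x r (cpy a b c) s (10 * regs s a + 3) (s\<lparr>regs := (regs s)(b := regs s b + regs s a)\<rparr>)"
proof -
 let ?f = "\<lambda>j. s\<lparr>regs := (regs s)(a := regs s a - j, b := regs s b + j, c := j)\<rparr>"
 have 1: "bt B x r (Wh (NZ a) (Dec a ;; Inc b ;; Inc c)) (?f 0) (regs s a * (5 + 1) + 1) (?f (regs s a))"
  using assms by (intro bt_loop) (auto intro!: bt_line' pst_eqI simp: fun_eq_iff)
 have 2: "?f 0 = s" using assms by (intro pst_eqI) (auto simp: fun_eq_iff)
 have 3: "bt B x r (mov c a) (?f (regs s a)) (4 * regs s a + 1) (s\<lparr>regs := (regs s)(b := regs s b + regs s a)\<rparr>)"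
 proof -
  have "(?f (regs s a))\<lparr>regs := (regs (?f (regs s a)))(c := 0, a := regs (?f (regs s a)) c + regs (?f (regs s a)) a)\<rparr>
   = s\<lparr>regs := (regs s)(b := regs s b + regs s a)\<rparr>"
   using assms(1-4) by (intro pst_eqI) (auto simp: fun_eq_iff)
  then show ?thesis using bt_mov[of c a "?f (regs s a)" B x r] assms by simp
 qed
 show ?thesis using bt_Sq[OF 1[unfolded 2] 3] unfolding cpy_def
  by (rule bt_mono) auto
qed

text \<open>Registers 0 and 1 hold the base and the stride of the current view of the tape; the
 environment sits above them, innermost variable on top.\<close>

definition env_regs :: "nat \<Rightarrow> nat \<Rightarrow> nat \<Rightarrow> (nat \<Rightarrow> nat) \<Rightarrow> nat \<Rightarrow> nat" where
 "env_regs ba sd k e i = (if i = 0 then ba else if i = 1 then sd else if i < k + 2 then e (k + 1 - i) else 0)"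

definition ES :: "nat \<Rightarrow> nat \<Rightarrow> nat \<Rightarrow> (nat \<Rightarrow> nat) \<Rightarrow> bool list \<Rightarrow> nat \<Rightarrow> pst" where
 "ES ba sd k e T h = \<lparr>regs = env_regs ba sd k e, tape = T, chd = 0, ihd = 0, rhd = h\<rparr>"

lemma ES_sel [simp]: "regs (ES ba sd k e T h) = env_regs ba sd k e" "tape (ES ba sd k e T h) = T"
 "chd (ES ba sd k e T h) = 0" "ihd (ES ba sd k e T h) = 0" "rhd (ES ba sd k e T h) = h"
 by (simp_all add: ES_def)

lemma env_regs_push: "env_regs ba sd (Suc k) (v ## e) = (env_regs ba sd k e)(k + 2 := v)"
proof
 fix i show "env_regs ba sd (Suc k) (v ## e) i = ((env_regs ba sd k e)(k + 2 := v)) i"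
 proof (cases "i < k + 2")
  case True
  then have "Suc (Suc k) - i = Suc (Suc k - i)" by linarith
  then show ?thesis using True by (simp add: env_regs_def)
 qed (auto simp: env_regs_def)
qed

lemma env_regs_top [simp]: "k + 2 \<le> i ==> env_regs ba sd k e i = 0"
 by (simp add: env_regs_def)

lemma env_regs_01 [simp]: "env_regs ba sd k e 0 = ba" "env_regs ba sd k e (Suc 0) = sd"
 by (simp_all add: env_regs_def)

lemma env_regs_le: "ba \<le> B ==> sd \<le> B ==> (\<forall>i<k. e i \<le> B) ==> env_regs ba sd k e j \<le> B"
 by (auto simp: env_regs_def)

section \<open>Views of the tape along arithmetic progressions\<close>

text \<open>A view is given by a base and a stride. Blocks are views of stride 1; the virtual block
  made of the free bits is a view whose stride is the block length.\<close>

definition viewok :: "nat \<Rightarrow> bool list \<Rightarrow> nat \<Rightarrow> nat \<Rightarrow> bool" where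
 "viewok l T ba sd \<longleftrightarrow> 1 \<le> sd \<and> (\<forall>i<l. ba + sd * i < length T)"

definition view :: "nat \<Rightarrow> bool list \<Rightarrow> nat \<Rightarrow> nat \<Rightarrow> bool list" where
 "view l T ba sd = map (\<lambda>i. T ! (ba + sd * i)) [0..<l]"

definition putv :: "bool list \<Rightarrow> nat \<Rightarrow> nat \<Rightarrow> bool list \<Rightarrow> bool list" where
 "putv T ba sd z = map (\<lambda>p. if \<exists>i<length z. p = ba + sd * i then z ! ((p - ba) div sd) else T ! p) [0..<length T]"

lemma length_view [simp]: "length (view l T ba sd) = l"
 by (simp add: view_def)

lemma length_putv [simp]: "length (putv T ba sd z) = length T"
 by (simp add: putv_def)

lemma viewok_putv [simp]: "viewok l (putv T ba sd z) ba' sd' = viewok l T ba' sd'"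
 by (simp add: viewok_def)

lemma view_putv: "viewok (length z) T ba sd ==> view (length z) (putv T ba sd z) ba sd = z"
 by (rule nth_equalityI) (auto simp: view_def putv_def viewok_def)

lemma putv_view: "viewok l T ba sd ==> putv T ba sd (view l T ba sd) = T"
 by (rule nth_equalityI) (auto simp: view_def putv_def viewok_def)

lemma putv_putv: "length z = length z' ==> putv (putv T ba sd z) ba sd z' = putv T ba sd z'"
 by (rule nth_equalityI) (auto simp: putv_def)

lemma view_id: "view (length z) z 0 1 = z"
 by (rule nth_equalityI) (auto simp: view_def)

lemma viewok_id: "viewok (length z) z 0 1"
 by (simp add: viewok_def)

lemma putv_upd:
 assumes "viewok (length z) T ba sd" "view (length z) T ba sd = z" "i < length z"
 shows "putv T ba sd (z[i := v]) = T[ba + sd * i := v]"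
proof (rule nth_equalityI)
 fix p assume "p < length (putv T ba sd (z[i := v]))"
 moreover have "z ! j = T ! (ba + sd * j)" if "j < length z" for j
  using assms(2) that by (metis (no_types, lifting) add_0 length_map length_upt minus_nat.diff_0 nth_map_upt view_def)
 ultimately show "putv T ba sd (z[i := v]) ! p = T[ba + sd * i := v] ! p"
  using assms by (auto simp: putv_def nth_list_update viewok_def)
qed simp

section \<open>Renaming of registers\<close>

primrec ren_tst :: "(nat \<Rightarrow> nat) \<Rightarrow> tst \<Rightarrow> tst" where
 "ren_tst f (NZ i) = NZ (f i)"
| "ren_tst f CT = CT"
| "ren_tst f IT = IT"
| "ren_tst f INN = INN"
| "ren_tst f RB = RB"

primrec ren :: "(nat \<Rightarrow> nat) \<Rightarrow> com \<Rightarrow> com" where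
 "ren f Skip = Skip"
| "ren f (Inc i) = Inc (f i)"
| "ren f (Dec i) = Dec (f i)"
| "ren f (CMv d) = CMv d"
| "ren f (CWr b) = CWr b"
| "ren f (IMv d) = IMv d"
| "ren f (a ;; b) = ren f a ;; ren f b"
| "ren f (Ite t a b) = Ite (ren_tst f t) (ren f a) (ren f b)"
| "ren f (Wh t a) = Wh (ren_tst f t) (ren f a)"

definition rlift :: "(nat \<Rightarrow> nat) \<Rightarrow> (nat \<Rightarrow> nat) \<Rightarrow> (nat \<Rightarrow> nat) \<Rightarrow> nat \<Rightarrow> nat" where
 "rlift f R R0 j = (if j \<in> range f then R (inv f j) else R0 j)"

lemma rlift_f [simp]: "inj f ==> rlift f R R0 (f i) = R i"
 by (simp add: rlift_def)

lemma rlift_upd: "inj f ==> rlift f (R(i := v)) R0 = (rlift f R R0)(f i := v)"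
proof (rule ext)
 fix j assume f: "inj f"
 show "rlift f (R(i := v)) R0 j = ((rlift f R R0)(f i := v)) j"
 proof (cases "j \<in> range f")
  case True
  then show ?thesis using f by (auto simp: inj_eq)
 next
  case False
  then have "j \<noteq> f i" by blast
  then show ?thesis using False by (simp add: rlift_def)
 qed
qed

lemma ren_tst_RB [simp]: "ren_tst f t = RB \<longleftrightarrow> t = RB"
 by (cases t) auto

lemma no_rand_ren [simp]: "no_rand (ren f c) = no_rand c"
 by (induction c) auto

lemma tval_ren: "inj f ==> tval x r (ren_tst f t) (s\<lparr>regs := rlift f (regs s) R0\<rparr>) = tval x r t s"
 by (cases t) auto

lemma tadv_ren: "tadv (ren_tst f t) (s\<lparr>regs := rlift f (regs s) R0\<rparr>) = (tadv t s)\<lparr>regs := rlift f (regs (tadv t s)) R0\<rparr>"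
 by (simp add: tadv_def)

text \<open>An injectively renamed program leaves the registers outside the range alone, so one
  program can be run inside a larger environment.\<close>

lemma bs_ren:
 assumes "bs B x r c s t s'" "inj f"
 shows "bs B x r (ren f c) (s\<lparr>regs := rlift f (regs s) R0\<rparr>) t (s'\<lparr>regs := rlift f (regs s') R0\<rparr>)"
 using assms
proof (induction rule: bs.induct)
 case (bs_Inc s i)
 then show ?case
  using bs.bs_Inc[of "s\<lparr>regs := rlift f (regs s) R0\<rparr>" "f i" B x r] by (simp add: rlift_upd del: fun_upd_apply)
next
 case (bs_Dec s i)
 then show ?case
  using bs.bs_Dec[of "s\<lparr>regs := rlift f (regs s) R0\<rparr>" "f i" B x r] by (simp add: rlift_upd del: fun_upd_apply)
next
 case (bs_CMv d s)
 show ?case unfolding ren.simps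
  by (rule back_subst[of "bs B x r _ _ _", OF bs.bs_CMv]) (rule pst_eqI; simp)
next
 case (bs_CWr d s)
 show ?case unfolding ren.simps
  by (rule back_subst[of "bs B x r _ _ _", OF bs.bs_CWr]) (rule pst_eqI; simp)
next
 case (bs_IMv d s)
 show ?case unfolding ren.simps
  by (rule back_subst[of "bs B x r _ _ _", OF bs.bs_IMv]) (rule pst_eqI; simp)
next
 case (bs_Sq a s t1 s1 b t2 s2)
 then show ?case unfolding ren.simps by (intro bs.bs_Sq)
next
 case (bs_IteT t s a t1 s1 b)
 show ?case unfolding ren.simps
  by (rule bs.bs_IteT) (use bs_IteT in \<open>simp_all only: tval_ren tadv_ren\<close>)
next
 case (bs_IteF t s b t1 s1 a)
 show ?case unfolding ren.simps
  by (rule bs.bs_IteF) (use bs_IteF in \<open>simp_all only: tval_ren tadv_ren not_False_eq_True\<close>)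
next
 case (bs_WhT t s a t1 s1 t2 s2)
 show ?case unfolding ren.simps
  by (rule bs.bs_WhT[where ?s1.0 = "s1\<lparr>regs := rlift f (regs s1) R0\<rparr>"])
   (use bs_WhT in \<open>simp_all only: tval_ren tadv_ren ren.simps\<close>)
next
 case (bs_WhF t s a)
 then have "bs B x r (Wh (ren_tst f t) (ren f a)) (s\<lparr>regs := rlift f (regs s) R0\<rparr>) 1
   (tadv (ren_tst f t) (s\<lparr>regs := rlift f (regs s) R0\<rparr>))"
  by (intro bs.bs_WhF) (simp only: tval_ren not_False_eq_True)
 then show ?case by (simp only: ren.simps tadv_ren)
next
 case (bs_Skip s)
 show ?case unfolding ren.simps by (rule bs.bs_Skip)
qed

lemma bt_ren:
 assumes "bt B x r c s n s'" "inj f"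
  "rlift f (regs s) R0 = R" "rlift f (regs s') R0 = R'"
 shows "bt B x r (ren f c) (s\<lparr>regs := R\<rparr>) n (s'\<lparr>regs := R'\<rparr>)"
 using assms bs_ren[of B x r c s _ s' f R0] by (auto simp: bt_def)

section \<open>Functions on variables and tape computed by programs\<close>

type_synonym tfun = "bool list \<Rightarrow> (nat \<Rightarrow> nat) \<Rightarrow> bool list \<Rightarrow> nat \<times> bool list"

text \<open>The calling convention: \<open>P\<close> finds \<open>k\<close> variables with zeros
  above them, pushes one value and rewrites the viewed cells. Catalytic and input head start and end
  at 0, the random head stays, and one polynomial bounds both registers and time.
  \<open>\<Lambda>\<close> is the set of views under which \<open>P\<close> has to work.\<close>

definition runs :: "(nat \<times> nat) set \<Rightarrow> (nat \<Rightarrow> nat) \<Rightarrow> nat \<Rightarrow> tfun \<Rightarrow> com \<Rightarrow> nat \<Rightarrow> nat \<Rightarrow> bool" where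
 "runs \<Lambda> Z k G P K K' \<longleftrightarrow> (\<forall>x r e T h ba sd. (ba, sd) \<in> \<Lambda> \<longrightarrow> ba \<le> pb K x \<longrightarrow> sd \<le> pb K x \<longrightarrow>
   (\<forall>i<k. e i \<le> pb K x) \<longrightarrow> viewok (Z (length x)) T ba sd \<longrightarrow>
   bt (pb K' x) x r P (ES ba sd k e T h) (pb K' x)
    (ES ba sd (Suc k) (fst (G x e (view (Z (length x)) T ba sd)) ## e)
     (putv T ba sd (snd (G x e (view (Z (length x)) T ba sd)))) h))"

definition cp :: "(nat \<times> nat) set \<Rightarrow> (nat \<Rightarrow> nat) \<Rightarrow> nat \<Rightarrow> tfun \<Rightarrow> bool" where
 "cp \<Lambda> Z k G \<longleftrightarrow> (0, 1) \<in> \<Lambda> \<and>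
  (\<forall>x e z. length z = Z (length x) \<longrightarrow> length (snd (G x e z)) = length z) \<and>
  (\<exists>P. no_rand P \<and> (\<forall>K. \<exists>K'. runs \<Lambda> Z k G P K K'))"

lemma runsD:
 assumes "runs \<Lambda> Z k G P K K'" "(ba, sd) \<in> \<Lambda>" "ba \<le> pb K x" "sd \<le> pb K x" "\<forall>i<k. e i \<le> pb K x"
  "viewok (Z (length x)) T ba sd"
 shows "bt (pb K' x) x r P (ES ba sd k e T h) (pb K' x)
    (ES ba sd (Suc k) (fst (G x e (view (Z (length x)) T ba sd)) ## e)
     (putv T ba sd (snd (G x e (view (Z (length x)) T ba sd)))) h)"
 using assms unfolding runs_def by blast

lemma cp_length: "cp \<Lambda> Z k G ==> length z = Z (length x) ==> length (snd (G x e z)) = length z"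
 by (simp add: cp_def)

lemma runs_mono: "runs \<Lambda> Z k G P K K' ==> K' \<le> K'' ==> runs \<Lambda> Z k G P K K''"
 unfolding runs_def by (intro allI impI) (rule bt_mono[OF _ pb_mono pb_mono], auto)

text \<open>No separate analysis of sizes is made: the result ends up in a register, and no register
  exceeds the bound of the run. The run is taken on the tape that consists of the view
  alone.\<close>

lemma runs_value:
 assumes "runs \<Lambda> Z k G P K K'" "(0, 1) \<in> \<Lambda>" "\<forall>i<k. e i \<le> pb K x" "length z = Z (length x)"
 shows "fst (G x e z) \<le> pb (max K K') x"
proof -
 let ?B = "pb (max K K') x"
 have "bt (pb K' x) x [] P (ES 0 1 k e z 0) (pb K' x)
    (ES 0 1 (Suc k) (fst (G x e z) ## e) (putv z 0 1 (snd (G x e z))) 0)"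
  using runsD[OF assms(1,2) _ _ assms(3), of z "[]" 0] assms(4) pb_ge1[of K x] viewok_id[of z] view_id[of z] by simp
 then obtain t where "bs (pb K' x) x [] P (ES 0 1 k e z 0) t
    (ES 0 1 (Suc k) (fst (G x e z) ## e) (putv z 0 1 (snd (G x e z))) 0)"
  unfolding bt_def by blast
 then have b: "bs ?B x [] P (ES 0 1 k e z 0) t
    (ES 0 1 (Suc k) (fst (G x e z) ## e) (putv z 0 1 (snd (G x e z))) 0)"
  by (rule bs_mono) (simp add: pb_mono)
 have "\<forall>i<k. e i \<le> ?B" using assms(3) pb_mono[of K "max K K'" x] by (auto intro: order_trans)
 then have "\<forall>i. regs (ES 0 1 k e z 0) i \<le> ?B" using pb_ge1 env_regs_le by auto
 from bs_regs_le[OF b this] show ?thesis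
  by (auto simp: env_regs_push dest: spec[of _ "k + 2"])
qed

lemma cp_bound:
 assumes "cp \<Lambda> Z k G"
 shows "\<exists>K'. \<forall>x e z. (\<forall>i<k. e i \<le> pb K x) \<longrightarrow> length z = Z (length x) \<longrightarrow> fst (G x e z) \<le> pb K' x"
proof -
 obtain P K' where "runs \<Lambda> Z k G P K K'" using assms unfolding cp_def by blast
 then show ?thesis using runs_value assms unfolding cp_def by blast
qed

lemma runs_bt:
 assumes "runs \<Lambda> Z k G P K K'" "(ba, sd) \<in> \<Lambda>" "ba \<le> pb K x" "sd \<le> pb K x"
   "\<forall>i<k. e i \<le> pb K x" "viewok (length z) T ba sd" "length z = Z (length x)"
   "length (snd (G x e z)) = length z" "pb K' x \<le> B" "pb K' x \<le> n"
 shows "bt B x r P (ES ba sd k e (putv T ba sd z) h) n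
    (ES ba sd (Suc k) (fst (G x e z) ## e) (putv T ba sd (snd (G x e z))) h)"
proof -
 have "view (Z (length x)) (putv T ba sd z) ba sd = z" using view_putv[OF assms(6)] assms(7) by simp
 then have "bt (pb K' x) x r P (ES ba sd k e (putv T ba sd z) h) (pb K' x)
    (ES ba sd (Suc k) (fst (G x e z) ## e) (putv (putv T ba sd z) ba sd (snd (G x e z))) h)"
  using runsD[OF assms(1-5), of "putv T ba sd z" r h] assms(6,7) by simp
 then show ?thesis using putv_putv[of z "snd (G x e z)" T ba sd] assms(8)
  by (intro bt_mono[OF _ assms(9,10)]) simp
qed

text \<open>The working form of a proof obligation: programs are run on tapes of the form putv T ba sd z.\<close>

lemma cpI:
 assumes "(0, 1) \<in> \<Lambda>" "no_rand P"
  "\<And>x e z. length z = Z (length x) ==> length (snd (G x e z)) = length z"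
  "\<And>K. \<exists>g. pol g \<and> (\<forall>x r e z T h ba sd. (ba, sd) \<in> \<Lambda> \<longrightarrow> ba \<le> pb K x \<longrightarrow> sd \<le> pb K x \<longrightarrow> (\<forall>i<k. e i \<le> pb K x)
   \<longrightarrow> viewok (length z) T ba sd \<longrightarrow> length z = Z (length x) \<longrightarrow>
   (\<forall>B. g x \<le> B \<longrightarrow> bt B x r P (ES ba sd k e (putv T ba sd z) h) (g x)
    (ES ba sd (Suc k) (fst (G x e z) ## e) (putv T ba sd (snd (G x e z))) h)))"
 shows "cp \<Lambda> Z k G"
 unfolding cp_def
proof (intro conjI exI[of _ P] allI impI)
 fix K
 obtain g where g: "pol g" and *: "\<And>x r e z T h ba sd. (ba, sd) \<in> \<Lambda> ==> ba \<le> pb K x ==> sd \<le> pb K x ==> (\<forall>i<k. e i \<le> pb K x)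
   ==> viewok (length z) T ba sd ==> length z = Z (length x) ==>
   (\<forall>B. g x \<le> B \<longrightarrow> bt B x r P (ES ba sd k e (putv T ba sd z) h) (g x)
    (ES ba sd (Suc k) (fst (G x e z) ## e) (putv T ba sd (snd (G x e z))) h))"
  using assms(4)[of K] by blast
 obtain K' where K': "\<And>x. g x \<le> pb K' x" using g unfolding pol_def by blast
 have "runs \<Lambda> Z k G P K K'"
  unfolding runs_def
 proof (intro allI impI)
  fix x r :: "bool list" and e T h ba sd
  assume a: "(ba, sd) \<in> \<Lambda>" "ba \<le> pb K x" "sd \<le> pb K x" "\<forall>i<k. e i \<le> pb K x" "viewok (Z (length x)) T ba sd"
  let ?z = "view (Z (length x)) T ba sd"
  have "bt (pb K' x) x r P (ES ba sd k e (putv T ba sd ?z) h) (g x)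
    (ES ba sd (Suc k) (fst (G x e ?z) ## e) (putv T ba sd (snd (G x e ?z))) h)"
   using *[of ba sd x e ?z T r h] a K'[of x] by simp
  then show "bt (pb K' x) x r P (ES ba sd k e T h) (pb K' x)
    (ES ba sd (Suc k) (fst (G x e ?z) ## e) (putv T ba sd (snd (G x e ?z))) h)"
   using putv_view[OF a(5)] bt_mono[OF _ order_refl K'] by simp
 qed
 then show "\<exists>K'. runs \<Lambda> Z k G P K K'" by blast
qed (use assms in auto)

lemma cpE:
 assumes "cp \<Lambda> Z k G"
 obtains P where "no_rand P" "\<And>K. \<exists>K'. K \<le> K' \<and> (\<forall>x e z. (\<forall>i<k. e i \<le> pb K x) \<longrightarrow> length z = Z (length x) \<longrightarrow>
   fst (G x e z) \<le> pb K' x) \<and> (\<forall>x r e z T h ba sd B n. (ba, sd) \<in> \<Lambda> \<longrightarrow> ba \<le> pb K x \<longrightarrow> sd \<le> pb K x \<longrightarrow>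
   (\<forall>i<k. e i \<le> pb K x) \<longrightarrow> viewok (length z) T ba sd \<longrightarrow> length z = Z (length x) \<longrightarrow> pb K' x \<le> B \<longrightarrow> pb K' x \<le> n \<longrightarrow>
   bt B x r P (ES ba sd k e (putv T ba sd z) h) n
    (ES ba sd (Suc k) (fst (G x e z) ## e) (putv T ba sd (snd (G x e z))) h))"
proof -
 obtain P where P: "no_rand P" "\<forall>K. \<exists>K'. runs \<Lambda> Z k G P K K'" using assms unfolding cp_def by blast
 have l: "(0, 1) \<in> \<Lambda>" using assms unfolding cp_def by blast
 have "\<exists>K'. K \<le> K' \<and> (\<forall>x e z. (\<forall>i<k. e i \<le> pb K x) \<longrightarrow> length z = Z (length x) \<longrightarrow>
   fst (G x e z) \<le> pb K' x) \<and> (\<forall>x r e z T h ba sd B n. (ba, sd) \<in> \<Lambda> \<longrightarrow> ba \<le> pb K x \<longrightarrow> sd \<le> pb K x \<longrightarrow>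
   (\<forall>i<k. e i \<le> pb K x) \<longrightarrow> viewok (length z) T ba sd \<longrightarrow> length z = Z (length x) \<longrightarrow> pb K' x \<le> B \<longrightarrow> pb K' x \<le> n \<longrightarrow>
   bt B x r P (ES ba sd k e (putv T ba sd z) h) n
    (ES ba sd (Suc k) (fst (G x e z) ## e) (putv T ba sd (snd (G x e z))) h))" for K
 proof -
  obtain K1 where K1: "runs \<Lambda> Z k G P K K1" using P(2) by blast
  have K2: "runs \<Lambda> Z k G P K (max K K1)" using runs_mono[OF K1] by simp
  show ?thesis
   using runs_value[OF K1 l] runs_bt[OF K2] cp_length[OF assms] by (intro exI[of _ "max K K1"]) auto
 qed
 with P(1) show ?thesis using that by blast
qed

abbreviation cf :: "(nat \<times> nat) set \<Rightarrow> (nat \<Rightarrow> nat) \<Rightarrow> nat \<Rightarrow> (bool list \<Rightarrow> (nat \<Rightarrow> nat) \<Rightarrow> bool list \<Rightarrow> nat) \<Rightarrow> bool" where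
 "cf \<Lambda> Z k F \<equiv> cp \<Lambda> Z k (\<lambda>x e z. (F x e z, z))"

lemma push_plus [simp]: "(a ## b ## c ## e) (i + 3) = e i" "(a ## e) (i + 1) = e i"
 by (simp_all add: push_def numeral_3_eq_3)

lemma ES_regs: "(ES ba sd k e T h)\<lparr>regs := env_regs ba' sd' k' e'\<rparr> = ES ba' sd' k' e' T h"
 by (simp add: ES_def)

definition rung :: "(nat \<times> nat) set \<Rightarrow> (nat \<Rightarrow> nat) \<Rightarrow> nat \<Rightarrow> tfun \<Rightarrow> com \<Rightarrow> nat \<Rightarrow> (bool list \<Rightarrow> nat) \<Rightarrow> bool" where
 "rung \<Lambda> Z k G P K g \<longleftrightarrow> (\<forall>x r e z T h ba sd. (ba, sd) \<in> \<Lambda> \<longrightarrow> ba \<le> pb K x \<longrightarrow> sd \<le> pb K x \<longrightarrow> (\<forall>i<k. e i \<le> pb K x)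
   \<longrightarrow> viewok (length z) T ba sd \<longrightarrow> length z = Z (length x) \<longrightarrow>
   (\<forall>B. g x \<le> B \<longrightarrow> bt B x r P (ES ba sd k e (putv T ba sd z) h) (g x)
    (ES ba sd (Suc k) (fst (G x e z) ## e) (putv T ba sd (snd (G x e z))) h)))"

text \<open>\<open>rung\<close> is the form in which a program is established and
  \<open>progr\<close> the form in which it is called, with the bound on its value and with any
  larger allowance of time and register size.\<close>

definition progr :: "(nat \<times> nat) set \<Rightarrow> (nat \<Rightarrow> nat) \<Rightarrow> nat \<Rightarrow> tfun \<Rightarrow> com \<Rightarrow> nat \<Rightarrow> nat \<Rightarrow> bool" where
 "progr \<Lambda> Z k G P K K' \<longleftrightarrow> K \<le> K' \<and> (\<forall>x e z. (\<forall>i<k. e i \<le> pb K x) \<longrightarrow> length z = Z (length x) \<longrightarrow>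
   fst (G x e z) \<le> pb K' x) \<and> (\<forall>x r e z T h ba sd B n. (ba, sd) \<in> \<Lambda> \<longrightarrow> ba \<le> pb K x \<longrightarrow> sd \<le> pb K x \<longrightarrow>
   (\<forall>i<k. e i \<le> pb K x) \<longrightarrow> viewok (length z) T ba sd \<longrightarrow> length z = Z (length x) \<longrightarrow> pb K' x \<le> B \<longrightarrow> pb K' x \<le> n \<longrightarrow>
   bt B x r P (ES ba sd k e (putv T ba sd z) h) n
    (ES ba sd (Suc k) (fst (G x e z) ## e) (putv T ba sd (snd (G x e z))) h))"

lemma cp_intro:
 assumes "(0, 1) \<in> \<Lambda>" "no_rand P"
  "\<And>x e z. length z = Z (length x) ==> length (snd (G x e z)) = length z"
  "\<And>K. \<exists>g. pol g \<and> rung \<Lambda> Z k G P K g"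
 shows "cp \<Lambda> Z k G"
 by (rule cpI[OF assms(1,2)]) (use assms(3,4) in \<open>auto simp: rung_def\<close>)

lemma cp_elim:
 assumes "cp \<Lambda> Z k G"
 obtains P where "no_rand P" "\<And>K. \<exists>K'. progr \<Lambda> Z k G P K K'"
 using cpE[OF assms] unfolding progr_def by blast

lemma progr_le: "progr \<Lambda> Z k G P K K' ==> K \<le> K'"
 by (simp add: progr_def)

lemma progr_value: "progr \<Lambda> Z k G P K K' ==> (\<forall>i<k. e i \<le> pb K x) ==> length z = Z (length x) ==>
   fst (G x e z) \<le> pb K' x"
 by (simp add: progr_def)

lemma progr_bt: "progr \<Lambda> Z k G P K K' ==> (ba, sd) \<in> \<Lambda> ==> ba \<le> pb K x ==> sd \<le> pb K x ==>
   (\<forall>i<k. e i \<le> pb K x) ==> viewok (length z) T ba sd ==> length z = Z (length x) ==> pb K' x \<le> B ==> pb K' x \<le> n ==>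
   bt B x r P (ES ba sd k e (putv T ba sd z) h) n
    (ES ba sd (Suc k) (fst (G x e z) ## e) (putv T ba sd (snd (G x e z))) h)"
 by (simp add: progr_def)

lemma rungI:
 assumes "\<And>x r e z T h ba sd B. (ba, sd) \<in> \<Lambda> ==> ba \<le> pb K x ==> sd \<le> pb K x ==> (\<forall>i<k. e i \<le> pb K x)
   ==> viewok (length z) T ba sd ==> length z = Z (length x) ==> g x \<le> B ==>
   bt B x r P (ES ba sd k e (putv T ba sd z) h) (g x)
    (ES ba sd (Suc k) (fst (G x e z) ## e) (putv T ba sd (snd (G x e z))) h)"
 shows "rung \<Lambda> Z k G P K g"
 using assms unfolding rung_def by blast

lemma cp_cong:
 assumes "cp \<Lambda> Z k G" "\<And>x e z. length z = Z (length x) ==> G' x e z = G x e z"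
 shows "cp \<Lambda> Z k G'"
 using assms unfolding cp_def runs_def by simp

lemma cp_L: "cp \<Lambda> Z k G ==> (0, 1) \<in> \<Lambda>"
 by (simp add: cp_def)

text \<open>The renamings in use open a gap of \<open>d\<close> registers at position
  \<open>m\<close>, which holds variables that the program does not know.\<close>

lemma rlift_gap:
 fixes d m :: nat
 defines "f \<equiv> \<lambda>i. if i < m then i else i + d"
 shows "inj f" "rlift f R R0 j = (if j < m then R j else if j < m + d then R0 j else R (j - d))"
proof -
 show i: "inj f" unfolding f_def by (auto simp: inj_def split: if_splits)
 show "rlift f R R0 j = (if j < m then R j else if j < m + d then R0 j else R (j - d))"
 proof (cases "j < m \<or> m + d \<le> j")
  case True
  then have "j = f (if j < m then j else j - d)" unfolding f_def by auto
  then have "rlift f R R0 j = R (if j < m then j else j - d)" using rlift_f[OF i] by metis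
  then show ?thesis using True by auto
 next
  case False
  then have "j \<notin> range f" unfolding f_def by auto
  then show ?thesis using False by (auto simp: rlift_def)
 qed
qed

lemma bt_ren_ES:
 assumes "bt B x r c (ES ba sd k e T h) n (ES ba sd k1 e1 T1 h1)" "inj f"
  "rlift f (env_regs ba sd k e) R0 = env_regs ba sd k' e'"
  "rlift f (env_regs ba sd k1 e1) R0 = env_regs ba sd k1' e1'"
 shows "bt B x r (ren f c) (ES ba sd k' e' T h) n (ES ba sd k1' e1' T1 h1)"
 using bt_ren[OF assms(1,2), of R0 "env_regs ba sd k' e'" "env_regs ba sd k1' e1'"] assms(3,4) by (simp add: ES_regs)

text \<open>The newest variable lies in register \<open>k + 2\<close>, exactly where the program
  would put its result. A gap of one register there moves the result above it.\<close>

lemma cp_wk: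
 assumes "cp \<Lambda> Z k G"
 shows "cp \<Lambda> Z (Suc k) (\<lambda>x e z. G x (\<lambda>i. e (Suc i)) z)"
proof -
 obtain P where P: "no_rand P" and Q: "\<And>K. \<exists>K'. progr \<Lambda> Z k G P K K'"
  using cp_elim[OF assms] by blast
 let ?f = "\<lambda>i. if i < k + 2 then i else i + 1"
 show ?thesis
 proof (rule cp_intro[where P = "ren ?f P"])
  fix K
  obtain K' where K': "progr \<Lambda> Z k G P K K'" using Q by blast
  have "rung \<Lambda> Z (Suc k) (\<lambda>x e z. G x (\<lambda>i. e (Suc i)) z) (ren ?f P) K (pb K')"
  proof (rule rungI)
   fix x r z T :: "bool list" and e h ba sd B
   assume a: "(ba, sd) \<in> \<Lambda>" "ba \<le> pb K x" "sd \<le> pb K x" "\<forall>i<Suc k. e i \<le> pb K x"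
    "viewok (length z) T ba sd" "length z = Z (length x)" "pb K' x \<le> B"
   let ?e = "\<lambda>i. e (Suc i)"
   have 1: "bt B x r P (ES ba sd k ?e (putv T ba sd z) h) (pb K' x)
    (ES ba sd (Suc k) (fst (G x ?e z) ## ?e) (putv T ba sd (snd (G x ?e z))) h)"
    using a by (intro progr_bt[OF K']) auto
   have 2: "rlift ?f (env_regs ba sd k ?e) (\<lambda>_. e 0) = env_regs ba sd (Suc k) e"
    unfolding rlift_gap(2)[abs_def] by (rule ext) (auto simp: env_regs_def Suc_diff_le)
   have 3: "rlift ?f (env_regs ba sd (Suc k) (v ## ?e)) (\<lambda>_. e 0) = env_regs ba sd (Suc (Suc k)) (v ## e)" for v
    unfolding env_regs_push rlift_gap(2)[abs_def] by (rule ext) (auto simp: env_regs_def Suc_diff_le)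
   show "bt B x r (ren ?f P) (ES ba sd (Suc k) e (putv T ba sd z) h) (pb K' x)
    (ES ba sd (Suc (Suc k)) (fst (G x ?e z) ## e) (putv T ba sd (snd (G x ?e z))) h)"
    by (rule bt_ren_ES[OF 1 rlift_gap(1) 2 3])
  qed
  then show "\<exists>g. pol g \<and> rung \<Lambda> Z (Suc k) (\<lambda>x e z. G x (\<lambda>i. e (Suc i)) z) (ren ?f P) K g" using pol_pb by blast
 qed (use P cp_L[OF assms] cp_length[OF assms] in auto)
qed

text \<open>Older variables lie below the newer ones, so a longer environment is a gap directly
  above base and stride.\<close>

lemma cp_up:
 assumes "cp \<Lambda> Z k G"
 shows "cp \<Lambda> Z (k + d) G"
proof -
 obtain P where P: "no_rand P" and Q: "\<And>K. \<exists>K'. progr \<Lambda> Z k G P K K'"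
  using cp_elim[OF assms] by blast
 let ?f = "\<lambda>i. if i < 2 then i else i + d"
 show ?thesis
 proof (rule cp_intro[where P = "ren ?f P"])
  fix K
  obtain K' where K': "progr \<Lambda> Z k G P K K'" using Q by blast
  have "rung \<Lambda> Z (k + d) G (ren ?f P) K (pb K')"
  proof (rule rungI)
   fix x r z T :: "bool list" and e h ba sd B
   assume a: "(ba, sd) \<in> \<Lambda>" "ba \<le> pb K x" "sd \<le> pb K x" "\<forall>i<k + d. e i \<le> pb K x"
    "viewok (length z) T ba sd" "length z = Z (length x)" "pb K' x \<le> B"
   let ?R = "env_regs ba sd (k + d) e"
   have 1: "bt B x r P (ES ba sd k e (putv T ba sd z) h) (pb K' x)
    (ES ba sd (Suc k) (fst (G x e z) ## e) (putv T ba sd (snd (G x e z))) h)"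
    using a by (intro progr_bt[OF K']) auto
   have 2: "rlift ?f (env_regs ba sd k e) ?R = env_regs ba sd (k + d) e"
    unfolding rlift_gap(2)[abs_def] by (rule ext) (auto simp: env_regs_def intro!: arg_cong[of _ _ e])
   have 3: "rlift ?f (env_regs ba sd (Suc k) (v ## e)) ?R = env_regs ba sd (Suc (k + d)) (v ## e)" for v
    unfolding env_regs_push rlift_gap(2)[abs_def] by (rule ext) (auto simp: env_regs_def intro!: arg_cong[of _ _ e])
   show "bt B x r (ren ?f P) (ES ba sd (k + d) e (putv T ba sd z) h) (pb K' x)
    (ES ba sd (Suc (k + d)) (fst (G x e z) ## e) (putv T ba sd (snd (G x e z))) h)"
    by (rule bt_ren_ES[OF 1 rlift_gap(1) 2 3])
  qed
  then show "\<exists>g. pol g \<and> rung \<Lambda> Z (k + d) G (ren ?f P) K g" using pol_pb by blast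
 qed (use P cp_L[OF assms] cp_length[OF assms] in auto)
qed

lemma cp_bind:
 assumes "cp \<Lambda> Z k G" "cp \<Lambda> Z (Suc k) H"
 shows "cp \<Lambda> Z k (\<lambda>x e z. H x (fst (G x e z) ## e) (snd (G x e z)))"
proof -
 obtain P where P: "no_rand P" and Q: "\<And>K. \<exists>K'. progr \<Lambda> Z k G P K K'"
  using cp_elim[OF assms(1)] by blast
 obtain P' where P': "no_rand P'" and Q': "\<And>K. \<exists>K'. progr \<Lambda> Z (Suc k) H P' K K'"
  using cp_elim[OF assms(2)] by blast
 let ?a = "Suc (Suc k)" let ?b = "Suc (Suc (Suc k))"
 show ?thesis
 proof (rule cp_intro[where P = "P ;; P' ;; clr ?a ;; mov ?b ?a"])
  fix K
  obtain K1 where K1: "progr \<Lambda> Z k G P K K1" using Q by blast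
  obtain K2 where K2: "progr \<Lambda> Z (Suc k) H P' K1 K2" using Q' by blast
  let ?g = "\<lambda>x. pb K1 x + (pb K2 x + ((2 * pb K1 x + 1) + (4 * pb K2 x + 1) + 1) + 1) + 1"
  have p: "pol ?g" by (intro pol_intros)
  have "rung \<Lambda> Z k (\<lambda>x e z. H x (fst (G x e z) ## e) (snd (G x e z))) (P ;; P' ;; clr ?a ;; mov ?b ?a) K ?g"
  proof (rule rungI)
   fix x r z T :: "bool list" and e h ba sd B
   assume a: "(ba, sd) \<in> \<Lambda>" "ba \<le> pb K x" "sd \<le> pb K x" "\<forall>i<k. e i \<le> pb K x"
    "viewok (length z) T ba sd" "length z = Z (length x)" "?g x \<le> B"
   define v where "v = fst (G x e z)"
   define z1 where "z1 = snd (G x e z)"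
   have l1: "length z1 = length z" using cp_length[OF assms(1) a(6)] by (simp add: z1_def)
   have le: "pb K x \<le> pb K1 x" using progr_le[OF K1] by (rule pb_mono)
   have e1: "\<forall>i<Suc k. (v ## e) i \<le> pb K1 x"
    using progr_value[OF K1 a(4,6)] a(4) le by (auto simp: v_def push_def split: nat.splits intro: order_trans)
   define v' where "v' = fst (H x (v ## e) z1)"
   define z2 where "z2 = snd (H x (v ## e) z1)"
   have v': "v' \<le> pb K2 x" using progr_value[OF K2 e1] l1 a(6) by (simp add: v'_def)
   have 1: "bt B x r P (ES ba sd k e (putv T ba sd z) h) (pb K1 x) (ES ba sd (Suc k) (v ## e) (putv T ba sd z1) h)"
    using progr_bt[OF K1 a(1-6)] a(7) by (simp add: v_def z1_def)
   have 2: "bt B x r P' (ES ba sd (Suc k) (v ## e) (putv T ba sd z1) h) (pb K2 x)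
     (ES ba sd ?a (v' ## v ## e) (putv T ba sd z2) h)"
    using progr_bt[OF K2, of ba sd x "v ## e" z1 T B "pb K2 x" r h] a l1 le e1 by (simp add: v'_def z2_def)
   let ?s = "ES ba sd ?a (v' ## v ## e) (putv T ba sd z2) h"
   have r: "regs ?s = (env_regs ba sd k e)(?a := v, ?b := v')" by (simp add: env_regs_push)
   have 3: "bt B x r (clr ?a) ?s (2 * pb K1 x + 1) (?s\<lparr>regs := (regs ?s)(?a := 0)\<rparr>)"
    by (rule bt_mono[OF bt_clr]) (use e1 r in \<open>auto dest: spec[of _ 0]\<close>)
   have 4: "bt B x r (mov ?b ?a) (?s\<lparr>regs := (regs ?s)(?a := 0)\<rparr>) (4 * pb K2 x + 1)
     (ES ba sd (Suc k) (v' ## e) (putv T ba sd z2) h)"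
   proof -
    have "(?s\<lparr>regs := (regs ?s)(?a := 0)\<rparr>)\<lparr>regs := (regs (?s\<lparr>regs := (regs ?s)(?a := 0)\<rparr>))(?b := 0, ?a := v' + 0)\<rparr>
     = ES ba sd (Suc k) (v' ## e) (putv T ba sd z2) h"
     unfolding r by (rule pst_eqI) (auto simp: env_regs_push fun_eq_iff)
    then show ?thesis
     using bt_mov[of ?b ?a "?s\<lparr>regs := (regs ?s)(?a := 0)\<rparr>" B x r] v' a(7) r
     by (auto intro: bt_mono)
   qed
   show "bt B x r (P ;; P' ;; clr ?a ;; mov ?b ?a) (ES ba sd k e (putv T ba sd z) h) (?g x)
    (ES ba sd (Suc k) (fst (H x (fst (G x e z) ## e) (snd (G x e z))) ## e) (putv T ba sd (snd (H x (fst (G x e z) ## e) (snd (G x e z))))) h)"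
    using bt_Sq[OF 1 bt_Sq[OF 2 bt_Sq[OF 3 4]]] by (simp add: v_def z1_def v'_def z2_def)
  qed
  then show "\<exists>g. pol g \<and> rung \<Lambda> Z k (\<lambda>x e z. H x (fst (G x e z) ## e) (snd (G x e z))) (P ;; P' ;; clr ?a ;; mov ?b ?a) K g"
   using p by blast
 next
  fix x z :: "bool list" and e assume a: "length z = Z (length x)"
  show "length (snd (H x (fst (G x e z) ## e) (snd (G x e z)))) = length z"
   using cp_length[OF assms(1) a] cp_length[OF assms(2)] a by simp
 qed (use P P' cp_L[OF assms(1)] in \<open>auto simp: clr_def mov_def\<close>)
qed

lemma cp_if:
 assumes "cf \<Lambda> Z k C" "cp \<Lambda> Z k G" "cp \<Lambda> Z k H"
 shows "cp \<Lambda> Z k (\<lambda>x e z. if C x e z \<noteq> 0 then G x e z else H x e z)"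
proof -
 obtain PC where PC: "no_rand PC" and QC: "\<And>K. \<exists>K'. progr \<Lambda> Z k (\<lambda>x e z. (C x e z, z)) PC K K'"
  using cp_elim[OF assms(1)] by blast
 obtain PG where PG: "no_rand PG" and QG: "\<And>K. \<exists>K'. progr \<Lambda> Z k G PG K K'"
  using cp_elim[OF assms(2)] by blast
 obtain PH where PH: "no_rand PH" and QH: "\<And>K. \<exists>K'. progr \<Lambda> Z k H PH K K'"
  using cp_elim[OF assms(3)] by blast
 let ?a = "Suc (Suc k)"
 let ?P = "PC ;; Ite (NZ ?a) (clr ?a ;; PG) PH"
 show ?thesis
 proof (rule cp_intro[where P = ?P])
  fix K
  obtain K1 K2 K3 where K1: "progr \<Lambda> Z k (\<lambda>x e z. (C x e z, z)) PC K K1"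
   and K2: "progr \<Lambda> Z k G PG K K2" and K3: "progr \<Lambda> Z k H PH K K3" using QC QG QH by blast
  let ?n = "\<lambda>x. (2 * pb K1 x + 1) + (pb K2 x + pb K3 x) + 1"
  let ?g = "\<lambda>x. pb K1 x + (?n x + 1) + 1"
  have p: "pol ?g" by (intro pol_intros)
  have "rung \<Lambda> Z k (\<lambda>x e z. if C x e z \<noteq> 0 then G x e z else H x e z) ?P K ?g"
  proof (rule rungI)
   fix x r z T :: "bool list" and e h ba sd B
   assume a: "(ba, sd) \<in> \<Lambda>" "ba \<le> pb K x" "sd \<le> pb K x" "\<forall>i<k. e i \<le> pb K x"
    "viewok (length z) T ba sd" "length z = Z (length x)" "?g x \<le> B"
   let ?T = "putv T ba sd z"
   define c where "c = C x e z"
   define vz where "vz = (if c \<noteq> 0 then G x e z else H x e z)"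
   let ?s' = "ES ba sd (Suc k) (fst vz ## e) (putv T ba sd (snd vz)) h"
   have c: "c \<le> pb K1 x" using progr_value[OF K1 a(4,6)] by (simp add: c_def)
   have 1: "bt B x r PC (ES ba sd k e ?T h) (pb K1 x) (ES ba sd (Suc k) (c ## e) ?T h)"
    using progr_bt[OF K1 a(1-6), of B "pb K1 x"] a(7) by (simp add: c_def)
   let ?s = "ES ba sd (Suc k) (c ## e) ?T h"
   have r: "regs ?s = (env_regs ba sd k e)(?a := c)" by (simp add: env_regs_push)
   have 2: "bt B x r (Ite (NZ ?a) (clr ?a ;; PG) PH) ?s (?n x + 1) ?s'"
   proof (rule bt_Ite)
    assume "tval x r (NZ ?a) ?s"
    then have c0: "c \<noteq> 0" using r by simp
    have "?s\<lparr>regs := (regs ?s)(?a := 0)\<rparr> = ES ba sd k e ?T h"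
     unfolding r by (rule pst_eqI) (auto simp: fun_eq_iff)
    then have "bt B x r (clr ?a) ?s (2 * pb K1 x + 1) (ES ba sd k e ?T h)"
     using bt_clr[of B x r ?a ?s] r c by (auto intro: bt_mono)
    moreover have "bt B x r PG (ES ba sd k e ?T h) (pb K2 x + pb K3 x) ?s'"
     using progr_bt[OF K2 a(1-6), of B "pb K2 x + pb K3 x"] a(7) c0 by (simp add: vz_def)
    ultimately show "bt B x r (clr ?a ;; PG) ?s (?n x) ?s'" by (rule bt_Sq)
   next
    assume "\<not> tval x r (NZ ?a) ?s"
    then have c0: "c = 0" using r by simp
    then have "?s = ES ba sd k e ?T h" by (intro pst_eqI) (auto simp: env_regs_push fun_eq_iff)
    then show "bt B x r PH ?s (?n x) ?s'"
     using progr_bt[OF K3 a(1-6), of B "?n x"] a(7) c0 by (simp add: vz_def)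
   qed simp
   show "bt B x r ?P (ES ba sd k e ?T h) (?g x) (ES ba sd (Suc k) (fst (if C x e z \<noteq> 0 then G x e z else H x e z) ## e)
     (putv T ba sd (snd (if C x e z \<noteq> 0 then G x e z else H x e z))) h)"
    using bt_Sq[OF 1 2] by (simp add: vz_def c_def)
  qed
  then show "\<exists>g. pol g \<and> rung \<Lambda> Z k (\<lambda>x e z. if C x e z \<noteq> 0 then G x e z else H x e z) ?P K g" using p by blast
 qed (use PC PG PH cp_L[OF assms(1)] cp_length[OF assms(2)] cp_length[OF assms(3)] in \<open>auto simp: clr_def\<close>)
qed

primrec itr :: "(nat \<Rightarrow> nat \<Rightarrow> bool list \<Rightarrow> nat \<times> bool list) \<Rightarrow> nat \<Rightarrow> bool list \<Rightarrow> nat \<Rightarrow> nat \<times> bool list" where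
 "itr g v z 0 = (v, z)"
| "itr g v z (Suc i) = g i (fst (itr g v z i)) (snd (itr g v z i))"

lemma env_regs_zero: "env_regs ba sd (Suc k) (0 ## e) = env_regs ba sd k e"
 unfolding env_regs_push by (rule ext) simp

text \<open>Iterating a polynomial-time body may raise the degree in every round, so a polynomial
  bound on the running value through all rounds has to be supplied. The shift by 3 steps over the
  round, the running value and the count of rounds left.\<close>

lemma cp_iter:
 assumes N: "cf \<Lambda> Z k N" and I: "cf \<Lambda> Z k I"
  and G: "cp \<Lambda> Z (Suc (Suc (Suc k))) (\<lambda>x e z. G x (e 0) (e 1) (\<lambda>i. e (i + 3)) z)"
  and bnd: "\<And>K. \<exists>K'. \<forall>x e z i. (\<forall>j<k. e j \<le> pb K x) \<longrightarrow> length z = Z (length x) \<longrightarrow> i \<le> N x e z \<longrightarrow>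
   fst (itr (\<lambda>i v z. G x i v e z) (I x e z) z i) \<le> pb K' x"
 shows "cp \<Lambda> Z k (\<lambda>x e z. itr (\<lambda>i v z. G x i v e z) (I x e z) z (N x e z))"
proof -
 define F where "F x e z i = itr (\<lambda>i v z. G x i v e z) (I x e z) z i" for x e z i
 obtain PN where PN: "no_rand PN" and QN: "\<And>K. \<exists>K'. progr \<Lambda> Z k (\<lambda>x e z. (N x e z, z)) PN K K'"
  using cp_elim[OF N] by blast
 obtain PI where PI: "no_rand PI" and QI: "\<And>K. \<exists>K'. progr \<Lambda> Z (Suc k) (\<lambda>x e z. (I x (\<lambda>i. e (Suc i)) z, z)) PI K K'"
  using cp_elim[OF cp_wk[OF I]] by blast
 obtain PG where PG: "no_rand PG" and QG: "\<And>K. \<exists>K'. progr \<Lambda> Z (Suc (Suc (Suc k))) (\<lambda>x e z. G x (e 0) (e 1) (\<lambda>i. e (i + 3)) z) PG K K'"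
  using cp_elim[OF G] by blast
 have lenG: "length (snd (G x i v e z)) = length z" if "length z = Z (length x)" for x i v e z
  using cp_length[OF G that, of "i ## v ## 0 ## e"] by simp
 have lenF: "length (snd (F x e z i)) = length z" if "length z = Z (length x)" for x e z i
  by (induction i) (use that lenG in \<open>auto simp: F_def\<close>)
 let ?n = "Suc (Suc k)" let ?v = "Suc ?n" let ?i = "Suc ?v" let ?w = "Suc ?i"
 let ?body = "PG ;; clr ?v ;; mov ?w ?v ;; Inc ?i ;; Dec ?n"
 let ?P = "PN ;; PI ;; Wh (NZ ?n) ?body ;; clr ?i ;; mov ?v ?n"
 show ?thesis
 proof (rule cp_intro[where P = ?P])
  fix K
  obtain K1 where K1: "progr \<Lambda> Z k (\<lambda>x e z. (N x e z, z)) PN K K1" using QN by blast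
  obtain K2 where K2: "progr \<Lambda> Z (Suc k) (\<lambda>x e z. (I x (\<lambda>i. e (Suc i)) z, z)) PI K1 K2" using QI by blast
  obtain Kb where Kb: "\<And>x e z i. (\<forall>j<k. e j \<le> pb K x) ==> length z = Z (length x) ==> i \<le> N x e z ==>
   fst (F x e z i) \<le> pb Kb x" using bnd[of K] unfolding F_def by blast
  \<comment> \<open>\<open>KM\<close> covers the variables and every intermediate value at once, so
    a single bound \<open>K3\<close> for the body serves all rounds.\<close>
  define KM where "KM = max K2 Kb"
  obtain K3 where K3: "progr \<Lambda> Z (Suc (Suc (Suc k))) (\<lambda>x e z. G x (e 0) (e 1) (\<lambda>i. e (i + 3)) z) PG KM K3" using QG by blast
  let ?b = "\<lambda>x. pb K3 x + ((2 * pb KM x + 1) + ((4 * pb KM x + 1) + 3 + 1) + 1) + 1"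
  let ?g = "\<lambda>x. pb K1 x + (pb K2 x + ((pb K1 x * (?b x + 1) + 1) + ((2 * pb KM x + 1) + (4 * pb KM x + 1) + 1) + 1) + 1) + 1"
  have p: "pol ?g" by (intro pol_intros)
  have "rung \<Lambda> Z k (\<lambda>x e z. F x e z (N x e z)) ?P K ?g"
  proof (rule rungI)
   fix x r z T :: "bool list" and e h ba sd B
   assume a: "(ba, sd) \<in> \<Lambda>" "ba \<le> pb K x" "sd \<le> pb K x" "\<forall>i<k. e i \<le> pb K x"
    "viewok (length z) T ba sd" "length z = Z (length x)" "?g x \<le> B"
   have le: "pb K x \<le> pb K1 x" "pb K1 x \<le> pb K2 x" "pb K2 x \<le> pb KM x" "pb Kb x \<le> pb KM x" "pb KM x \<le> pb K3 x"
    using progr_le[OF K1] progr_le[OF K2] progr_le[OF K3] by (auto intro!: pb_mono simp: KM_def)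
   have "1 * (?b x + 1) \<le> pb K1 x * (?b x + 1)" by (intro mult_le_mono1 pb_ge1)
   also have "pb K1 x * (?b x + 1) \<le> ?g x" by simp
   finally have m: "?b x + 1 \<le> B" using a(7) by simp
   have gB: "pb K1 x \<le> B" "pb K2 x \<le> B" using a(7) by linarith+
   have gB: "pb K1 x \<le> B" "pb K2 x \<le> B" "pb K3 x \<le> B" "pb KM x < B" using gB m le by linarith+
   define M where "M = N x e z"
   define v where "v j = fst (F x e z j)" for j
   define zz where "zz j = snd (F x e z j)" for j
   have v0: "v 0 = I x e z" "zz 0 = z" by (simp_all add: v_def zz_def F_def)
   have vS: "v (Suc j) = fst (G x j (v j) e (zz j))" "zz (Suc j) = snd (G x j (v j) e (zz j))" for j
    by (simp_all add: v_def zz_def F_def)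
   have lz: "length (zz j) = length z" for j using lenF[OF a(6)] by (simp add: zz_def)
   have M: "M \<le> pb K1 x" using progr_value[OF K1 a(4,6)] by (simp add: M_def)
   have vb: "v j \<le> pb KM x" if "j \<le> M" for j
    using Kb[OF a(4,6), of j] that le by (auto simp: v_def M_def intro: order_trans)
   have 1: "bt B x r PN (ES ba sd k e (putv T ba sd z) h) (pb K1 x) (ES ba sd (Suc k) (M ## e) (putv T ba sd z) h)"
    using progr_bt[OF K1 a(1-6) gB(1)] by (simp add: M_def)
   have e1: "\<forall>i<Suc k. (M ## e) i \<le> pb K1 x"
    using M a(4) le by (auto simp: push_def split: nat.splits intro: order_trans)
   let ?f = "\<lambda>j. ES ba sd (Suc (Suc (Suc k))) (j ## v j ## (M - j) ## e) (putv T ba sd (zz j)) h"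
   have 2: "bt B x r PI (ES ba sd (Suc k) (M ## e) (putv T ba sd z) h) (pb K2 x) (?f 0)"
   proof -
    have "?f 0 = ES ba sd (Suc (Suc k)) (I x e z ## M ## e) (putv T ba sd z) h"
     using v0 env_regs_zero[of ba sd "Suc (Suc k)" "v 0 ## M ## e"] by (simp add: ES_def)
    then show ?thesis using progr_bt[OF K2 a(1) _ _ e1 a(5,6) gB(2), of "pb K2 x" r h] a(2,3) le by simp
   qed
   have 3: "bt B x r (Wh (NZ ?n) ?body) (?f 0) (M * (?b x + 1) + 1) (?f M)"
   proof (rule bt_loop)
    fix j assume j: "j < M"
    show "regs (?f j) ?n \<noteq> 0" using j by (simp add: env_regs_push)
    let ?s = "ES ba sd (Suc (Suc (Suc (Suc k)))) (v (Suc j) ## j ## v j ## (M - j) ## e) (putv T ba sd (zz (Suc j))) h"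
    have eb: "\<forall>i<Suc (Suc (Suc k)). (j ## v j ## (M - j) ## e) i \<le> pb KM x"
     using M j a(4) le vb[of j] by (auto simp: push_def split: nat.splits intro: order_trans)
    have b1: "bt B x r PG (?f j) (pb K3 x) ?s"
     using progr_bt[OF K3 a(1) _ _ eb _ _ gB(3), of "zz j" T "pb K3 x" r h] a le lz[of j] by (simp add: vS)
    have r: "regs ?s = (env_regs ba sd k e)(?n := M - j, ?v := v j, ?i := j, ?w := v (Suc j))"
     by (simp add: env_regs_push)
    let ?s1 = "?s\<lparr>regs := (regs ?s)(?v := 0)\<rparr>"
    let ?s2 = "?s1\<lparr>regs := (regs ?s1)(?w := 0, ?v := v (Suc j) + 0)\<rparr>"
    have b2: "bt B x r (clr ?v) ?s (2 * pb KM x + 1) ?s1"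
     using bt_clr[of B x r ?v ?s] r vb[of j] j by (auto intro: bt_mono)
    have b3: "bt B x r (mov ?w ?v) ?s1 (4 * pb KM x + 1) ?s2"
     using bt_mov[of ?w ?v ?s1 B x r] r vb[of "Suc j"] j gB(4) by (auto intro: bt_mono)
    have rf: "regs (?f (Suc j)) = (env_regs ba sd k e)(?n := M - Suc j, ?v := v (Suc j), ?i := Suc j)"
     by (simp add: env_regs_push)
    have b4: "bt B x r (Inc ?i ;; Dec ?n) ?s2 3 (?f (Suc j))"
    proof (rule bt_line')
     show "line B x (Inc ?i ;; Dec ?n) ?s2" using r j M le gB by simp
     show "eff x (Inc ?i ;; Dec ?n) ?s2 = ?f (Suc j)"
      by (rule pst_eqI) (use j in \<open>auto simp: r rf fun_eq_iff simp del: ES_sel(1)\<close>)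
    qed simp
    show "bt B x r ?body (?f j) (?b x) (?f (Suc j))"
     using bt_Sq[OF b1 bt_Sq[OF b2 bt_Sq[OF b3 b4]]] .
   next
    show "regs (?f M) ?n = 0" by (simp add: env_regs_push)
   qed
   let ?s = "?f M"
   let ?s1 = "?s\<lparr>regs := (regs ?s)(?i := 0)\<rparr>"
   have r: "regs ?s = (env_regs ba sd k e)(?n := 0, ?v := v M, ?i := M)" by (simp add: env_regs_push)
   have 4: "bt B x r (clr ?i) ?s (2 * pb KM x + 1) ?s1"
    using bt_clr[of B x r ?i ?s] r M le by (auto intro: bt_mono)
   have 5: "bt B x r (mov ?v ?n) ?s1 (4 * pb KM x + 1) (ES ba sd (Suc k) (v M ## e) (putv T ba sd (zz M)) h)"
   proof -
    have "?s1\<lparr>regs := (regs ?s1)(?v := 0, ?n := v M + 0)\<rparr> = ES ba sd (Suc k) (v M ## e) (putv T ba sd (zz M)) h"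
     unfolding r by (rule pst_eqI) (auto simp: env_regs_push fun_eq_iff)
    then show ?thesis using bt_mov[of ?v ?n ?s1 B x r] r vb[of M] gB(4) by (auto intro: bt_mono)
   qed
   have 3: "bt B x r (Wh (NZ ?n) ?body) (?f 0) (pb K1 x * (?b x + 1) + 1) (?f M)"
    by (rule bt_mono[OF 3 order_refl]) (use M in \<open>intro add_right_mono mult_le_mono1\<close>)
   show "bt B x r ?P (ES ba sd k e (putv T ba sd z) h) (?g x)
     (ES ba sd (Suc k) (fst (F x e z (N x e z)) ## e) (putv T ba sd (snd (F x e z (N x e z)))) h)"
    using bt_Sq[OF 1 bt_Sq[OF 2 bt_Sq[OF 3 bt_Sq[OF 4 5]]]] by (simp add: v_def zz_def M_def)
  qed
  then show "\<exists>g. pol g \<and> rung \<Lambda> Z k (\<lambda>x e z. itr (\<lambda>i v z. G x i v e z) (I x e z) z (N x e z)) ?P K g"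
   using p unfolding F_def by blast
 next
  show "length (snd (itr (\<lambda>i v z. G x i v e z) (I x e z) z (N x e z))) = length z" if "length z = Z (length x)" for x e z
   using lenF[OF that] by (simp add: F_def)
 qed (use PN PI PG cp_L[OF N] in \<open>auto simp: clr_def mov_def\<close>)
qed

text \<open>For primitive operations, which rework the topmost value in place.\<close>

lemma cp_post:
 assumes "cp \<Lambda> Z k G" "no_rand Q"
  "\<And>x e z. length z = Z (length x) ==> length (snd (H x e z)) = length z"
  "\<And>K. \<exists>q. pol q \<and> (\<forall>x r e z T h ba sd B. (ba, sd) \<in> \<Lambda> \<longrightarrow> ba \<le> pb K x \<longrightarrow> sd \<le> pb K x \<longrightarrow> (\<forall>i<Suc k. e i \<le> pb K x)
   \<longrightarrow> viewok (length z) T ba sd \<longrightarrow> length z = Z (length x) \<longrightarrow> q x \<le> B \<longrightarrow>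
   bt B x r Q (ES ba sd (Suc k) e (putv T ba sd z) h) (q x)
    (ES ba sd (Suc k) (fst (H x e z) ## (\<lambda>i. e (Suc i))) (putv T ba sd (snd (H x e z))) h))"
 shows "cp \<Lambda> Z k (\<lambda>x e z. H x (fst (G x e z) ## e) (snd (G x e z)))"
proof -
 obtain P where P: "no_rand P" and QG: "\<And>K. \<exists>K'. progr \<Lambda> Z k G P K K'"
  using cp_elim[OF assms(1)] by blast
 show ?thesis
 proof (rule cp_intro[where P = "P ;; Q"])
  fix K
  obtain K1 where K1: "progr \<Lambda> Z k G P K K1" using QG by blast
  obtain q where q: "pol q" and *: "\<And>x r e z T h ba sd B. (ba, sd) \<in> \<Lambda> ==> ba \<le> pb K1 x ==> sd \<le> pb K1 x ==> (\<forall>i<Suc k. e i \<le> pb K1 x)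
   ==> viewok (length z) T ba sd ==> length z = Z (length x) ==> q x \<le> B ==>
   bt B x r Q (ES ba sd (Suc k) e (putv T ba sd z) h) (q x)
    (ES ba sd (Suc k) (fst (H x e z) ## (\<lambda>i. e (Suc i))) (putv T ba sd (snd (H x e z))) h)"
   using assms(4)[of K1] by blast
  let ?g = "\<lambda>x. pb K1 x + q x + 1"
  have p: "pol ?g" by (intro pol_intros q)
  have "rung \<Lambda> Z k (\<lambda>x e z. H x (fst (G x e z) ## e) (snd (G x e z))) (P ;; Q) K ?g"
  proof (rule rungI)
   fix x r z T :: "bool list" and e h ba sd B
   assume a: "(ba, sd) \<in> \<Lambda>" "ba \<le> pb K x" "sd \<le> pb K x" "\<forall>i<k. e i \<le> pb K x"
    "viewok (length z) T ba sd" "length z = Z (length x)" "?g x \<le> B"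
   have le: "pb K x \<le> pb K1 x" using progr_le[OF K1] by (rule pb_mono)
   let ?v = "fst (G x e z)" let ?z = "snd (G x e z)"
   have l: "length ?z = length z" using cp_length[OF assms(1) a(6)] by simp
   have e1: "\<forall>i<Suc k. (?v ## e) i \<le> pb K1 x"
    using progr_value[OF K1 a(4,6)] a(4) le by (auto simp: push_def split: nat.splits intro: order_trans)
   have 1: "bt B x r P (ES ba sd k e (putv T ba sd z) h) (pb K1 x) (ES ba sd (Suc k) (?v ## e) (putv T ba sd ?z) h)"
    using progr_bt[OF K1 a(1-6)] a(7) by simp
   have 2: "bt B x r Q (ES ba sd (Suc k) (?v ## e) (putv T ba sd ?z) h) (q x)
     (ES ba sd (Suc k) (fst (H x (?v ## e) ?z) ## e) (putv T ba sd (snd (H x (?v ## e) ?z))) h)"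
    using *[of ba sd x "?v ## e" ?z T B r h] a l le e1 by simp
   show "bt B x r (P ;; Q) (ES ba sd k e (putv T ba sd z) h) (?g x)
     (ES ba sd (Suc k) (fst (H x (?v ## e) ?z) ## e) (putv T ba sd (snd (H x (?v ## e) ?z))) h)"
    using bt_Sq[OF 1 2] .
  qed
  then show "\<exists>g. pol g \<and> rung \<Lambda> Z k (\<lambda>x e z. H x (fst (G x e z) ## e) (snd (G x e z))) (P ;; Q) K g" using p by blast
 next
  show "length (snd (H x (fst (G x e z) ## e) (snd (G x e z)))) = length z" if "length z = Z (length x)" for x e z
   using assms(3) cp_length[OF assms(1) that] that by simp
 qed (use assms(2) P cp_L[OF assms(1)] in auto)
qed

lemma ES_upd_top:
 assumes "e' = (\<lambda>i. e (Suc i))"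
 shows "(ES ba sd (Suc k) e T h)\<lparr>regs := (env_regs ba sd (Suc k) e)(Suc (Suc k) := v)\<rparr> = ES ba sd (Suc k) (v ## e') T h"
proof -
 have "e = e 0 ## e'" using assms by (auto simp: push_def fun_eq_iff split: nat.split)
 then have "env_regs ba sd (Suc k) e = (env_regs ba sd k e')(Suc (Suc k) := e 0)"
  using env_regs_push[of ba sd k "e 0" e'] by simp
 then show ?thesis by (intro pst_eqI) (simp_all add: env_regs_push)
qed

lemma env_regs_topvar: "env_regs ba sd (Suc k) e (Suc (Suc k)) = e 0"
 by (simp add: env_regs_def)

lemma cf_zero: "(0, 1) \<in> \<Lambda> ==> cf \<Lambda> Z k (\<lambda>x e z. 0)"
proof (rule cp_intro[where P = Skip])
 have "rung \<Lambda> Z k (\<lambda>x e z. (0, z)) Skip K (\<lambda>_. 1)" for K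
 proof (rule rungI)
  fix x r z T :: "bool list" and e h ba sd B
  have "ES ba sd (Suc k) (0 ## e) (putv T ba sd z) h = ES ba sd k e (putv T ba sd z) h"
   by (simp add: ES_def env_regs_zero)
  then show "bt B x r Skip (ES ba sd k e (putv T ba sd z) h) 1
   (ES ba sd (Suc k) (fst (0, z) ## e) (putv T ba sd (snd (0, z))) h)"
   by (auto intro!: bt_line')
 qed
 then show "\<exists>g. pol g \<and> rung \<Lambda> Z k (\<lambda>x e z. (0, z)) Skip K g" for K using pol_const by blast
qed auto

lemma cp_Suc:
 assumes "cp \<Lambda> Z k G"
 shows "cp \<Lambda> Z k (\<lambda>x e z. (Suc (fst (G x e z)), snd (G x e z)))"
proof -
 have "cp \<Lambda> Z k (\<lambda>x e z. (\<lambda>x e z. (Suc (e 0), z)) x (fst (G x e z) ## e) (snd (G x e z)))"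
 proof (rule cp_post[OF assms, where Q = "Inc (Suc (Suc k))"], goal_cases)
  case (3 K)
  show ?case
  proof (intro exI[of _ "\<lambda>x. pb K x + 1"] conjI allI impI)
   show "pol (\<lambda>x. pb K x + 1)" by (intro pol_intros)
   fix x r z T :: "bool list" and e h ba sd B
   assume a: "\<forall>i<Suc k. e i \<le> pb K x" "pb K x + 1 \<le> B"
   then have "e 0 < B" by (metis Suc_eq_plus1 le_imp_less_Suc order_less_le_trans zero_less_Suc)
   then show "bt B x r (Inc (Suc (Suc k))) (ES ba sd (Suc k) e (putv T ba sd z) h) (pb K x + 1)
     (ES ba sd (Suc k) (fst (Suc (e 0), z) ## (\<lambda>i. e (Suc i))) (putv T ba sd (snd (Suc (e 0), z))) h)"
    by (intro bt_line') (simp_all add: env_regs_topvar ES_upd_top)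
  qed
 qed auto
 then show ?thesis by simp
qed

lemma cf_Suc: "cf \<Lambda> Z k F ==> cf \<Lambda> Z k (\<lambda>x e z. Suc (F x e z))"
 using cp_Suc[of \<Lambda> Z k "\<lambda>x e z. (F x e z, z)"] by simp

lemma cf_pred:
 assumes "cf \<Lambda> Z k F"
 shows "cf \<Lambda> Z k (\<lambda>x e z. F x e z - Suc 0)"
proof -
 let ?Q = "Ite (NZ (Suc (Suc k))) (Dec (Suc (Suc k))) Skip"
 have "cp \<Lambda> Z k (\<lambda>x e z. (\<lambda>x e z. (e 0 - Suc 0, z)) x (fst (F x e z, z) ## e) (snd (F x e z, z)))"
 proof (rule cp_post[OF assms, where Q = ?Q], goal_cases)
  case (3 K)
  show ?case
  proof (intro exI[of _ "\<lambda>x. 1 + 1"] conjI allI impI)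
   show "pol (\<lambda>x. 1 + 1)" by (intro pol_intros)
   fix x r z T :: "bool list" and e h ba sd B
   show "bt B x r ?Q (ES ba sd (Suc k) e (putv T ba sd z) h) (1 + 1)
     (ES ba sd (Suc k) (fst (e 0 - Suc 0, z) ## (\<lambda>i. e (Suc i))) (putv T ba sd (snd (e 0 - Suc 0, z))) h)"
   proof (rule bt_Ite)
    assume "tval x r (NZ (Suc (Suc k))) (ES ba sd (Suc k) e (putv T ba sd z) h)"
    then show "bt B x r (Dec (Suc (Suc k))) (ES ba sd (Suc k) e (putv T ba sd z) h) 1
     (ES ba sd (Suc k) (fst (e 0 - Suc 0, z) ## (\<lambda>i. e (Suc i))) (putv T ba sd (snd (e 0 - Suc 0, z))) h)"
     by (intro bt_line') (simp_all add: env_regs_topvar ES_upd_top)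
   next
    assume "\<not> tval x r (NZ (Suc (Suc k))) (ES ba sd (Suc k) e (putv T ba sd z) h)"
    then have "e 0 = 0" by (simp add: env_regs_topvar)
    then have "ES ba sd (Suc k) ((e 0 - Suc 0) ## (\<lambda>i. e (Suc i))) (putv T ba sd z) h = ES ba sd (Suc k) e (putv T ba sd z) h"
     by (auto intro!: arg_cong[of _ _ "\<lambda>e. ES ba sd (Suc k) e _ h"] simp: push_def fun_eq_iff split: nat.split)
    then show "bt B x r Skip (ES ba sd (Suc k) e (putv T ba sd z) h) 1
     (ES ba sd (Suc k) (fst (e 0 - Suc 0, z) ## (\<lambda>i. e (Suc i))) (putv T ba sd (snd (e 0 - Suc 0, z))) h)"
     by (intro bt_line') simp_all
   qed simp
  qed
 qed auto
 then show ?thesis by simp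
qed

lemma cf_var:
 assumes "(0, 1) \<in> \<Lambda>" "i < k"
 shows "cf \<Lambda> Z k (\<lambda>x e z. e i)"
proof (rule cp_intro[where P = "cpy (k + 1 - i) (Suc (Suc k)) (Suc (Suc (Suc k)))"])
 fix K
 let ?g = "\<lambda>x. 10 * pb K x + 3"
 let ?P = "cpy (k + 1 - i) (Suc (Suc k)) (Suc (Suc (Suc k)))"
 have p: "pol ?g" by (intro pol_intros)
 have "rung \<Lambda> Z k (\<lambda>x e z. (e i, z)) ?P K ?g"
 proof (rule rungI)
  fix x r z T :: "bool list" and e h ba sd B
  assume a: "\<forall>i<k. e i \<le> pb K x" "?g x \<le> B"
  let ?s = "ES ba sd k e (putv T ba sd z) h"
  have ei: "env_regs ba sd k e (k + 1 - i) = e i" using assms(2) by (auto simp: env_regs_def Suc_diff_le)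
  have "e i \<le> pb K x" using a assms(2) by simp
  moreover have "?s\<lparr>regs := (regs ?s)(Suc (Suc k) := e i)\<rparr> = ES ba sd (Suc k) (e i ## e) (putv T ba sd z) h"
   by (rule pst_eqI) (simp_all add: env_regs_push)
  moreover have "k + 1 - i \<noteq> Suc (Suc k)" "k + 1 - i \<noteq> Suc (Suc (Suc k))" by simp_all
  ultimately have "bt B x r ?P ?s (10 * e i + 3) (ES ba sd (Suc k) (e i ## e) (putv T ba sd z) h)"
   using bt_cpy[of "k + 1 - i" "Suc (Suc k)" "Suc (Suc (Suc k))" ?s B x r] ei a(2) by simp
  then show "bt B x r ?P ?s (?g x) (ES ba sd (Suc k) (fst (e i, z) ## e) (putv T ba sd (snd (e i, z))) h)"
   using \<open>e i \<le> pb K x\<close> by (auto elim: bt_mono)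
 qed
 then show "\<exists>g. pol g \<and> rung \<Lambda> Z k (\<lambda>x e z. (e i, z)) ?P K g" using p by blast
qed (use assms in \<open>auto simp: cpy_def mov_def\<close>)

section \<open>Access to tape, input and subviews\<close>

text \<open>The address, base plus stride times index, is accumulated in \<open>a\<close> by
  repeated copying. Then \<open>a\<close> is moved to \<open>c\<close> during the walk, so that
  \<open>c\<close> remembers the way back. The single extra move steps over the left
  endmarker.\<close>

definition seek :: "nat \<Rightarrow> nat \<Rightarrow> nat \<Rightarrow> com" where
 "seek i a c = cpy 0 a c ;; Wh (NZ i) (Dec i ;; cpy 1 a c) ;; CMv MRight ;; Wh (NZ a) (Dec a ;; Inc c ;; CMv MRight)"

definition home :: "nat \<Rightarrow> com" where
 "home c = CMv MLeft ;; Wh (NZ c) (Dec c ;; CMv MLeft)"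

lemma bt_seek:
 assumes "distinct [0, 1, i, a, c]" "regs s a = 0" "regs s c = 0" "chd s = 0"
  "A = regs s 0 + regs s 1 * regs s i" "A < length (tape s)" "A + regs s 0 + regs s 1 \<le> B"
 shows "bt B x r (seek i a c) s ((10 * regs s 0 + 3) + ((regs s i * (10 * regs s 1 + 6) + 1) + (1 + (A * 6 + 1) + 1) + 1) + 1)
  (s\<lparr>regs := (regs s)(i := 0, c := A), chd := Suc A\<rparr>)"
proof -
 let ?ba = "regs s 0" let ?sd = "regs s 1" let ?I = "regs s i"
 let ?s1 = "s\<lparr>regs := (regs s)(a := ?ba)\<rparr>"
 have 1: "bt B x r (cpy 0 a c) s (10 * ?ba + 3) ?s1"
  using bt_cpy[of 0 a c s B x r] assms by simp
 let ?f = "\<lambda>j. s\<lparr>regs := (regs s)(a := ?ba + ?sd * j, i := ?I - j)\<rparr>"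
 have 2: "bt B x r (Wh (NZ i) (Dec i ;; cpy 1 a c)) (?f 0) (?I * ((1 + (10 * ?sd + 3) + 1) + 1) + 1) (?f ?I)"
 proof (rule bt_loop)
  fix j assume j: "j < ?I"
  show "regs (?f j) i \<noteq> 0" using j assms(1) by simp
  let ?t = "s\<lparr>regs := (regs s)(a := ?ba + ?sd * j, i := ?I - Suc j)\<rparr>"
  have b1: "bt B x r (Dec i) (?f j) 1 ?t"
   by (rule bt_line') (use j assms(1) in \<open>auto intro!: pst_eqI simp: fun_eq_iff\<close>)
  have "?sd * j \<le> ?sd * ?I" using j by (intro mult_le_mono2) simp
  then have "?sd + (?ba + ?sd * j) \<le> B" using assms(5,7) by linarith
  then have b2: "bt B x r (cpy 1 a c) ?t (10 * ?sd + 3) (?t\<lparr>regs := (regs ?t)(a := ?ba + ?sd * j + ?sd)\<rparr>)"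
   using bt_cpy[of 1 a c ?t B x r] assms by simp
  have eq: "?t\<lparr>regs := (regs ?t)(a := ?ba + ?sd * j + ?sd)\<rparr> = ?f (Suc j)"
   using assms(1) by (intro pst_eqI) (auto simp: fun_eq_iff)
  show "bt B x r (Dec i ;; cpy 1 a c) (?f j) (1 + (10 * ?sd + 3) + 1) (?f (Suc j))"
   by (rule bt_Sq[OF b1 b2[unfolded eq]])
 qed (use assms(1) in auto)
 have f0: "?f 0 = ?s1" using assms(1) by (intro pst_eqI) (auto simp: fun_eq_iff)
 let ?h = "\<lambda>j. s\<lparr>regs := (regs s)(i := 0, a := A - j, c := j), chd := Suc j\<rparr>"
 have 3: "bt B x r (CMv MRight) (?f ?I) 1 (?h 0)"
  using assms by (intro bt_line') (auto intro!: pst_eqI simp: fun_eq_iff)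
 have 4: "bt B x r (Wh (NZ a) (Dec a ;; Inc c ;; CMv MRight)) (?h 0) (A * (5 + 1) + 1) (?h A)"
 proof (rule bt_loop)
  fix j assume "j < A"
  then show "bt B x r (Dec a ;; Inc c ;; CMv MRight) (?h j) 5 (?h (Suc j))"
   using assms by (intro bt_line') (auto intro!: pst_eqI simp: fun_eq_iff)
 qed (use assms(1) in auto)
 have hA: "?h A = s\<lparr>regs := (regs s)(i := 0, c := A), chd := Suc A\<rparr>"
  using assms(1,2) by (intro pst_eqI) (auto simp: fun_eq_iff)
 show ?thesis unfolding seek_def
  by (rule bt_mono[OF bt_Sq[OF 1 bt_Sq[OF 2[unfolded f0] bt_Sq[OF 3 4[unfolded hA]]]]]) (auto simp: algebra_simps)
qed

lemma bt_home:
 assumes "chd s = Suc (regs s c)"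
 shows "bt B x r (home c) s (1 + (regs s c * 4 + 1) + 1) (s\<lparr>regs := (regs s)(c := 0), chd := 0\<rparr>)"
proof -
 let ?h = "\<lambda>j. s\<lparr>regs := (regs s)(c := regs s c - j), chd := regs s c - j\<rparr>"
 have 1: "bt B x r (CMv MLeft) s 1 (?h 0)"
  using assms by (intro bt_line') (auto intro!: pst_eqI simp: fun_eq_iff)
 have 2: "bt B x r (Wh (NZ c) (Dec c ;; CMv MLeft)) (?h 0) (regs s c * (3 + 1) + 1) (?h (regs s c))"
 proof (rule bt_loop)
  fix j assume "j < regs s c"
  then show "bt B x r (Dec c ;; CMv MLeft) (?h j) 3 (?h (Suc j))"
   by (intro bt_line') (auto intro!: pst_eqI simp: fun_eq_iff)
 qed auto
 show ?thesis unfolding home_def using bt_Sq[OF 1 2] by simp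
qed

lemma cf_read_raw:
 assumes "cf \<Lambda> Z k I" "\<And>x e z. length z = Z (length x) ==> I x e z < Z (length x)"
 shows "cf \<Lambda> Z k (\<lambda>x e z. of_bool (z ! I x e z))"
proof -
 let ?i = "Suc (Suc k)" let ?a = "Suc ?i" let ?c = "Suc ?a"
 let ?Q = "seek ?i ?a ?c ;; Ite CT (Inc ?i) Skip ;; home ?c"
 obtain P where P: "no_rand P" and QI: "\<And>K. \<exists>K'. progr \<Lambda> Z k (\<lambda>x e z. (I x e z, z)) P K K'"
  using cp_elim[OF assms(1)] by blast
 show ?thesis
 proof (rule cp_intro[where P = "P ;; ?Q"])
  fix K
  obtain K1 where K1: "progr \<Lambda> Z k (\<lambda>x e z. (I x e z, z)) P K K1" using QI by blast
  let ?A = "\<lambda>x. pb K1 x + pb K1 x * pb K1 x"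
  let ?ss = "\<lambda>x. (10 * pb K1 x + 3) + ((pb K1 x * (10 * pb K1 x + 6) + 1) + (1 + (?A x * 6 + 1) + 1) + 1) + 1"
  let ?g = "\<lambda>x. pb K1 x + (?ss x + ((1 + 1) + (1 + (?A x * 4 + 1) + 1) + 1) + 1) + 1"
  have p: "pol ?g" by (intro pol_intros)
  have "rung \<Lambda> Z k (\<lambda>x e z. (of_bool (z ! I x e z), z)) (P ;; ?Q) K ?g"
  proof (rule rungI)
   fix x r z T :: "bool list" and e h ba sd B
   assume a: "(ba, sd) \<in> \<Lambda>" "ba \<le> pb K x" "sd \<le> pb K x" "\<forall>i<k. e i \<le> pb K x"
    "viewok (length z) T ba sd" "length z = Z (length x)" "?g x \<le> B"
   have le: "pb K x \<le> pb K1 x" using progr_le[OF K1] by (rule pb_mono)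
   define J where "J = I x e z"
   define A where "A = ba + sd * J"
   let ?T = "putv T ba sd z"
   have J: "J \<le> pb K1 x" "J < length z" using progr_value[OF K1 a(4,6)] assms(2)[OF a(6)] a(6) by (simp_all add: J_def)
   have Al: "A < length ?T" using J(2) a(5) by (simp add: A_def viewok_def)
   have AT: "?T ! A = z ! J" using J(2) a(5) by (auto simp: A_def viewok_def putv_def)
   have "sd * J \<le> pb K1 x * pb K1 x" using J(1) a(3) le by (intro mult_le_mono) auto
   then have Ab: "A \<le> ?A x" using a(2) le by (simp add: A_def)
   have 1: "bt B x r P (ES ba sd k e ?T h) (pb K1 x) (ES ba sd (Suc k) (J ## e) ?T h)"
    using progr_bt[OF K1 a(1-6), of B "pb K1 x"] a(7) by (simp add: J_def)
   let ?s = "ES ba sd (Suc k) (J ## e) ?T h"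
   have r: "regs ?s = (env_regs ba sd k e)(?i := J)" by (simp add: env_regs_push)
   let ?s1 = "?s\<lparr>regs := (regs ?s)(?i := 0, ?c := A), chd := Suc A\<rparr>"
   have 2: "bt B x r (seek ?i ?a ?c) ?s (?ss x) ?s1"
   proof (rule bt_mono[OF bt_seek])
    have "J * (10 * sd + 6) \<le> pb K1 x * (10 * pb K1 x + 6)"
     using J(1) a(3) le by (intro mult_le_mono) auto
    then show "10 * regs ?s 0 + 3 + (regs ?s ?i * (10 * regs ?s 1 + 6) + 1 + (1 + (A * 6 + 1) + 1) + 1) + 1 \<le> ?ss x"
     using a(2) le r Ab by simp
    show "A + regs ?s 0 + regs ?s 1 \<le> B" using a(2,3,7) le r Ab by simp
   qed (use r Al in \<open>simp_all add: A_def\<close>)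
   let ?b = "of_bool (z ! J) :: nat"
   let ?s2 = "?s1\<lparr>regs := (regs ?s)(?i := ?b, ?c := A)\<rparr>"
   have 3: "bt B x r (Ite CT (Inc ?i) Skip) ?s1 (1 + 1) ?s2"
   proof (rule bt_Ite)
    assume "tval x r CT ?s1"
    then have "?b = 1" using Al AT by (simp add: read_tape_def)
    moreover have "0 < B" using a(7) by simp
    ultimately show "bt B x r (Inc ?i) ?s1 1 ?s2"
     using r by (intro bt_line') (auto intro!: pst_eqI simp: fun_eq_iff)
   next
    assume "\<not> tval x r CT ?s1"
    then have "?b = 0" using Al AT by (simp add: read_tape_def)
    then show "bt B x r Skip ?s1 1 ?s2" by (intro bt_line') simp_all
   qed simp
   have 4: "bt B x r (home ?c) ?s2 (1 + (?A x * 4 + 1) + 1) (ES ba sd (Suc k) (?b ## e) ?T h)"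
   proof -
    have eq: "?s2\<lparr>regs := (regs ?s2)(?c := 0), chd := 0\<rparr> = ES ba sd (Suc k) (?b ## e) ?T h"
     using r by (intro pst_eqI) (auto simp: env_regs_push fun_eq_iff)
    have h: "bt B x r (home ?c) ?s2 (1 + (regs ?s2 ?c * 4 + 1) + 1) (?s2\<lparr>regs := (regs ?s2)(?c := 0), chd := 0\<rparr>)"
     by (rule bt_home) simp
    show ?thesis by (rule bt_mono[OF h[unfolded eq]]) (use Ab in simp_all)
   qed
   show "bt B x r (P ;; ?Q) (ES ba sd k e ?T h) (?g x)
     (ES ba sd (Suc k) (fst (of_bool (z ! I x e z), z) ## e) (putv T ba sd (snd (of_bool (z ! I x e z), z))) h)"
    using bt_Sq[OF 1 bt_Sq[OF 2 bt_Sq[OF 3 4]]] by (simp add: J_def)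
  qed
  then show "\<exists>g. pol g \<and> rung \<Lambda> Z k (\<lambda>x e z. (of_bool (z ! I x e z), z)) (P ;; ?Q) K g" using p by blast
 qed (use P cp_L[OF assms(1)] in \<open>auto simp: seek_def home_def cpy_def mov_def\<close>)
qed

lemma cp_write_raw:
 assumes "cf \<Lambda> Z k I" "cf \<Lambda> Z k V" "\<And>x e z. length z = Z (length x) ==> I x e z < Z (length x)"
 shows "cp \<Lambda> Z k (\<lambda>x e z. (0, z[I x e z := (V x e z \<noteq> 0)]))"
proof -
 let ?i = "Suc (Suc k)" let ?v = "Suc ?i" let ?a = "Suc ?v" let ?c = "Suc ?a"
 obtain P where P: "no_rand P" and QI: "\<And>K. \<exists>K'. progr \<Lambda> Z k (\<lambda>x e z. (I x e z, z)) P K K'"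
  using cp_elim[OF assms(1)] by blast
 obtain PV where PV: "no_rand PV" and QV: "\<And>K. \<exists>K'. progr \<Lambda> Z (Suc k) (\<lambda>x e z. (V x (\<lambda>i. e (Suc i)) z, z)) PV K K'"
  using cp_elim[OF cp_wk[OF assms(2)]] by blast
 let ?P = "P ;; PV ;; seek ?i ?a ?c ;; Ite (NZ ?v) (CWr True) (CWr False) ;; home ?c ;; clr ?v"
 show ?thesis
 proof (rule cp_intro[where P = ?P])
  fix K
  obtain K1 where K1: "progr \<Lambda> Z k (\<lambda>x e z. (I x e z, z)) P K K1" using QI by blast
  obtain K2 where K2: "progr \<Lambda> Z (Suc k) (\<lambda>x e z. (V x (\<lambda>i. e (Suc i)) z, z)) PV K1 K2" using QV by blast
  let ?A = "\<lambda>x. pb K1 x + pb K1 x * pb K1 x"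
  let ?ss = "\<lambda>x. (10 * pb K1 x + 3) + ((pb K1 x * (10 * pb K1 x + 6) + 1) + (1 + (?A x * 6 + 1) + 1) + 1) + 1"
  let ?g = "\<lambda>x. pb K1 x + (pb K2 x + (?ss x + ((1 + 1) + ((1 + (?A x * 4 + 1) + 1) + (2 * pb K2 x + 1) + 1) + 1) + 1) + 1) + 1"
  have p: "pol ?g" by (intro pol_intros)
  have "rung \<Lambda> Z k (\<lambda>x e z. (0, z[I x e z := (V x e z \<noteq> 0)])) ?P K ?g"
  proof (rule rungI)
   fix x r z T :: "bool list" and e h ba sd B
   assume a: "(ba, sd) \<in> \<Lambda>" "ba \<le> pb K x" "sd \<le> pb K x" "\<forall>i<k. e i \<le> pb K x"
    "viewok (length z) T ba sd" "length z = Z (length x)" "?g x \<le> B"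
   have le: "pb K x \<le> pb K1 x" using progr_le[OF K1] by (rule pb_mono)
   define J where "J = I x e z"
   define W where "W = V x e z"
   define A where "A = ba + sd * J"
   let ?T = "putv T ba sd z"
   let ?T' = "putv T ba sd (z[J := (W \<noteq> 0)])"
   have J: "J \<le> pb K1 x" "J < length z" using progr_value[OF K1 a(4,6)] assms(3)[OF a(6)] a(6) by (simp_all add: J_def)
   have e1: "\<forall>i<Suc k. (J ## e) i \<le> pb K1 x"
    using J a(4) le by (auto simp: push_def split: nat.splits intro: order_trans)
   have W: "W \<le> pb K2 x" using progr_value[OF K2 e1 a(6)] by (simp add: W_def)
   have Al: "A < length ?T" using J(2) a(5) by (simp add: A_def viewok_def)
   have T': "?T[A := (W \<noteq> 0)] = ?T'"
    using putv_upd[of z ?T ba sd J "W \<noteq> 0"] a(5) J(2) view_putv[OF a(5)] putv_putv[of z "z[J := (W \<noteq> 0)]" T ba sd]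
    by (simp add: A_def)
   have "sd * J \<le> pb K1 x * pb K1 x" using J(1) a(3) le by (intro mult_le_mono) auto
   then have Ab: "A \<le> ?A x" using a(2) le by (simp add: A_def)
   have 1: "bt B x r P (ES ba sd k e ?T h) (pb K1 x) (ES ba sd (Suc k) (J ## e) ?T h)"
    using progr_bt[OF K1 a(1-6), of B "pb K1 x"] a(7) by (simp add: J_def)
   have 2: "bt B x r PV (ES ba sd (Suc k) (J ## e) ?T h) (pb K2 x) (ES ba sd (Suc (Suc k)) (W ## J ## e) ?T h)"
    using progr_bt[OF K2 a(1) _ _ e1 a(5,6), of B "pb K2 x" r h] a(2,3,7) le by (simp add: W_def)
   let ?s = "ES ba sd (Suc (Suc k)) (W ## J ## e) ?T h"
   have r: "regs ?s = (env_regs ba sd k e)(?i := J, ?v := W)" by (simp add: env_regs_push)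
   let ?s1 = "?s\<lparr>regs := (regs ?s)(?i := 0, ?c := A), chd := Suc A\<rparr>"
   have 3: "bt B x r (seek ?i ?a ?c) ?s (?ss x) ?s1"
   proof (rule bt_mono[OF bt_seek])
    have "J * (10 * sd + 6) \<le> pb K1 x * (10 * pb K1 x + 6)"
     using J(1) a(3) le by (intro mult_le_mono) auto
    then show "10 * regs ?s 0 + 3 + (regs ?s ?i * (10 * regs ?s 1 + 6) + 1 + (1 + (A * 6 + 1) + 1) + 1) + 1 \<le> ?ss x"
     using a(2) le r Ab by simp
    show "A + regs ?s 0 + regs ?s 1 \<le> B" using a(2,3,7) le r Ab by simp
   qed (use r Al in \<open>simp_all add: A_def\<close>)
   let ?s2 = "?s1\<lparr>tape := ?T'\<rparr>"
   have 4: "bt B x r (Ite (NZ ?v) (CWr True) (CWr False)) ?s1 (1 + 1) ?s2"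
    by (rule bt_Ite) (use r Al T' in \<open>auto intro!: bt_line' pst_eqI simp: write_tape_def\<close>)
   let ?s3 = "?s2\<lparr>regs := (regs ?s)(?i := 0), chd := 0\<rparr>"
   have 5: "bt B x r (home ?c) ?s2 (1 + (?A x * 4 + 1) + 1) ?s3"
   proof -
    have eq: "?s2\<lparr>regs := (regs ?s2)(?c := 0), chd := 0\<rparr> = ?s3"
     using r by (intro pst_eqI) (auto simp: env_regs_push fun_eq_iff)
    have h: "bt B x r (home ?c) ?s2 (1 + (regs ?s2 ?c * 4 + 1) + 1) (?s2\<lparr>regs := (regs ?s2)(?c := 0), chd := 0\<rparr>)"
     by (rule bt_home) simp
    show ?thesis by (rule bt_mono[OF h[unfolded eq]]) (use Ab in simp_all)
   qed
   have 6: "bt B x r (clr ?v) ?s3 (2 * pb K2 x + 1) (ES ba sd (Suc k) (0 ## e) ?T' h)"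
   proof -
    have "?s3\<lparr>regs := (regs ?s3)(?v := 0)\<rparr> = ES ba sd (Suc k) (0 ## e) ?T' h"
     using r by (intro pst_eqI) (auto simp: env_regs_push fun_eq_iff)
    then show ?thesis using bt_clr[of B x r ?v ?s3] r W by (auto elim: bt_mono)
   qed
   show "bt B x r ?P (ES ba sd k e ?T h) (?g x)
     (ES ba sd (Suc k) (fst (0, z[I x e z := (V x e z \<noteq> 0)]) ## e) (putv T ba sd (snd (0, z[I x e z := (V x e z \<noteq> 0)]))) h)"
    using bt_Sq[OF 1 bt_Sq[OF 2 bt_Sq[OF 3 bt_Sq[OF 4 bt_Sq[OF 5 6]]]]] by (simp add: J_def W_def)
  qed
  then show "\<exists>g. pol g \<and> rung \<Lambda> Z k (\<lambda>x e z. (0, z[I x e z := (V x e z \<noteq> 0)])) ?P K g" using p by blast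
 qed (use P PV cp_L[OF assms(1)] in \<open>auto simp: seek_def home_def cpy_def mov_def clr_def\<close>)
qed

lemma cf_len:
 assumes "(0, 1) \<in> \<Lambda>"
 shows "cf \<Lambda> Z k (\<lambda>x e z. length x)"
proof -
 let ?i = "Suc (Suc k)" let ?c = "Suc ?i"
 let ?P = "IMv MRight ;; Wh INN (Inc ?i ;; IMv MRight) ;; IMv MLeft ;; Wh INN (IMv MLeft)"
 have loop1: "bt B x r (Wh INN (Inc i ;; IMv MRight)) (s\<lparr>regs := (regs s)(i := length x - j), ihd := Suc (length x - j)\<rparr>)
   (5 * j + 1) (s\<lparr>regs := (regs s)(i := length x), ihd := Suc (length x)\<rparr>)" if "length x < B" "j \<le> length x" for B x r s i j
  using that(2)
 proof (induction j)
  case 0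
  let ?s = "s\<lparr>regs := (regs s)(i := length x), ihd := Suc (length x)\<rparr>"
  have "bs B x r (Wh INN (Inc i ;; IMv MRight)) ?s 1 (tadv INN ?s)" by (rule bs_WhF) (simp add: read_tape_def)
  then show ?case by (auto simp: bt_def tadv_def simp del: fun_upd_apply)
 next
  case (Suc j)
  let ?s = "s\<lparr>regs := (regs s)(i := length x - Suc j), ihd := Suc (length x - Suc j)\<rparr>"
  let ?s1 = "s\<lparr>regs := (regs s)(i := length x - j), ihd := Suc (length x - j)\<rparr>"
  have "bt B x r (Inc i ;; IMv MRight) ?s 3 ?s1"
   using Suc.prems that(1) by (intro bt_line') (auto intro!: pst_eqI simp: fun_eq_iff Suc_diff_Suc)
  then obtain t1 where t1: "t1 \<le> 3" "bs B x r (Inc i ;; IMv MRight) ?s t1 ?s1" by (auto simp: bt_def)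
  obtain t2 where t2: "t2 \<le> 5 * j + 1" "bs B x r (Wh INN (Inc i ;; IMv MRight)) ?s1 t2 (s\<lparr>regs := (regs s)(i := length x), ihd := Suc (length x)\<rparr>)"
   using Suc.IH Suc.prems unfolding bt_def by (meson Suc_leD)
  have "bs B x r (Wh INN (Inc i ;; IMv MRight)) ?s (Suc (t1 + t2)) (s\<lparr>regs := (regs s)(i := length x), ihd := Suc (length x)\<rparr>)"
   using t1(2) t2(2) Suc.prems by (intro bs_WhT) (auto simp: read_tape_def tadv_def)
  then show ?case using t1(1) t2(1) unfolding bt_def by (intro exI[of _ "Suc (t1 + t2)"]) auto
 qed
 have loop2: "bt B x r (Wh INN (IMv MLeft)) (s\<lparr>ihd := j\<rparr>) (3 * j + 1) (s\<lparr>ihd := 0\<rparr>)" if "j \<le> length x" for B x r s j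
  using that
 proof (induction j)
  case 0
  have "bs B x r (Wh INN (IMv MLeft)) (s\<lparr>ihd := 0\<rparr>) 1 (tadv INN (s\<lparr>ihd := 0\<rparr>))" by (rule bs_WhF) (simp add: read_tape_def)
  then show ?case by (auto simp: bt_def tadv_def)
 next
  case (Suc j)
  have t1: "bs B x r (IMv MLeft) (s\<lparr>ihd := Suc j\<rparr>) 1 (s\<lparr>ihd := j\<rparr>)"
   using bs_IMv[of B x r MLeft "s\<lparr>ihd := Suc j\<rparr>"] by simp
  obtain t2 where t2: "t2 \<le> 3 * j + 1" "bs B x r (Wh INN (IMv MLeft)) (s\<lparr>ihd := j\<rparr>) t2 (s\<lparr>ihd := 0\<rparr>)"
   using Suc by (auto simp: bt_def)
  have "bs B x r (Wh INN (IMv MLeft)) (s\<lparr>ihd := Suc j\<rparr>) (Suc (1 + t2)) (s\<lparr>ihd := 0\<rparr>)"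
   using t1 t2(2) Suc.prems by (intro bs_WhT) (auto simp: read_tape_def tadv_def)
  then show ?case using t2(1) unfolding bt_def by (intro exI[of _ "Suc (1 + t2)"]) auto
 qed
 show ?thesis
 proof (rule cp_intro[where P = ?P])
  fix K
  let ?g = "\<lambda>x. 1 + ((5 * length x + 1) + (1 + (3 * length x + 1) + 1) + 1) + (1::nat)"
  have p: "pol ?g" by (intro pol_intros)
  have "rung \<Lambda> Z k (\<lambda>x e z. (length x, z)) ?P K ?g"
  proof (rule rungI)
   fix x r z T :: "bool list" and e h ba sd B
   assume a: "?g x \<le> B"
   let ?s = "ES ba sd k e (putv T ba sd z) h"
   let ?s1 = "?s\<lparr>regs := (regs ?s)(?i := length x - length x), ihd := Suc (length x - length x)\<rparr>"
   let ?s2 = "?s\<lparr>regs := (regs ?s)(?i := length x), ihd := Suc (length x)\<rparr>"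
   let ?t = "ES ba sd (Suc k) (length x ## e) (putv T ba sd z) h"
   have 1: "bt B x r (IMv MRight) ?s 1 ?s1" by (intro bt_line') (auto intro!: pst_eqI)
   have 2: "bt B x r (Wh INN (Inc ?i ;; IMv MRight)) ?s1 (5 * length x + 1) ?s2"
    using a by (intro loop1) auto
   have 3: "bt B x r (IMv MLeft) ?s2 1 (?t\<lparr>ihd := length x\<rparr>)"
    by (intro bt_line') (auto intro!: pst_eqI simp: env_regs_push)
   have 4: "bt B x r (Wh INN (IMv MLeft)) (?t\<lparr>ihd := length x\<rparr>) (3 * length x + 1) ?t"
    using loop2[of "length x" x B r ?t] by (simp add: ES_def)
   show "bt B x r ?P ?s (?g x) (ES ba sd (Suc k) (fst (length x, z) ## e) (putv T ba sd (snd (length x, z))) h)"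
    using bt_Sq[OF 1 bt_Sq[OF 2 bt_Sq[OF 3 4]]] by simp
  qed
  then show "\<exists>g. pol g \<and> rung \<Lambda> Z k (\<lambda>x e z. (length x, z)) ?P K g" using p by blast
 qed (use assms in auto)
qed

lemma cf_input:
 assumes "cf \<Lambda> Z k I"
 shows "cf \<Lambda> Z k (\<lambda>x e z. of_bool (I x e z < length x \<and> x ! I x e z))"
proof -
 let ?i = "Suc (Suc k)" let ?c = "Suc ?i"
 let ?Q = "IMv MRight ;; Wh (NZ ?i) (Dec ?i ;; Inc ?c ;; IMv MRight) ;; Ite IT (Inc ?i) Skip ;;
  IMv MLeft ;; Wh (NZ ?c) (Dec ?c ;; IMv MLeft)"
 let ?H = "\<lambda>x e z. (of_bool (e 0 < length x \<and> x ! e 0) :: nat, z)"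
 have "cp \<Lambda> Z k (\<lambda>x e z. ?H x (fst (I x e z, z) ## e) (snd (I x e z, z)))"
 proof (rule cp_post[OF assms, where Q = ?Q], goal_cases)
  case (3 K)
  let ?q = "\<lambda>x. 1 + ((pb K x * (5 + 1) + 1) + ((1 + 1) + (1 + (pb K x * (3 + 1) + 1) + 1) + 1) + 1) + 1"
  show ?case
  proof (intro exI[of _ ?q] conjI allI impI)
   show "pol ?q" by (intro pol_intros)
   fix x r z T :: "bool list" and e h ba sd B
   assume a: "\<forall>i<Suc k. e i \<le> pb K x" "?q x \<le> B"
   let ?J = "e 0" let ?e = "\<lambda>i. e (Suc i)"
   have J: "?J \<le> pb K x" "?J < B" using a by (auto dest: spec[of _ 0])
   let ?s = "ES ba sd (Suc k) e (putv T ba sd z) h"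
   let ?R = "env_regs ba sd k ?e"
   have r: "regs ?s = ?R(?i := ?J)"
   proof -
    have "e = ?J ## ?e" by (auto simp: push_def fun_eq_iff split: nat.split)
    then have "env_regs ba sd (Suc k) e = env_regs ba sd (Suc k) (?J ## ?e)" by (rule arg_cong)
    then show ?thesis by (simp add: env_regs_push)
   qed
   let ?h = "\<lambda>j. ?s\<lparr>regs := ?R(?i := ?J - j, ?c := j), ihd := min (Suc j) (Suc (length x))\<rparr>"
   have 1: "bt B x r (IMv MRight) ?s 1 (?h 0)"
    by (intro bt_line') (use r in \<open>auto intro!: pst_eqI simp: fun_eq_iff\<close>)
   have 2: "bt B x r (Wh (NZ ?i) (Dec ?i ;; Inc ?c ;; IMv MRight)) (?h 0) (?J * (5 + 1) + 1) (?h ?J)"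
   proof (rule bt_loop)
    fix j assume "j < ?J"
    then show "bt B x r (Dec ?i ;; Inc ?c ;; IMv MRight) (?h j) 5 (?h (Suc j))"
     using J by (intro bt_line') (auto intro!: pst_eqI simp: fun_eq_iff)
   qed auto
   let ?b = "of_bool (?J < length x \<and> x ! ?J) :: nat"
   let ?s2 = "?s\<lparr>regs := ?R(?i := ?b, ?c := ?J), ihd := min (Suc ?J) (Suc (length x))\<rparr>"
   have 3: "bt B x r (Ite IT (Inc ?i) Skip) (?h ?J) (1 + 1) ?s2"
   proof (rule bt_Ite)
    assume "tval x r IT (?h ?J)"
    then have "?b = 1" by (auto simp: read_tape_def min_def split: if_splits)
    then show "bt B x r (Inc ?i) (?h ?J) 1 ?s2"
     using J by (intro bt_line') (auto intro!: pst_eqI simp: fun_eq_iff)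
   next
    assume "\<not> tval x r IT (?h ?J)"
    then have "?b = 0" by (auto simp: read_tape_def min_def split: if_splits)
    then show "bt B x r Skip (?h ?J) 1 ?s2" by (intro bt_line') auto
   qed simp
   let ?l = "\<lambda>j. ?s\<lparr>regs := ?R(?i := ?b, ?c := ?J - j), ihd := min ?J (length x) - j\<rparr>"
   have 4: "bt B x r (IMv MLeft) ?s2 1 (?l 0)"
    by (intro bt_line') (auto intro!: pst_eqI simp: min_def)
   have 5: "bt B x r (Wh (NZ ?c) (Dec ?c ;; IMv MLeft)) (?l 0) (?J * (3 + 1) + 1) (?l ?J)"
   proof (rule bt_loop)
    fix j assume "j < ?J"
    then show "bt B x r (Dec ?c ;; IMv MLeft) (?l j) 3 (?l (Suc j))"
     by (intro bt_line') (auto intro!: pst_eqI simp: fun_eq_iff)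
   qed auto
   have 6: "?l ?J = ES ba sd (Suc k) (?b ## ?e) (putv T ba sd z) h"
    by (rule pst_eqI) (auto simp: env_regs_push fun_eq_iff)
   show "bt B x r ?Q ?s (?q x) (ES ba sd (Suc k) (fst (?H x e z) ## ?e) (putv T ba sd (snd (?H x e z))) h)"
    using bt_mono[OF bt_Sq[OF 1 bt_Sq[OF 2 bt_Sq[OF 3 bt_Sq[OF 4 5[unfolded 6]]]]] order_refl, of "?q x"] J(1) by simp
  qed
 qed auto
 then show ?thesis by simp
qed

lemma nth_putv: "i < length T ==> putv T ba sd z ! i =
  (if \<exists>j<length z. i = ba + sd * j then z ! ((i - ba) div sd) else T ! i)"
 by (auto simp: putv_def)

text \<open>A block program runs inside a program for the whole tape once base and stride are set.
  It has to work under all views, hence \<open>UNIV\<close>. The caller only ever has the view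
  \<open>(0, 1)\<close>, so its own base and stride need not be saved: they are restored as
  constants.\<close>

lemma cp_sub:
 assumes G: "cp UNIV Z1 0 G" and BA: "cf {(0, 1)} Z k BA" and SD: "cf {(0, 1)} Z k SD"
  and ok: "\<And>x e z. length z = Z (length x) ==> 1 \<le> SD x e z \<and> (\<forall>i<Z1 (length x). BA x e z + SD x e z * i < Z (length x))"
 shows "cp {(0, 1)} Z k (\<lambda>x e z.
  (fst (G x e (view (Z1 (length x)) z (BA x e z) (SD x e z))),
   putv z (BA x e z) (SD x e z) (snd (G x e (view (Z1 (length x)) z (BA x e z) (SD x e z))))))"
proof -
 define F where "F x e z = (fst (G x e (view (Z1 (length x)) z (BA x e z) (SD x e z))),
   putv z (BA x e z) (SD x e z) (snd (G x e (view (Z1 (length x)) z (BA x e z) (SD x e z)))))" for x e z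
 obtain PB where PB: "no_rand PB" and QB: "\<And>K. \<exists>K'. progr {(0, 1)} Z k (\<lambda>x e z. (BA x e z, z)) PB K K'"
  using cp_elim[OF BA] by blast
 obtain PD where PD: "no_rand PD" and QD: "\<And>K. \<exists>K'. progr {(0, 1)} Z (Suc k) (\<lambda>x e z. (SD x (\<lambda>i. e (Suc i)) z, z)) PD K K'"
  using cp_elim[OF cp_wk[OF SD]] by blast
 obtain PG where PG: "no_rand PG" and QG: "\<And>K. \<exists>K'. progr UNIV Z1 (0 + k) G PG K K'"
  using cp_elim[OF cp_up[OF G]] by blast
 let ?a = "Suc (Suc k)" let ?b = "Suc ?a"
 let ?P = "PB ;; PD ;; mov ?a 0 ;; Dec 1 ;; mov ?b 1 ;; PG ;; clr 0 ;; clr 1 ;; Inc 1"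
 have "cp {(0, 1)} Z k F"
 proof (rule cp_intro[where P = ?P])
  fix K
  obtain K1 where K1: "progr {(0, 1)} Z k (\<lambda>x e z. (BA x e z, z)) PB K K1" using QB by blast
  obtain K2 where K2: "progr {(0, 1)} Z (Suc k) (\<lambda>x e z. (SD x (\<lambda>i. e (Suc i)) z, z)) PD K1 K2" using QD by blast
  obtain K3 where K3: "progr UNIV Z1 k G PG K2 K3" using QG by auto
  let ?g = "\<lambda>x. pb K1 x + (pb K2 x + ((4 * pb K1 x + 1) + (1 + ((4 * pb K2 x + 1) + (pb K3 x + ((2 * pb K1 x + 1) + ((2 * pb K2 x + 1) + 1 + 1) + 1) + 1) + 1) + 1) + 1) + 1) + 1"
  have p: "pol ?g" by (intro pol_intros)
  have "rung {(0, 1)} Z k F ?P K ?g"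
  proof (rule rungI)
   fix x r z T :: "bool list" and e h ba sd B
   assume a: "(ba, sd) \<in> {(0, 1)}" "ba \<le> pb K x" "sd \<le> pb K x" "\<forall>i<k. e i \<le> pb K x"
    "viewok (length z) T ba sd" "length z = Z (length x)" "?g x \<le> B"
   have bs0: "ba = 0" "sd = 1" using a(1) by auto
   have le: "pb K x \<le> pb K1 x" "pb K1 x \<le> pb K2 x" "pb K2 x \<le> pb K3 x"
    using progr_le[OF K1] progr_le[OF K2] progr_le[OF K3] by (auto intro!: pb_mono)
   define b where "b = BA x e z"
   define d where "d = SD x e z"
   define y where "y = view (Z1 (length x)) z b d"
   define v where "v = fst (G x e y)"
   define y' where "y' = snd (G x e y)"
   let ?T = "putv T 0 1 z"
   have lT: "length z \<le> length T"
    using a(5) bs0 unfolding viewok_def by (metis add_0 leI less_irrefl nat_mult_1)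
   have Tz: "?T ! i = z ! i" if "i < length z" for i
    using that lT by (auto simp: putv_def)
   have okx: "1 \<le> d" "\<And>i. i < Z1 (length x) ==> b + d * i < length z"
    using ok[OF a(6), of e] a(6) by (auto simp: b_def d_def)
   have vok: "viewok (Z1 (length x)) ?T b d"
    using okx lT by (auto simp: viewok_def intro: less_le_trans)
   have vT: "view (Z1 (length x)) ?T b d = y"
    unfolding y_def view_def using okx(2) Tz by auto
   have ly: "length y = Z1 (length x)" "length y' = length y"
    using cp_length[OF G, of y x e] by (simp_all add: y_def y'_def)
   \<comment> \<open>The inner view lies inside the outer one, so writing through the inner view on
     the actual tape is writing the changed content through the outer view.\<close>
   have pT: "putv ?T b d y' = putv T 0 1 (putv z b d y')"
   proof (rule nth_equalityI)
    fix i assume i: "i < length (putv ?T b d y')"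
    show "putv ?T b d y' ! i = putv T 0 1 (putv z b d y') ! i"
    proof (cases "\<exists>j<length y'. i = b + d * j")
     case True
     then have "i < length z" using okx(2) ly by auto
     then show ?thesis using i True by (auto simp: putv_def)
    next
     case False
     then have 1: "putv ?T b d y' ! i = ?T ! i" using i by (subst nth_putv) auto
     have 2: "putv z b d y' ! i = z ! i" if "i < length z" using that False by (subst nth_putv) auto
     show ?thesis unfolding 1 using i 2 lT by (auto simp: putv_def[of T])
    qed
   qed simp
   have B1: "b \<le> pb K1 x" using progr_value[OF K1 a(4,6)] by (simp add: b_def)
   have e1: "\<forall>i<Suc k. (b ## e) i \<le> pb K1 x"
    using B1 a(4) le by (auto simp: push_def split: nat.splits intro: order_trans)
   have D1: "d \<le> pb K2 x" using progr_value[OF K2 e1 a(6)] by (simp add: d_def)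
   have e2: "\<forall>i<k. e i \<le> pb K2 x" using a(4) le by (auto intro: order_trans)
   have 1: "bt B x r PB (ES 0 1 k e ?T h) (pb K1 x) (ES 0 1 (Suc k) (b ## e) ?T h)"
    using progr_bt[OF K1 a(1-6), of B "pb K1 x" r h] a(7) bs0 by (simp add: b_def)
   have 2: "bt B x r PD (ES 0 1 (Suc k) (b ## e) ?T h) (pb K2 x) (ES 0 1 (Suc (Suc k)) (d ## b ## e) ?T h)"
    using progr_bt[OF K2 a(1) _ _ e1 a(5,6), of B "pb K2 x" r h] a(2,3,7) le bs0 by (simp add: d_def)
   let ?R = "env_regs 0 1 k e"
   let ?s = "ES 0 1 (Suc (Suc k)) (d ## b ## e) ?T h"
   have r: "regs ?s = ?R(?a := b, ?b := d)" by (simp add: env_regs_push)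
   let ?s1 = "?s\<lparr>regs := ?R(0 := b, ?b := d)\<rparr>"
   have 3: "bt B x r (mov ?a 0) ?s (4 * pb K1 x + 1) ?s1"
   proof -
    have eq: "?s\<lparr>regs := (regs ?s)(?a := 0, 0 := regs ?s ?a + regs ?s 0)\<rparr> = ?s1"
     unfolding r by (rule pst_eqI) (auto simp: fun_eq_iff)
    have "bt B x r (mov ?a 0) ?s (4 * regs ?s ?a + 1) (?s\<lparr>regs := (regs ?s)(?a := 0, 0 := regs ?s ?a + regs ?s 0)\<rparr>)"
     by (rule bt_mov) (use r B1 a(7) in auto)
    from this[unfolded eq] show ?thesis by (rule bt_mono) (use r B1 in auto)
   qed
   let ?s2 = "?s\<lparr>regs := ?R(0 := b, 1 := 0, ?b := d)\<rparr>"
   \<comment> \<open>The stride of the caller is 1; one decrement empties the register, since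
     \<open>mov\<close> adds to its target.\<close>
   have 4: "bt B x r (Dec 1) ?s1 1 ?s2"
    by (intro bt_line') (auto intro!: pst_eqI simp: fun_eq_iff)
   have 5: "bt B x r (mov ?b 1) ?s2 (4 * pb K2 x + 1) (ES b d k e ?T h)"
   proof -
    have eq: "?s2\<lparr>regs := (regs ?s2)(?b := 0, 1 := regs ?s2 ?b + regs ?s2 1)\<rparr> = ES b d k e ?T h"
     by (rule pst_eqI) (auto simp: fun_eq_iff env_regs_def)
    have "bt B x r (mov ?b 1) ?s2 (4 * regs ?s2 ?b + 1) (?s2\<lparr>regs := (regs ?s2)(?b := 0, 1 := regs ?s2 ?b + regs ?s2 1)\<rparr>)"
     by (rule bt_mov) (use D1 a(7) in auto)
    from this[unfolded eq] show ?thesis by (rule bt_mono) (use D1 in auto)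
   qed
   have 6: "bt B x r PG (ES b d k e ?T h) (pb K3 x) (ES b d (Suc k) (v ## e) (putv ?T b d y') h)"
    using progr_bt[OF K3, of b d x e y ?T B "pb K3 x" r h] B1 D1 e2 vok le a(7) ly(1) putv_view[OF vok] vT
    by (simp add: v_def y'_def)
   let ?t = "ES b d (Suc k) (v ## e) (putv ?T b d y') h"
   let ?t1 = "?t\<lparr>regs := (regs ?t)(0 := 0)\<rparr>"
   have 7: "bt B x r (clr 0) ?t (2 * pb K1 x + 1) ?t1"
    by (rule bt_mono[OF bt_clr]) (use B1 in auto)
   let ?t2 = "?t1\<lparr>regs := (regs ?t1)(1 := 0)\<rparr>"
   have 8: "bt B x r (clr 1) ?t1 (2 * pb K2 x + 1) ?t2"
    by (rule bt_mono[OF bt_clr]) (use D1 in auto)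
   have 9: "bt B x r (Inc 1) ?t2 1 (ES 0 1 (Suc k) (v ## e) (putv T 0 1 (putv z b d y')) h)"
    using a(7) pT by (intro bt_line') (auto intro!: pst_eqI simp: fun_eq_iff env_regs_def)
   show "bt B x r ?P (ES ba sd k e (putv T ba sd z) h) (?g x)
    (ES ba sd (Suc k) (fst (F x e z) ## e) (putv T ba sd (snd (F x e z))) h)"
    using bt_Sq[OF 1 bt_Sq[OF 2 bt_Sq[OF 3 bt_Sq[OF 4 bt_Sq[OF 5 bt_Sq[OF 6 bt_Sq[OF 7 bt_Sq[OF 8 9]]]]]]]] bs0
    unfolding F_def b_def[symmetric] d_def[symmetric] y_def[symmetric] v_def y'_def by simp
  qed
  then show "\<exists>g. pol g \<and> rung {(0, 1)} Z k F ?P K g" using p by blast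
 qed (use PB PD PG in \<open>auto simp: mov_def clr_def F_def\<close>)
 then show ?thesis unfolding F_def .
qed

section \<open>Arithmetic and logic for programs\<close>

locale cat =
 fixes \<Lambda> :: "(nat \<times> nat) set" and Z :: "nat \<Rightarrow> nat"
 assumes L: "(0, 1) \<in> \<Lambda>"
begin

abbreviation "CP \<equiv> cp \<Lambda> Z"
abbreviation "CF \<equiv> cf \<Lambda> Z"
abbreviation "CB k P \<equiv> cf \<Lambda> Z k (\<lambda>x e z. of_bool (P x e z))"

definition pbd :: "nat \<Rightarrow> (bool list \<Rightarrow> (nat \<Rightarrow> nat) \<Rightarrow> bool list \<Rightarrow> nat) \<Rightarrow> bool" where
 "pbd k M \<longleftrightarrow> (\<forall>K. \<exists>K'. \<forall>x e z. (\<forall>i<k. e i \<le> pb K x) \<longrightarrow> length z = Z (length x) \<longrightarrow> M x e z \<le> pb K' x)"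

lemma pbd_CF: "CF k F ==> pbd k F"
 unfolding pbd_def using cp_bound[of \<Lambda> Z k "\<lambda>x e z. (F x e z, z)"] by simp

lemma pbd_pol: "pol f ==> pbd k (\<lambda>x e z. f x)"
 unfolding pbd_def pol_def by blast

lemma pbdE:
 assumes "pbd k F"
 obtains K' where "\<And>x e z. (\<forall>i<k. e i \<le> pb K x) ==> length z = Z (length x) ==> F x e z \<le> pb K' x"
 using assms unfolding pbd_def by blast

lemma pbd_add:
 assumes "pbd k F" "pbd k G" shows "pbd k (\<lambda>x e z. F x e z + G x e z)"
 unfolding pbd_def
proof
 fix K
 obtain K1 where K1: "\<And>x e z. (\<forall>i<k. e i \<le> pb K x) ==> length z = Z (length x) ==> F x e z \<le> pb K1 x"
  using pbdE[OF assms(1)] by blast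
 obtain K2 where K2: "\<And>x e z. (\<forall>i<k. e i \<le> pb K x) ==> length z = Z (length x) ==> G x e z \<le> pb K2 x"
  using pbdE[OF assms(2)] by blast
 obtain K' where K': "\<And>x. pb K1 x + pb K2 x \<le> pb K' x"
  using pol_add[OF pol_pb pol_pb, of K1 K2] unfolding pol_def by blast
 have "F x e z + G x e z \<le> pb K' x" if "\<forall>i<k. e i \<le> pb K x" "length z = Z (length x)" for x e z
  using K1[OF that] K2[OF that] K'[of x] by linarith
 then show "\<exists>K'. \<forall>x e z. (\<forall>i<k. e i \<le> pb K x) \<longrightarrow> length z = Z (length x) \<longrightarrow> F x e z + G x e z \<le> pb K' x"
  by blast
qed

lemma pbd_mult:
 assumes "pbd k F" "pbd k G" shows "pbd k (\<lambda>x e z. F x e z * G x e z)"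
 unfolding pbd_def
proof
 fix K
 obtain K1 where K1: "\<And>x e z. (\<forall>i<k. e i \<le> pb K x) ==> length z = Z (length x) ==> F x e z \<le> pb K1 x"
  using pbdE[OF assms(1)] by blast
 obtain K2 where K2: "\<And>x e z. (\<forall>i<k. e i \<le> pb K x) ==> length z = Z (length x) ==> G x e z \<le> pb K2 x"
  using pbdE[OF assms(2)] by blast
 have "F x e z * G x e z \<le> pb (K1 + K2) x" if "\<forall>i<k. e i \<le> pb K x" "length z = Z (length x)" for x e z
  using mult_le_mono[OF K1[OF that] K2[OF that]] by (simp add: pb_mult)
 then show "\<exists>K'. \<forall>x e z. (\<forall>i<k. e i \<le> pb K x) \<longrightarrow> length z = Z (length x) \<longrightarrow> F x e z * G x e z \<le> pb K' x"
  by blast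
qed

lemma cp_let:
 assumes "CF k F" "CP (Suc k) (\<lambda>x e z. H x (e 0) (\<lambda>i. e (i + 1)) z)"
 shows "CP k (\<lambda>x e z. H x (F x e z) e z)"
 using cp_bind[OF assms] by simp

lemma cp_bind':
 assumes "CP k G" "CP (Suc k) (\<lambda>x e z. H x (e 0) (\<lambda>i. e (i + 1)) z)"
 shows "CP k (\<lambda>x e z. H x (fst (G x e z)) e (snd (G x e z)))"
 using cp_bind[OF assms] by simp

lemma cp_seq:
 assumes "CP k G" "CP k H"
 shows "CP k (\<lambda>x e z. H x e (snd (G x e z)))"
 using cp_bind[OF assms(1) cp_wk[OF assms(2)]] by simp

lemma cp_mono_arity: "CP j G ==> j \<le> k ==> CP k G"
 using cp_up[of \<Lambda> Z j G "k - j"] by simp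

lemma cf_wk1: "CF k F ==> CF (Suc k) (\<lambda>x e z. F x (\<lambda>i. e (i + 1)) z)"
 using cp_wk[of \<Lambda> Z k "\<lambda>x e z. (F x e z, z)"] by simp

lemma cf_wk3: "CF k F ==> CF (Suc (Suc (Suc k))) (\<lambda>x e z. F x (\<lambda>i. e (i + 3)) z)"
 using cp_wk[OF cp_wk[OF cp_wk[of \<Lambda> Z k "\<lambda>x e z. (F x e z, z)"]]] by (simp add: numeral_3_eq_3)

lemma cp_comp1:
 assumes "CP (Suc 0) (\<lambda>x e z. f x (e 0) z)" "CF k F"
 shows "CP k (\<lambda>x e z. f x (F x e z) z)"
 by (rule cp_let[OF assms(2)]) (rule cp_mono_arity[OF assms(1)], simp)

lemma cp_comp2:
 assumes "CP (Suc (Suc 0)) (\<lambda>x e z. f x (e 0) (e (Suc 0)) z)" "CF k F" "CF k G"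
 shows "CP k (\<lambda>x e z. f x (F x e z) (G x e z) z)"
proof (rule cp_let[OF assms(3)])
 have "CP (Suc (Suc k)) (\<lambda>x e z. f x (e 0) (e (0 + 1)) z)"
  by (rule cp_cong[OF cp_mono_arity[OF assms(1)]]) simp_all
 then show "CP (Suc k) (\<lambda>x e z. f x (F x (\<lambda>i. e (i + 1)) z) (e 0) z)"
  by (rule cp_let[OF cf_wk1[OF assms(2)], where H = "\<lambda>x v e z. f x v (e 0) z"])
qed

lemma cp_comp3:
 assumes "CP (Suc (Suc (Suc 0))) (\<lambda>x e z. f x (e 0) (e (Suc 0)) (e (Suc (Suc 0))) z)" "CF k F" "CF k G" "CF k H"
 shows "CP k (\<lambda>x e z. f x (F x e z) (G x e z) (H x e z) z)"
proof (rule cp_let[OF assms(4)])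
 have "CP (Suc (Suc (Suc k))) (\<lambda>x e z. f x (e 0) (e (0 + 1)) (e (1 + 1)) z)"
  by (rule cp_cong[OF cp_mono_arity[OF assms(1)]]) (simp_all add: numeral_2_eq_2)
 then have "CP (Suc (Suc k)) (\<lambda>x e z. f x (F x (\<lambda>i. e (i + 1 + 1)) z) (e 0) (e 1) z)"
  by (rule cp_let[OF cf_wk1[OF cf_wk1[OF assms(2)]], where H = "\<lambda>x v e z. f x v (e 0) (e 1) z"])
 then have "CP (Suc (Suc k)) (\<lambda>x e z. f x (F x (\<lambda>i. e (i + 1 + 1)) z) (e 0) (e (0 + 1)) z)" by simp
 then show "CP (Suc k) (\<lambda>x e z. f x (F x (\<lambda>i. e (i + 1)) z) (G x (\<lambda>i. e (i + 1)) z) (e 0) z)"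
  by (rule cp_let[OF cf_wk1[OF assms(3)], where H = "\<lambda>x v e z. f x (F x (\<lambda>i. e (i + 1)) z) v (e 0) z"])
qed

lemma cf_const: "CF k (\<lambda>x e z. c)"
 by (induction c) (auto intro: cf_zero[OF L] cf_Suc)

lemmas cf_v = cf_var[OF L]

lemma itr_pure: "itr (\<lambda>i v z. (h i v z, z)) v z n = (rec_nat v (\<lambda>i v. h i v z) n, z)"
 by (induction n) auto

text \<open>Limited recursion: primitive recursion under a polynomial majorant \<open>M\<close> of
  all intermediate values.\<close>

lemma cf_rec:
 assumes "CF k N" "CF k I" "CF (Suc (Suc (Suc k))) (\<lambda>x e z. g x (e 0) (e 1) (\<lambda>i. e (i + 3)) z)" "pbd k M"
  "\<And>x e z i. length z = Z (length x) ==> i \<le> N x e z ==> rec_nat (I x e z) (\<lambda>i v. g x i v e z) i \<le> M x e z"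
 shows "CF k (\<lambda>x e z. rec_nat (I x e z) (\<lambda>i v. g x i v e z) (N x e z))"
proof -
 have "CP k (\<lambda>x e z. itr (\<lambda>i v z. (g x i v e z, z)) (I x e z) z (N x e z))"
 proof (rule cp_iter[OF assms(1-3)])
  fix K
  obtain K' where K': "\<And>x e z. (\<forall>i<k. e i \<le> pb K x) ==> length z = Z (length x) ==> M x e z \<le> pb K' x"
   using pbdE[OF assms(4)] by blast
  have "rec_nat (I x e z) (\<lambda>i v. g x i v e z) i \<le> pb K' x"
   if "\<forall>j<k. e j \<le> pb K x" "length z = Z (length x)" "i \<le> N x e z" for x e z i
   using K'[OF that(1,2)] assms(5)[OF that(2,3)] by linarith
  then show "\<exists>K'. \<forall>x e z i. (\<forall>j<k. e j \<le> pb K x) \<longrightarrow> length z = Z (length x) \<longrightarrow> i \<le> N x e z \<longrightarrow>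
   fst (itr (\<lambda>i v z. (g x i v e z, z)) (I x e z) z i) \<le> pb K' x"
   unfolding itr_pure fst_conv by blast
 qed
 then show ?thesis unfolding itr_pure .
qed

lemma cf_add: assumes "CF k F" "CF k G" shows "CF k (\<lambda>x e z. F x e z + G x e z)"
proof -
 have r: "rec_nat a (\<lambda>i v. Suc v) n = a + n" for a n by (induction n) auto
 have "CF k (\<lambda>x e z. rec_nat (F x e z) (\<lambda>i v. Suc v) (G x e z))"
  by (rule cf_rec[OF assms(2,1) _ pbd_add[OF pbd_CF pbd_CF, OF assms]]) (auto simp: r intro!: cf_Suc cf_v)
 then show ?thesis unfolding r .
qed

lemma cf_minus: assumes "CF k F" "CF k G" shows "CF k (\<lambda>x e z. F x e z - G x e z)"
proof -
 have r: "rec_nat a (\<lambda>i v. v - Suc 0) n = a - n" for a n by (induction n) auto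
 have "CF k (\<lambda>x e z. rec_nat (F x e z) (\<lambda>i v. v - Suc 0) (G x e z))"
  by (rule cf_rec[OF assms(2,1) _ pbd_CF[OF assms(1)]]) (auto simp: r intro!: cf_pred cf_v)
 then show ?thesis unfolding r .
qed

lemma cf_mult: assumes "CF k F" "CF k G" shows "CF k (\<lambda>x e z. F x e z * G x e z)"
proof -
 have r: "rec_nat 0 (\<lambda>i v. v + a) n = a * n" for a n :: nat by (induction n) auto
 have "CF k (\<lambda>x e z. rec_nat 0 (\<lambda>i v. v + F x e z) (G x e z))"
  by (rule cf_rec[OF assms(2) _ _ pbd_mult[OF pbd_CF pbd_CF, OF assms]])
   (auto simp: r intro!: cf_add cf_v cf_const cf_wk3 assms(1))
 then show ?thesis unfolding r .
qed

lemma cf_power: "CF k F ==> CF k (\<lambda>x e z. F x e z ^ c)"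
 by (induction c) (auto intro: cf_const cf_mult)

lemma cf_if:
 assumes "CB k P" "CF k F" "CF k G" shows "CF k (\<lambda>x e z. if P x e z then F x e z else G x e z)"
 by (rule cp_cong[OF cp_if[OF assms]]) simp

lemma cp_ifb:
 assumes "CB k P" "CP k F" "CP k G" shows "CP k (\<lambda>x e z. if P x e z then F x e z else G x e z)"
 by (rule cp_cong[OF cp_if[OF assms]]) simp

lemma cb_nz: "CF k F ==> CB k (\<lambda>x e z. F x e z \<noteq> 0)"
 by (rule cp_cong[OF cp_if[OF _ cf_const[of k 1] cf_const[of k 0], of F]]) simp_all

lemma cb_not: "CB k P ==> CB k (\<lambda>x e z. \<not> P x e z)"
 by (rule cp_cong[OF cf_if[of k P "\<lambda>x e z. 0" "\<lambda>x e z. 1"]]) (auto intro: cf_const)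

lemma cb_conj: "CB k P ==> CB k Q ==> CB k (\<lambda>x e z. P x e z \<and> Q x e z)"
 by (rule cp_cong[OF cf_if[of k P "\<lambda>x e z. of_bool (Q x e z)" "\<lambda>x e z. 0"]]) (auto intro: cf_const)

lemma cb_disj: "CB k P ==> CB k Q ==> CB k (\<lambda>x e z. P x e z \<or> Q x e z)"
 by (rule cp_cong[OF cf_if[of k P "\<lambda>x e z. 1" "\<lambda>x e z. of_bool (Q x e z)"]]) (auto intro: cf_const)

lemma cb_imp: "CB k P ==> CB k Q ==> CB k (\<lambda>x e z. P x e z \<longrightarrow> Q x e z)"
 by (rule cp_cong[OF cf_if[of k P "\<lambda>x e z. of_bool (Q x e z)" "\<lambda>x e z. 1"]]) (auto intro: cf_const)

lemma cb_less: "CF k F ==> CF k G ==> CB k (\<lambda>x e z. F x e z < G x e z)"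
 by (rule cp_cong[OF cb_nz[OF cf_minus[of k G F]]]) auto

lemma cb_le: "CF k F ==> CF k G ==> CB k (\<lambda>x e z. F x e z \<le> G x e z)"
 by (rule cp_cong[OF cb_not[OF cb_less[of k G F]]]) auto

lemma cb_eq: "CF k F ==> CF k G ==> CB k (\<lambda>x e z. F x e z = G x e z)"
 by (rule cp_cong[OF cb_conj[OF cb_le[of k F G] cb_le[of k G F]]]) auto

lemma cb_const: "CB k (\<lambda>x e z. b)" using cf_const[of k "of_bool b"] .

lemma cf_sum:
 assumes "CF k N" "CF (Suc (Suc (Suc k))) (\<lambda>x e z. F x (e 0) (\<lambda>i. e (i + 3)) z)"
 shows "CF k (\<lambda>x e z. \<Sum>i<N x e z. F x i e z)"
proof -
 have r: "rec_nat 0 (\<lambda>i v. v + f i) n = (\<Sum>i<n. f i)" for f :: "nat \<Rightarrow> nat" and n by (induction n) auto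
 \<comment> \<open>The full sum is the majorant of the recursion. It is polynomial, being at most
   the number of terms times a bound for each term.\<close>
 have pb: "pbd k (\<lambda>x e z. \<Sum>i<N x e z. F x i e z)"
  unfolding pbd_def
 proof
  fix K
  obtain K1 where K1: "\<And>x e z. (\<forall>i<k. e i \<le> pb K x) ==> length z = Z (length x) ==> N x e z \<le> pb K1 x"
   using pbdE[OF pbd_CF[OF assms(1)]] by blast
  obtain K2 where K2: "\<And>x e z. (\<forall>i<Suc (Suc (Suc k)). e i \<le> pb (max K K1) x) ==> length z = Z (length x) ==>
   F x (e 0) (\<lambda>i. e (i + 3)) z \<le> pb K2 x" using pbdE[OF pbd_CF[OF assms(2)]] by blast
  have "(\<Sum>i<N x e z. F x i e z) \<le> pb (K1 + K2) x" if a: "\<forall>i<k. e i \<le> pb K x" "length z = Z (length x)" for x e z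
  proof -
   have mm: "pb K x \<le> pb (max K K1) x" "pb K1 x \<le> pb (max K K1) x" by (simp_all add: pb_mono)
   have "F x i e z \<le> pb K2 x" if "i < N x e z" for i
   proof -
    have "i \<le> pb (max K K1) x" using that K1[OF a] mm by linarith
    then have "\<forall>j<Suc (Suc (Suc k)). (i ## 0 ## 0 ## e) j \<le> pb (max K K1) x"
     using a(1) mm by (auto simp: push_def split: nat.splits intro: order_trans)
    from K2[OF this a(2)] show ?thesis by simp
   qed
   then have "(\<Sum>i<N x e z. F x i e z) \<le> (\<Sum>i<N x e z. pb K2 x)" by (intro sum_mono) auto
   also have "\<dots> \<le> pb K1 x * pb K2 x" using K1[OF a] by simp
   finally show ?thesis by (simp add: pb_mult)
  qed
  then show "\<exists>K'. \<forall>x e z. (\<forall>i<k. e i \<le> pb K x) \<longrightarrow> length z = Z (length x) \<longrightarrow> (\<Sum>i<N x e z. F x i e z) \<le> pb K' x"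
   by blast
 qed
 have "CF k (\<lambda>x e z. rec_nat 0 (\<lambda>i v. v + F x i e z) (N x e z))"
 proof (rule cf_rec[OF assms(1) cf_const _ pb])
  show "CF (Suc (Suc (Suc k))) (\<lambda>x e z. e 1 + F x (e 0) (\<lambda>i. e (i + 3)) z)"
   by (intro cf_add cf_v assms) simp
  show "rec_nat 0 (\<lambda>i v. v + F x i e z) i \<le> (\<Sum>i<N x e z. F x i e z)" if "i \<le> N x e z" for x e z i
   unfolding r using that by (intro sum_mono2) auto
 qed
 then show ?thesis unfolding r .
qed

lemma cb_ex:
 assumes "CF k N" "CB (Suc (Suc (Suc k))) (\<lambda>x e z. P x (e 0) (\<lambda>i. e (i + 3)) z)"
 shows "CB k (\<lambda>x e z. \<exists>i<N x e z. P x i e z)"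
 by (rule cp_cong[OF cb_nz[OF cf_sum[OF assms(1), of "\<lambda>x i e z. of_bool (P x i e z)"]]])
  (use assms(2) in \<open>auto simp: sum_eq_0_iff\<close>)

lemma cb_all:
 assumes "CF k N" "CB (Suc (Suc (Suc k))) (\<lambda>x e z. P x (e 0) (\<lambda>i. e (i + 3)) z)"
 shows "CB k (\<lambda>x e z. \<forall>i<N x e z. P x i e z)"
 by (rule cp_cong[OF cb_not[OF cb_ex[OF assms(1) cb_not[OF assms(2)]]]]) auto

text \<open>The quotient counts the positive multiples of the divisor up to the dividend; the test
  \<open>0 < b\<close> makes division by zero give 0.\<close>

lemma cf_div: assumes "CF k F" "CF k G" shows "CF k (\<lambda>x e z. F x e z div G x e z)"
proof -
 have "(\<Sum>i<a. of_bool (0 < b \<and> Suc i * b \<le> a)) = a div b" for a b :: nat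
 proof (cases "b = 0")
  case False
  have "{i. i < a \<and> Suc i * b \<le> a} = {..<a div b}"
  proof (intro set_eqI iffI)
   fix i assume "i \<in> {..<a div b}"
   then have "Suc i \<le> a div b" by simp
   then have "Suc i * b \<le> a" by (metis False div_times_less_eq_dividend le_trans mult_le_mono1)
   moreover have "Suc i \<le> Suc i * b" using False mult_le_mono2[of 1 b "Suc i"] by simp
   ultimately show "i \<in> {i. i < a \<and> Suc i * b \<le> a}" by simp
  next
   fix i assume "i \<in> {i. i < a \<and> Suc i * b \<le> a}"
   then show "i \<in> {..<a div b}" using False by (simp add: less_eq_div_iff_mult_less_eq Suc_le_eq[symmetric])
  qed
  then show ?thesis using False by (simp add: sum.If_cases of_bool_def Int_def lessThan_def)
 qed simp
 moreover have "CF k (\<lambda>x e z. \<Sum>i<F x e z. of_bool (0 < G x e z \<and> Suc i * G x e z \<le> F x e z))"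
  by (intro cf_sum cb_conj cb_less cb_le cf_mult cf_Suc cf_const cf_wk3 cf_v assms) simp
 ultimately show ?thesis by simp
qed

lemma cf_mod: assumes "CF k F" "CF k G" shows "CF k (\<lambda>x e z. F x e z mod G x e z)"
 using cf_minus[OF assms(1) cf_mult[OF cf_div[OF assms] assms(2)]] by (simp add: minus_div_mult_eq_mod)

text \<open>Repeated halving avoids the divisor \<open>2 ^ G\<close>, which may be too large for a
  register.\<close>

lemma cf_shift: assumes "CF k F" "CF k G" shows "CF k (\<lambda>x e z. F x e z div 2 ^ G x e z)"
proof -
 have r: "rec_nat a (\<lambda>i v. v div 2) n = a div 2 ^ n" for a n :: nat
  by (induction n) (simp_all add: div_mult2_eq[symmetric] mult.commute)
 have "CF k (\<lambda>x e z. rec_nat (F x e z) (\<lambda>i v. v div 2) (G x e z))"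
  by (rule cf_rec[OF assms(2,1) _ pbd_CF[OF assms(1)]]) (auto simp: r intro!: cf_div cf_v cf_const)
 then show ?thesis unfolding r .
qed

lemma cb_odd: "CF k F ==> CB k (\<lambda>x e z. odd (F x e z))"
 by (rule cp_cong[OF cb_eq[OF cf_mod[of k F "\<lambda>x e z. 2"] cf_const[of k 1]]]) (auto intro: cf_const simp: odd_iff_mod_2_eq_one)

lemma cb_bit: "CF k F ==> CF k G ==> CB k (\<lambda>x e z. bit (F x e z) (G x e z))"
 using cb_odd[OF cf_shift[of k F G]] by (simp add: bit_iff_odd)

lemma cf_pow2: assumes "CF k F" "pbd k (\<lambda>x e z. 2 ^ F x e z)" shows "CF k (\<lambda>x e z. 2 ^ F x e z)"
proof -
 have r: "rec_nat 1 (\<lambda>i v. v + v) n = (2::nat) ^ n" for n by (induction n) auto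
 have "CF k (\<lambda>x e z. rec_nat 1 (\<lambda>i v. v + v) (F x e z))"
  by (rule cf_rec[OF assms(1) _ _ assms(2)]) (unfold r, auto intro!: cf_add cf_v cf_const power_increasing)
 then show ?thesis unfolding r .
qed

text \<open>A fixed finite table is a nest of case distinctions, whatever \<open>g\<close> is. This
  is how the transition function of an arbitrary machine enters a program.\<close>

lemma cf_table: "CF k F ==> CF k (\<lambda>x e z. if F x e z < m then g (F x e z) else 0)"
proof (induction m)
 case (Suc m)
 have "CF k (\<lambda>x e z. if F x e z = m then g m else if F x e z < m then g (F x e z) else 0)"
  by (rule cf_if[OF cb_eq[OF Suc.prems cf_const] cf_const Suc.IH[OF Suc.prems]])
 then show ?case by (rule cp_cong) auto
qed (simp add: cf_const)

lemma cf_inp: "CF k I ==> CB k (\<lambda>x e z. I x e z < length x \<and> x ! I x e z)"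
 by (rule cf_input)

lemmas cf_length = cf_len[OF L]

end

locale cat_tape = cat +
 assumes Zc: "cf \<Lambda> Z 0 (\<lambda>x e z. Z (length x))" and Zpos: "\<And>n. 0 < Z n"
begin

lemma cb_read: assumes "CF k I" shows "CB k (\<lambda>x e z. I x e z < Z (length x) \<and> z ! I x e z)"
proof -
 \<comment> \<open>An index out of range is redirected to cell 0, which exists because
   \<open>Z\<close> is positive; so reading needs no side condition.\<close>
 let ?J = "\<lambda>x e z. if I x e z < Z (length x) then I x e z else 0"
 have zc: "CF k (\<lambda>x e z. Z (length x))" using cp_mono_arity[OF Zc] by simp
 have "CB k (\<lambda>x e z. I x e z < Z (length x) \<and> z ! ?J x e z)"
  by (intro cb_conj cb_less zc cf_read_raw cf_if assms cf_const) (use Zpos in auto)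
 then show ?thesis by (rule cp_cong) auto
qed

lemma cp_write: assumes "CF k I" "CB k V" shows "CP k (\<lambda>x e z. (0, z[I x e z := V x e z]))"
proof -
 let ?J = "\<lambda>x e z. if I x e z < Z (length x) then I x e z else 0"
 have zc: "CF k (\<lambda>x e z. Z (length x))" using cp_mono_arity[OF Zc] by simp
 have "CP k (\<lambda>x e z. if I x e z < Z (length x) then (0, z[?J x e z := (of_bool (V x e z) \<noteq> (0::nat))]) else (0, z))"
  by (intro cp_ifb cb_less zc cp_write_raw cf_if assms cf_const) (use Zpos in auto)
 then show ?thesis by (rule cp_cong) (auto simp: list_update_beyond)
qed

end

section \<open>Inner products modulo 2 and their second moment\<close>

definition ip :: "nat \<Rightarrow> nat \<Rightarrow> nat \<Rightarrow> bool" where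
 "ip b a y = odd (\<Sum>i<b. of_bool (bit a i \<and> bit y i) :: nat)"

definition chi :: "nat \<Rightarrow> nat \<Rightarrow> nat \<Rightarrow> int" where
 "chi b a y = (if ip b a y then -1 else 1)"

lemma ip_flip:
 assumes "i < b"
 shows "ip b (flip_bit i a) y = (ip b a y \<noteq> bit y i)"
proof -
 let ?f = "\<lambda>a j. of_bool (bit a j \<and> bit y j) :: nat"
 have 1: "(\<Sum>j<b. ?f a' j) = ?f a' i + (\<Sum>j\<in>{..<b} - {i}. ?f a' j)" for a'
  using assms by (subst sum.remove[of _ i]) auto
 have 2: "(\<Sum>j\<in>{..<b} - {i}. ?f (flip_bit i a) j) = (\<Sum>j\<in>{..<b} - {i}. ?f a j)"
  by (intro sum.cong) (auto simp: bit_flip_bit_iff)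
 show ?thesis unfolding ip_def 1 2 by (auto simp: bit_flip_bit_iff)
qed

lemma flip_bit_lt: "i < b ==> a < 2 ^ b ==> flip_bit i a < (2::nat) ^ b"
 by (metis (no_types, lifting) bit_eqI bit_flip_bit_iff bit_less_pow bit_take_bit_iff take_bit_nat_less_exp)

lemma flip_flip: "flip_bit i (flip_bit i a) = (a::nat)"
 by (rule bit_eqI) (auto simp: bit_flip_bit_iff)

text \<open>Flip the bit of the row at a place where the two seeds differ: an involution on the rows
  that reverses the sign of every summand.\<close>

lemma chi_orth:
 assumes "y < 2 ^ b" "y' < 2 ^ b" "y \<noteq> y'"
 shows "(\<Sum>a<2 ^ b. chi b a y * chi b a y') = 0"
proof -
 obtain i where i: "bit y i \<noteq> bit y' i" using assms(3) bit_eqI by metis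
 have ib: "i < b" using i assms bit_less_pow by metis
 have "(\<Sum>a<2 ^ b. chi b a y * chi b a y') = (\<Sum>a<2 ^ b. chi b (flip_bit i a) y * chi b (flip_bit i a) y')"
  by (rule sum.reindex_bij_witness[of _ "flip_bit i" "flip_bit i"])
   (auto simp: flip_bit_lt[OF ib] flip_flip)
 also have "\<dots> = (\<Sum>a<2 ^ b. - (chi b a y * chi b a y'))"
  by (intro sum.cong) (use i in \<open>auto simp: chi_def ip_flip[OF ib]\<close>)
 finally show ?thesis by (simp add: sum_negf)
qed

text \<open>Parseval's identity for the indicator of \<open>Y\<close>: the mixed terms vanish by
  orthogonality. On average over the rows, the squared imbalance with which a row splits a set of
  seeds is the size of the set.\<close>

lemma chi_second_moment:
 assumes "Y \<subseteq> {..<2 ^ b}"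
 shows "(\<Sum>a<2 ^ b. (\<Sum>y\<in>Y. chi b a y)\<^sup>2) = 2 ^ b * int (card Y)"
proof -
 have fin: "finite Y" by (rule finite_subset[OF assms]) simp
 have "(\<Sum>a<2 ^ b. (\<Sum>y\<in>Y. chi b a y)\<^sup>2) = (\<Sum>a<2 ^ b. \<Sum>y\<in>Y. \<Sum>y'\<in>Y. chi b a y * chi b a y')"
  by (simp add: power2_eq_square sum_product)
 also have "\<dots> = (\<Sum>y\<in>Y. \<Sum>a<2 ^ b. \<Sum>y'\<in>Y. chi b a y * chi b a y')"
  by (rule sum.swap)
 also have "\<dots> = (\<Sum>y\<in>Y. \<Sum>y'\<in>Y. \<Sum>a<2 ^ b. chi b a y * chi b a y')"
  by (intro sum.cong refl sum.swap)
 also have "\<dots> = (\<Sum>y\<in>Y. \<Sum>y'\<in>Y. if y' = y then 2 ^ b else 0)"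
 proof (intro sum.cong refl)
  fix y y' assume "y \<in> Y" "y' \<in> Y"
  then have "y < 2 ^ b" "y' < 2 ^ b" using assms by auto
  then show "(\<Sum>a<2 ^ b. chi b a y * chi b a y') = (if y' = y then 2 ^ b else 0)"
   using chi_orth[of y b y'] by (auto simp: chi_def power2_eq_square[symmetric] if_distrib cong: if_cong)
 qed
 also have "\<dots> = 2 ^ b * int (card Y)" using fin by simp
 finally show ?thesis .
qed

lemma sum_chi:
 assumes "finite Y"
 shows "(\<Sum>y\<in>Y. chi b a y) = int (card {y\<in>Y. \<not> ip b a y}) - int (card {y\<in>Y. ip b a y})"
proof -
 have "(\<Sum>y\<in>Y. chi b a y) = (\<Sum>y\<in>Y. of_bool (\<not> ip b a y) - of_bool (ip b a y))"
  by (intro sum.cong) (auto simp: chi_def)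
 also have "\<dots> = (\<Sum>y\<in>Y. of_bool (\<not> ip b a y)) - (\<Sum>y\<in>Y. of_bool (ip b a y))" by (simp add: sum_subtractf)
 finally show ?thesis using assms by (simp add: of_bool_def sum.If_cases Int_def)
qed

section \<open>Reversible tours of configuration trees\<close>

text \<open>\<open>Btw g\<close> stands in front of tree \<open>g\<close>; \<open>Nd g u k\<close>
  is at a node with state \<open>u\<close>, about to try child number \<open>k\<close>. The content
  of the catalytic tape belongs to the position too, but is kept on the tape itself.\<close>

datatype wst = Btw nat | Nd nat nat nat

text \<open>The state \<open>u\<close> holds everything except the catalytic tape, so a
  configuration is a pair of a state and a content. \<open>hp\<close> is the catalytic head,
  \<open>rp\<close> the random head, and \<open>hl\<close> is 0 while the machine runs and otherwise
  its outcome. \<open>dn\<close> and \<open>dw\<close> take the state, the scanned symbol (2 for an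
  endmarker) and the random bit.\<close>

locale acm =
 fixes Q c R b :: nat and hp hl rp :: "nat \<Rightarrow> nat"
  and dn :: "nat \<Rightarrow> nat \<Rightarrow> bool \<Rightarrow> nat" and dw :: "nat \<Rightarrow> nat \<Rightarrow> bool \<Rightarrow> bool"
 assumes rp_mono: "\<And>u s v. hl u = 0 ==> rp u \<le> rp (dn u s v)" and Qpos: "0 < Q"
begin

definition sy :: "bool list \<Rightarrow> nat \<Rightarrow> nat" where
 "sy t h = (if h < c then of_bool (t ! h) else 2)"

definition nxt :: "(nat \<Rightarrow> bool) \<Rightarrow> nat \<times> bool list \<Rightarrow> nat \<times> bool list" where
 "nxt f v = (case v of (u, t) \<Rightarrow> (dn u (sy t (hp u)) (f (rp u)), t[hp u := dw u (sy t (hp u)) (f (rp u))]))"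

text \<open>The tree of configurations whose run ends in \<open>r\<close>, cut down to those with
  random position at least \<open>lev\<close>. Such a tree consults only the random bits from
  \<open>lev\<close> on.\<close>

inductive_set lead :: "(nat \<Rightarrow> bool) \<Rightarrow> nat \<Rightarrow> nat \<times> bool list \<Rightarrow> (nat \<times> bool list) set"
 for f :: "nat \<Rightarrow> bool" and lev :: nat and r :: "nat \<times> bool list" where
 lead_root: "r \<in> lead f lev r"
| lead_step: "nxt f (u, t) \<in> lead f lev r ==> hl u = 0 ==> u < Q ==> length t = c ==> lev \<le> rp u ==> (u, t) \<in> lead f lev r"

lemma lead_bounds: "v \<in> lead f lev r ==> fst r < Q ==> length (snd r) = c ==> fst v < Q \<and> length (snd v) = c"
 by (induction rule: lead.induct) auto

lemma lead_halted: "v \<in> lead f lev r ==> hl (fst v) \<noteq> 0 ==> v = r"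
 by (induction rule: lead.induct) auto

lemma lead_nonhalted: "(u, t) \<in> lead f lev r ==> hl u = 0 ==> hl (fst r) \<noteq> 0 ==>
  nxt f (u, t) \<in> lead f lev r \<and> lev \<le> rp u \<and> u < Q \<and> length t = c"
 by (auto elim: lead.cases)

lemma lead_mono: "v \<in> lead f lev r ==> lev' \<le> lev ==> v \<in> lead f lev' r"
proof (induction rule: lead.induct)
 case (lead_step u t)
 then show ?case by (intro lead.lead_step) simp_all
qed (rule lead_root)

lemma rp_nxt: "hl u = 0 ==> rp u \<le> rp (fst (nxt f (u, t)))"
 by (simp add: nxt_def rp_mono)

text \<open>The random position never decreases along a run, so it suffices that the first
  configuration is on the level.\<close>

lemma lead_raise: "v \<in> lead f l0 r ==> v = r \<or> lev \<le> rp (fst v) ==> v \<in> lead f lev r"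
proof (induction rule: lead.induct)
 case (lead_step u t)
 show ?case
 proof (cases "(u, t) = r")
  case True then show ?thesis by (auto intro: lead_root)
 next
  case False
  then have "lev \<le> rp u" using lead_step.prems by simp
  then have "nxt f (u, t) \<in> lead f lev r" using lead_step.IH lead_step.hyps rp_nxt[of u f t] by linarith
  then show ?thesis using lead_step.hyps \<open>lev \<le> rp u\<close> by (intro lead.lead_step)
 qed
qed (auto intro: lead_root)

lemma lead_dep: "v \<in> lead f lev r ==> (\<And>i. lev \<le> i ==> f i = f' i) ==> v \<in> lead f' lev r"
proof (induction rule: lead.induct)
 case (lead_step u t)
 then have "nxt f' (u, t) = nxt f (u, t)" by (simp add: nxt_def)
 then show ?case using lead_step by (intro lead.lead_step) simp_all
qed (rule lead_root)

lemma lead_dep_iff: "(\<And>i. lev \<le> i ==> f i = f' i) ==> v \<in> lead f lev r \<longleftrightarrow> v \<in> lead f' lev r"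
 using lead_dep[of v f lev r f'] lead_dep[of v f' lev r f] by auto

lemma lead_lev_iff: "v = r \<or> lev \<le> rp (fst v) ==> v \<in> lead f 0 r \<longleftrightarrow> v \<in> lead f lev r"
 using lead_raise[of v f 0 r lev] lead_mono[of v f lev r 0] by auto

definition sd :: "(nat \<Rightarrow> nat) \<Rightarrow> nat \<Rightarrow> nat \<Rightarrow> bool" where
 "sd A y i = (i < R \<and> ip b (A i) y)"

text \<open>One tour visits a tree for every pair of a root state and a seed; states that do not
  halt have no tree and are passed by.\<close>

definition G :: nat where "G = Q * 2 ^ b"
definition eg :: "nat \<Rightarrow> nat" where "eg g = g div 2 ^ b"
definition yg :: "nat \<Rightarrow> nat" where "yg g = g mod 2 ^ b"

lemma eg_less: "g < G ==> eg g < Q"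
 by (simp add: G_def eg_def less_mult_imp_div_less)

definition vsym :: "nat \<Rightarrow> nat" where
 "vsym k = (if hp (k div 2) < c then of_bool (odd k) else 2)"

text \<open>Child \<open>k\<close> is the candidate predecessor with state \<open>k div 2\<close>
  whose scanned cell held \<open>odd k\<close>; with the head off the tape only the even number
  counts. A step changes one cell, so the test is that this cell now holds what the predecessor
  would have written.\<close>

definition val :: "(nat \<Rightarrow> nat) \<Rightarrow> nat \<Rightarrow> nat \<Rightarrow> nat \<Rightarrow> nat \<Rightarrow> bool list \<Rightarrow> bool" where
 "val A lev g u k t \<longleftrightarrow> hl (k div 2) = 0 \<and> (hp (k div 2) < c \<or> even k) \<and> lev \<le> rp (k div 2) \<and>
  dn (k div 2) (vsym k) (sd A (yg g) (rp (k div 2))) = u \<and>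
  (hp (k div 2) < c \<longrightarrow> t ! hp (k div 2) = dw (k div 2) (vsym k) (sd A (yg g) (rp (k div 2))))"

definition oc :: "nat \<Rightarrow> bool list \<Rightarrow> nat" where
 "oc u t = of_bool (hp u < c \<and> t ! hp u)"

fun nx :: "(nat \<Rightarrow> nat) \<Rightarrow> nat \<Rightarrow> wst \<times> bool list \<Rightarrow> wst \<times> bool list" where
 "nx A lev (Btw g, t) = (if g < G then if hl (eg g) \<noteq> 0 then (Nd g (eg g) 0, t) else (Btw (Suc g), t) else (Btw g, t))"
| "nx A lev (Nd g u k, t) = (if k < 2 * Q
   then if val A lev g u k t then (Nd g (k div 2) 0, t[hp (k div 2) := odd k]) else (Nd g u (Suc k), t)
   else if hl u \<noteq> 0 then (Btw (Suc g), t)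
   else (case nxt (sd A (yg g)) (u, t) of (u', t') \<Rightarrow> (Nd g u' (Suc (2 * u + oc u t)), t')))"

fun pv :: "(nat \<Rightarrow> nat) \<Rightarrow> nat \<Rightarrow> wst \<times> bool list \<Rightarrow> wst \<times> bool list" where
 "pv A lev (Btw g, t) = (if g = 0 then (Btw g, t)
   else if hl (eg (g - 1)) \<noteq> 0 then (Nd (g - 1) (eg (g - 1)) (2 * Q), t) else (Btw (g - 1), t))"
| "pv A lev (Nd g u k, t) = (if k = 0 then if hl u \<noteq> 0 then (Btw g, t)
    else (case nxt (sd A (yg g)) (u, t) of (u', t') \<Rightarrow> (Nd g u' (2 * u + oc u t), t'))
   else if val A lev g u (k - 1) t then (Nd g ((k - 1) div 2) (2 * Q), t[hp ((k - 1) div 2) := odd (k - 1)])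
   else (Nd g u (k - 1), t))"

fun winv :: "(nat \<Rightarrow> nat) \<Rightarrow> nat \<Rightarrow> bool list \<Rightarrow> wst \<times> bool list \<Rightarrow> bool" where
 "winv A lev t0 (Btw g, t) \<longleftrightarrow> g \<le> G \<and> t = t0"
| "winv A lev t0 (Nd g u k, t) \<longleftrightarrow> g < G \<and> k \<le> 2 * Q \<and> hl (eg g) \<noteq> 0 \<and> (u, t) \<in> lead (sd A (yg g)) lev (eg g, t0)"

lemma val_child:
 assumes "val A lev g u k t" "length t = c"
 shows "nxt (sd A (yg g)) (k div 2, t[hp (k div 2) := odd k]) = (u, t)" "oc (k div 2) (t[hp (k div 2) := odd k]) = of_bool (odd k)"
proof -
 let ?h = "hp (k div 2)"
 have s: "sy (t[?h := odd k]) ?h = vsym k" using assms(2) by (auto simp: sy_def vsym_def)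
 have tt: "t[?h := dw (k div 2) (vsym k) (sd A (yg g) (rp (k div 2)))] = t"
  using assms by (cases "?h < c") (simp_all add: val_def list_update_same_conv list_update_beyond not_less)
 show "nxt (sd A (yg g)) (k div 2, t[?h := odd k]) = (u, t)"
  using assms(1) tt by (simp add: nxt_def s val_def)
 show "oc (k div 2) (t[?h := odd k]) = of_bool (odd k)"
  using assms by (auto simp: oc_def val_def)
qed

lemma val_parent:
 assumes "nxt (sd A (yg g)) (u, t) = (u', t')" "hl u = 0" "lev \<le> rp u" "length t = c"
 shows "val A lev g u' (2 * u + oc u t) t'" "t'[hp u := odd (oc u t)] = t" "length t' = c"
proof -
 have d: "(2 * u + oc u t) div 2 = u" "odd (2 * u + oc u t) = odd (oc u t)" by (auto simp: oc_def)
 have s: "vsym (2 * u + oc u t) = sy t (hp u)" unfolding vsym_def d by (simp add: sy_def oc_def)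
 show "val A lev g u' (2 * u + oc u t) t'"
  using assms unfolding val_def d s by (auto simp: nxt_def oc_def)
 have "t[hp u := odd (oc u t)] = t" using assms(4) by (cases "hp u < c") (simp_all add: oc_def list_update_beyond not_less)
 then show "t'[hp u := odd (oc u t)] = t" using assms(1) by (auto simp: nxt_def)
 show "length t' = c" using assms by (auto simp: nxt_def)
qed

text \<open>A descent is undone by a step of the machine, an ascent by rewriting one cell. A halting
  node is the root of its tree, so leaving a tree forgets nothing: the root is known from
  \<open>g\<close> and the content.\<close>

lemma winv_nx:
 assumes "length t0 = c" "winv A lev t0 s" "fst s \<noteq> Btw G"
 shows "winv A lev t0 (nx A lev s)" "pv A lev (nx A lev s) = s"
proof -
 have "winv A lev t0 (nx A lev s) \<and> pv A lev (nx A lev s) = s"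
 proof (cases s)
  case (Pair q t)
  show ?thesis
  proof (cases q)
   case (Btw g)
   then have "g < G" "t = t0" using assms Pair by auto
   then show ?thesis using Pair Btw by (auto intro: lead_root)
  next
   case (Nd g u k)
   have i: "g < G" "k \<le> 2 * Q" "hl (eg g) \<noteq> 0" "(u, t) \<in> lead (sd A (yg g)) lev (eg g, t0)"
    using assms Pair Nd by auto
   have bd: "u < Q" "length t = c" using lead_bounds[OF i(4)] eg_less[OF i(1)] assms(1) by auto
   show ?thesis
   proof (cases "k < 2 * Q")
    case k: True
    show ?thesis
    proof (cases "val A lev g u k t")
     case True
     note ch = val_child[OF True bd(2)]
     have hk: "hl (k div 2) = 0" "lev \<le> rp (k div 2)" using True by (auto simp: val_def)
     have "(k div 2, t[hp (k div 2) := odd k]) \<in> lead (sd A (yg g)) lev (eg g, t0)"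
      using ch(1) i(4) hk k bd by (intro lead_step) auto
     moreover have "2 * (k div 2) + of_bool (odd k) = k" by (cases "odd k") auto
     ultimately show ?thesis using Pair Nd True k ch hk i by simp
    next
     case False
     then show ?thesis using Pair Nd k i by auto
    qed
   next
    case False
    then have k: "k = 2 * Q" using i by simp
    show ?thesis
    proof (cases "hl u = 0")
     case True
     obtain u' t' where n: "nxt (sd A (yg g)) (u, t) = (u', t')" by fastforce
     have l: "(u', t') \<in> lead (sd A (yg g)) lev (eg g, t0)" "lev \<le> rp u"
      using lead_nonhalted[OF i(4) True] i(3) n by auto
     note p = val_parent[OF n True l(2) bd(2)]
     have d: "(2 * u + oc u t) div 2 = u" "odd (2 * u + oc u t) = odd (oc u t)" "oc u t \<le> 1" by (auto simp: oc_def)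
     have "Suc (2 * u + oc u t) \<le> 2 * Q" using bd(1) d(3) by linarith
     then show ?thesis using Pair Nd k True n i l p d by simp
    next
     case False
     then have "(u, t) = (eg g, t0)" using lead_halted[OF i(4)] by simp
     then show ?thesis using Pair Nd k False i by auto
    qed
   qed
  qed
 qed
 then show "winv A lev t0 (nx A lev s)" "pv A lev (nx A lev s) = s" by auto
qed

definition W :: "(nat \<Rightarrow> nat) \<Rightarrow> nat \<Rightarrow> bool list \<Rightarrow> nat \<Rightarrow> wst \<times> bool list" where
 "W A lev t0 s = (nx A lev ^^ s) (Btw 0, t0)"

lemma W_0 [simp]: "W A lev t0 0 = (Btw 0, t0)" by (simp add: W_def)
lemma W_Suc: "W A lev t0 (Suc s) = nx A lev (W A lev t0 s)" by (simp add: W_def)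

lemma nx_final: "fst s = Btw G ==> nx A lev s = s"
 by (cases s) auto

lemma winv_W: "length t0 = c ==> winv A lev t0 (W A lev t0 s)"
proof (induction s)
 case (Suc s)
 then show ?case using winv_nx(1)[of t0 A lev "W A lev t0 s"] nx_final[of "W A lev t0 s" A lev]
  by (cases "fst (W A lev t0 s) = Btw G") (auto simp: W_Suc)
qed simp

lemma pv_W: "length t0 = c ==> fst (W A lev t0 s) \<noteq> Btw G ==> pv A lev (W A lev t0 (Suc s)) = W A lev t0 s"
 using winv_nx(2)[OF _ winv_W] by (simp add: W_Suc)

lemma W_final_stays: "fst (W A lev t0 s) = Btw G ==> s \<le> s' ==> W A lev t0 s' = W A lev t0 s"
 by (induction s' rule: nat_induct) (auto simp: W_Suc nx_final le_Suc_eq)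

lemma W_not_final_mono: "fst (W A lev t0 s') \<noteq> Btw G ==> s \<le> s' ==> fst (W A lev t0 s) \<noteq> Btw G"
 using W_final_stays by metis

lemma nx_not_init: "winv A lev t0 s ==> fst s \<noteq> Btw G ==> fst (nx A lev s) \<noteq> Btw 0"
 by (cases s; cases "fst s") (auto split: prod.splits)

lemma pv_iter_W:
 "length t0 = c ==> (\<And>s'. s' < s ==> fst (W A lev t0 s') \<noteq> Btw G) ==> j \<le> s ==>
  (pv A lev ^^ j) (W A lev t0 s) = W A lev t0 (s - j)"
proof (induction j)
 case (Suc j)
 then have "(pv A lev ^^ Suc j) (W A lev t0 s) = pv A lev (W A lev t0 (Suc (s - Suc j)))"
  by (simp add: Suc_diff_Suc)
 also have "\<dots> = W A lev t0 (s - Suc j)" using Suc.prems by (intro pv_W) auto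
 finally show ?case .
qed simp

lemma W_init_only:
 assumes "length t0 = c" "0 < s" "fst (W A lev t0 (s - 1)) \<noteq> Btw G"
 shows "fst (W A lev t0 s) \<noteq> Btw 0"
 using nx_not_init[OF winv_W[OF assms(1)] assms(3)] assms(2) W_Suc[of A lev t0 "s - 1"] by simp

text \<open>Walk both positions back together. The tour with fewer steps arrives at
  \<open>Btw 0\<close>, and the other one can be there only if it has no steps left either. So a
  position determines both the content at the start and the step number.\<close>

lemma W_joint_inj:
 assumes "length t = c" "length t' = c" "W A lev t s = W A lev t' s'"
  "\<And>i. i < s ==> fst (W A lev t i) \<noteq> Btw G" "\<And>i. i < s' ==> fst (W A lev t' i) \<noteq> Btw G"
 shows "t = t' \<and> s = s'"
proof -
 have *: "t = t' \<and> s = s'" if a: "length t = c" "length t' = c" "W A lev t s = W A lev t' s'"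
  "\<And>i. i < s ==> fst (W A lev t i) \<noteq> Btw G" "\<And>i. i < s' ==> fst (W A lev t' i) \<noteq> Btw G" "s \<le> s'" for t t' s s'
 proof -
  have e: "W A lev t' (s' - s) = (Btw 0, t)"
   using pv_iter_W[OF a(1,4), of s s] pv_iter_W[OF a(2,5), of s' s] a(3,6) by simp
  show ?thesis
  proof (cases "s = s'")
   case False
   then show ?thesis using W_init_only[OF a(2), of "s' - s" A lev] a(5)[of "s' - s - 1"] a(6) e by auto
  qed (use e in simp)
 qed
 show ?thesis using *[of t t' s s'] *[of t' t s' s] assms by (cases "s \<le> s'") auto
qed

lemma node_nf: "W A lev t0 s = (Nd g u k, t) ==> i \<le> s ==> fst (W A lev t0 i) \<noteq> Btw G"
 using W_final_stays[of A lev t0 i s] by (metis fst_conv wst.distinct(1))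

lemma W_back:
 assumes "length t0 = c" "W A lev t0 s = (Nd g u k, t)"
 shows "0 < s" "W A lev t0 (s - 1) = pv A lev (Nd g u k, t)" "length t = c"
proof -
 show s: "0 < s" using assms(2) by (cases s) auto
 have "fst (W A lev t0 (s - 1)) \<noteq> Btw G"
  using node_nf[OF assms(2)] by simp
 then show "W A lev t0 (s - 1) = pv A lev (Nd g u k, t)"
  using pv_W[OF assms(1), of A lev "s - 1"] s assms(2) by simp
 have i: "g < G" "(u, t) \<in> lead (sd A (yg g)) lev (eg g, t0)" using winv_W[OF assms(1), of A lev s] assms(2) by auto
 show "length t = c" using lead_bounds[OF i(2)] eg_less[OF i(1)] assms(1) by simp
qed

text \<open>Read backwards from the moment when a node is left. The preceding position either is the
  same node with a smaller child number, or is the exit of a child, which was entered from that very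
  number.\<close>

lemma exit_all:
 assumes "length t0 = c"
 shows "W A lev t0 s = (Nd g u (2 * Q), t) ==> k \<le> 2 * Q ==> \<exists>s'\<le>s. W A lev t0 s' = (Nd g u k, t)"
proof (induction s arbitrary: g u t k rule: less_induct)
 case (less s)
 have "\<exists>s'\<le>s. W A lev t0 s' = (Nd g u (2 * Q - j), t)" for j
 proof (induction j)
  case 0
  then show ?case using less.prems(1) by auto
 next
  case (Suc j)
  then obtain s' where s': "s' \<le> s" "W A lev t0 s' = (Nd g u (2 * Q - j), t)" by blast
  show ?case
  proof (cases "2 * Q - j")
   case 0
   then show ?thesis using s' by auto
  next
   case (Suc k')
   then have k': "2 * Q - Suc j = k'" by simp
   note b = W_back[OF assms s'(2)]
   show ?thesis
   proof (cases "val A lev g u k' t")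
    case False
    then have "W A lev t0 (s' - 1) = (Nd g u k', t)" using b(2) Suc by simp
    then show ?thesis using s'(1) k' by (intro exI[of _ "s' - 1"]) auto
   next
    case True
    let ?tc = "t[hp (k' div 2) := odd k']"
    have 1: "W A lev t0 (s' - 1) = (Nd g (k' div 2) (2 * Q), ?tc)" using b(2) Suc True by simp
    \<comment> \<open>The child was left strictly earlier, so the induction on time covers its whole
      stay back to its entry.\<close>
    have "s' - 1 < s" using b(1) s'(1) by simp
    from less.IH[OF this 1, of 0] obtain s'' where s'': "s'' \<le> s' - 1" "W A lev t0 s'' = (Nd g (k' div 2) 0, ?tc)" by auto
    note c = W_back[OF assms s''(2)]
    have "2 * (k' div 2) + of_bool (odd k') = k'" by (cases "odd k'") auto
    moreover have "hl (k' div 2) = 0" using True by (simp add: val_def)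
    ultimately have "W A lev t0 (s'' - 1) = (Nd g u k', t)"
     using c(2) val_child[OF True b(3)] by simp
    then show ?thesis using s'(1) s''(1) k' by (intro exI[of _ "s'' - 1"]) auto
   qed
  qed
 qed
 from this[of "2 * Q - k"] show ?case using less.prems(2) by simp
qed

definition fin :: "(nat \<Rightarrow> nat) \<Rightarrow> nat \<Rightarrow> bool list \<Rightarrow> nat \<Rightarrow> bool" where
 "fin A lev t0 B \<longleftrightarrow> (\<exists>s\<le>B. fst (W A lev t0 s) = Btw G)"

lemma fin_first:
 assumes "fin A lev t0 B" "length t0 = c"
 obtains sf where "sf \<le> B" "W A lev t0 sf = (Btw G, t0)" "\<And>i. i < sf ==> fst (W A lev t0 i) \<noteq> Btw G"
proof -
 define sf where "sf = (LEAST s. fst (W A lev t0 s) = Btw G)"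
 obtain s where s: "s \<le> B" "fst (W A lev t0 s) = Btw G" using assms(1) by (auto simp: fin_def)
 have 1: "fst (W A lev t0 sf) = Btw G" unfolding sf_def using s(2) by (rule LeastI)
 then have "W A lev t0 sf = (Btw G, t0)" using winv_W[OF assms(2), of A lev sf] by (cases "W A lev t0 sf") auto
 moreover have "sf \<le> B" using Least_le[of "\<lambda>s. fst (W A lev t0 s) = Btw G" s] s unfolding sf_def by simp
 moreover have "fst (W A lev t0 i) \<noteq> Btw G" if "i < sf" for i using not_less_Least that unfolding sf_def by blast
 ultimately show ?thesis using that by blast
qed

text \<open>Argued backwards from the final position: every root has been left; a node that has been
  left had all child numbers tried; so each of its children has been left as well. Induction along
  the run to the root then reaches every node.\<close>

lemma lead_visited:
 assumes "fin A lev t0 B" "length t0 = c" "g < G" "hl (eg g) \<noteq> 0" "v \<in> lead (sd A (yg g)) lev (eg g, t0)"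
 shows "\<exists>s<B. W A lev t0 s = (Nd g (fst v) 0, snd v)"
proof -
 obtain sf where sf: "sf \<le> B" "W A lev t0 sf = (Btw G, t0)" "\<And>i. i < sf ==> fst (W A lev t0 i) \<noteq> Btw G"
  using fin_first[OF assms(1,2)] by blast
 define vis where "vis w \<longleftrightarrow> (\<exists>s\<le>sf. W A lev t0 s = w)" for w
 have visI: "vis (W A lev t0 s)" if "s \<le> sf" for s using that by (auto simp: vis_def)
 have bk: "vis (pv A lev (Btw (Suc g), t0))" if v: "vis (Btw (Suc g), t0)" for g
 proof -
  obtain s where s: "s \<le> sf" "W A lev t0 s = (Btw (Suc g), t0)" using v by (auto simp: vis_def)
  have "0 < s" using s(2) by (cases s) auto
  then have "W A lev t0 (s - 1) = pv A lev (Btw (Suc g), t0)"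
   using pv_W[OF assms(2), of A lev "s - 1"] sf(3)[of "s - 1"] s by simp
  then show ?thesis using visI[of "s - 1"] s(1) by simp
 qed
 have nback: "vis (pv A lev (Nd g u k, t)) \<and> length t = c" if v: "vis (Nd g u k, t)" for g u k t
 proof -
  obtain s where s: "s \<le> sf" "W A lev t0 s = (Nd g u k, t)" using v by (auto simp: vis_def)
  show ?thesis using W_back[OF assms(2) s(2)] visI[of "s - 1"] s(1) by simp
 qed
 have ex: "vis (Nd g u k, t)" if v: "vis (Nd g u (2 * Q), t)" and k: "k \<le> 2 * Q" for g u k t
 proof -
  obtain s where s: "s \<le> sf" "W A lev t0 s = (Nd g u (2 * Q), t)" using v by (auto simp: vis_def)
  obtain s' where "s' \<le> s" "W A lev t0 s' = (Nd g u k, t)" using exit_all[OF assms(2) s(2) k] by blast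
  then show ?thesis using visI[of s'] s(1) by simp
 qed
 have root: "vis (Nd g (eg g) (2 * Q), t0)" if "vis (Btw (Suc g), t0)" "hl (eg g) \<noteq> 0" for g
  using bk[OF that(1)] that(2) by simp
 have btw: "vis (Btw g, t0)" if "vis (Btw (Suc g), t0)" for g
 proof (cases "hl (eg g) = 0")
  case True
  then show ?thesis using bk[OF that] by simp
 next
  case False
  have "vis (Nd g (eg g) 0, t0)" using ex[OF root[OF that False], of 0] by simp
  from nback[OF this] show ?thesis using False by simp
 qed
 have down: "j \<le> G ==> vis (Btw (G - j), t0)" for j
 proof (induction j)
  case 0
  then show ?case using sf(2) visI[of sf] by simp
 next
  case (Suc j)
  have "G - j = Suc (G - Suc j)" using Suc.prems by simp
  then show ?case using btw[of "G - Suc j"] Suc by simp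
 qed
 have "G - (G - Suc g) = Suc g" using assms(3) by simp
 then have "vis (Btw (Suc g), t0)" using down[of "G - Suc g"] by simp
 then have r: "vis (Nd g (eg g) (2 * Q), t0)" using root assms(4) by simp
 have "vis (Nd g (fst v) (2 * Q), snd v)"
  using assms(5)
 proof (induction rule: lead.induct)
  case lead_root
  then show ?case using r by simp
 next
  case (lead_step u t)
  obtain u' t' where n: "nxt (sd A (yg g)) (u, t) = (u', t')" by fastforce
  have v': "vis (Nd g u' (2 * Q), t')" using lead_step.IH n by simp
  have "oc u t \<le> 1" by (simp add: oc_def)
  then have "Suc (2 * u + oc u t) \<le> 2 * Q" using lead_step.hyps by linarith
  from nback[OF ex[OF v' this]] have "vis (pv A lev (Nd g u' (Suc (2 * u + oc u t)), t'))" by simp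
  moreover note p = val_parent[OF n lead_step.hyps(2,5,4)]
  have d: "(2 * u + oc u t) div 2 = u" "odd (2 * u + oc u t) = odd (oc u t)" by (auto simp: oc_def)
  have "pv A lev (Nd g u' (Suc (2 * u + oc u t)), t') = (Nd g u (2 * Q), t)"
   unfolding pv.simps diff_Suc_1 d p(2) using p(1) by simp
  ultimately show ?case by simp
 qed
 from ex[OF this, of 0] obtain s where s: "s \<le> sf" "W A lev t0 s = (Nd g (fst v) 0, snd v)" by (auto simp: vis_def)
 have "s \<noteq> sf" using s sf(2) by auto
 then show ?thesis using s sf(1) by (intro exI[of _ s]) auto
qed

lemma W_node_inj:
 assumes "length t0 = c" "W A lev t0 s = (Nd g u k, t)" "W A lev t0 s' = (Nd g u k, t)"
 shows "s = s'"
proof -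
 have "W A lev t0 s = W A lev t0 s'" using assms by simp
 from W_joint_inj[OF assms(1,1) this] node_nf[OF assms(2)] node_nf[OF assms(3)]
 show ?thesis by (meson less_imp_le)
qed

section \<open>Classes of seeds and balanced rows\<close>

definition Y :: "(nat \<Rightarrow> nat) \<Rightarrow> nat \<Rightarrow> bool list \<Rightarrow> nat \<Rightarrow> nat \<times> bool list \<Rightarrow> nat set" where
 "Y A lev t0 e v = {y. y < 2 ^ b \<and> v \<in> lead (sd A y) lev (e, t0)}"

text \<open>The times at which the tour enters the node \<open>v\<close> in trees with root state
  \<open>e\<close>. Once a tour finishes within \<open>B\<close> steps, each seed of the class
  contributes one time, so seeds are counted by watching the tour.\<close>

definition cls :: "(nat \<Rightarrow> nat) \<Rightarrow> nat \<Rightarrow> bool list \<Rightarrow> nat \<Rightarrow> nat \<Rightarrow> nat \<times> bool list \<Rightarrow> (nat \<Rightarrow> bool) \<Rightarrow> nat set" where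
 "cls A lev t0 B e v P = {s. s < B \<and> (\<exists>g. W A lev t0 s = (Nd g (fst v) 0, snd v) \<and> eg g = e \<and> P (yg g))}"

lemma eg_yg: "eg g * 2 ^ b + yg g = g"
 unfolding eg_def yg_def by (rule div_mult_mod_eq)

lemma card_cls:
 assumes "fin A lev t0 B" "length t0 = c" "e < Q" "hl e \<noteq> 0"
 shows "card (cls A lev t0 B e v P) = card {y\<in>Y A lev t0 e v. P y}"
proof (rule bij_betw_same_card)
 define f where "f s = (case fst (W A lev t0 s) of Nd g _ _ \<Rightarrow> yg g | Btw _ \<Rightarrow> 0)" for s
 show "bij_betw f (cls A lev t0 B e v P) {y\<in>Y A lev t0 e v. P y}"
  unfolding bij_betw_def
 proof
  show "inj_on f (cls A lev t0 B e v P)"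
  proof (rule inj_onI)
   fix s s' assume a: "s \<in> cls A lev t0 B e v P" "s' \<in> cls A lev t0 B e v P" "f s = f s'"
   obtain g g' where g: "W A lev t0 s = (Nd g (fst v) 0, snd v)" "eg g = e" "W A lev t0 s' = (Nd g' (fst v) 0, snd v)" "eg g' = e"
    using a(1,2) by (auto simp: cls_def)
   then have "yg g = yg g'" using a(3) by (simp add: f_def)
   then have "g = g'" using g eg_yg[of g] eg_yg[of g'] by simp
   then show "s = s'" using W_node_inj[OF assms(2)] g by blast
  qed
  show "f ` cls A lev t0 B e v P = {y\<in>Y A lev t0 e v. P y}"
  proof (intro set_eqI iffI)
   fix y assume "y \<in> f ` cls A lev t0 B e v P"
   then obtain s g where s: "W A lev t0 s = (Nd g (fst v) 0, snd v)" "eg g = e" "P (yg g)" "y = yg g"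
    by (auto simp: cls_def f_def)
   then show "y \<in> {y\<in>Y A lev t0 e v. P y}"
    using winv_W[OF assms(2), of A lev s] by (auto simp: Y_def yg_def)
  next
   fix y assume y: "y \<in> {y\<in>Y A lev t0 e v. P y}"
   let ?g = "e * 2 ^ b + y"
   have yb: "y < 2 ^ b" using y by (simp add: Y_def)
   have e: "eg ?g = e" "yg ?g = y" using yb by (auto simp: eg_def yg_def)
   have "?g < (e + 1) * 2 ^ b" using yb by simp
   also have "\<dots> \<le> Q * 2 ^ b" using assms(3) by (intro mult_le_mono1) simp
   finally have "?g < G" by (simp add: G_def)
   then obtain s where "s < B" "W A lev t0 s = (Nd ?g (fst v) 0, snd v)"
    using lead_visited[OF assms(1,2), of ?g v] e y assms(4) by (auto simp: Y_def)
   then have "s \<in> cls A lev t0 B e v P" "f s = y" using e y by (auto simp: cls_def f_def)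
   then show "y \<in> f ` cls A lev t0 B e v P" by blast
  qed
 qed
qed

text \<open>Stated in terms of times instead of seeds, because these are the numbers that a program
  can count even when the tour is not over.\<close>

definition bad :: "(nat \<Rightarrow> nat) \<Rightarrow> nat \<Rightarrow> bool list \<Rightarrow> nat \<Rightarrow> nat \<Rightarrow> nat \<Rightarrow> bool" where
 "bad A lev t0 B D a \<longleftrightarrow> (\<exists>s<B. \<exists>g u t. W A lev t0 s = (Nd g u 0, t) \<and>
   (card (cls A lev t0 B (eg g) (u, t) (\<lambda>y. ip b a y)) + 2 * D < card (cls A lev t0 B (eg g) (u, t) (\<lambda>y. \<not> ip b a y)) \<or>
   card (cls A lev t0 B (eg g) (u, t) (\<lambda>y. \<not> ip b a y)) + 2 * D < card (cls A lev t0 B (eg g) (u, t) (\<lambda>y. ip b a y))))"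

lemma Y_sub: "Y A lev t0 e v \<subseteq> {..<2 ^ b}"
 by (auto simp: Y_def)

lemma finite_Y: "finite (Y A lev t0 e v)"
 by (rule finite_subset[OF Y_sub]) simp

text \<open>Distinct classes occupy disjoint sets of times, so the class sizes add up to at most
  \<open>B\<close>. By the second moment the squared imbalances, summed over all rows and classes,
  are at most \<open>2 ^ b * B\<close>, and each bad row contributes at least
  \<open>4 * D\<^sup>2\<close>.\<close>

lemma bad_count:
 assumes "fin A lev t0 B" "length t0 = c"
 shows "card {a. a < 2 ^ b \<and> bad A lev t0 B D a} * (4 * D\<^sup>2) \<le> 2 ^ b * B"
proof -
 define K where "K = {(eg g, u, t) |s g u t. s < B \<and> W A lev t0 s = (Nd g u 0, t)}"
 define X where "X a \<kappa> = (\<Sum>y\<in>Y A lev t0 (fst \<kappa>) (snd \<kappa>). chi b a y)" for a \<kappa>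
 have K_sub: "K \<subseteq> (\<lambda>s. case W A lev t0 s of (Nd g u k, t) \<Rightarrow> (eg g, u, t) | _ \<Rightarrow> (0, 0, [])) ` {..<B}"
 proof
  fix \<kappa> assume "\<kappa> \<in> K"
  then obtain s g u t where "\<kappa> = (eg g, u, t)" "s < B" "W A lev t0 s = (Nd g u 0, t)" unfolding K_def by blast
  then show "\<kappa> \<in> (\<lambda>s. case W A lev t0 s of (Nd g u k, t) \<Rightarrow> (eg g, u, t) | _ \<Rightarrow> (0, 0, [])) ` {..<B}"
   by (intro image_eqI[of _ _ s]) simp_all
 qed
 then have fK: "finite K" by (rule finite_subset) simp
 have Kok: "fst \<kappa> < Q \<and> hl (fst \<kappa>) \<noteq> 0" if \<kappa>: "\<kappa> \<in> K" for \<kappa>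
 proof -
  obtain s g u t where "\<kappa> = (eg g, u, t)" "W A lev t0 s = (Nd g u 0, t)" using \<kappa> by (auto simp: K_def)
  then show ?thesis using winv_W[OF assms(2), of A lev s] eg_less by auto
 qed
 let ?C = "\<lambda>\<kappa>. cls A lev t0 B (fst \<kappa>) (snd \<kappa>) (\<lambda>_. True)"
 have cC: "card (?C \<kappa>) = card (Y A lev t0 (fst \<kappa>) (snd \<kappa>))" if "\<kappa> \<in> K" for \<kappa>
  using card_cls[OF assms, of "fst \<kappa>" "snd \<kappa>" "\<lambda>_. True"] Kok[OF that] by simp
 have "(\<Sum>\<kappa>\<in>K. card (?C \<kappa>)) = card (\<Union>\<kappa>\<in>K. ?C \<kappa>)"
 proof (rule card_UN_disjoint[symmetric])
  have "i = j" if si: "s \<in> ?C i" "s \<in> ?C j" for s i j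
  proof -
   obtain g g' where "W A lev t0 s = (Nd g (fst (snd i)) 0, snd (snd i))" "eg g = fst i"
    "W A lev t0 s = (Nd g' (fst (snd j)) 0, snd (snd j))" "eg g' = fst j"
    using si unfolding cls_def by blast
   then show "i = j" by (intro prod_eqI) simp_all
  qed
  then show "\<forall>i\<in>K. \<forall>j\<in>K. i \<noteq> j \<longrightarrow> ?C i \<inter> ?C j = {}" by blast
  show "\<forall>i\<in>K. finite (?C i)" by (auto simp: cls_def)
 qed (use fK in auto)
 also have "\<dots> \<le> card {..<B}" by (intro card_mono) (auto simp: cls_def)
 finally have sumY: "(\<Sum>\<kappa>\<in>K. card (Y A lev t0 (fst \<kappa>) (snd \<kappa>))) \<le> B" using cC by simp
 have badX: "4 * (int D)\<^sup>2 \<le> (\<Sum>\<kappa>\<in>K. (X a \<kappa>)\<^sup>2)" if ba: "bad A lev t0 B D a" for a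
 proof -
  obtain s g u t where s: "s < B" "W A lev t0 s = (Nd g u 0, t)" and
   n: "card (cls A lev t0 B (eg g) (u, t) (\<lambda>y. ip b a y)) + 2 * D < card (cls A lev t0 B (eg g) (u, t) (\<lambda>y. \<not> ip b a y)) \<or>
   card (cls A lev t0 B (eg g) (u, t) (\<lambda>y. \<not> ip b a y)) + 2 * D < card (cls A lev t0 B (eg g) (u, t) (\<lambda>y. ip b a y))"
   using ba unfolding bad_def by blast
  let ?k = "(eg g, u, t)"
  have k: "?k \<in> K" using s by (auto simp: K_def)
  have "X a ?k = int (card {y\<in>Y A lev t0 (eg g) (u, t). \<not> ip b a y}) - int (card {y\<in>Y A lev t0 (eg g) (u, t). ip b a y})"
   unfolding X_def by (simp add: sum_chi finite_Y)
  moreover have c: "card (cls A lev t0 B (eg g) (u, t) Z) = card {y\<in>Y A lev t0 (eg g) (u, t). Z y}" for Z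
   using card_cls[OF assms] Kok[OF k] by simp
  ultimately have "2 * int D \<le> \<bar>X a ?k\<bar>" using n unfolding c by linarith
  then have "\<bar>2 * int D\<bar> \<le> \<bar>X a ?k\<bar>" by simp
  then have "(2 * int D)\<^sup>2 \<le> (X a ?k)\<^sup>2" by (simp only: abs_le_square_iff)
  also have "\<dots> \<le> (\<Sum>\<kappa>\<in>K. (X a \<kappa>)\<^sup>2)" using k fK by (intro member_le_sum) auto
  finally show ?thesis by (simp add: power_mult_distrib)
 qed
 let ?S = "{a. a < 2 ^ b \<and> bad A lev t0 B D a}"
 have "int (card ?S) * (4 * (int D)\<^sup>2) = (\<Sum>a\<in>?S. 4 * (int D)\<^sup>2)" by simp
 also have "\<dots> \<le> (\<Sum>a\<in>?S. \<Sum>\<kappa>\<in>K. (X a \<kappa>)\<^sup>2)" using badX by (intro sum_mono) auto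
 also have "\<dots> \<le> (\<Sum>a<2 ^ b. \<Sum>\<kappa>\<in>K. (X a \<kappa>)\<^sup>2)" by (intro sum_mono2) (auto intro: sum_nonneg)
 also have "\<dots> = (\<Sum>\<kappa>\<in>K. \<Sum>a<2 ^ b. (X a \<kappa>)\<^sup>2)" by (rule sum.swap)
 also have "\<dots> = (\<Sum>\<kappa>\<in>K. 2 ^ b * int (card (Y A lev t0 (fst \<kappa>) (snd \<kappa>))))"
  unfolding X_def using chi_second_moment[OF Y_sub] by simp
 also have "\<dots> = 2 ^ b * int (\<Sum>\<kappa>\<in>K. card (Y A lev t0 (fst \<kappa>) (snd \<kappa>)))" by (simp add: sum_distrib_left)
 also have "\<dots> \<le> 2 ^ b * int B" using sumY by (simp add: mult_left_mono del: of_nat_sum)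
 finally have "int (card ?S * (4 * D\<^sup>2)) \<le> int (2 ^ b * B)" by simp
 then show ?thesis by (simp only: of_nat_le_iff)
qed

text \<open>\<open>bad\<close> only speaks of classes met by the tour. The remaining ones are empty,
  since a finished tour meets every node of every tree.\<close>

lemma good_balance:
 assumes "fin A lev t0 B" "length t0 = c" "e < Q" "hl e \<noteq> 0" "\<not> bad A lev t0 B D a"
 shows "card {y\<in>Y A lev t0 e v. \<not> ip b a y} \<le> card {y\<in>Y A lev t0 e v. ip b a y} + 2 * D"
  "card {y\<in>Y A lev t0 e v. ip b a y} \<le> card {y\<in>Y A lev t0 e v. \<not> ip b a y} + 2 * D"
proof -
 have "card {y\<in>Y A lev t0 e v. \<not> ip b a y} \<le> card {y\<in>Y A lev t0 e v. ip b a y} + 2 * D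
  \<and> card {y\<in>Y A lev t0 e v. ip b a y} \<le> card {y\<in>Y A lev t0 e v. \<not> ip b a y} + 2 * D"
 proof (cases "Y A lev t0 e v = {}")
  case False
  then have "card {y\<in>Y A lev t0 e v. True} \<noteq> 0" using finite_Y by simp
  then have "cls A lev t0 B e v (\<lambda>_. True) \<noteq> {}" using card_cls[OF assms(1-4), of v "\<lambda>_. True"] by fastforce
  then obtain s g where s: "s < B" "W A lev t0 s = (Nd g (fst v) 0, snd v)" "eg g = e" by (auto simp: cls_def)
  let ?n1 = "card (cls A lev t0 B e v (\<lambda>y. ip b a y))" let ?n0 = "card (cls A lev t0 B e v (\<lambda>y. \<not> ip b a y))"
  have "bad A lev t0 B D a" if "?n1 + 2 * D < ?n0 \<or> ?n0 + 2 * D < ?n1"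
   unfolding bad_def using s that by (intro exI[of _ s] exI[of _ g] exI[of _ "fst v"] exI[of _ "snd v"] conjI) simp_all
  then have "\<not> (?n1 + 2 * D < ?n0 \<or> ?n0 + 2 * D < ?n1)" using assms(5) by blast
  then show ?thesis unfolding card_cls[OF assms(1-4)] by linarith
 qed simp
 then show "card {y\<in>Y A lev t0 e v. \<not> ip b a y} \<le> card {y\<in>Y A lev t0 e v. ip b a y} + 2 * D"
  "card {y\<in>Y A lev t0 e v. ip b a y} \<le> card {y\<in>Y A lev t0 e v. \<not> ip b a y} + 2 * D" by auto
qed

section \<open>The hybrid argument\<close>

text \<open>The list supplies the bits from position \<open>j\<close> on. The earlier positions get
  a default that runs starting at level \<open>j\<close> never consult.\<close>

definition sh :: "nat \<Rightarrow> bool list \<Rightarrow> nat \<Rightarrow> bool" where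
 "sh j l i = (j \<le> i \<and> i - j < length l \<and> l ! (i - j))"

text \<open>The hybrid at \<open>j\<close>: the probability, over independent bits from position
  \<open>j\<close> on, that the run from \<open>v\<close> ends in \<open>r\<close>.\<close>

definition P :: "nat \<Rightarrow> nat \<times> bool list \<Rightarrow> nat \<times> bool list \<Rightarrow> real" where
 "P j r v = real (card {l. length l = R - j \<and> v \<in> lead (sh j l) 0 r}) / 2 ^ (R - j)"

text \<open>With the bit at position j fixed, the run from a node of level at least j passes through
 one particular node of level above j (or its root), whatever the later bits are.\<close>

lemma lead_exit:
 assumes "v \<in> lead f0 0 r" "f0 j = d" "v = r \<or> j \<le> rp (fst v)" "hl (fst r) \<noteq> 0"
 shows "\<exists>w. (w = r \<or> Suc j \<le> rp (fst w)) \<and> (\<forall>f. f j = d \<longrightarrow> (v \<in> lead f 0 r \<longleftrightarrow> w \<in> lead f 0 r))"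
 using assms
proof (induction rule: lead.induct)
 case (lead_step u t)
 show ?case
 proof (cases "(u, t) = r \<or> Suc j \<le> rp u")
  case True
  then show ?thesis by (intro exI[of _ "(u, t)"]) auto
 next
  case False
  then have j: "rp u = j" using lead_step.prems by auto
  have n: "nxt f (u, t) = nxt f0 (u, t)" if "f j = d" for f using that lead_step.prems(1) j by (simp add: nxt_def)
  have "j \<le> rp (fst (nxt f0 (u, t)))" using rp_nxt[OF lead_step.hyps(2), of f0 t] j by simp
  then obtain w where w: "w = r \<or> Suc j \<le> rp (fst w)" "\<And>f. f j = d ==> (nxt f0 (u, t) \<in> lead f 0 r \<longleftrightarrow> w \<in> lead f 0 r)"
   using lead_step.IH lead_step.prems by blast
  have "(u, t) \<in> lead f 0 r \<longleftrightarrow> w \<in> lead f 0 r" if f: "f j = d" for f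
  proof -
   have "(u, t) \<in> lead f 0 r \<longleftrightarrow> nxt f (u, t) \<in> lead f 0 r"
    using lead_nonhalted[of u t f 0 r] lead_step.hyps(2-4) lead_step.prems(3) lead.lead_step[of f u t 0 r] by blast
   then show ?thesis using n[of f, OF f] w(2)[of f, OF f] by simp
  qed
  then show ?thesis using w(1) by blast
 qed
qed (intro exI[of _ r], simp)

lemma card_lists_Cons:
 "card {l. length l = Suc m \<and> X l} = card {l. length l = m \<and> X (False # l)} + card {l. length l = m \<and> X (True # l)}"
proof -
 have fin: "finite {l. length l = m \<and> Z l}" for Z :: "bool list \<Rightarrow> bool"
  by (rule finite_subset[OF _ finite_lists_length_eq[of "UNIV :: bool set" m]]) auto
 have "{l. length l = Suc m \<and> X l} = Cons False ` {l. length l = m \<and> X (False # l)} \<union> Cons True ` {l. length l = m \<and> X (True # l)}"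
 proof (intro set_eqI)
  fix l show "l \<in> {l. length l = Suc m \<and> X l} \<longleftrightarrow> l \<in> Cons False ` {l. length l = m \<and> X (False # l)} \<union> Cons True ` {l. length l = m \<and> X (True # l)}"
   by (cases l; cases "hd l") (auto simp: image_iff)
 qed
 moreover have "card (Cons False ` {l. length l = m \<and> X (False # l)} \<union> Cons True ` {l. length l = m \<and> X (True # l)})
   = card (Cons False ` {l. length l = m \<and> X (False # l)}) + card (Cons True ` {l. length l = m \<and> X (True # l)})"
  using fin by (intro card_Un_disjoint) auto
 ultimately show ?thesis by (simp add: card_image)
qed

text \<open>Conditioning on bit \<open>j\<close>. The flags \<open>E0\<close> and \<open>E1\<close>
  provide for the case that with this value of the bit no choice of the others leads from
  \<open>v\<close> to \<open>r\<close>; then that half contributes nothing.\<close>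

lemma P_step:
 assumes "j < R" "hl (fst r) \<noteq> 0"
  "w0 = r \<or> Suc j \<le> rp (fst w0)" "\<And>f. \<not> f j ==> v \<in> lead f 0 r \<longleftrightarrow> E0 \<and> w0 \<in> lead f 0 r"
  "w1 = r \<or> Suc j \<le> rp (fst w1)" "\<And>f. f j ==> v \<in> lead f 0 r \<longleftrightarrow> E1 \<and> w1 \<in> lead f 0 r"
 shows "P j r v = (of_bool E0 * P (Suc j) r w0 + of_bool E1 * P (Suc j) r w1) / 2"
proof -
 have Rj: "R - j = Suc (R - Suc j)" using assms(1) by simp
 have sh0: "sh j (d # l) j = d" for d l by (simp add: sh_def)
 have shS: "sh j (d # l) i = sh (Suc j) l i" if "Suc j \<le> i" for d l i
 proof -
  have "i - j = Suc (i - Suc j)" using that by simp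
  then show ?thesis using that by (simp add: sh_def)
 qed
 have dep: "w \<in> lead (sh j (d # l)) 0 r \<longleftrightarrow> w \<in> lead (sh (Suc j) l) 0 r" if "w = r \<or> Suc j \<le> rp (fst w)" for w d l
 proof -
  have "w \<in> lead (sh j (d # l)) 0 r \<longleftrightarrow> w \<in> lead (sh j (d # l)) (Suc j) r"
   by (rule lead_lev_iff[OF that])
  also have "\<dots> \<longleftrightarrow> w \<in> lead (sh (Suc j) l) (Suc j) r"
   by (rule lead_dep_iff) (rule shS)
  also have "\<dots> \<longleftrightarrow> w \<in> lead (sh (Suc j) l) 0 r"
   by (rule lead_lev_iff[OF that, symmetric])
  finally show ?thesis .
 qed
 have 0: "v \<in> lead (sh j (False # l)) 0 r \<longleftrightarrow> E0 \<and> w0 \<in> lead (sh (Suc j) l) 0 r" for l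
  using assms(4)[of "sh j (False # l)"] sh0[of False l] dep[OF assms(3)] by simp
 have 1: "v \<in> lead (sh j (True # l)) 0 r \<longleftrightarrow> E1 \<and> w1 \<in> lead (sh (Suc j) l) 0 r" for l
  using assms(6)[of "sh j (True # l)"] sh0[of True l] dep[OF assms(5)] by simp
 show ?thesis unfolding P_def Rj card_lists_Cons 0 1
  by (cases E0; cases E1) (simp_all add: field_simps)
qed

text \<open>Induction on the number of random bits left. The exit nodes for bit \<open>j\<close>
  have seed classes that depend on later rows only, and row \<open>j\<close>, not being bad at level
  \<open>Suc j\<close>, halves each of these classes up to \<open>D\<close>. The errors inherited by
  the two halves are halved too and add up to a single one, so each bit costs just
  \<open>2 * D\<close>.\<close>

lemma Y_approx:
 assumes tl: "length t0 = c" and e: "e < Q" "hl e \<noteq> 0"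
  and fn: "\<And>j. j < R ==> fin A (Suc j) t0 B" and nb: "\<And>j. j < R ==> \<not> bad A (Suc j) t0 B D (A j)"
 shows "j \<le> R ==> v = (e, t0) \<or> j \<le> rp (fst v) ==>
  \<bar>real (card (Y A 0 t0 e v)) - 2 ^ b * P j (e, t0) v\<bar> \<le> real (R - j) * (2 * real D)"
proof (induction "R - j" arbitrary: j v)
 case 0
 then have j: "j = R" by simp
 let ?r = "(e, t0)"
 \<comment> \<open>From position \<open>R\<close> on, both the seeded and the independent source
   give \<open>False\<close>.\<close>
 have dep: "v \<in> lead (sd A y) 0 ?r \<longleftrightarrow> v \<in> lead (sh R []) 0 ?r" for y
 proof -
  have v: "v = ?r \<or> R \<le> rp (fst v)" using 0(3) j by simp
  have "v \<in> lead (sd A y) 0 ?r \<longleftrightarrow> v \<in> lead (sd A y) R ?r" by (rule lead_lev_iff[OF v])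
  also have "\<dots> \<longleftrightarrow> v \<in> lead (sh R []) R ?r" by (rule lead_dep_iff) (simp add: sd_def sh_def)
  also have "\<dots> \<longleftrightarrow> v \<in> lead (sh R []) 0 ?r" by (rule lead_lev_iff[OF v, symmetric])
  finally show ?thesis .
 qed
 have "card (Y A 0 t0 e v) = (if v \<in> lead (sh R []) 0 ?r then 2 ^ b else 0)"
  unfolding Y_def dep by simp
 moreover have "P R ?r v = of_bool (v \<in> lead (sh R []) 0 ?r)"
 proof -
  have "{l. length l = R - R \<and> v \<in> lead (sh R l) 0 ?r} = (if v \<in> lead (sh R []) 0 ?r then {[]} else {})" by auto
  then show ?thesis by (simp add: P_def)
 qed
 ultimately show ?case using j by simp
next
 case (Suc m)
 let ?r = "(e, t0)"
 have jR: "j < R" and m: "m = R - Suc j" using Suc.hyps(2) by auto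
 have hr: "hl (fst ?r) \<noteq> 0" using e by simp
 have exits: "\<exists>w E. (w = ?r \<or> Suc j \<le> rp (fst w)) \<and> (\<forall>f. f j = d \<longrightarrow> (v \<in> lead f 0 ?r \<longleftrightarrow> E \<and> w \<in> lead f 0 ?r))" for d
 proof (cases "\<exists>f0. f0 j = d \<and> v \<in> lead f0 0 ?r")
  case True
  then obtain f0 where "f0 j = d" "v \<in> lead f0 0 ?r" by blast
  then show ?thesis using lead_exit[of v f0 ?r j d] Suc.prems(2) hr by blast
 next
  case False
  then show ?thesis by blast
 qed
 obtain w0 E0 where w0: "w0 = ?r \<or> Suc j \<le> rp (fst w0)" "\<And>f. \<not> f j ==> v \<in> lead f 0 ?r \<longleftrightarrow> E0 \<and> w0 \<in> lead f 0 ?r"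
 proof -
  obtain w E where "w = ?r \<or> Suc j \<le> rp (fst w)" "\<forall>f. f j = False \<longrightarrow> (v \<in> lead f 0 ?r \<longleftrightarrow> E \<and> w \<in> lead f 0 ?r)"
   using exits by blast
  then show thesis using that[of w E] by simp
 qed
 obtain w1 E1 where w1: "w1 = ?r \<or> Suc j \<le> rp (fst w1)" "\<And>f. f j ==> v \<in> lead f 0 ?r \<longleftrightarrow> E1 \<and> w1 \<in> lead f 0 ?r"
 proof -
  obtain w E where "w = ?r \<or> Suc j \<le> rp (fst w)" "\<forall>f. f j = True \<longrightarrow> (v \<in> lead f 0 ?r \<longleftrightarrow> E \<and> w \<in> lead f 0 ?r)"
   using exits by blast
  then show thesis using that[of w E] by simp
 qed
 let ?Y = "\<lambda>w. Y A 0 t0 e w"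
 let ?i = "\<lambda>y. ip b (A j) y"
 have sdj: "sd A y j = ?i y" for y using jR by (simp add: sd_def)
 have Yv: "?Y v = {y\<in>?Y w0. E0 \<and> \<not> ?i y} \<union> {y\<in>?Y w1. E1 \<and> ?i y}"
 proof (rule set_eqI)
  fix y show "y \<in> ?Y v \<longleftrightarrow> y \<in> {y\<in>?Y w0. E0 \<and> \<not> ?i y} \<union> {y\<in>?Y w1. E1 \<and> ?i y}"
   using w0(2)[of "sd A y"] w1(2)[of "sd A y"] sdj[of y] by (cases "?i y") (auto simp: Y_def)
 qed
 have "card (?Y v) = card {y\<in>?Y w0. E0 \<and> \<not> ?i y} + card {y\<in>?Y w1. E1 \<and> ?i y}"
  unfolding Yv using finite_Y by (intro card_Un_disjoint) auto
 then have cv: "real (card (?Y v)) = of_bool E0 * real (card {y\<in>?Y w0. \<not> ?i y}) + of_bool E1 * real (card {y\<in>?Y w1. ?i y})"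
  by (cases E0; cases E1) auto
 have bal: "\<bar>real (card {y\<in>?Y w. \<not> ?i y}) - real (card (?Y w)) / 2\<bar> \<le> real D \<and> \<bar>real (card {y\<in>?Y w. ?i y}) - real (card (?Y w)) / 2\<bar> \<le> real D"
  if "w = ?r \<or> Suc j \<le> rp (fst w)" for w
 proof -
  \<comment> \<open>Runs from such a node stay on level \<open>Suc j\<close>, so the class for which
    the row is known to be balanced is the full class.\<close>
  have YY: "Y A (Suc j) t0 e w = ?Y w"
   unfolding Y_def using lead_lev_iff[OF that] by simp
  have "card ({y\<in>?Y w. \<not> ?i y} \<union> {y\<in>?Y w. ?i y}) = card {y\<in>?Y w. \<not> ?i y} + card {y\<in>?Y w. ?i y}"
   by (rule card_Un_disjoint) (use finite_Y in auto)
  moreover have "{y\<in>?Y w. \<not> ?i y} \<union> {y\<in>?Y w. ?i y} = ?Y w" by blast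
  ultimately have "card (?Y w) = card {y\<in>?Y w. \<not> ?i y} + card {y\<in>?Y w. ?i y}" by simp
  then show ?thesis using good_balance[OF fn[OF jR] tl e nb[OF jR], of w] unfolding YY by linarith
 qed
 have IH: "\<bar>real (card (?Y w)) - 2 ^ b * P (Suc j) ?r w\<bar> \<le> real (R - Suc j) * (2 * real D)"
  if "w = ?r \<or> Suc j \<le> rp (fst w)" for w
  using Suc.hyps(1)[OF m _ that] jR by simp
 have Pv: "P j ?r v = (of_bool E0 * P (Suc j) ?r w0 + of_bool E1 * P (Suc j) ?r w1) / 2"
  by (rule P_step[OF jR hr w0 w1])
 \<comment> \<open>Half of the inherited error plus the imbalance of row \<open>j\<close>.\<close>
 have one: "\<bar>of_bool E * X - 2 ^ b * (of_bool E * p / 2)\<bar> \<le> real (R - Suc j) * real D + real D"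
  if "\<bar>X - C / 2\<bar> \<le> real D" "\<bar>C - 2 ^ b * p\<bar> \<le> real (R - Suc j) * (2 * real D)" for E X C p
 proof (cases E)
  case True
  then show ?thesis using that by (simp add: abs_le_iff field_simps)
 qed simp
 have "\<bar>real (card (?Y v)) - 2 ^ b * P j ?r v\<bar> \<le> (real (R - Suc j) * real D + real D) + (real (R - Suc j) * real D + real D)"
  unfolding cv Pv
  using one[OF conjunct1[OF bal[OF w0(1)]] IH[OF w0(1)], of E0] one[OF conjunct2[OF bal[OF w1(1)]] IH[OF w1(1)], of E1]
  by (simp add: abs_le_iff field_simps)
 also have "\<dots> = real (R - j) * (2 * real D)"
 proof -
  have "real (R - j) = real (R - Suc j) + 1" using jR by simp
  then show ?thesis by (simp add: algebra_simps)
 qed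
 finally show ?case .
qed

end

section \<open>Bit fields and bounded search\<close>

definition getf :: "bool list \<Rightarrow> nat \<Rightarrow> nat \<Rightarrow> nat" where
 "getf z off w = (\<Sum>i<w. of_bool (z ! (off + i)) * 2 ^ i)"

definition setf :: "bool list \<Rightarrow> nat \<Rightarrow> nat \<Rightarrow> nat \<Rightarrow> bool list" where
 "setf z off w v = map (\<lambda>i. if off \<le> i \<and> i < off + w then bit v (i - off) else z ! i) [0..<length z]"

lemma length_setf [simp]: "length (setf z off w v) = length z"
 by (simp add: setf_def)

lemma nth_setf: "i < length z ==> setf z off w v ! i = (if off \<le> i \<and> i < off + w then bit v (i - off) else z ! i)"
 by (simp add: setf_def)

lemma getf_less: "getf z off w < 2 ^ w"
proof (induction w)
 case (Suc w)
 then show ?case by (simp add: getf_def)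
qed (simp add: getf_def)

lemma bit_getf: "bit (getf z off w) i \<longleftrightarrow> i < w \<and> z ! (off + i)"
proof (induction w arbitrary: i)
 case (Suc w)
 have 1: "getf z off (Suc w) = getf z off w + of_bool (z ! (off + w)) * 2 ^ w" by (simp add: getf_def)
 have t: "take_bit w (getf z off w) = getf z off w" using getf_less by (simp add: take_bit_nat_eq_self)
 show ?case
 proof (cases "z ! (off + w)")
  case True
  have "getf z off (Suc w) = set_bit w (getf z off w)"
  proof -
   have "\<not> bit (getf z off w) w" using Suc.IH[of w] by simp
   then show ?thesis using True 1 by (simp add: set_bit_eq)
  qed
  then show ?thesis using Suc True by (auto simp: bit_set_bit_iff less_Suc_eq)
 next
  case False
  then show ?thesis using Suc 1 by (auto simp: less_Suc_eq)
 qed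
qed (simp add: getf_def)

lemma getf_setf:
 assumes "off + w \<le> length z" "v < 2 ^ w"
 shows "getf (setf z off w v) off w = v"
proof (rule bit_eqI)
 fix i
 show "bit (getf (setf z off w v) off w) i = bit v i"
  using assms bit_less_pow[of v i w] by (auto simp: bit_getf nth_setf)
qed

lemma getf_cong: "(\<And>i. off \<le> i ==> i < off + w ==> z ! i = z' ! i) ==> getf z off w = getf z' off w"
 by (simp add: getf_def)

text \<open>The value grows only while it equals the number of candidates rejected so far, so it
  freezes at the first hit and is \<open>n\<close> if there is none. In this form the search is a
  limited recursion.\<close>

primrec lst :: "nat \<Rightarrow> (nat \<Rightarrow> bool) \<Rightarrow> nat" where
 "lst 0 P = 0"
| "lst (Suc n) P = (if lst n P = n \<and> \<not> P n then Suc n else lst n P)"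

lemma lst_props: "lst n P \<le> n \<and> (\<forall>j<lst n P. \<not> P j) \<and> (lst n P < n \<longrightarrow> P (lst n P))"
 by (induction n) (auto simp: less_Suc_eq)

lemma lst_eq: "lst n P = (if \<exists>i<n. P i then LEAST i. P i else n)"
proof (cases "\<exists>i<n. P i")
 case True
 then obtain i where i: "i < n" "P i" by blast
 have l: "lst n P < n"
 proof (rule ccontr)
  assume "\<not> lst n P < n"
  then have "i < lst n P" using i(1) by simp
  then show False using lst_props[of n P] i(2) by blast
 qed
 have "(LEAST i. P i) = lst n P"
 proof (rule Least_equality)
  show "P (lst n P)" using l lst_props[of n P] by blast
  fix y assume "P y"
  then show "lst n P \<le> y" using lst_props[of n P] by (meson not_le)
 qed
 then show ?thesis unfolding if_P[OF True] by simp
next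
 case False
 have "\<not> lst n P < n" using False lst_props[of n P] by blast
 then show ?thesis unfolding if_not_P[OF False] using lst_props[of n P] by simp
qed

section \<open>Blocks, their defects and their compression\<close>

text \<open>A block is a header of \<open>H\<close> bits, a field of \<open>be\<close> bits,
  \<open>R\<close> rows of \<open>b\<close> bits and a content of \<open>c\<close> bits.
  \<open>codeH\<close> lets the header hold twice a defect code, which leaves its lowest bit free.
  \<open>tauH\<close> makes the field large enough for a tour position followed by the displaced
  header; \<open>rowH\<close> does the same for a row, which has to take the rank of a bad row and
  the header.\<close>

locale blk = acm +
 fixes H be D :: nat
 assumes H0: "1 \<le> H" and codeH: "2 * (2 * R + 2) \<le> 2 ^ H"
  and tauH: "(Q * 2 ^ b + 1) * (Q * (2 * Q + 1) + 1) * 2 ^ H \<le> 2 ^ be"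
  and rowH: "2 ^ be * 2 ^ H \<le> 4 * D\<^sup>2"
begin

text \<open>A tour is too long if it is not over after \<open>2 ^ be\<close> steps. Then every value
  of the field of \<open>be\<close> bits names one of its steps, and the field and the content
  together are traded for a position.\<close>

definition B :: nat where "B = 2 ^ be"
definition oR :: nat where "oR = H + be"
definition oT :: nat where "oT = oR + R * b"
definition ZL :: nat where "ZL = oT + c"
definition S :: nat where "S = Q * (2 * Q + 1) + 1"
definition Zc :: nat where "Zc = (G + 1) * S"

fun enc :: "wst \<Rightarrow> nat" where
 "enc (Btw g) = g * S + Q * (2 * Q + 1)"
| "enc (Nd g u k) = g * S + (u * (2 * Q + 1) + k)"

text \<open>The residue \<open>Q * (2 * Q + 1)\<close> is larger than every node code and marks
  \<open>Btw\<close>.\<close>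

definition dec :: "nat \<Rightarrow> wst" where
 "dec v = (if v mod S = Q * (2 * Q + 1) then Btw (v div S)
   else Nd (v div S) (v mod S div (2 * Q + 1)) (v mod S mod (2 * Q + 1)))"

fun wok :: "wst \<Rightarrow> bool" where
 "wok (Btw g) \<longleftrightarrow> g \<le> G"
| "wok (Nd g u k) \<longleftrightarrow> g < G \<and> u < Q \<and> k \<le> 2 * Q"

lemma node_less: "u < Q ==> k \<le> 2 * Q ==> u * (2 * Q + 1) + k < Q * (2 * Q + 1)"
proof -
 assume "u < Q" "k \<le> 2 * Q"
 then have "u * (2 * Q + 1) + k < Suc u * (2 * Q + 1)" by simp
 also have "\<dots> \<le> Q * (2 * Q + 1)" using \<open>u < Q\<close> by (intro mult_le_mono1) simp
 finally show ?thesis .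
qed

lemma mod_S: "w < S ==> (g * S + w) mod S = w \<and> (g * S + w) div S = g"
 by simp

lemma dec_enc: "wok q ==> dec (enc q) = q"
proof (cases q)
 case (Btw g)
 then show ?thesis using mod_S[of "Q * (2 * Q + 1)" g] by (simp add: dec_def S_def)
next
 case (Nd g u k)
 assume "wok q"
 then have a: "u < Q" "k \<le> 2 * Q" using Nd by auto
 have l: "u * (2 * Q + 1) + k < Q * (2 * Q + 1)" using node_less[OF a] .
 then have m: "(g * S + (u * (2 * Q + 1) + k)) mod S = u * (2 * Q + 1) + k \<and> (g * S + (u * (2 * Q + 1) + k)) div S = g"
  by (intro mod_S) (simp add: S_def)
 have "(u * m + k) div m = u \<and> (u * m + k) mod m = k" if "k < m" for m using that by simp
 from this[of "2 * Q + 1"] have "(u * (2 * Q + 1) + k) div (2 * Q + 1) = u" "(u * (2 * Q + 1) + k) mod (2 * Q + 1) = k"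
  using a(2) by auto
 then show ?thesis using m l Nd unfolding dec_def enc.simps by simp
qed

lemma enc_less: "wok q ==> enc q < Zc"
proof (cases q)
 case (Btw g)
 assume "wok q"
 then have "g * S \<le> G * S" using Btw by simp
 then show ?thesis using Btw by (simp add: Zc_def S_def)
next
 case (Nd g u k)
 assume "wok q"
 then have a: "g < G" "u < Q" "k \<le> 2 * Q" using Nd by auto
 have "g * S + (u * (2 * Q + 1) + k) < g * S + S" using node_less[OF a(2,3)] by (simp add: S_def)
 also have "\<dots> \<le> G * S" using mult_le_mono1[of "Suc g" G S] a(1) by simp
 finally show ?thesis using Nd by (simp add: Zc_def)
qed

lemma winv_wok: "length t0 = c ==> winv A lev t0 (q, t) ==> wok q \<and> length t = c"
proof (cases q)
 case (Nd g u k)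
 assume a: "length t0 = c" "winv A lev t0 (q, t)"
 then have "(u, t) \<in> lead (sd A (yg g)) lev (eg g, t0)" "g < G" "k \<le> 2 * Q" using Nd by auto
 then show ?thesis using lead_bounds[of "(u, t)" "sd A (yg g)" lev "(eg g, t0)"] eg_less[of g] a Nd by auto
qed auto

definition row :: "bool list \<Rightarrow> nat \<Rightarrow> nat" where "row z j = getf z (oR + j * b) b"
definition tau :: "bool list \<Rightarrow> bool list" where "tau z = map (\<lambda>i. z ! (oT + i)) [0..<c]"
definition sett :: "bool list \<Rightarrow> bool list \<Rightarrow> bool list" where
 "sett z t = map (\<lambda>i. if oT \<le> i \<and> i < oT + c then t ! (i - oT) else z ! i) [0..<length z]"

lemma length_tau [simp]: "length (tau z) = c" by (simp add: tau_def)
lemma length_sett [simp]: "length (sett z t) = length z" by (simp add: sett_def)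
lemma nth_sett: "i < length z ==> sett z t ! i = (if oT \<le> i \<and> i < oT + c then t ! (i - oT) else z ! i)"
 by (simp add: sett_def)

lemma tau_sett: "length z = ZL ==> length t = c ==> tau (sett z t) = t"
 by (rule nth_equalityI) (auto simp: tau_def nth_sett ZL_def)

lemma sett_tau: "sett z (tau z) = z"
 by (rule nth_equalityI) (auto simp: tau_def nth_sett)

lemma sett_sett: "sett (sett z t) t' = sett z t'"
 by (rule nth_equalityI) (auto simp: nth_sett)

lemma sett_upd: "length z = ZL ==> length t = c ==> h < c ==> (sett z t)[oT + h := v] = sett z (t[h := v])"
 by (rule nth_equalityI) (auto simp: nth_sett nth_list_update ZL_def)

lemma rows_le: "j < R ==> oR + j * b + b \<le> oT"
proof -
 assume "j < R"
 then have "Suc j * b \<le> R * b" by (intro mult_le_mono1) simp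
 then show ?thesis by (simp add: oT_def)
qed

lemma row_sett: "length z = ZL ==> j < R ==> row (sett z t) j = row z j"
 unfolding row_def using rows_le[of j] by (intro getf_cong) (auto simp: nth_sett ZL_def)

text \<open>A row is consulted only at configurations of level at least \<open>lev\<close>:
  \<open>val\<close> requires the level of the child, and an ascent starts at a node inside the
  tree.\<close>

lemma nx_dep:
 assumes "\<And>i. lev \<le> i ==> i < R ==> A i = A' i" "winv A lev t0 s"
 shows "nx A lev s = nx A' lev s"
proof -
 have sd: "sd A y i = sd A' y i" if "lev \<le> i" for y i using assms(1) that by (auto simp: sd_def)
 have v: "val A lev g u k t = val A' lev g u k t" for g u k t
  unfolding val_def by (cases "lev \<le> rp (k div 2)") (simp_all add: sd)
 have n: "nxt (sd A (yg g)) (u, t) = nxt (sd A' (yg g)) (u, t)" if "s = (Nd g u k, t)" "hl u = 0" for g u k t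
 proof -
  have "lev \<le> rp u" using assms(2) that lead_nonhalted[of u t "sd A (yg g)" lev "(eg g, t0)"] by auto
  then show ?thesis using sd by (simp add: nxt_def)
 qed
 show ?thesis
 proof (cases s)
  case (Pair q t)
  then show ?thesis using v n by (cases q) auto
 qed
qed

lemma W_dep:
 assumes "\<And>i. lev \<le> i ==> i < R ==> A i = A' i" "length t0 = c"
 shows "W A lev t0 s = W A' lev t0 s"
proof (induction s)
 case (Suc s)
 have "nx A lev (W A lev t0 s) = nx A' lev (W A lev t0 s)"
  by (rule nx_dep[OF assms(1) winv_W[OF assms(2)]])
 then show ?case using Suc by (simp add: W_Suc)
qed simp

text \<open>Badness at level \<open>Suc j\<close> is the same before and after row \<open>j\<close>
  is overwritten, which lets decompression recompute the ranks.\<close>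

lemma bad_dep: "(\<And>i. lev \<le> i ==> i < R ==> A i = A' i) ==> length t0 = c ==> bad A lev t0 B D a = bad A' lev t0 B D a"
 unfolding bad_def cls_def using W_dep[of lev A A' t0] by simp

lemma pv_cong:
 assumes "\<And>i. i < R ==> A i = A' i"
 shows "pv A lev s = pv A' lev s"
proof -
 have sd: "sd A y = sd A' y" for y
 proof
  fix i show "sd A y i = sd A' y i" by (cases "i < R") (simp_all add: sd_def assms)
 qed
 have v: "val A l g u k t = val A' l g u k t" for l g u k t unfolding val_def sd by (rule refl)
 show ?thesis
 proof (cases s)
  case (Pair q t)
  then show ?thesis by (cases q) (simp_all only: nx.simps pv.simps sd v)
 qed
qed

lemma nx_cong:
 assumes "\<And>i. i < R ==> A i = A' i"
 shows "nx A lev s = nx A' lev s"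
proof -
 have sd: "sd A y = sd A' y" for y
 proof
  fix i show "sd A y i = sd A' y i" by (cases "i < R") (simp_all add: sd_def assms)
 qed
 have v: "val A l g u k t = val A' l g u k t" for l g u k t unfolding val_def sd by (rule refl)
 show ?thesis
 proof (cases s)
  case (Pair q t)
  then show ?thesis by (cases q) (simp_all only: nx.simps pv.simps sd v)
 qed
qed

definition stp :: "nat \<Rightarrow> nat \<Rightarrow> bool list \<Rightarrow> nat \<times> bool list" where
 "stp lev v z = (case nx (row z) lev (dec v, tau z) of (q, t) \<Rightarrow> (enc q, sett z t))"

text \<open>The cap at \<open>Zc\<close> is inactive on positions of a tour. It keeps the value
  polynomial when the function meets a number that codes no such position.\<close>

definition bst :: "nat \<Rightarrow> nat \<Rightarrow> bool list \<Rightarrow> nat \<times> bool list" where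
 "bst lev v z = (case pv (row z) lev (dec v, tau z) of (q, t) \<Rightarrow> (min Zc (enc q), sett z t))"

lemma stp_sett:
 assumes "length z = ZL" "wok q" "length t = c"
 shows "stp lev (enc q) (sett z t) = (enc (fst (nx (row z) lev (q, t))), sett z (snd (nx (row z) lev (q, t))))"
proof -
 have "nx (row (sett z t)) lev (q, t) = nx (row z) lev (q, t)" by (rule nx_cong) (simp add: row_sett assms)
 then show ?thesis unfolding stp_def by (simp add: dec_enc tau_sett assms sett_sett split: prod.split)
qed

lemma bst_sett:
 assumes "length z = ZL" "wok q" "length t = c" "wok (fst (pv (row z) lev (q, t)))"
 shows "bst lev (enc q) (sett z t) = (enc (fst (pv (row z) lev (q, t))), sett z (snd (pv (row z) lev (q, t))))"
proof -
 have "pv (row (sett z t)) lev (q, t) = pv (row z) lev (q, t)" by (rule pv_cong) (simp add: row_sett assms)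
 then show ?thesis unfolding bst_def using enc_less[OF assms(4)]
  by (cases "pv (row z) lev (q, t)") (simp add: dec_enc tau_sett assms sett_sett)
qed

lemma W_ok: "length t0 = c ==> wok (fst (W A lev t0 s)) \<and> length (snd (W A lev t0 s)) = c"
 using winv_wok[of t0 A lev "fst (W A lev t0 s)" "snd (W A lev t0 s)"] winv_W[of t0 A lev s] by simp

definition wlk :: "nat \<Rightarrow> bool list \<Rightarrow> nat \<Rightarrow> nat \<times> bool list" where
 "wlk lev z n = itr (\<lambda>i v z. stp lev v z) (enc (Btw 0)) z n"

lemma wlk_W:
 assumes "length z = ZL"
 shows "wlk lev z n = (enc (fst (W (row z) lev (tau z) n)), sett z (snd (W (row z) lev (tau z) n)))"
proof (induction n)
 case 0
 then show ?case by (simp add: wlk_def sett_tau)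
next
 case (Suc n)
 let ?w = "W (row z) lev (tau z) n"
 have "wlk lev z (Suc n) = stp lev (enc (fst ?w)) (sett z (snd ?w))" using Suc by (simp add: wlk_def)
 also have "\<dots> = (enc (fst (nx (row z) lev (fst ?w, snd ?w))), sett z (snd (nx (row z) lev (fst ?w, snd ?w))))"
  using W_ok[of "tau z" "row z" lev n] by (intro stp_sett assms) auto
 finally show ?case by (simp add: W_Suc)
qed

text \<open>Two numbers packed into one: the position is the remainder modulo \<open>Zc + 1\<close>,
  the number of steps walked back is the quotient. The walk stalls at \<open>Btw 0\<close>, so a
  generous number of rounds still yields the exact step number.\<close>

definition und :: "nat \<Rightarrow> nat \<Rightarrow> bool list \<Rightarrow> nat \<Rightarrow> nat \<times> bool list" where
 "und lev v z n = itr (\<lambda>i w z. if w mod (Zc + 1) = enc (Btw 0) then (w, z)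
   else ((w div (Zc + 1) + 1) * (Zc + 1) + fst (bst lev (w mod (Zc + 1)) z), snd (bst lev (w mod (Zc + 1)) z))) v z n"

lemma wok_Btw0: "wok (Btw 0)" by simp

lemma und_W:
 assumes "length z = ZL" "length t0 = c" "\<And>i. i < k ==> fst (W (row z) lev t0 i) \<noteq> Btw G"
 shows "und lev (enc (fst (W (row z) lev t0 k))) (sett z (snd (W (row z) lev t0 k))) n =
  (min n k * (Zc + 1) + enc (fst (W (row z) lev t0 (k - n))), sett z (snd (W (row z) lev t0 (k - n))))"
proof (induction n)
 case 0
 then show ?case by (simp add: und_def)
next
 case (Suc n)
 let ?w = "\<lambda>i. W (row z) lev t0 i"
 have ok: "wok (fst (?w i))" "length (snd (?w i)) = c" for i using W_ok[OF assms(2)] by auto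
 have lt: "enc (fst (?w i)) < Zc + 1" for i using enc_less[OF ok(1)] by (simp add: less_Suc_eq)
 have md: "(m * (Zc + 1) + enc (fst (?w i))) mod (Zc + 1) = enc (fst (?w i))"
  "(m * (Zc + 1) + enc (fst (?w i))) div (Zc + 1) = m" for m i
  using lt[of i] by (simp_all only: mod_mult_self3 mod_less div_mult_self3 div_less)
 show ?case
 proof (cases "n < k")
  case True
  \<comment> \<open>Only step 0 is at \<open>Btw 0\<close>, so the walk back neither stops early nor
    miscounts.\<close>
  have nf: "fst (?w (k - n)) \<noteq> Btw 0"
   using W_init_only[OF assms(2), of "k - n" "row z" lev] assms(3)[of "k - n - 1"] True by simp
  then have nf': "enc (fst (?w (k - n))) \<noteq> enc (Btw 0)" using dec_enc[OF ok(1)] dec_enc[OF wok_Btw0] by metis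
  have "pv (row z) lev (?w (Suc (k - Suc n))) = ?w (k - Suc n)"
   using True by (intro pv_W assms) auto
  then have p: "pv (row z) lev (fst (?w (k - n)), snd (?w (k - n))) = ?w (k - Suc n)" using True by (simp add: Suc_diff_Suc)
  have "bst lev (enc (fst (?w (k - n)))) (sett z (snd (?w (k - n)))) = (enc (fst (?w (k - Suc n))), sett z (snd (?w (k - Suc n))))"
   using bst_sett[OF assms(1) ok(1) ok(2), of lev "k - n" "k - n"] ok(1) unfolding p by blast
  moreover have "min n k = n" "min (Suc n) k = Suc n" using True by auto
  ultimately show ?thesis using Suc nf' unfolding und_def itr.simps by (simp only: fst_conv snd_conv md if_False) simp
 next
  case False
  then have "k - n = 0" "k - Suc n = 0" "min n k = k" "min (Suc n) k = k" by auto
  then show ?thesis using Suc md[of k 0] unfolding und_def itr.simps by (simp only: fst_conv snd_conv W_0 if_True) simp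
 qed
qed

lemma nth_block_cong: "length z = length z' ==> (\<And>i. i < length z ==> z ! i = z' ! i) ==> z = z'"
 by (rule nth_equalityI) auto

definition lok :: "bool list \<Rightarrow> nat \<Rightarrow> bool" where "lok z lev = fin (row z) lev (tau z) B"
definition rbad :: "bool list \<Rightarrow> nat \<Rightarrow> nat \<Rightarrow> bool" where "rbad z j a = bad (row z) (Suc j) (tau z) B D a"

text \<open>Tours are needed at \<open>R + 1\<close> levels: level \<open>Suc j\<close> judges row
  \<open>j\<close>, and level 0 counts the answers. A row is judged only when all tours are short,
  as counting seeds by times presupposes.\<close>

definition code :: "bool list \<Rightarrow> nat" where
 "code z = (if \<exists>lev\<le>R. \<not> lok z lev then LEAST lev. \<not> lok z lev
   else if \<exists>j<R. rbad z j (row z j) then R + 1 + (LEAST j. rbad z j (row z j)) else 2 * R + 1)"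

definition good :: "bool list \<Rightarrow> bool" where "good z \<longleftrightarrow> code z = 2 * R + 1"

lemma good_iff: "good z \<longleftrightarrow> (\<forall>lev\<le>R. lok z lev) \<and> (\<forall>j<R. \<not> rbad z j (row z j))"
proof -
 have 1: "(LEAST lev. \<not> lok z lev) \<le> R" if "\<exists>lev\<le>R. \<not> lok z lev"
  using that Least_le[of "\<lambda>lev. \<not> lok z lev"] by (meson le_trans)
 have 2: "(LEAST j. rbad z j (row z j)) < R" if "\<exists>j<R. rbad z j (row z j)"
  using that Least_le[of "\<lambda>j. rbad z j (row z j)"] by (meson le_less_trans)
 show ?thesis
 proof (cases "\<exists>lev\<le>R. \<not> lok z lev")
  case True
  then have "code z \<le> R" using 1 unfolding code_def by (simp only: if_True)
  then show ?thesis using True by (auto simp: good_def)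
 next
  case False
  show ?thesis
  proof (cases "\<exists>j<R. rbad z j (row z j)")
   case True
   then have "code z < 2 * R + 1" using 2[OF True] False unfolding code_def by (simp only: if_True if_False)
   then show ?thesis using True by (auto simp: good_def)
  next
   case F: False
   then have "code z = 2 * R + 1" using False unfolding code_def by (simp only: if_False)
   then show ?thesis using False F by (auto simp: good_def)
  qed
 qed
qed

lemma code_cases:
 assumes "\<not> good z"
 obtains (lev) "code z \<le> R" "\<not> lok z (code z)"
 | (rw) j where "code z = R + 1 + j" "j < R" "\<forall>lev\<le>R. lok z lev" "rbad z j (row z j)"
proof (cases "\<exists>lev\<le>R. \<not> lok z lev")
 case True
 then have "code z = (LEAST lev. \<not> lok z lev)" by (simp add: code_def)
 moreover have "(LEAST lev. \<not> lok z lev) \<le> R"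
  using True Least_le[of "\<lambda>lev. \<not> lok z lev"] by (meson le_trans)
 moreover have "\<not> lok z (LEAST lev. \<not> lok z lev)" using True LeastI[of "\<lambda>lev. \<not> lok z lev"] by blast
 ultimately show ?thesis using lev by simp
next
 case False
 then have ex: "\<exists>j<R. rbad z j (row z j)" using assms by (auto simp: good_iff)
 let ?j = "LEAST j. rbad z j (row z j)"
 have "code z = R + 1 + ?j" using False ex unfolding code_def by (simp only: if_True if_False)
 moreover have "?j < R" using ex Least_le[of "\<lambda>j. rbad z j (row z j)"] by (meson le_less_trans)
 moreover have "rbad z ?j (row z ?j)" using ex LeastI[of "\<lambda>j. rbad z j (row z j)"] by blast
 ultimately show ?thesis using rw False by simp
qed

definition rank :: "bool list \<Rightarrow> nat \<Rightarrow> nat \<Rightarrow> nat" where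
 "rank z j a = card {a'. a' < a \<and> rbad z j a'}"

definition hdr :: "bool list \<Rightarrow> nat" where "hdr z = getf z 0 H"

text \<open>The old header rides along in the low \<open>H\<close> bits of the shortened field or
  row. The new header is twice the code, so its bit 0 carries no information.\<close>

definition cmp :: "bool list \<Rightarrow> bool list" where
 "cmp z = (if code z \<le> R then
   (case W (row z) (code z) (tau z) (getf z H be) of (q, t) \<Rightarrow>
    setf (setf (sett z t) H be (enc q * 2 ^ H + hdr z)) 0 H (2 * code z))
  else setf (setf z (oR + (code z - R - 1) * b) b (rank z (code z - R - 1) (row z (code z - R - 1)) * 2 ^ H + hdr z)) 0 H (2 * code z))"

text \<open>Defined on all strings; the cap \<open>Zc\<close> and the default row 0 make no
  difference on compressed blocks.\<close>

definition dcm :: "bool list \<Rightarrow> bool list" where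
 "dcm z = (let f = hdr z div 2 in if f \<le> R then
   (case und f (min Zc (getf z H be div 2 ^ H)) z B of (w, z') \<Rightarrow>
    setf (setf z' H be (w div (Zc + 1))) 0 H (getf z H be mod 2 ^ H))
  else (let j = f - R - 1; v = (if j < R then row z j else 0) in
    setf (setf z (oR + j * b) b (lst (2 ^ b) (\<lambda>a. rbad z j a \<and> rank z j a = v div 2 ^ H))) 0 H (v mod 2 ^ H)))"

lemma tau_setf: "length z = ZL ==> off + w \<le> oT ==> tau (setf z off w v) = tau z"
 by (rule nth_equalityI) (auto simp: tau_def nth_setf ZL_def)

lemma getf_setf_other: "off' + w' \<le> length z ==> off' + w' \<le> off \<or> off + w \<le> off' ==> getf (setf z off w v) off' w' = getf z off' w'"
 by (intro getf_cong) (auto simp: nth_setf)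

lemma getf_upd0: "0 < off ==> getf (z[0 := fb]) off w = getf z off w"
 by (intro getf_cong) auto

lemma tau_upd0: "0 < oT ==> tau (z[0 := fb]) = tau z"
 by (simp add: tau_def)

lemma offs: "H + be = oR" "oR \<le> oT" "oT \<le> ZL" "0 < H" "H \<le> oT"
 using H0 by (auto simp: oR_def oT_def ZL_def)

lemma setf_restore:
 assumes "length z' = length z" "off + w \<le> length z" "v = getf z off w"
  "\<And>i. i < length z ==> \<not> (off \<le> i \<and> i < off + w) ==> z' ! i = z ! i"
 shows "setf z' off w v = z"
 using assms by (intro nth_block_cong) (auto simp: nth_setf bit_getf)

lemma hdr_code:
 assumes "length z = ZL" "f \<le> 2 * R + 1"
 shows "hdr ((setf z 0 H (2 * f))[0 := fb]) div 2 = f"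
proof (rule bit_eqI)
 fix i
 have "2 * f < 2 * (2 * R + 2)" using assms(2) by simp
 then have f: "2 * f < 2 ^ H" using codeH by (rule less_le_trans)
 have "bit (2 * f) (Suc i) = bit f i" by (simp add: bit_Suc)
 then show "bit (hdr ((setf z 0 H (2 * f))[0 := fb]) div 2) i = bit f i"
  using bit_less_pow[OF _ f, of "Suc i"] assms(1) offs
  by (auto simp: hdr_def bit_Suc[symmetric] bit_getf nth_setf)
qed

text \<open>If a tour was too long, all its steps up to \<open>B\<close> can be reversed, and
  walking back yields the old content and the step number; the rows were never touched. If a row was
  bad, content and later rows are intact, so the bad rows and their ranks come out as before. In
  neither case does bit 0 of the header matter.\<close>

theorem dcm_cmp:
 assumes l: "length z = ZL" and ng: "\<not> good z"
 shows "length (cmp z) = ZL" "dcm ((cmp z)[0 := fb]) = z"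
proof -
 have "length (cmp z) = ZL \<and> dcm ((cmp z)[0 := fb]) = z"
  using ng
 proof (cases rule: code_cases)
  case lev
  define f where "f = code z"
  define k where "k = getf z H be"
  obtain q t where q: "W (row z) f (tau z) k = (q, t)" by fastforce
  have kB: "k < B" unfolding k_def B_def by (rule getf_less)
  \<comment> \<open>Reversal fails only where the tour has stalled at its end, and by the choice of
    the level this does not happen up to step \<open>B\<close>.\<close>
  have nf: "fst (W (row z) f (tau z) i) \<noteq> Btw G" if "i \<le> B" for i
   using lev(2) that by (auto simp: lok_def fin_def f_def)
  have wq: "wok q" "length t = c" using winv_wok[of "tau z" "row z" f q t] winv_W[of "tau z" "row z" f k] q by auto
  let ?v = "enc q * 2 ^ H + hdr z"
  have hz: "hdr z < 2 ^ H" by (simp add: hdr_def getf_less)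
  have "?v < (enc q + 1) * 2 ^ H" using hz by simp
  also have "\<dots> \<le> Zc * 2 ^ H" using enc_less[OF wq(1)] by (intro mult_le_mono1) simp
  also have "\<dots> \<le> 2 ^ be" using tauH by (simp add: Zc_def S_def G_def)
  finally have v: "?v < 2 ^ be" .
  define z1 where "z1 = setf (setf (sett z t) H be ?v) 0 H (2 * f)"
  have c: "cmp z = z1" using lev q by (simp add: cmp_def z1_def f_def k_def)
  let ?z = "z1[0 := fb]"
  have h: "hdr ?z div 2 = f" unfolding z1_def using lev(1) l by (intro hdr_code) (auto simp: f_def)
  have g: "getf ?z H be = ?v"
   unfolding z1_def using l v offs by (simp add: getf_upd0 getf_setf_other getf_setf ZL_def)
  have ta: "tau ?z = t"
   unfolding z1_def using l wq offs by (simp add: tau_upd0 tau_setf tau_sett)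
  have rw: "row ?z i = row z i" if "i < R" for i
  proof -
   have "row ?z i = row (sett z t) i"
    unfolding z1_def row_def using l rows_le[OF that] offs by (intro getf_cong) (auto simp: nth_setf ZL_def)
   then show ?thesis using row_sett[OF l that] by simp
  qed
  have W: "W (row ?z) f (tau z) i = W (row z) f (tau z) i" for i
   by (rule W_dep) (use rw in auto)
  have "und f (enc q) (sett ?z t) B = (min B k * (Zc + 1) + enc (fst (W (row ?z) f (tau z) (k - B))), sett ?z (snd (W (row ?z) f (tau z) (k - B))))"
   using und_W[of ?z "tau z" k f B] nf kB q l unfolding W by (simp add: z1_def)
  moreover have "min B k = k" "k - B = 0" using kB by auto
  moreover have "sett ?z t = ?z" using sett_tau[of ?z] unfolding ta .
  ultimately have u: "und f (enc q) ?z B = (k * (Zc + 1) + enc (Btw 0), sett ?z (tau z))" by simp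
  have "enc (Btw 0) < Zc + 1" using enc_less[OF wok_Btw0] by simp
  then have kd: "(k * (Zc + 1) + enc (Btw 0)) div (Zc + 1) = k" by (simp only: div_mult_self3) simp
  have "?v div 2 ^ H = enc q" using hz by simp
  then have d: "min Zc (?v div 2 ^ H) = enc q" "?v mod 2 ^ H = hdr z" using enc_less[OF wq(1)] hz by simp_all
  have fR: "f \<le> R" using lev(1) by (simp add: f_def)
  have "dcm ?z = setf (setf (sett ?z (tau z)) H be k) 0 H (hdr z)"
   unfolding dcm_def Let_def h g d u using fR by (simp only: if_True prod.case kd)
  also have "\<dots> = z"
   unfolding hdr_def[of z]
  proof (rule setf_restore)
   fix i assume i: "i < length z" "\<not> (0 \<le> i \<and> i < 0 + H)"
   then show "setf (sett ?z (tau z)) H be k ! i = z ! i"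
    using l offs by (auto simp: nth_setf nth_sett bit_getf k_def tau_def z1_def)
  qed (use l offs in \<open>auto simp: ZL_def z1_def\<close>)
  finally show ?thesis using c l by (simp add: z1_def)
 next
  case (rw j)
  let ?o = "oR + j * b"
  define a where "a = row z j"
  have ab: "a < 2 ^ b" unfolding a_def row_def by (rule getf_less)
  have fz: "fin (row z) (Suc j) (tau z) B" using rw(2,3) by (auto simp: lok_def)
  \<comment> \<open>The bound on bad rows together with \<open>rowH\<close> gives
    \<open>N * 2 ^ H \<le> 2 ^ b\<close>: a rank followed by the header fits into the row.\<close>
  define N where "N = card {a. a < 2 ^ b \<and> rbad z j a}"
  have "N * (4 * D\<^sup>2) \<le> 2 ^ b * B" unfolding N_def rbad_def using bad_count[OF fz] by simp
  moreover have "N * (2 ^ be * 2 ^ H) \<le> N * (4 * D\<^sup>2)" using rowH by (rule mult_le_mono2)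
  ultimately have "N * (2 ^ be * 2 ^ H) \<le> 2 ^ b * 2 ^ be" unfolding B_def by (rule order_trans[rotated])
  then have "N * 2 ^ H * 2 ^ be \<le> 2 ^ b * 2 ^ be" by (simp only: ac_simps)
  then have N: "N * 2 ^ H \<le> 2 ^ b" by simp
  have fb: "finite {a. a < 2 ^ b \<and> rbad z j a}" by (rule finite_subset[of _ "{..<2 ^ b}"]) auto
  have rN: "rank z j a < N"
   unfolding rank_def N_def using fb ab rw(4) by (intro psubset_card_mono) (auto simp: a_def)
  have hz: "hdr z < 2 ^ H" by (simp add: hdr_def getf_less)
  let ?v = "rank z j a * 2 ^ H + hdr z"
  have "?v < (rank z j a + 1) * 2 ^ H" using hz by simp
  also have "\<dots> \<le> N * 2 ^ H" using rN by (intro mult_le_mono1) simp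
  finally have v: "?v < 2 ^ b" using N by linarith
  define z1 where "z1 = setf (setf z ?o b ?v) 0 H (2 * (R + 1 + j))"
  have c: "cmp z = z1" using rw by (simp add: cmp_def z1_def a_def)
  let ?z = "z1[0 := fb]"
  have ol: "?o + b \<le> oT" "H \<le> ?o" "?o + b \<le> ZL" using rows_le[OF rw(2)] offs by auto
  have h: "hdr ?z div 2 = R + 1 + j" unfolding z1_def using rw(2) l by (intro hdr_code) auto
  have g: "row ?z j = ?v"
   unfolding z1_def row_def using l v ol offs by (simp add: getf_upd0 getf_setf_other getf_setf)
  have ta: "tau ?z = tau z"
   unfolding z1_def using l ol offs by (simp add: tau_upd0 tau_setf)
  have rws: "row ?z i = row z i" if i: "i < R" "Suc j \<le> i" for i
  proof -
   have "?o + b \<le> oR + i * b" using mult_le_mono1[OF i(2), of b] by simp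
   then show ?thesis
    unfolding z1_def row_def using l rows_le[OF i(1)] ol offs by (intro getf_cong) (auto simp: nth_setf)
  qed
  have rb: "rbad ?z j a' = rbad z j a'" for a'
   unfolding rbad_def ta by (rule bad_dep) (simp_all add: rws)
  \<comment> \<open>Ranks increase strictly along the bad rows, so the least bad row of the given
    rank is the right one.\<close>
  have "(LEAST a'. rbad z j a' \<and> rank z j a' = rank z j a) = a"
  proof (rule Least_equality)
   show "rbad z j a \<and> rank z j a = rank z j a" using rw(4) by (simp add: a_def)
   fix a' assume a': "rbad z j a' \<and> rank z j a' = rank z j a"
   show "a \<le> a'"
   proof (rule ccontr)
    assume "\<not> a \<le> a'"
    then have "a' < a" by simp
    moreover have "{x. x < a' \<and> rbad z j x} \<subseteq> {x. x < a \<and> rbad z j x}" using \<open>a' < a\<close> by fastforce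
    moreover have "a' \<in> {x. x < a \<and> rbad z j x}" "a' \<notin> {x. x < a' \<and> rbad z j x}" using a' \<open>a' < a\<close> by simp_all
    ultimately have "rank z j a' < rank z j a" unfolding rank_def by (intro psubset_card_mono psubsetI) (simp, blast+)
    then show False using a' by simp
   qed
  qed
  moreover have "\<exists>a'<2 ^ b. rbad z j a' \<and> rank z j a' = rank z j a" using rw(4) ab by (auto simp: a_def)
  ultimately have "lst (2 ^ b) (\<lambda>a'. rbad z j a' \<and> rank z j a' = rank z j a) = a" unfolding lst_eq by (simp only: if_True)
  then have le: "lst (2 ^ b) (\<lambda>a'. rbad ?z j a' \<and> rank ?z j a' = ?v div 2 ^ H) = a" using rb hz by (simp add: rank_def)
  have "dcm ?z = setf (setf ?z ?o b a) 0 H (hdr z)"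
   unfolding dcm_def h Let_def using g le hz rw(2) by simp
  also have "\<dots> = z"
   unfolding hdr_def[of z]
  proof (rule setf_restore)
   fix i assume "i < length z" "\<not> (0 \<le> i \<and> i < 0 + H)"
   then show "setf ?z ?o b a ! i = z ! i"
    using l offs ol by (auto simp: nth_setf bit_getf a_def row_def z1_def)
  qed (use l offs in \<open>auto simp: z1_def\<close>)
  finally show ?thesis using c l by (simp add: z1_def)
 qed
 then show "length (cmp z) = ZL" "dcm ((cmp z)[0 := fb]) = z" by auto
qed

end

section \<open>Good blocks: their number and the answers that they give\<close>

context blk begin
lemma cmp_header: "length z = ZL ==> i < H ==> cmp z ! i = bit (2 * code z) i"
 using offs by (auto simp: cmp_def nth_setf split: prod.split)

lemma code_le: "\<not> good z ==> code z < 2 * R + 1"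
 by (erule code_cases) auto

text \<open>Compression itself shows that few blocks are not good: such a block is determined by the code
 and the part of its compression behind the header.\<close>

lemma few_not_good: "card {z. length z = ZL \<and> \<not> good z} * 2 ^ H \<le> (2 * R + 1) * 2 ^ ZL"
proof -
 let ?S = "{z. length z = ZL \<and> \<not> good z}"
 let ?T = "{..<2 * R + 1} \<times> {l :: bool list. length l = ZL - H}"
 let ?f = "\<lambda>z. (code z, drop H (cmp z))"
 have "inj_on ?f ?S"
 proof (rule inj_onI)
  fix z z' assume a: "z \<in> ?S" "z' \<in> ?S" "?f z = ?f z'"
  have zl: "length z = ZL" "\<not> good z" "length z' = ZL" "\<not> good z'" using a(1,2) by blast+
  have c: "code z = code z'" "drop H (cmp z) = drop H (cmp z')" using a(3) by simp_all
  note l = dcm_cmp(1)[OF zl(1,2)] dcm_cmp(1)[OF zl(3,4)]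
  have "cmp z = cmp z'"
  proof (rule nth_equalityI)
   fix i assume i: "i < length (cmp z)"
   show "cmp z ! i = cmp z' ! i"
   proof (cases "i < H")
    case True
    then show ?thesis using cmp_header[OF zl(1)] cmp_header[OF zl(3)] c(1) by simp
   next
    case False
    then have "cmp z ! i = drop H (cmp z) ! (i - H)" "cmp z' ! i = drop H (cmp z') ! (i - H)" using l i by simp_all
    then show ?thesis using c(2) by simp
   qed
  qed (use l in simp)
  then have "dcm ((cmp z)[0 := True]) = dcm ((cmp z')[0 := True])" by (rule arg_cong)
  then show "z = z'" unfolding dcm_cmp(2)[OF zl(1,2)] dcm_cmp(2)[OF zl(3,4)] .
 qed
 moreover have "?f ` ?S \<subseteq> ?T"
 proof (rule image_subsetI)
  fix z assume "z \<in> ?S"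
  then have "length z = ZL" "\<not> good z" by blast+
  then show "?f z \<in> ?T" using dcm_cmp(1) code_le by simp
 qed
 moreover have "finite {l :: bool list. length l = ZL - H}" using finite_lists_length_eq[of "UNIV :: bool set" "ZL - H"] by simp
 then have "finite ?T" by simp
 ultimately have "card ?S \<le> card ?T" by (rule card_inj_on_le)
 also have "\<dots> = (2 * R + 1) * 2 ^ (ZL - H)"
  using card_lists_length_eq[of "UNIV :: bool set" "ZL - H"] by (simp add: card_cartesian_product)
 finally have "card ?S * 2 ^ H \<le> (2 * R + 1) * 2 ^ (ZL - H) * 2 ^ H" by (rule mult_le_mono1)
 also have "\<dots> = (2 * R + 1) * 2 ^ (ZL - H + H)" by (simp only: power_add mult.assoc)
 also have "ZL - H + H = ZL" using offs by simp
 finally show ?thesis .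
qed

lemma lead_unique: "v \<in> lead f lev r ==> v \<in> lead f lev r' ==> hl (fst r) \<noteq> 0 ==> hl (fst r') \<noteq> 0 ==> r = r'"
proof (induction rule: lead.induct)
 case lead_root
 then show ?case using lead_halted[of r f lev r'] by simp
next
 case (lead_step u t)
 then show ?case using lead_nonhalted[of u t f lev r'] by blast
qed

text \<open>All roots carry the content \<open>tau z\<close>. That the start configuration with
  content \<open>tau z\<close> lies in a tree therefore says: with this seed the run restores the
  tape and halts in the root state of the tree.\<close>

definition cnt :: "nat \<Rightarrow> bool list \<Rightarrow> nat \<Rightarrow> nat" where
 "cnt s0 z o1 = card {s. s < B \<and> (\<exists>g. W (row z) 0 (tau z) s = (Nd g s0 0, tau z) \<and> hl (eg g) = o1)}"

definition ans :: "nat \<Rightarrow> bool list \<Rightarrow> bool" where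
 "ans s0 z \<longleftrightarrow> cnt s0 z 2 < cnt s0 z 1"

definition pr :: "nat \<Rightarrow> bool list \<Rightarrow> nat \<Rightarrow> real" where
 "pr s0 t o1 = real (card {l. length l = R \<and> (\<exists>e<Q. hl e = o1 \<and> (s0, t) \<in> lead (sh 0 l) 0 (e, t))}) / 2 ^ R"

text \<open>Trees with different root states are disjoint, both as sets of times and as sets of
  random strings. So the count and the probability are sums over root states, and the error of the
  hybrid argument is paid at most \<open>Q\<close> times.\<close>

lemma cnt_approx:
 assumes "good z" "o1 \<noteq> 0"
 shows "\<bar>real (cnt s0 z o1) - 2 ^ b * pr s0 (tau z) o1\<bar> \<le> real Q * (real R * (2 * real D))"
proof -
 let ?t = "tau z"
 define E where "E = {e. e < Q \<and> hl e = o1}"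
 have fE: "finite E" and cE: "card E \<le> Q" unfolding E_def using card_mono[of "{..<Q}" "{e. e < Q \<and> hl e = o1}"] by auto
 have fn: "fin (row z) lev ?t B" if "lev \<le> R" for lev using assms(1) that by (simp add: good_iff lok_def)
 have nb: "\<not> bad (row z) (Suc j) ?t B D (row z j)" if "j < R" for j using assms(1) that by (simp add: good_iff rbad_def)
 let ?C = "\<lambda>e. cls (row z) 0 ?t B e (s0, ?t) (\<lambda>_. True)"
 have "{s. s < B \<and> (\<exists>g. W (row z) 0 ?t s = (Nd g s0 0, ?t) \<and> hl (eg g) = o1)} = (\<Union>e\<in>E. ?C e)" (is "?l = ?r")
 proof
  show "?l \<subseteq> ?r"
  proof
   fix s assume "s \<in> ?l"
   then obtain g where g: "s < B" "W (row z) 0 ?t s = (Nd g s0 0, ?t)" "hl (eg g) = o1" by blast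
   have "g < G" using winv_W[of ?t "row z" 0 s] g(2) by simp
   then have "eg g \<in> E" using eg_less g(3) by (simp add: E_def)
   then show "s \<in> ?r" using g by (auto simp: cls_def)
  qed
  show "?r \<subseteq> ?l" by (auto simp: cls_def E_def)
 qed
 then have "cnt s0 z o1 = card (\<Union>e\<in>E. ?C e)" by (simp add: cnt_def)
 also have "\<dots> = (\<Sum>e\<in>E. card (?C e))"
 proof (rule card_UN_disjoint[OF fE])
  show "\<forall>e\<in>E. finite (?C e)" by (simp add: cls_def)
  show "\<forall>e\<in>E. \<forall>e'\<in>E. e \<noteq> e' \<longrightarrow> ?C e \<inter> ?C e' = {}" by (auto simp: cls_def)
 qed
 also have "\<dots> = (\<Sum>e\<in>E. card (Y (row z) 0 ?t e (s0, ?t)))"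
 proof (rule sum.cong[OF refl])
  fix e assume "e \<in> E"
  then show "card (?C e) = card (Y (row z) 0 ?t e (s0, ?t))"
   using card_cls[OF fn[of 0], of e "(s0, ?t)" "\<lambda>_. True"] assms(2) by (simp add: E_def)
 qed
 finally have c: "cnt s0 z o1 = (\<Sum>e\<in>E. card (Y (row z) 0 ?t e (s0, ?t)))" .
 let ?L = "\<lambda>e. {l. length l = R \<and> (s0, ?t) \<in> lead (sh 0 l) 0 (e, ?t)}"
 have fL: "finite {l :: bool list. length l = R}" using finite_lists_length_eq[of "UNIV :: bool set" R] by simp
 have "{l. length l = R \<and> (\<exists>e<Q. hl e = o1 \<and> (s0, ?t) \<in> lead (sh 0 l) 0 (e, ?t))} = (\<Union>e\<in>E. ?L e)"
  by (auto simp: E_def)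
 then have "real (card {l. length l = R \<and> (\<exists>e<Q. hl e = o1 \<and> (s0, ?t) \<in> lead (sh 0 l) 0 (e, ?t))}) = real (card (\<Union>e\<in>E. ?L e))"
  by simp
 also have "card (\<Union>e\<in>E. ?L e) = (\<Sum>e\<in>E. card (?L e))"
 proof (rule card_UN_disjoint[OF fE])
  show "\<forall>e\<in>E. finite (?L e)" using fL by simp
  show "\<forall>e\<in>E. \<forall>e'\<in>E. e \<noteq> e' \<longrightarrow> ?L e \<inter> ?L e' = {}"
  proof (intro ballI impI)
   fix e e' assume e: "e \<in> E" "e' \<in> E" "e \<noteq> e'"
   show "?L e \<inter> ?L e' = {}"
   proof (rule equals0I)
    fix l assume "l \<in> ?L e \<inter> ?L e'"
    then have "(s0, ?t) \<in> lead (sh 0 l) 0 (e, ?t)" "(s0, ?t) \<in> lead (sh 0 l) 0 (e', ?t)" by blast+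
    then have "(e, ?t) = (e', ?t)" by (rule lead_unique) (use e assms(2) in \<open>simp_all add: E_def\<close>)
    then show False using e(3) by simp
   qed
  qed
 qed
 finally have p: "pr s0 ?t o1 = (\<Sum>e\<in>E. P 0 (e, ?t) (s0, ?t))"
  by (simp add: pr_def P_def sum_divide_distrib)
 have "\<bar>real (card (Y (row z) 0 ?t e (s0, ?t))) - 2 ^ b * P 0 (e, ?t) (s0, ?t)\<bar> \<le> real R * (2 * real D)" if "e \<in> E" for e
  using Y_approx[of ?t e "row z" B D 0 "(s0, ?t)"] fn nb that assms(2) by (simp add: E_def)
 then have "(\<Sum>e\<in>E. \<bar>real (card (Y (row z) 0 ?t e (s0, ?t))) - 2 ^ b * P 0 (e, ?t) (s0, ?t)\<bar>) \<le> real (card E) * (real R * (2 * real D))"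
  by (rule sum_bounded_above)
 also have "\<dots> \<le> real Q * (real R * (2 * real D))" using cE by (intro mult_right_mono) auto
 finally have "\<bar>\<Sum>e\<in>E. real (card (Y (row z) 0 ?t e (s0, ?t))) - 2 ^ b * P 0 (e, ?t) (s0, ?t)\<bar> \<le> real Q * (real R * (2 * real D))"
  by (rule order_trans[OF sum_abs])
 then show ?thesis unfolding c p of_nat_sum sum_distrib_left sum_subtractf .
qed

text \<open>Either count is off by at most \<open>2 * Q * R * D\<close>, hence their difference by
  at most twice that, which is less than the gap scaled by \<open>2 ^ b\<close>.\<close>

lemma ans_correct:
 assumes "good z" and gap: "4 * (real Q * (real R * real D)) < \<gamma> * 2 ^ b"
 shows "\<gamma> \<le> pr s0 (tau z) 1 - pr s0 (tau z) 2 ==> ans s0 z"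
  "\<gamma> \<le> pr s0 (tau z) 2 - pr s0 (tau z) 1 ==> \<not> ans s0 z"
proof -
 have a: "\<bar>real (cnt s0 z 1) - 2 ^ b * pr s0 (tau z) 1\<bar> \<le> real Q * (real R * (2 * real D))"
  "\<bar>real (cnt s0 z 2) - 2 ^ b * pr s0 (tau z) 2\<bar> \<le> real Q * (real R * (2 * real D))"
  by (rule cnt_approx[OF assms(1)]; simp)+
 have m: "\<gamma> * 2 ^ b \<le> 2 ^ b * p - 2 ^ b * q" if "\<gamma> \<le> p - q" for p q
  using mult_left_mono[OF that, of "2 ^ b"] by (simp add: algebra_simps)
 {
  assume "\<gamma> \<le> pr s0 (tau z) 1 - pr s0 (tau z) 2"
  from m[OF this] a gap have "real (cnt s0 z 2) < real (cnt s0 z 1)" by (simp add: abs_le_iff algebra_simps)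
  then show "ans s0 z" by (simp add: ans_def)
 next
  assume "\<gamma> \<le> pr s0 (tau z) 2 - pr s0 (tau z) 1"
  from m[OF this] a gap have "real (cnt s0 z 1) < real (cnt s0 z 2)" by (simp add: abs_le_iff algebra_simps)
  then show "\<not> ans s0 z" by (simp add: ans_def)
 }
qed

text \<open>A forward walk may have stalled at the end of the tour; \<open>n'\<close> is the number
  of steps that were actually made.\<close>

lemma pv_back:
 assumes "length t0 = c"
 shows "\<exists>n'\<le>n. \<forall>j. (pv A lev ^^ j) (W A lev t0 n) = W A lev t0 (n' - j)"
proof (induction n)
 case 0
 have "(pv A lev ^^ j) (W A lev t0 0) = W A lev t0 0" for j by (induction j) auto
 then show ?case by auto
next
 case (Suc n)
 show ?case
 proof (cases "fst (W A lev t0 n) = Btw G")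
  case True
  then have "W A lev t0 (Suc n) = W A lev t0 n" by (simp add: W_Suc nx_final)
  then show ?thesis using Suc le_SucI by metis
 next
  case False
  have p: "pv A lev (W A lev t0 m) = W A lev t0 (m - 1)" if "m \<le> Suc n" for m
  proof (cases m)
   case (Suc m')
   then have "fst (W A lev t0 m') \<noteq> Btw G" using W_not_final_mono[OF False, of m'] that by simp
   from pv_W[OF assms this] Suc show ?thesis by simp
  qed simp
  have "(pv A lev ^^ j) (W A lev t0 (Suc n)) = W A lev t0 (Suc n - j)" for j
  proof (induction j)
   case (Suc j)
   then show ?case using p[of "Suc n - j"] by simp
  qed simp
  then show ?thesis by blast
 qed
qed

definition bwk :: "nat \<Rightarrow> nat \<Rightarrow> bool list \<Rightarrow> nat \<Rightarrow> nat \<times> bool list" where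
 "bwk lev v z n = itr (\<lambda>i v z. bst lev v z) v z n"

text \<open>The backward walk stalls at \<open>Btw 0\<close> just as the forward walk stalls at the
  end. So \<open>n\<close> steps forward and \<open>n\<close> steps back restore the block, whether
  or not the tour was over in between.\<close>

lemma bwk_wlk:
 assumes "length z = ZL"
 shows "bwk lev (fst (wlk lev z n)) (snd (wlk lev z n)) n = (enc (Btw 0), z)"
proof -
 let ?w = "W (row z) lev (tau z)"
 have tl: "length (tau z) = c" by simp
 obtain n' where n': "n' \<le> n" "\<And>j. (pv (row z) lev ^^ j) (?w n) = ?w (n' - j)" using pv_back[OF tl] by blast
 have p: "pv (row z) lev (?w (n' - j)) = ?w (n' - Suc j)" for j using n'(2)[of j] n'(2)[of "Suc j"] by simp
 have ok: "wok (fst (?w i))" "length (snd (?w i)) = c" for i using W_ok[OF tl] by auto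
 have "bwk lev (fst (wlk lev z n)) (snd (wlk lev z n)) j = (enc (fst (?w (n' - j))), sett z (snd (?w (n' - j))))" for j
 proof (induction j)
  case 0
  then show ?case using n'(2)[of 0] by (simp add: bwk_def wlk_W[OF assms])
 next
  case (Suc j)
  have q: "pv (row z) lev (fst (?w (n' - j)), snd (?w (n' - j))) = ?w (n' - Suc j)" using p[of j] by simp
  have "bst lev (enc (fst (?w (n' - j)))) (sett z (snd (?w (n' - j)))) = (enc (fst (?w (n' - Suc j))), sett z (snd (?w (n' - Suc j))))"
   using bst_sett[OF assms ok(1) ok(2), of lev "n' - j" "n' - j"] ok(1) unfolding q by blast
  then show ?case using Suc unfolding bwk_def itr.simps by (simp only: fst_conv snd_conv)
 qed
 from this[of n] n'(1) show ?thesis by (simp add: sett_tau)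
qed

section \<open>The tour in terms of numbers and single cells\<close>

definition gv :: "nat \<Rightarrow> nat" where "gv v = v div S"
definition uv :: "nat \<Rightarrow> nat" where "uv v = v mod S div (2 * Q + 1)"
definition kv :: "nat \<Rightarrow> nat" where "kv v = v mod S mod (2 * Q + 1)"
definition btw :: "nat \<Rightarrow> bool" where "btw v \<longleftrightarrow> v mod S = Q * (2 * Q + 1)"

lemma dec_eq: "dec v = (if btw v then Btw (gv v) else Nd (gv v) (uv v) (kv v))"
 by (simp add: dec_def btw_def gv_def uv_def kv_def)

lemma sett_upd_tau: "length z = ZL ==> sett z ((tau z)[h := v]) = z[oT + h := v]"
 using sett_upd[of z "tau z" h v] by (cases "h < c") (simp_all add: sett_tau list_update_beyond ZL_def)

lemma nxt_tau: "nxt f (u, tau z) = (dn u (sy (tau z) (hp u)) (f (rp u)), (tau z)[hp u := dw u (sy (tau z) (hp u)) (f (rp u))])"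
 by (simp add: nxt_def)

text \<open>The form that a program can execute: numeric case distinctions with at most one cell
  written in each branch.\<close>

lemma stp_eq:
 assumes "length z = ZL"
 shows "stp lev v z = (if btw v then (if gv v < G then if hl (eg (gv v)) \<noteq> 0 then (enc (Nd (gv v) (eg (gv v)) 0), z)
   else (enc (Btw (Suc (gv v))), z) else (enc (Btw (gv v)), z))
  else if kv v < 2 * Q then if val (row z) lev (gv v) (uv v) (kv v) (tau z)
   then (enc (Nd (gv v) (kv v div 2) 0), z[oT + hp (kv v div 2) := odd (kv v)]) else (enc (Nd (gv v) (uv v) (Suc (kv v))), z)
  else if hl (uv v) \<noteq> 0 then (enc (Btw (Suc (gv v))), z)
  else (enc (Nd (gv v) (dn (uv v) (sy (tau z) (hp (uv v))) (sd (row z) (yg (gv v)) (rp (uv v)))) (Suc (2 * uv v + oc (uv v) (tau z)))),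
   z[oT + hp (uv v) := dw (uv v) (sy (tau z) (hp (uv v))) (sd (row z) (yg (gv v)) (rp (uv v)))]))"
 unfolding stp_def dec_eq
 by (simp add: nxt_tau sett_upd_tau[OF assms] sett_tau del: enc.simps)

lemma bst_eq:
 assumes "length z = ZL"
 shows "bst lev v z = (if btw v then (if gv v = 0 then (min Zc (enc (Btw (gv v))), z)
   else if hl (eg (gv v - 1)) \<noteq> 0 then (min Zc (enc (Nd (gv v - 1) (eg (gv v - 1)) (2 * Q))), z) else (min Zc (enc (Btw (gv v - 1))), z))
  else if kv v = 0 then if hl (uv v) \<noteq> 0 then (min Zc (enc (Btw (gv v))), z)
   else (min Zc (enc (Nd (gv v) (dn (uv v) (sy (tau z) (hp (uv v))) (sd (row z) (yg (gv v)) (rp (uv v)))) (2 * uv v + oc (uv v) (tau z)))),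
    z[oT + hp (uv v) := dw (uv v) (sy (tau z) (hp (uv v))) (sd (row z) (yg (gv v)) (rp (uv v)))])
  else if val (row z) lev (gv v) (uv v) (kv v - 1) (tau z)
   then (min Zc (enc (Nd (gv v) ((kv v - 1) div 2) (2 * Q))), z[oT + hp ((kv v - 1) div 2) := odd (kv v - 1)])
   else (min Zc (enc (Nd (gv v) (uv v) (kv v - 1))), z))"
 unfolding bst_def dec_eq
 by (simp add: nxt_tau sett_upd_tau[OF assms] sett_tau del: enc.simps)

text \<open>The content at step \<open>s\<close> exists only while the tape stands at that step. It
  is therefore queried in small pieces, here the number of the position and below one bit of
  content, each query walking there and back.\<close>

definition pn :: "nat \<Rightarrow> bool list \<Rightarrow> nat \<Rightarrow> nat" where "pn lev z s = fst (wlk lev z s)"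
definition pt :: "nat \<Rightarrow> bool list \<Rightarrow> nat \<Rightarrow> nat \<Rightarrow> bool" where
 "pt lev z s i \<longleftrightarrow> oT + i < ZL \<and> snd (wlk lev z s) ! (oT + i)"
text \<open>Two contents of one tour are never on the tape together; they are compared bit by bit,
  with a walk for each bit.\<close>

definition tq :: "nat \<Rightarrow> bool list \<Rightarrow> nat \<Rightarrow> nat \<Rightarrow> bool" where
 "tq lev z s s' \<longleftrightarrow> (\<forall>i<c. pt lev z s i = pt lev z s' i)"
definition nd0 :: "nat \<Rightarrow> bool" where "nd0 v \<longleftrightarrow> \<not> btw v \<and> kv v = 0"
definition cc :: "nat \<Rightarrow> bool list \<Rightarrow> nat \<Rightarrow> nat \<Rightarrow> nat \<Rightarrow> nat" where
 "cc lev z s a o1 = (\<Sum>s'<B. of_bool (nd0 (pn lev z s') \<and> eg (gv (pn lev z s')) = eg (gv (pn lev z s)) \<and>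
   uv (pn lev z s') = uv (pn lev z s) \<and> tq lev z s' s \<and> of_bool (ip b a (yg (gv (pn lev z s')))) = o1))"

context
 fixes z :: "bool list" assumes zl: "length z = ZL"
begin

lemma pn_W: "pn lev z s = enc (fst (W (row z) lev (tau z) s))"
 by (simp add: pn_def wlk_W[OF zl])

lemma pn_dec: "dec (pn lev z s) = fst (W (row z) lev (tau z) s)"
 unfolding pn_W using W_ok[of "tau z"] by (intro dec_enc) simp

lemma pt_W: "i < c ==> pt lev z s i = snd (W (row z) lev (tau z) s) ! i"
 by (simp add: pt_def wlk_W[OF zl] nth_sett zl ZL_def)

lemma tq_W: "tq lev z s s' \<longleftrightarrow> snd (W (row z) lev (tau z) s) = snd (W (row z) lev (tau z) s')"
proof -
 have "length (snd (W (row z) lev (tau z) i)) = c" for i using W_ok[of "tau z"] by simp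
 then show ?thesis unfolding tq_def by (simp add: pt_W list_eq_iff_nth_eq)
qed

lemma nd0_W: "nd0 (pn lev z s) \<longleftrightarrow> (\<exists>g u. fst (W (row z) lev (tau z) s) = Nd g u 0)"
 unfolding pn_dec[symmetric] dec_eq nd0_def by simp

lemma node_W: "fst (W (row z) lev (tau z) s) = Nd g u k \<longleftrightarrow> \<not> btw (pn lev z s) \<and> gv (pn lev z s) = g \<and> uv (pn lev z s) = u \<and> kv (pn lev z s) = k"
 unfolding pn_dec[symmetric] dec_eq by simp

lemma card_less_sum: "card {s. s < (n::nat) \<and> X s} = (\<Sum>s<n. of_bool (X s))"
 by (simp add: Collect_conj_eq lessThan_def)

lemma cc_cls:
 assumes "W (row z) lev (tau z) s = (Nd g u 0, t)"
 shows "card (cls (row z) lev (tau z) B (eg g) (u, t) (\<lambda>y. of_bool (ip b a y) = o1)) = cc lev z s a o1"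
proof -
 have n: "gv (pn lev z s) = g" "uv (pn lev z s) = u" using node_W[of lev s g u 0] assms by auto
 have "(\<exists>g'. W (row z) lev (tau z) s' = (Nd g' (fst (u, t)) 0, snd (u, t)) \<and> eg g' = eg g \<and> of_bool (ip b a (yg g')) = o1) \<longleftrightarrow>
   nd0 (pn lev z s') \<and> eg (gv (pn lev z s')) = eg (gv (pn lev z s)) \<and>
   uv (pn lev z s') = uv (pn lev z s) \<and> tq lev z s' s \<and> of_bool (ip b a (yg (gv (pn lev z s')))) = o1" for s'
  unfolding prod_eq_iff fst_conv snd_conv node_W tq_W n nd0_def assms by blast
 then show ?thesis unfolding cls_def cc_def card_less_sum by presburger
qed

lemma rbad_num: "rbad z j a \<longleftrightarrow> (\<exists>s<B. nd0 (pn (Suc j) z s) \<and>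
  (cc (Suc j) z s a 1 + 2 * D < cc (Suc j) z s a 0 \<or> cc (Suc j) z s a 0 + 2 * D < cc (Suc j) z s a 1))"
proof -
 let ?W = "W (row z) (Suc j) (tau z)"
 let ?c = "\<lambda>g u t o1. card (cls (row z) (Suc j) (tau z) B (eg g) (u, t) (\<lambda>y. of_bool (ip b a y) = (o1 :: nat)))"
 have *: "(\<exists>g u t. ?W s = (Nd g u 0, t) \<and> (?c g u t 1 + 2 * D < ?c g u t 0 \<or> ?c g u t 0 + 2 * D < ?c g u t 1)) \<longleftrightarrow>
  nd0 (pn (Suc j) z s) \<and> (cc (Suc j) z s a 1 + 2 * D < cc (Suc j) z s a 0 \<or> cc (Suc j) z s a 0 + 2 * D < cc (Suc j) z s a 1)" for s
 proof (cases "\<exists>g u t. ?W s = (Nd g u 0, t)")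
  case True
  then obtain g u t where w: "?W s = (Nd g u 0, t)" by blast
  define X where "X g u t \<longleftrightarrow> ?c g u t 1 + 2 * D < ?c g u t 0 \<or> ?c g u t 0 + 2 * D < ?c g u t 1" for g u t
  have "(\<exists>g u t. ?W s = (Nd g u 0, t) \<and> X g u t) \<longleftrightarrow> X g u t" unfolding w by simp
  moreover have "nd0 (pn (Suc j) z s)" unfolding nd0_W w by simp
  moreover have "X g u t \<longleftrightarrow> cc (Suc j) z s a 1 + 2 * D < cc (Suc j) z s a 0 \<or> cc (Suc j) z s a 0 + 2 * D < cc (Suc j) z s a 1"
   unfolding X_def cc_cls[OF w] by (rule refl)
  ultimately show ?thesis unfolding X_def by blast
 next
  case False
  then show ?thesis unfolding nd0_W by (metis prod.collapse)
 qed
 have "rbad z j a \<longleftrightarrow> (\<exists>s<B. \<exists>g u t. ?W s = (Nd g u 0, t) \<and> (?c g u t 1 + 2 * D < ?c g u t 0 \<or> ?c g u t 0 + 2 * D < ?c g u t 1))"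
  unfolding rbad_def bad_def by simp
 then show ?thesis unfolding * .
qed

lemma lok_num: "lok z lev \<longleftrightarrow> btw (pn lev z B) \<and> gv (pn lev z B) = G"
proof -
 have "lok z lev \<longleftrightarrow> fst (W (row z) lev (tau z) B) = Btw G"
  unfolding lok_def fin_def using W_final_stays[of "row z" lev "tau z" _ B] by (metis le_refl)
 also have "\<dots> \<longleftrightarrow> btw (pn lev z B) \<and> gv (pn lev z B) = G" unfolding pn_dec[symmetric] dec_eq by simp
 finally show ?thesis .
qed

lemma code_num: "code z = (if lst (R + 1) (\<lambda>lev. \<not> lok z lev) \<le> R then lst (R + 1) (\<lambda>lev. \<not> lok z lev)
  else R + 1 + lst R (\<lambda>j. rbad z j (row z j)))"
proof (cases "\<exists>lev<R + 1. \<not> lok z lev")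
 case True
 then have l: "lst (R + 1) (\<lambda>lev. \<not> lok z lev) = (LEAST lev. \<not> lok z lev)" unfolding lst_eq by (rule if_P)
 obtain lev where lev: "lev < R + 1" "\<not> lok z lev" using True by blast
 have "(LEAST lev. \<not> lok z lev) \<le> lev" using lev(2) by (rule Least_le)
 then have le: "(LEAST lev. \<not> lok z lev) \<le> R" using lev(1) by simp
 have "\<exists>lev\<le>R. \<not> lok z lev" using lev by (intro exI[of _ lev]) simp
 then show ?thesis using le l unfolding code_def by (simp only: if_True)
next
 case False
 then have l: "lst (R + 1) (\<lambda>lev. \<not> lok z lev) = R + 1" unfolding lst_eq by (rule if_not_P)
 have n: "\<not> (\<exists>lev\<le>R. \<not> lok z lev)" using False by (auto simp: less_Suc_eq_le)
 have "(if \<exists>j<R. rbad z j (row z j) then R + 1 + (LEAST j. rbad z j (row z j)) else 2 * R + 1) = R + 1 + lst R (\<lambda>j. rbad z j (row z j))"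
 proof (cases "\<exists>j<R. rbad z j (row z j)")
  case True
  show ?thesis unfolding lst_eq if_P[OF True] by (rule refl)
 next
  case False
  show ?thesis unfolding lst_eq if_not_P[OF False] by simp
 qed
 then show ?thesis unfolding code_def if_not_P[OF n] l by simp
qed

lemma cnt_num: "cnt s0 z o1 = (\<Sum>s<B. of_bool (nd0 (pn 0 z s) \<and> uv (pn 0 z s) = s0 \<and>
  (\<forall>i<c. pt 0 z s i = (oT + i < ZL \<and> z ! (oT + i))) \<and> hl (eg (gv (pn 0 z s))) = o1))"
proof -
 have t: "(\<forall>i<c. pt 0 z s i = (oT + i < ZL \<and> z ! (oT + i))) \<longleftrightarrow> snd (W (row z) 0 (tau z) s) = tau z" for s
  using W_ok[of "tau z" "row z" 0 s] by (simp add: pt_W list_eq_iff_nth_eq ZL_def) (simp add: tau_def)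
 have "(\<exists>g. W (row z) 0 (tau z) s = (Nd g s0 0, tau z) \<and> hl (eg g) = o1) \<longleftrightarrow>
   nd0 (pn 0 z s) \<and> uv (pn 0 z s) = s0 \<and> (\<forall>i<c. pt 0 z s i = (oT + i < ZL \<and> z ! (oT + i))) \<and> hl (eg (gv (pn 0 z s))) = o1" for s
  unfolding t prod_eq_iff fst_conv snd_conv node_W nd0_def by blast
 then show ?thesis unfolding cnt_def card_less_sum by presburger
qed

end

end

section \<open>Further operations for programs\<close>

context cat begin

lemma cb_iff: "CB k P ==> CB k Q ==> CB k (\<lambda>x e z. P x e z = Q x e z)"
proof -
 assume a: "CB k P" "CB k Q"
 have "CB k (\<lambda>x e z. of_bool (P x e z) = (of_bool (Q x e z) :: nat))" by (rule cb_eq[OF a])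
 then show ?thesis by (rule cp_cong) auto
qed

lemma cf_min: "CF k F ==> CF k G ==> CF k (\<lambda>x e z. min (F x e z) (G x e z))"
 unfolding min_def by (intro cf_if cb_le)

lemma cb_even: "CF k F ==> CB k (\<lambda>x e z. even (F x e z))"
 using cb_not[OF cb_odd] by simp

lemma itr_bound:
 assumes "CF k M" "\<And>x e z i. length z = Z (length x) ==> i \<le> N x e z ==> T x e z i \<le> M x e z"
 shows "\<exists>K'. \<forall>x e z i. (\<forall>j<k. e j \<le> pb K x) \<longrightarrow> length z = Z (length x) \<longrightarrow> i \<le> N x e z \<longrightarrow> T x e z i \<le> pb K' x"
proof -
 from spec[OF pbd_CF[OF assms(1), unfolded pbd_def], of K]
 obtain K' where K': "\<forall>x e z. (\<forall>i<k. e i \<le> pb K x) \<longrightarrow> length z = Z (length x) \<longrightarrow> M x e z \<le> pb K' x" by (rule exE)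
 show ?thesis
 proof (intro exI[of _ K'] allI impI)
  fix x e z i assume a: "\<forall>j<k. e j \<le> pb K x" "length z = Z (length x)" "i \<le> N x e z"
  have "M x e z \<le> pb K' x" using K'[THEN spec, THEN spec, THEN spec, THEN mp, THEN mp, OF a(1,2)] .
  then show "T x e z i \<le> pb K' x" by (rule order_trans[OF assms(2)[OF a(2,3)]])
 qed
qed

lemma cf_lst:
 assumes "CF k N" "CB (Suc (Suc (Suc k))) (\<lambda>x e z. P x (e 0) (\<lambda>i. e (i + 3)) z)"
 shows "CF k (\<lambda>x e z. lst (N x e z) (\<lambda>i. P x i e z))"
proof -
 have r: "rec_nat 0 (\<lambda>i v. if v = i \<and> \<not> P i then Suc i else v) n = lst n P" for P n by (induction n) auto
 have "CF k (\<lambda>x e z. rec_nat 0 (\<lambda>i v. if v = i \<and> \<not> P x i e z then Suc i else v) (N x e z))"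
 proof (rule cf_rec[OF assms(1) cf_const _ pbd_CF[OF assms(1)]])
  show "CF (Suc (Suc (Suc k))) (\<lambda>x e z. if e 1 = e 0 \<and> \<not> P x (e 0) (\<lambda>i. e (i + 3)) z then Suc (e 0) else e 1)"
   by (intro cf_if cb_conj cb_eq cb_not assms(2) cf_Suc cf_v) auto
  fix x z :: "bool list" and e and i assume "i \<le> N x e z"
  then show "rec_nat 0 (\<lambda>i v. if v = i \<and> \<not> P x i e z then Suc i else v) i \<le> N x e z"
   unfolding r using lst_props[of i "\<lambda>i. P x i e z"] by linarith
 qed
 then show ?thesis unfolding r .
qed

end

lemma nth_list_update_if: "i < length l ==> l[j := v] ! i = (if i = j then v else l ! i)"
 by (simp add: nth_list_update)

context cat_tape begin

lemma cp_upd: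
 assumes "CF k F" "CF k I" "CB k V"
 shows "CP k (\<lambda>x e z. (F x e z, z[I x e z := V x e z]))"
proof (rule cp_let[OF assms(1), where H = "\<lambda>x v e z. (v, z[I x e z := V x e z])"])
 show "CP (Suc k) (\<lambda>x e z. (e 0, z[I x (\<lambda>i. e (i + 1)) z := V x (\<lambda>i. e (i + 1)) z]))"
  using cp_seq[OF cp_write[OF cf_wk1[OF assms(2)] cf_wk1[OF assms(3)]] cf_v[of 0 "Suc k"]] by simp
qed

text \<open>The power \<open>2 ^ i\<close> is computed as \<open>2 ^ w div 2 ^ (w - i)\<close>: the
  one power \<open>2 ^ w\<close> is available by hypothesis, and the rest is shifting.\<close>

lemma cf_getf:
 assumes "CF k F" "CF k w" "CF k (\<lambda>x e z. 2 ^ w x e z)"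
  "\<And>x e z. length z = Z (length x) ==> F x e z + w x e z \<le> Z (length x)"
 shows "CF k (\<lambda>x e z. getf z (F x e z) (w x e z))"
proof (rule cp_cong)
 show "CF k (\<lambda>x e z. \<Sum>i<w x e z. of_bool (F x e z + i < Z (length x) \<and> z ! (F x e z + i)) * (2 ^ w x e z div 2 ^ (w x e z - i)))"
  by (intro cf_sum cf_mult cb_read cf_add cf_shift cf_minus cf_wk3 assms(1-3) cf_v) simp_all
 fix x z :: "bool list" and e assume l: "length z = Z (length x)"
 have "getf z (F x e z) (w x e z) = (\<Sum>i<w x e z. of_bool (F x e z + i < Z (length x) \<and> z ! (F x e z + i)) * (2 ^ w x e z div 2 ^ (w x e z - i)))"
  unfolding getf_def
 proof (rule sum.cong[OF refl])
  fix i assume "i \<in> {..<w x e z}"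
  then have i: "i < w x e z" by simp
  have "(2::nat) ^ w x e z div 2 ^ (w x e z - i) = 2 ^ i" using i by (simp add: power_diff[symmetric] flip: power_diff)
  moreover have "F x e z + i < Z (length x)" using assms(4)[OF l, of e] i by simp
  ultimately show "of_bool (z ! (F x e z + i)) * 2 ^ i = (of_bool (F x e z + i < Z (length x) \<and> z ! (F x e z + i)) * (2 ^ w x e z div 2 ^ (w x e z - i)) :: nat)"
   by simp
 qed
 then show "(getf z (F x e z) (w x e z), z) = (\<Sum>i<w x e z. of_bool (F x e z + i < Z (length x) \<and> z ! (F x e z + i)) * (2 ^ w x e z div 2 ^ (w x e z - i)), z)"
  by simp
qed

lemma cp_setf:
 assumes "CF k F" "CF k w" "CF k V"
 shows "CP k (\<lambda>x e z. (0, setf z (F x e z) (w x e z) (V x e z)))"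
proof (rule cp_comp3[OF _ assms, where f = "\<lambda>x a b c z. (0, setf z a b c)"])
 have s: "(setf z a n c)[a + n := bit c n] = setf z a (Suc n) c" for z a n c
  by (rule nth_equalityI) (auto simp: nth_setf nth_list_update_if less_Suc_eq)
 have r: "itr (\<lambda>i v z. (0, z[e 0 + i := bit (e 2) i])) 0 z n = (0, setf z (e 0) n (e 2))" for e :: "nat \<Rightarrow> nat" and z n
 proof (induction n)
  case 0
  then show ?case by (auto simp: list_eq_iff_nth_eq nth_setf)
 qed (simp add: s)
 have "CP (Suc (Suc (Suc 0))) (\<lambda>x e z. itr (\<lambda>i v z. (0, z[e 0 + i := bit (e 2) i])) 0 z (e (Suc 0)))"
 proof (rule cp_iter[where G = "\<lambda>x i v e z. (0, z[e 0 + i := bit (e 2) i])" and I = "\<lambda>x e z. 0"])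
  show "CP (Suc (Suc (Suc (Suc (Suc (Suc 0)))))) (\<lambda>x e z. (0, z[e (0 + 3) + e 0 := bit (e (2 + 3)) (e 0)]))"
   by (intro cp_write cf_add cb_bit cf_v) auto
 qed (auto simp: r intro!: cf_v cf_const)
 then show "CP (Suc (Suc (Suc 0))) (\<lambda>x e z. (0, setf z (e 0) (e (Suc 0)) (e (Suc (Suc 0)))))"
  unfolding r by (simp add: numeral_2_eq_2)
qed

end

section \<open>Block operations as programs\<close>

text \<open>The parameters of a block become computable functions of the input. Programs for a block
  have to work under all views, since they run both on the blocks and on the virtual block.\<close>

locale comp = cat_tape UNIV Zx for Zx :: "nat \<Rightarrow> nat" +
 fixes Qx cx Rx bx Hx bex Dx s0x :: "bool list \<Rightarrow> nat" and hpx hlx rpx :: "bool list \<Rightarrow> nat \<Rightarrow> nat"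
  and dnx :: "bool list \<Rightarrow> nat \<Rightarrow> nat \<Rightarrow> bool \<Rightarrow> nat" and dwx :: "bool list \<Rightarrow> nat \<Rightarrow> nat \<Rightarrow> bool \<Rightarrow> bool"
 assumes blk: "\<And>x. blk (Qx x) (Rx x) (bx x) (hlx x) (rpx x) (dnx x) (Hx x) (bex x) (Dx x)"
  and ZLx: "\<And>x. Zx (length x) = Hx x + bex x + Rx x * bx x + cx x"
  and c0: "CF 0 (\<lambda>x e z. Qx x)" "CF 0 (\<lambda>x e z. cx x)" "CF 0 (\<lambda>x e z. Rx x)" "CF 0 (\<lambda>x e z. bx x)"
   "CF 0 (\<lambda>x e z. Hx x)" "CF 0 (\<lambda>x e z. bex x)" "CF 0 (\<lambda>x e z. Dx x)" "CF 0 (\<lambda>x e z. s0x x)"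
   "CF 0 (\<lambda>x e z. 2 ^ bx x)" "CF 0 (\<lambda>x e z. 2 ^ Hx x)" "CF 0 (\<lambda>x e z. 2 ^ bex x)"
  and c1: "CF (Suc 0) (\<lambda>x e z. hpx x (e 0))" "CF (Suc 0) (\<lambda>x e z. hlx x (e 0))" "CF (Suc 0) (\<lambda>x e z. rpx x (e 0))"
  and c3: "CF (Suc (Suc (Suc 0))) (\<lambda>x e z. dnx x (e 0) (e (Suc 0)) (e (Suc (Suc 0)) \<noteq> 0))"
   "CB (Suc (Suc (Suc 0))) (\<lambda>x e z. dwx x (e 0) (e (Suc 0)) (e (Suc (Suc 0)) \<noteq> 0))"

sublocale comp \<subseteq> I: blk "Qx x" "cx x" "Rx x" "bx x" "hpx x" "hlx x" "rpx x" "dnx x" "dwx x" "Hx x" "bex x" "Dx x" for x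
 by (rule blk)

context comp begin

lemma ZL: "Zx (length x) = I.ZL x"
 by (simp add: ZLx I.ZL_def I.oT_def I.oR_def)

lemmas p0 = c0[THEN cp_mono_arity[OF _ le0]]

lemma cf_hp: "CF k F ==> CF k (\<lambda>x e z. hpx x (F x e z))"
 by (rule cp_comp1[OF c1(1)])
lemma cf_hl: "CF k F ==> CF k (\<lambda>x e z. hlx x (F x e z))"
 by (rule cp_comp1[OF c1(2)])
lemma cf_rp: "CF k F ==> CF k (\<lambda>x e z. rpx x (F x e z))"
 by (rule cp_comp1[OF c1(3)])

lemma cf_dn: "CF k F ==> CF k G ==> CB k V ==> CF k (\<lambda>x e z. dnx x (F x e z) (G x e z) (V x e z))"
 using cp_comp3[OF c3(1), of k F G "\<lambda>x e z. of_bool (V x e z)"] by simp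
lemma cb_dw: "CF k F ==> CF k G ==> CB k V ==> CB k (\<lambda>x e z. dwx x (F x e z) (G x e z) (V x e z))"
 using cp_comp3[OF c3(2), of k F G "\<lambda>x e z. of_bool (V x e z)"] by simp

lemmas ar = cf_add cf_minus cf_mult cf_const cf_div cf_mod cf_Suc

lemma cf_S: "CF k (\<lambda>x e z. I.S x)" unfolding I.S_def by (intro ar p0)
lemma cf_G: "CF k (\<lambda>x e z. I.G x)" unfolding I.G_def by (intro ar p0)
lemma cf_Zc: "CF k (\<lambda>x e z. I.Zc x)" unfolding I.Zc_def by (intro ar p0 cf_S cf_G)
lemma cf_B: "CF k (\<lambda>x e z. I.B x)" unfolding I.B_def by (intro p0)
lemma cf_oR: "CF k (\<lambda>x e z. I.oR x)" unfolding I.oR_def by (intro ar p0)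
lemma cf_oT: "CF k (\<lambda>x e z. I.oT x)" unfolding I.oT_def by (intro ar p0 cf_oR)
lemma cf_ZL: "CF k (\<lambda>x e z. I.ZL x)" unfolding I.ZL_def by (intro ar p0 cf_oT)

lemmas ps = ar p0 cf_S cf_G cf_Zc cf_B cf_oR cf_oT cf_ZL

lemma cf_gv: "CF k F ==> CF k (\<lambda>x e z. I.gv x (F x e z))" unfolding I.gv_def by (intro ps)
lemma cf_uv: "CF k F ==> CF k (\<lambda>x e z. I.uv x (F x e z))" unfolding I.uv_def by (intro ps)
lemma cf_kv: "CF k F ==> CF k (\<lambda>x e z. I.kv x (F x e z))" unfolding I.kv_def by (intro ps)
lemma cb_btw: "CF k F ==> CB k (\<lambda>x e z. I.btw x (F x e z))" unfolding I.btw_def by (intro ps cb_eq)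
lemma cf_eg: "CF k F ==> CF k (\<lambda>x e z. I.eg x (F x e z))" unfolding I.eg_def by (intro ps)
lemma cf_yg: "CF k F ==> CF k (\<lambda>x e z. I.yg x (F x e z))" unfolding I.yg_def by (intro ps)
lemma cb_nd0: "CF k F ==> CB k (\<lambda>x e z. I.nd0 x (F x e z))"
 unfolding I.nd0_def by (intro cb_conj cb_not cb_btw cb_eq cf_kv cf_const)
lemma cf_encB: "CF k F ==> CF k (\<lambda>x e z. I.enc x (Btw (F x e z)))" unfolding I.enc.simps by (intro ps)
lemma cf_encN: "CF k F ==> CF k G ==> CF k H ==> CF k (\<lambda>x e z. I.enc x (Nd (F x e z) (G x e z) (H x e z)))"
 unfolding I.enc.simps by (intro ps)

lemma cb_ip: "CF k F ==> CF k G ==> CB k (\<lambda>x e z. ip (bx x) (F x e z) (G x e z))"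
 unfolding ip_def by (intro cb_odd cf_sum cb_conj cb_bit cf_wk3 p0 cf_v) simp_all

text \<open>Keeps the dummy read at offset 0, made by \<open>cf_row\<close> for an index out of
  range, inside the block.\<close>

lemma b_le: "Hx x + bx x \<le> I.ZL x"
proof -
 have "bx x \<le> bex x"
 proof (rule ccontr)
  assume "\<not> bx x \<le> bex x"
  then have "(2::nat) ^ bex x < 2 ^ bx x" by simp
  also have "\<dots> \<le> Qx x * 2 ^ bx x" using I.Qpos[of x] by simp
  also have "\<dots> \<le> (Qx x * 2 ^ bx x + 1) * (Qx x * (2 * Qx x + 1) + 1) * 2 ^ Hx x"
   using mult_le_mono[of "Qx x * 2 ^ bx x" "(Qx x * 2 ^ bx x + 1) * (Qx x * (2 * Qx x + 1) + 1)" 1 "2 ^ Hx x"] by simp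
  finally show False using I.tauH[of x] by simp
 qed
 then show ?thesis by (simp add: I.ZL_def I.oT_def I.oR_def)
qed

lemma cf_row:
 assumes "CF k J"
 shows "CF k (\<lambda>x e z. if J x e z < Rx x then I.row x z (J x e z) else 0)"
proof -
 have "CF k (\<lambda>x e z. getf z (if J x e z < Rx x then I.oR x + J x e z * bx x else 0) (bx x))"
  by (intro cf_getf cf_if cb_less assms ps) (use I.rows_le b_le in \<open>auto simp: ZL I.ZL_def intro: order_trans[OF _ le_add1] order_trans[OF le_add2]\<close>)
 then have "CF k (\<lambda>x e z. if J x e z < Rx x then getf z (if J x e z < Rx x then I.oR x + J x e z * bx x else 0) (bx x) else 0)"
  by (intro cf_if cb_less assms ps)
 then show ?thesis by (rule cp_cong) (auto simp: I.row_def)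
qed

lemma cb_sd:
 assumes "CF k F" "CF k J"
 shows "CB k (\<lambda>x e z. I.sd x (I.row x z) (F x e z) (J x e z))"
proof -
 have "CB k (\<lambda>x e z. J x e z < Rx x \<and> ip (bx x) (if J x e z < Rx x then I.row x z (J x e z) else 0) (F x e z))"
  by (intro cb_conj cb_less cb_ip cf_row assms ps)
 then show ?thesis by (rule cp_cong) (auto simp: I.sd_def)
qed

lemma cb_tau: "CF k F ==> CB k (\<lambda>x e z. F x e z < cx x \<and> I.tau x z ! F x e z)"
proof -
 assume a: "CF k F"
 have "CB k (\<lambda>x e z. F x e z < cx x \<and> (I.oT x + F x e z < Zx (length x) \<and> z ! (I.oT x + F x e z)))"
  by (intro cb_conj cb_less cb_read a ps)
 then show ?thesis by (rule cp_cong) (auto simp: I.tau_def ZL I.ZL_def)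
qed

lemma cf_sy:
 assumes "CF k F"
 shows "CF k (\<lambda>x e z. I.sy x (I.tau x z) (F x e z))"
proof -
 have "CF k (\<lambda>x e z. if F x e z < cx x then of_bool (F x e z < cx x \<and> I.tau x z ! F x e z) else 2)"
  by (intro cf_if cb_less cb_tau assms ps)
 then show ?thesis by (rule cp_cong) (auto simp: I.sy_def)
qed

lemma cf_oc: "CF k F ==> CF k (\<lambda>x e z. I.oc x (F x e z) (I.tau x z))"
 unfolding I.oc_def by (intro cb_tau cf_hp)

lemma cf_vsym: "CF k F ==> CF k (\<lambda>x e z. I.vsym x (F x e z))"
 unfolding I.vsym_def by (intro cf_if cb_less cf_hp ps cb_odd)

lemma cb_val:
 assumes "CF k L" "CF k F" "CF k U" "CF k K"
 shows "CB k (\<lambda>x e z. I.val x (I.row x z) (L x e z) (F x e z) (U x e z) (K x e z) (I.tau x z))"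
proof -
 let ?h = "\<lambda>x e z. hpx x (K x e z div 2)"
 let ?s = "\<lambda>x e z. I.sd x (I.row x z) (I.yg x (F x e z)) (rpx x (K x e z div 2))"
 have "CB k (\<lambda>x e z. hlx x (K x e z div 2) = 0 \<and> (?h x e z < cx x \<or> even (K x e z)) \<and> L x e z \<le> rpx x (K x e z div 2) \<and>
   dnx x (K x e z div 2) (I.vsym x (K x e z)) (?s x e z) = U x e z \<and>
   (?h x e z < cx x \<longrightarrow> (?h x e z < cx x \<and> I.tau x z ! ?h x e z) = dwx x (K x e z div 2) (I.vsym x (K x e z)) (?s x e z)))"
  by (intro cb_conj cb_disj cb_imp cb_iff cb_eq cb_less cb_le cb_even cf_hl cf_hp cf_rp cf_dn cb_dw cf_vsym cb_sd cf_yg cb_tau assms ps)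
 then show ?thesis by (rule cp_cong) (auto simp: I.val_def)
qed

lemmas wk = cf_gv cf_uv cf_kv cf_eg cf_yg cf_encB cf_encN cf_hp cf_hl cf_rp cf_dn cf_oc cf_sy cf_vsym

lemma cp_stp:
 assumes "CF k L" "CF k V"
 shows "CP k (\<lambda>x e z. I.stp x (L x e z) (V x e z) z)"
proof (rule cp_cong)
 fix x z :: "bool list" and e assume "length z = Zx (length x)"
 then show "I.stp x (L x e z) (V x e z) z = (if I.btw x (V x e z) then (if I.gv x (V x e z) < I.G x then if hlx x (I.eg x (I.gv x (V x e z))) \<noteq> 0
   then (I.enc x (Nd (I.gv x (V x e z)) (I.eg x (I.gv x (V x e z))) 0), z)
   else (I.enc x (Btw (Suc (I.gv x (V x e z)))), z) else (I.enc x (Btw (I.gv x (V x e z))), z))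
  else if I.kv x (V x e z) < 2 * Qx x then if I.val x (I.row x z) (L x e z) (I.gv x (V x e z)) (I.uv x (V x e z)) (I.kv x (V x e z)) (I.tau x z)
   then (I.enc x (Nd (I.gv x (V x e z)) (I.kv x (V x e z) div 2) 0), z[I.oT x + hpx x (I.kv x (V x e z) div 2) := odd (I.kv x (V x e z))])
   else (I.enc x (Nd (I.gv x (V x e z)) (I.uv x (V x e z)) (Suc (I.kv x (V x e z)))), z)
  else if hlx x (I.uv x (V x e z)) \<noteq> 0 then (I.enc x (Btw (Suc (I.gv x (V x e z)))), z)
  else (I.enc x (Nd (I.gv x (V x e z)) (dnx x (I.uv x (V x e z)) (I.sy x (I.tau x z) (hpx x (I.uv x (V x e z))))
    (I.sd x (I.row x z) (I.yg x (I.gv x (V x e z))) (rpx x (I.uv x (V x e z))))) (Suc (2 * I.uv x (V x e z) + I.oc x (I.uv x (V x e z)) (I.tau x z)))),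
   z[I.oT x + hpx x (I.uv x (V x e z)) := dwx x (I.uv x (V x e z)) (I.sy x (I.tau x z) (hpx x (I.uv x (V x e z))))
    (I.sd x (I.row x z) (I.yg x (I.gv x (V x e z))) (rpx x (I.uv x (V x e z))))]))"
  by (intro I.stp_eq) (simp add: ZL)
qed (intro cp_ifb cp_upd cb_btw cb_less cb_val cb_not cb_eq cb_odd cb_dw cb_sd wk assms ps)

lemma cp_bst:
 assumes "CF k L" "CF k V"
 shows "CP k (\<lambda>x e z. I.bst x (L x e z) (V x e z) z)"
proof (rule cp_cong)
 fix x z :: "bool list" and e assume "length z = Zx (length x)"
 then show "I.bst x (L x e z) (V x e z) z = (if I.btw x (V x e z) then (if I.gv x (V x e z) = 0 then (min (I.Zc x) (I.enc x (Btw (I.gv x (V x e z)))), z)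
   else if hlx x (I.eg x (I.gv x (V x e z) - 1)) \<noteq> 0 then (min (I.Zc x) (I.enc x (Nd (I.gv x (V x e z) - 1) (I.eg x (I.gv x (V x e z) - 1)) (2 * Qx x))), z)
   else (min (I.Zc x) (I.enc x (Btw (I.gv x (V x e z) - 1))), z))
  else if I.kv x (V x e z) = 0 then if hlx x (I.uv x (V x e z)) \<noteq> 0 then (min (I.Zc x) (I.enc x (Btw (I.gv x (V x e z)))), z)
   else (min (I.Zc x) (I.enc x (Nd (I.gv x (V x e z)) (dnx x (I.uv x (V x e z)) (I.sy x (I.tau x z) (hpx x (I.uv x (V x e z))))
    (I.sd x (I.row x z) (I.yg x (I.gv x (V x e z))) (rpx x (I.uv x (V x e z))))) (2 * I.uv x (V x e z) + I.oc x (I.uv x (V x e z)) (I.tau x z)))),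
   z[I.oT x + hpx x (I.uv x (V x e z)) := dwx x (I.uv x (V x e z)) (I.sy x (I.tau x z) (hpx x (I.uv x (V x e z))))
    (I.sd x (I.row x z) (I.yg x (I.gv x (V x e z))) (rpx x (I.uv x (V x e z))))])
  else if I.val x (I.row x z) (L x e z) (I.gv x (V x e z)) (I.uv x (V x e z)) (I.kv x (V x e z) - 1) (I.tau x z)
   then (min (I.Zc x) (I.enc x (Nd (I.gv x (V x e z)) ((I.kv x (V x e z) - 1) div 2) (2 * Qx x))),
    z[I.oT x + hpx x ((I.kv x (V x e z) - 1) div 2) := odd (I.kv x (V x e z) - 1)])
   else (min (I.Zc x) (I.enc x (Nd (I.gv x (V x e z)) (I.uv x (V x e z)) (I.kv x (V x e z) - 1))), z))"
  by (intro I.bst_eq) (simp add: ZL)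
qed (intro cp_ifb cp_upd cb_btw cb_less cb_val cb_not cb_eq cb_odd cb_dw cb_sd cf_min wk assms ps)

lemma cp_wlk:
 assumes "CF k L" "CF k N"
 shows "CP k (\<lambda>x e z. I.wlk x (L x e z) z (N x e z))"
proof (rule cp_comp2[OF _ assms, where f = "\<lambda>x a b z. I.wlk x a z b"])
 show "CP (Suc (Suc 0)) (\<lambda>x e z. I.wlk x (e 0) z (e (Suc 0)))"
  unfolding I.wlk_def
 proof (rule cp_iter[where G = "\<lambda>x i v e z. I.stp x (e 0) v z" and I = "\<lambda>x e z. I.enc x (Btw 0)"])
  show "CP (Suc (Suc (Suc (Suc (Suc 0))))) (\<lambda>x e z. I.stp x (e (0 + 3)) (e 1) z)"
   by (intro cp_stp cf_v) auto
  fix K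
  show "\<exists>K'. \<forall>x e z i. (\<forall>j<Suc (Suc 0). e j \<le> pb K x) \<longrightarrow> length z = Zx (length x) \<longrightarrow> i \<le> e (Suc 0) \<longrightarrow>
    fst (itr (\<lambda>i v z. I.stp x (e 0) v z) (I.enc x (Btw 0)) z i) \<le> pb K' x"
  proof (rule itr_bound[OF cf_Zc])
   fix x z :: "bool list" and e :: "nat \<Rightarrow> nat" and i assume a: "length z = Zx (length x)"
   have "length z = I.ZL x" using a by (simp add: ZL)
   then have "fst (I.wlk x (e 0) z i) = I.enc x (fst (I.W x (I.row x z) (e 0) (I.tau x z) i))" by (simp add: I.wlk_W)
   also have "\<dots> < I.Zc x" using I.W_ok[OF I.length_tau] by (intro I.enc_less) simp
   finally show "fst (itr (\<lambda>i v z. I.stp x (e 0) v z) (I.enc x (Btw 0)) z i) \<le> I.Zc x" by (simp add: I.wlk_def)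
  qed
 qed (intro cf_encB cf_v cf_const; simp)+
qed

lemma cp_bwk:
 assumes "CF k L" "CF k V" "CF k N"
 shows "CP k (\<lambda>x e z. I.bwk x (L x e z) (V x e z) z (N x e z))"
proof (rule cp_comp3[OF _ assms, where f = "\<lambda>x a v b z. I.bwk x a v z b"])
 show "CP (Suc (Suc (Suc 0))) (\<lambda>x e z. I.bwk x (e 0) (e (Suc 0)) z (e (Suc (Suc 0))))"
  unfolding I.bwk_def
 proof (rule cp_iter[where G = "\<lambda>x i v e z. I.bst x (e 0) v z" and I = "\<lambda>x e z. e (Suc 0)"])
  show "CP (Suc (Suc (Suc (Suc (Suc (Suc 0)))))) (\<lambda>x e z. I.bst x (e (0 + 3)) (e 1) z)"
   by (intro cp_bst cf_v) auto
  fix K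
  have B: "CF (Suc (Suc (Suc 0))) (\<lambda>x e z. e (Suc 0) + I.Zc x)" by (intro cf_add cf_v cf_Zc) simp
  show "\<exists>K'. \<forall>x e z i. (\<forall>j<Suc (Suc (Suc 0)). e j \<le> pb K x) \<longrightarrow> length z = Zx (length x) \<longrightarrow> i \<le> e (Suc (Suc 0)) \<longrightarrow>
    fst (itr (\<lambda>i v z. I.bst x (e 0) v z) (e (Suc 0)) z i) \<le> pb K' x"
  proof (rule itr_bound[OF B])
   fix x z :: "bool list" and e :: "nat \<Rightarrow> nat" and i
   have "fst (I.bst x lev v z') \<le> I.Zc x" for lev v z' by (auto simp: I.bst_def split: prod.split)
   then have "fst (I.bst x lev v z') \<le> e (Suc 0) + I.Zc x" for lev v z' by (rule trans_le_add2)
   then show "fst (itr (\<lambda>i v z. I.bst x (e 0) v z) (e (Suc 0)) z i) \<le> e (Suc 0) + I.Zc x" by (cases i) simp_all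
  qed
 qed (intro cf_v; simp)+
qed

lemma cp_und:
 assumes "CF k L" "CF k V" "CF k N"
 shows "CP k (\<lambda>x e z. I.und x (L x e z) (V x e z) z (N x e z))"
proof (rule cp_comp3[OF _ assms, where f = "\<lambda>x a v b z. I.und x a v z b"])
 define U where "U x lev w z = (if w mod (I.Zc x + 1) = I.enc x (Btw 0) then (w, z)
   else ((w div (I.Zc x + 1) + 1) * (I.Zc x + 1) + fst (I.bst x lev (w mod (I.Zc x + 1)) z), snd (I.bst x lev (w mod (I.Zc x + 1)) z)))" for x lev w z
 have "CP (Suc (Suc (Suc 0))) (\<lambda>x e z. itr (\<lambda>i v z. U x (e 0) v z) (e (Suc 0)) z (e (Suc (Suc 0))))"
 proof (rule cp_iter[where G = "\<lambda>x i v e z. U x (e 0) v z" and I = "\<lambda>x e z. e (Suc 0)"])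
  have "CP (Suc (Suc (Suc (Suc (Suc (Suc 0)))))) (\<lambda>x e z. ((e 1 div (I.Zc x + 1) + 1) * (I.Zc x + 1) + fst (I.bst x (e (0 + 3)) (e 1 mod (I.Zc x + 1)) z),
    snd (I.bst x (e (0 + 3)) (e 1 mod (I.Zc x + 1)) z)))"
  proof (rule cp_bind'[where H = "\<lambda>x v e z. ((e 1 div (I.Zc x + 1) + 1) * (I.Zc x + 1) + v, z)"])
   show "CP (Suc (Suc (Suc (Suc (Suc (Suc 0)))))) (\<lambda>x e z. I.bst x (e (0 + 3)) (e 1 mod (I.Zc x + 1)) z)"
    by (intro cp_bst ps cf_v) simp_all
   show "CF (Suc (Suc (Suc (Suc (Suc (Suc (Suc 0))))))) (\<lambda>x e z. (e (1 + 1) div (I.Zc x + 1) + 1) * (I.Zc x + 1) + e 0)"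
    by (intro ps cf_v) simp_all
  qed
  then show "CP (Suc (Suc (Suc (Suc (Suc (Suc 0)))))) (\<lambda>x e z. U x (e (0 + 3)) (e 1) z)"
   unfolding U_def by (intro cp_ifb cb_eq cf_encB ps cf_v) simp_all
  fix K
  have B: "CF (Suc (Suc (Suc 0))) (\<lambda>x e z. (e (Suc 0) + e (Suc (Suc 0)) + 1) * (I.Zc x + 1))" by (intro ps cf_v) simp_all
  show "\<exists>K'. \<forall>x e z i. (\<forall>j<Suc (Suc (Suc 0)). e j \<le> pb K x) \<longrightarrow> length z = Zx (length x) \<longrightarrow> i \<le> e (Suc (Suc 0)) \<longrightarrow>
    fst (itr (\<lambda>i v z. U x (e 0) v z) (e (Suc 0)) z i) \<le> pb K' x"
  proof (rule itr_bound[OF B])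
   fix x z :: "bool list" and e :: "nat \<Rightarrow> nat" and i assume a: "i \<le> e (Suc (Suc 0))"
   define M where "M = I.Zc x + 1"
   have M0: "0 < M" by (simp add: M_def)
   \<comment> \<open>One round raises the quotient by at most one, because the new remainder is
     capped. So the packed number grows by at most \<open>M\<close> per round.\<close>
   have st: "fst (U x lev w z') < (m + 1) * M" if w: "w < m * M" for lev w z' m
   proof (cases "w mod M = I.enc x (Btw 0)")
    case True
    then have "fst (U x lev w z') = w" unfolding U_def M_def[symmetric] by simp
    then show ?thesis using w by simp
   next
    case False
    have "w div M < m" using w by (rule less_mult_imp_div_less)
    then have 1: "(w div M + 1) * M \<le> m * M" by (intro mult_le_mono1) simp
    have 2: "fst (I.bst x lev (w mod M) z') < M" by (auto simp: I.bst_def M_def split: prod.split)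
    have "fst (U x lev w z') = (w div M + 1) * M + fst (I.bst x lev (w mod M) z')"
     using False unfolding U_def M_def[symmetric] by simp
    also have "\<dots> < m * M + M" using 1 2 by (rule add_le_less_mono)
    finally show ?thesis by simp
   qed
   have "fst (itr (\<lambda>i v z. U x (e 0) v z) (e (Suc 0)) z i) < (e (Suc 0) + 1 + i) * M"
   proof (induction i)
    case 0
    have "e (Suc 0) < (e (Suc 0) + 1) * 1" by simp
    also have "\<dots> \<le> (e (Suc 0) + 1) * M" using M0 by (intro mult_le_mono2) simp
    finally show ?case by simp
   next
    case (Suc i)
    from st[OF this] show ?case by simp
   qed
   also have "\<dots> \<le> (e (Suc 0) + e (Suc (Suc 0)) + 1) * M" using a by (intro mult_le_mono1) simp
   finally show "fst (itr (\<lambda>i v z. U x (e 0) v z) (e (Suc 0)) z i) \<le> (e (Suc 0) + e (Suc (Suc 0)) + 1) * (I.Zc x + 1)"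
    by (simp add: M_def)
  qed
 qed (intro cf_v; simp)+
 then show "CP (Suc (Suc (Suc 0))) (\<lambda>x e z. I.und x (e 0) (e (Suc 0)) z (e (Suc (Suc 0))))"
  unfolding I.und_def U_def .
qed

text \<open>Walk forward, keep the number of the position, walk back: the value is read off although
  the tape ends up unchanged.\<close>

lemma cf_pn:
 assumes "CF k L" "CF k N"
 shows "CF k (\<lambda>x e z. I.pn x (L x e z) z (N x e z))"
proof (rule cp_comp2[OF _ assms, where f = "\<lambda>x a b z. (I.pn x a z b, z)"])
 have "CP (Suc (Suc 0)) (\<lambda>x e z. (fst (I.wlk x (e 0) z (e (Suc 0))), snd (I.bwk x (e 0) (fst (I.wlk x (e 0) z (e (Suc 0)))) (snd (I.wlk x (e 0) z (e (Suc 0)))) (e (Suc 0)))))"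
 proof (rule cp_bind'[where H = "\<lambda>x v e z. (v, snd (I.bwk x (e 0) v z (e (Suc 0))))"])
  show "CP (Suc (Suc 0)) (\<lambda>x e z. I.wlk x (e 0) z (e (Suc 0)))" by (intro cp_wlk cf_v) simp_all
  show "CP (Suc (Suc (Suc 0))) (\<lambda>x e z. (e 0, snd (I.bwk x (e (0 + 1)) (e 0) z (e (Suc 0 + 1)))))"
   by (rule cp_seq[OF cp_bwk[OF cf_v cf_v cf_v] cf_v[of 0], simplified]; simp)
 qed
 then show "CF (Suc (Suc 0)) (\<lambda>x e z. I.pn x (e 0) z (e (Suc 0)))"
  by (rule cp_cong) (simp add: I.bwk_wlk ZL I.pn_def)
qed

lemma cb_pt:
 assumes "CF k L" "CF k N" "CF k J"
 shows "CB k (\<lambda>x e z. I.pt x (L x e z) z (N x e z) (J x e z))"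
proof (rule cp_comp3[OF _ assms, where f = "\<lambda>x a b j z. (of_bool (I.pt x a z b j), z)"])
 have "CP (Suc (Suc (Suc 0))) (\<lambda>x e z. (of_bool (I.oT x + e (Suc (Suc 0)) < Zx (length x) \<and> snd (I.wlk x (e 0) z (e (Suc 0))) ! (I.oT x + e (Suc (Suc 0)))),
   snd (I.bwk x (e 0) (fst (I.wlk x (e 0) z (e (Suc 0)))) (snd (I.wlk x (e 0) z (e (Suc 0)))) (e (Suc 0)))))"
 proof (rule cp_bind'[where H = "\<lambda>x v e z. (of_bool (I.oT x + e (Suc (Suc 0)) < Zx (length x) \<and> z ! (I.oT x + e (Suc (Suc 0)))), snd (I.bwk x (e 0) v z (e (Suc 0))))"])
  show "CP (Suc (Suc (Suc 0))) (\<lambda>x e z. I.wlk x (e 0) z (e (Suc 0)))" by (intro cp_wlk cf_v) simp_all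
  show "CP (Suc (Suc (Suc (Suc 0)))) (\<lambda>x e z. (of_bool (I.oT x + e (Suc (Suc 0) + 1) < Zx (length x) \<and> z ! (I.oT x + e (Suc (Suc 0) + 1))),
    snd (I.bwk x (e (0 + 1)) (e 0) z (e (Suc 0 + 1)))))"
  proof (rule cp_let[where F = "\<lambda>x e z. of_bool (I.oT x + e (Suc (Suc 0) + 1) < Zx (length x) \<and> z ! (I.oT x + e (Suc (Suc 0) + 1)))"
    and H = "\<lambda>x v e z. (v, snd (I.bwk x (e (0 + 1)) (e 0) z (e (Suc 0 + 1))))"])
   show "CB (Suc (Suc (Suc (Suc 0)))) (\<lambda>x e z. I.oT x + e (Suc (Suc 0) + 1) < Zx (length x) \<and> z ! (I.oT x + e (Suc (Suc 0) + 1)))"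
    by (intro cb_read ps cf_v) simp_all
   show "CP (Suc (Suc (Suc (Suc (Suc 0))))) (\<lambda>x e z. (e 0, snd (I.bwk x (e (0 + 1 + 1)) (e (0 + 1)) z (e (Suc 0 + 1 + 1)))))"
    by (rule cp_seq[OF cp_bwk[OF cf_v cf_v cf_v] cf_v[of 0], simplified]; simp)
  qed
 qed
 then show "CB (Suc (Suc (Suc 0))) (\<lambda>x e z. I.pt x (e 0) z (e (Suc 0)) (e (Suc (Suc 0))))"
  by (rule cp_cong) (simp add: I.bwk_wlk ZL I.pt_def)
qed

end

lemma lst_cong: "(\<And>i. i < n ==> P i = P' i) ==> lst n P = lst n P'"
 by (induction n) auto

lemma card_lt_sum: "card {s. s < (n::nat) \<and> P s} = (\<Sum>s<n. of_bool (P s))"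
 by (simp add: Collect_conj_eq lessThan_def)

context comp begin

lemma cb_tq:
 assumes "CF k L" "CF k N" "CF k N'"
 shows "CB k (\<lambda>x e z. I.tq x (L x e z) z (N x e z) (N' x e z))"
 unfolding I.tq_def by (intro cb_all cb_iff cb_pt assms[THEN cf_wk3] p0 cf_v) simp_all

lemma cf_cc:
 assumes "CF k L" "CF k N" "CF k A" "CF k Oo"
 shows "CF k (\<lambda>x e z. I.cc x (L x e z) z (N x e z) (A x e z) (Oo x e z))"
 unfolding I.cc_def
 by (intro cf_sum cb_conj cb_nd0 cb_eq cb_tq cb_ip cf_yg cf_eg cf_gv cf_uv cf_pn assms[THEN cf_wk3] cf_B cf_v) simp_all

lemma cb_rbad:
 assumes "CF k J" "CF k A"
 shows "CB k (\<lambda>x e z. I.rbad x z (J x e z) (A x e z))"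
proof (rule cp_cong)
 show "CB k (\<lambda>x e z. \<exists>s<I.B x. I.nd0 x (I.pn x (Suc (J x e z)) z s) \<and>
   (I.cc x (Suc (J x e z)) z s (A x e z) 1 + 2 * Dx x < I.cc x (Suc (J x e z)) z s (A x e z) 0 \<or>
   I.cc x (Suc (J x e z)) z s (A x e z) 0 + 2 * Dx x < I.cc x (Suc (J x e z)) z s (A x e z) 1))"
  by (intro cb_ex cb_conj cb_disj cb_nd0 cb_less cf_pn cf_cc assms[THEN cf_wk3] cf_B cf_v ps) simp_all
 fix x z :: "bool list" and e assume "length z = Zx (length x)"
 then have l: "length z = I.ZL x" by (simp add: ZL)
 show "(of_bool (I.rbad x z (J x e z) (A x e z)), z) = (of_bool (\<exists>s<I.B x. I.nd0 x (I.pn x (Suc (J x e z)) z s) \<and>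
   (I.cc x (Suc (J x e z)) z s (A x e z) 1 + 2 * Dx x < I.cc x (Suc (J x e z)) z s (A x e z) 0 \<or>
   I.cc x (Suc (J x e z)) z s (A x e z) 0 + 2 * Dx x < I.cc x (Suc (J x e z)) z s (A x e z) 1)), z)"
  unfolding I.rbad_num[OF l] by (rule refl)
qed

lemma cb_lok:
 assumes "CF k L"
 shows "CB k (\<lambda>x e z. I.lok x z (L x e z))"
proof (rule cp_cong)
 show "CB k (\<lambda>x e z. I.btw x (I.pn x (L x e z) z (I.B x)) \<and> I.gv x (I.pn x (L x e z) z (I.B x)) = I.G x)"
  by (intro cb_conj cb_btw cb_eq cf_gv cf_pn cf_B cf_G assms)
 fix x z :: "bool list" and e assume "length z = Zx (length x)"
 then have l: "length z = I.ZL x" by (simp add: ZL)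
 show "(of_bool (I.lok x z (L x e z)), z) = (of_bool (I.btw x (I.pn x (L x e z) z (I.B x)) \<and> I.gv x (I.pn x (L x e z) z (I.B x)) = I.G x), z)"
  unfolding I.lok_num[OF l] by (rule refl)
qed

lemma cf_code: "CF k (\<lambda>x e z. I.code x z)"
proof (rule cp_cong)
 let ?r = "\<lambda>x z j. if j < Rx x then I.row x z j else 0"
 show "CF k (\<lambda>x e z. if lst (Rx x + 1) (\<lambda>lev. \<not> I.lok x z lev) \<le> Rx x then lst (Rx x + 1) (\<lambda>lev. \<not> I.lok x z lev)
  else Rx x + 1 + lst (Rx x) (\<lambda>j. I.rbad x z j (?r x z j)))"
  by (intro cf_if cb_le cf_lst cb_not cb_lok cb_rbad cf_row ps cf_v) simp_all
 fix x z :: "bool list" and e :: "nat \<Rightarrow> nat" assume "length z = Zx (length x)"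
 then have l: "length z = I.ZL x" by (simp add: ZL)
 have "lst (Rx x) (\<lambda>j. I.rbad x z j (?r x z j)) = lst (Rx x) (\<lambda>j. I.rbad x z j (I.row x z j))" by (rule lst_cong) simp
 then show "(I.code x z, z) = (if lst (Rx x + 1) (\<lambda>lev. \<not> I.lok x z lev) \<le> Rx x then lst (Rx x + 1) (\<lambda>lev. \<not> I.lok x z lev)
  else Rx x + 1 + lst (Rx x) (\<lambda>j. I.rbad x z j (?r x z j)), z)"
  unfolding I.code_num[OF l] by (simp only:)
qed

lemma cb_good: "CB k (\<lambda>x e z. I.good x z)"
 unfolding I.good_def by (intro cb_eq cf_code ps)

lemma cf_rank:
 assumes "CF k J" "CF k A"
 shows "CF k (\<lambda>x e z. I.rank x z (J x e z) (A x e z))"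
 unfolding I.rank_def card_lt_sum by (intro cf_sum cb_rbad assms(1)[THEN cf_wk3] assms(2) cf_v) simp

lemma cf_cnt: "CF k (\<lambda>x e z. I.cnt x (s0x x) z o1)"
proof (rule cp_cong)
 show "CF k (\<lambda>x e z. \<Sum>s<I.B x. of_bool (I.nd0 x (I.pn x 0 z s) \<and> I.uv x (I.pn x 0 z s) = s0x x \<and>
   (\<forall>i<cx x. I.pt x 0 z s i = (I.oT x + i < Zx (length x) \<and> z ! (I.oT x + i))) \<and> hlx x (I.eg x (I.gv x (I.pn x 0 z s))) = o1))"
  by (intro cf_sum cb_conj cb_nd0 cb_eq cb_all cb_iff cb_pt cb_read cf_hl cf_eg cf_gv cf_uv cf_pn cf_B ps cf_v) simp_all
 fix x z :: "bool list" and e :: "nat \<Rightarrow> nat" assume "length z = Zx (length x)"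
 then have l: "length z = I.ZL x" by (simp add: ZL)
 show "(I.cnt x (s0x x) z o1, z) = (\<Sum>s<I.B x. of_bool (I.nd0 x (I.pn x 0 z s) \<and> I.uv x (I.pn x 0 z s) = s0x x \<and>
   (\<forall>i<cx x. I.pt x 0 z s i = (I.oT x + i < Zx (length x) \<and> z ! (I.oT x + i))) \<and> hlx x (I.eg x (I.gv x (I.pn x 0 z s))) = o1), z)"
  unfolding I.cnt_num[OF l] ZL by (rule refl)
qed

lemma cb_ans: "CB k (\<lambda>x e z. I.ans x (s0x x) z)"
 unfolding I.ans_def by (intro cb_less cf_cnt)

lemma cf_hdr: "CF k (\<lambda>x e z. I.hdr x z)"
 unfolding I.hdr_def by (intro cf_getf ps) (auto simp: ZLx)

lemma cf_kap: "CF k (\<lambda>x e z. getf z (Hx x) (bex x))"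
 by (intro cf_getf ps) (auto simp: ZLx)

lemma cp_setf2:
 assumes "CF k F" "CF k w" "CF k V" "CF k V'"
 shows "CP k (\<lambda>x e z. (0, setf (setf z (F x e z) (w x e z) (V x e z)) 0 (Hx x) (V' x e z)))"
proof (rule cp_let[OF assms(4), where H = "\<lambda>x v e z. (0, setf (setf z (F x e z) (w x e z) (V x e z)) 0 (Hx x) v)"])
 have "CP (Suc k) (\<lambda>x e z. (0, setf z (F x (\<lambda>i. e (i + 1)) z) (w x (\<lambda>i. e (i + 1)) z) (V x (\<lambda>i. e (i + 1)) z)))"
  by (intro cp_setf assms[THEN cf_wk1])
 from cp_seq[OF this cp_setf[OF cf_const p0(5) cf_v[of 0 "Suc k"], of 0]]
 show "CP (Suc k) (\<lambda>x e z. (0, setf (setf z (F x (\<lambda>i. e (i + 1)) z) (w x (\<lambda>i. e (i + 1)) z) (V x (\<lambda>i. e (i + 1)) z)) 0 (Hx x) (e 0)))" by simp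
qed

text \<open>On a good block the code would point past the last row, so compression is computed only
  where there is a defect.\<close>

lemma cp_cmp: "CP k (\<lambda>x e z. if I.good x z then (0, z) else (0, I.cmp x z))"
proof (rule cp_cong)
 let ?r = "\<lambda>x z j. if j < Rx x then I.row x z j else 0"
 let ?j = "\<lambda>x z. I.code x z - Rx x - 1"
 have "CP (Suc (Suc (Suc (Suc 0)))) (\<lambda>x e z. (0, setf (setf z (Hx x) (bex x) (e 0 * 2 ^ Hx x + e (0 + 1))) 0 (Hx x) (2 * e (Suc (Suc 0) + 1))))"
  by (intro cp_setf2 ps cf_v) simp_all
 then have "CP (Suc (Suc (Suc 0))) (\<lambda>x e z. (0, setf (setf (snd (I.wlk x (e (Suc (Suc 0))) z (e (Suc 0)))) (Hx x) (bex x)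
   (fst (I.wlk x (e (Suc (Suc 0))) z (e (Suc 0))) * 2 ^ Hx x + e 0)) 0 (Hx x) (2 * e (Suc (Suc 0)))))"
  by (intro cp_bind'[where H = "\<lambda>x v e z. (0, setf (setf z (Hx x) (bex x) (v * 2 ^ Hx x + e 0)) 0 (Hx x) (2 * e (Suc (Suc 0))))" and G = "\<lambda>x e z. I.wlk x (e (Suc (Suc 0))) z (e (Suc 0))"]
    cp_wlk cf_v) simp_all
 from cp_comp3[OF this cf_hdr cf_kap cf_code, of k]
 have 1: "CP k (\<lambda>x e z. (0, setf (setf (snd (I.wlk x (I.code x z) z (getf z (Hx x) (bex x)))) (Hx x) (bex x)
   (fst (I.wlk x (I.code x z) z (getf z (Hx x) (bex x))) * 2 ^ Hx x + I.hdr x z)) 0 (Hx x) (2 * I.code x z)))" .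
 have 2: "CP k (\<lambda>x e z. (0, setf (setf z (I.oR x + ?j x z * bx x) (bx x) (I.rank x z (?j x z) (?r x z (?j x z)) * 2 ^ Hx x + I.hdr x z)) 0 (Hx x) (2 * I.code x z)))"
  by (intro cp_setf2 ps cf_rank cf_row cf_hdr cf_code)
 show "CP k (\<lambda>x e z. if I.good x z then (0, z) else if I.code x z \<le> Rx x then
   (0, setf (setf (snd (I.wlk x (I.code x z) z (getf z (Hx x) (bex x)))) (Hx x) (bex x)
    (fst (I.wlk x (I.code x z) z (getf z (Hx x) (bex x))) * 2 ^ Hx x + I.hdr x z)) 0 (Hx x) (2 * I.code x z))
   else (0, setf (setf z (I.oR x + ?j x z * bx x) (bx x) (I.rank x z (?j x z) (?r x z (?j x z)) * 2 ^ Hx x + I.hdr x z)) 0 (Hx x) (2 * I.code x z)))"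
  by (intro cp_ifb cb_good cb_le cf_code ps 1 2)
 fix x z :: "bool list" and e :: "nat \<Rightarrow> nat" assume "length z = Zx (length x)"
 then have l: "length z = I.ZL x" by (simp add: ZL)
 show "(if I.good x z then (0, z) else (0, I.cmp x z)) = (if I.good x z then (0, z) else if I.code x z \<le> Rx x then
   (0, setf (setf (snd (I.wlk x (I.code x z) z (getf z (Hx x) (bex x)))) (Hx x) (bex x)
    (fst (I.wlk x (I.code x z) z (getf z (Hx x) (bex x))) * 2 ^ Hx x + I.hdr x z)) 0 (Hx x) (2 * I.code x z))
   else (0, setf (setf z (I.oR x + ?j x z * bx x) (bx x) (I.rank x z (?j x z) (?r x z (?j x z)) * 2 ^ Hx x + I.hdr x z)) 0 (Hx x) (2 * I.code x z)))"
 proof (cases "I.good x z")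
  case False
  show ?thesis
  proof (cases "I.code x z \<le> Rx x")
   case True
   then show ?thesis using False by (simp add: I.cmp_def I.wlk_W[OF l] split: prod.split)
  next
   case F: False
   have "?j x z < Rx x" using I.code_le[OF False] F by linarith
   then show ?thesis using False F by (simp add: I.cmp_def)
  qed
 qed simp
qed

lemma cp_dcm: "CP k (\<lambda>x e z. (0, I.dcm x z))"
proof (rule cp_cong)
 let ?r = "\<lambda>x z j. if j < Rx x then I.row x z j else 0"
 let ?f = "\<lambda>x z. I.hdr x z div 2"
 let ?j = "\<lambda>x z. ?f x z - Rx x - 1"
 let ?v = "\<lambda>x z. ?r x z (?j x z)"
 let ?s = "\<lambda>x z. min (I.Zc x) (getf z (Hx x) (bex x) div 2 ^ Hx x)"
 have "CP (Suc (Suc (Suc (Suc 0)))) (\<lambda>x e z. (0, setf (setf z (Hx x) (bex x) (e 0 div (I.Zc x + 1))) 0 (Hx x) (e (Suc (Suc 0) + 1))))"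
  by (intro cp_setf2 ps cf_v) simp_all
 then have "CP (Suc (Suc (Suc 0))) (\<lambda>x e z. (0, setf (setf (snd (I.und x (e 0) (e (Suc 0)) z (I.B x))) (Hx x) (bex x)
   (fst (I.und x (e 0) (e (Suc 0)) z (I.B x)) div (I.Zc x + 1))) 0 (Hx x) (e (Suc (Suc 0)))))"
  by (intro cp_bind'[where H = "\<lambda>x v e z. (0, setf (setf z (Hx x) (bex x) (v div (I.Zc x + 1))) 0 (Hx x) (e (Suc (Suc 0))))" and G = "\<lambda>x e z. I.und x (e 0) (e (Suc 0)) z (I.B x)"]
    cp_und cf_B cf_v) simp_all
 then have 1: "CP k (\<lambda>x e z. (0, setf (setf (snd (I.und x (?f x z) (?s x z) z (I.B x))) (Hx x) (bex x)
   (fst (I.und x (?f x z) (?s x z) z (I.B x)) div (I.Zc x + 1))) 0 (Hx x) (getf z (Hx x) (bex x) mod 2 ^ Hx x)))"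
  by (rule cp_comp3[where f = "\<lambda>x a b c z. (0, setf (setf (snd (I.und x a b z (I.B x))) (Hx x) (bex x)
   (fst (I.und x a b z (I.B x)) div (I.Zc x + 1))) 0 (Hx x) c)"]) (intro cf_min cf_hdr cf_kap ps)+
 have 2: "CP k (\<lambda>x e z. (0, setf (setf z (I.oR x + ?j x z * bx x) (bx x)
   (lst (2 ^ bx x) (\<lambda>a. I.rbad x z (?j x z) a \<and> I.rank x z (?j x z) a = ?v x z div 2 ^ Hx x))) 0 (Hx x) (?v x z mod 2 ^ Hx x)))"
  by (intro cp_setf2 cf_lst cb_conj cb_eq cb_rbad cf_rank cf_row cf_hdr ps cf_v) simp_all
 show "CP k (\<lambda>x e z. if ?f x z \<le> Rx x then (0, setf (setf (snd (I.und x (?f x z) (?s x z) z (I.B x))) (Hx x) (bex x)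
   (fst (I.und x (?f x z) (?s x z) z (I.B x)) div (I.Zc x + 1))) 0 (Hx x) (getf z (Hx x) (bex x) mod 2 ^ Hx x))
  else (0, setf (setf z (I.oR x + ?j x z * bx x) (bx x)
   (lst (2 ^ bx x) (\<lambda>a. I.rbad x z (?j x z) a \<and> I.rank x z (?j x z) a = ?v x z div 2 ^ Hx x))) 0 (Hx x) (?v x z mod 2 ^ Hx x)))"
  by (intro cp_ifb cb_le cf_hdr ps 1 2)
 fix x z :: "bool list" and e :: "nat \<Rightarrow> nat"
 show "(0, I.dcm x z) = (if ?f x z \<le> Rx x then (0, setf (setf (snd (I.und x (?f x z) (?s x z) z (I.B x))) (Hx x) (bex x)
   (fst (I.und x (?f x z) (?s x z) z (I.B x)) div (I.Zc x + 1))) 0 (Hx x) (getf z (Hx x) (bex x) mod 2 ^ Hx x))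
  else (0, setf (setf z (I.oR x + ?j x z * bx x) (bx x)
   (lst (2 ^ bx x) (\<lambda>a. I.rbad x z (?j x z) a \<and> I.rank x z (?j x z) a = ?v x z div 2 ^ Hx x))) 0 (Hx x) (?v x z mod 2 ^ Hx x)))"
  unfolding I.dcm_def Let_def by (simp add: case_prod_unfold)
qed

end

section \<open>The tape as a square array of blocks\<close>

text \<open>Indices out of range fall back to block 0, so that the view of a block always lies
  within the \<open>Z * Z\<close> cells.\<close>

definition bo :: "nat \<Rightarrow> nat \<Rightarrow> nat" where "bo Z i = (if i < Z then i * Z else 0)"
definition bk :: "nat \<Rightarrow> bool list \<Rightarrow> nat \<Rightarrow> bool list" where "bk Z z i = view Z z (bo Z i) 1"
text \<open>Bit 0 of each block. \<open>Z\<close> blocks of length \<open>Z\<close> provide exactly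
  as many free bits as a block has cells, which is why the array is square.\<close>

definition vr :: "nat \<Rightarrow> bool list \<Rightarrow> bool list" where "vr Z z = view Z z 0 Z"

lemma bo_less: "j < Z ==> bo Z i + j < Z * Z"
proof -
 assume j: "j < Z"
 show ?thesis
 proof (cases "i < Z")
  case True
  have "i * Z + j < Suc i * Z" using j by simp
  also have "\<dots> \<le> Z * Z" using True by (intro mult_le_mono1) simp
  finally show ?thesis using True by (simp add: bo_def)
 next
  case False
  have "j * 1 < Z * Z" using j by (intro mult_less_le_imp_less) auto
  then show ?thesis using False by (simp add: bo_def)
 qed
qed

lemma length_bk [simp]: "length (bk Z z i) = Z" by (simp add: bk_def)
lemma length_vr [simp]: "length (vr Z z) = Z" by (simp add: vr_def)
lemma bk_nth: "j < Z ==> bk Z z i ! j = z ! (bo Z i + j)" by (simp add: bk_def view_def)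
lemma vr_nth: "i < Z ==> vr Z z ! i = z ! (Z * i)" by (simp add: vr_def view_def)

lemma digits_eq: "j < Z ==> q < Z ==> i * Z + j = i' * Z + q \<longleftrightarrow> i = i' \<and> j = (q::nat)"
proof
 assume a: "j < Z" "q < Z" and e: "i * Z + j = i' * Z + q"
 have "(i * Z + j) div Z = i" "(i' * Z + q) div Z = i'" "(i * Z + j) mod Z = j" "(i' * Z + q) mod Z = q" using a by simp_all
 then show "i = i' \<and> j = q" using e by metis
qed simp

lemma bk_putv:
 assumes "length z = Z * Z" "i < Z" "i' < Z" "length w = Z"
 shows "bk Z (putv z (bo Z i) 1 w) i' = (if i' = i then w else bk Z z i')"
proof (rule nth_equalityI)
 fix j assume "j < length (bk Z (putv z (bo Z i) 1 w) i')"
 then have j: "j < Z" by simp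
 have l: "bo Z i' + j < length z" using bo_less[OF j] assms(1) by simp
 have b: "bo Z i = i * Z" "bo Z i' = i' * Z" using assms by (simp_all add: bo_def)
 have ex: "(\<exists>q<length w. bo Z i' + j = bo Z i + 1 * q) \<longleftrightarrow> i' = i"
  unfolding b using digits_eq[OF j, of _ i' i] j assms(4) by auto
 show "bk Z (putv z (bo Z i) 1 w) i' ! j = (if i' = i then w else bk Z z i') ! j"
  unfolding bk_nth[OF j] nth_putv[OF l] ex using j by (auto simp: bk_nth b)
qed (use assms in simp)

lemma blocks_eq:
 assumes "length z = Z * Z" "length z' = Z * Z" "\<And>i. i < Z ==> bk Z z i = bk Z z' i"
 shows "z = z'"
proof (rule nth_equalityI)
 fix p assume "p < length z"
 then have p: "p < Z * Z" using assms by simp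
 then have Z: "0 < Z" by (cases Z) auto
 have i: "p div Z < Z" using p by (simp add: less_mult_imp_div_less)
 have j: "p mod Z < Z" using Z by simp
 have e: "bo Z (p div Z) + p mod Z = p" using i by (simp add: bo_def)
 show "z ! p = z' ! p" using bk_nth[OF j, of z "p div Z"] bk_nth[OF j, of z' "p div Z"] assms(3)[OF i] unfolding e by simp
qed (use assms in simp)

definition allb :: "nat \<Rightarrow> (bool list \<Rightarrow> bool list) \<Rightarrow> bool list \<Rightarrow> bool list" where
 "allb Z f z = snd (itr (\<lambda>i v z. (0, putv z (bo Z i) 1 (f (bk Z z i)))) 0 z Z)"

lemma bk_allb:
 assumes "length z = Z * Z" "\<And>i. i < Z ==> length (f (bk Z z i)) = Z"
 shows "length (allb Z f z) = Z * Z" "i < Z ==> bk Z (allb Z f z) i = f (bk Z z i)"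
proof -
 let ?t = "\<lambda>n. snd (itr (\<lambda>i v z. (0, putv z (bo Z i) 1 (f (bk Z z i)))) 0 z n)"
 have "n \<le> Z ==> length (?t n) = Z * Z \<and> (\<forall>i<Z. bk Z (?t n) i = (if i < n then f (bk Z z i) else bk Z z i))" for n
 proof (induction n)
  case (Suc n)
  then have l: "length (?t n) = Z * Z" and b: "\<And>i. i < Z ==> bk Z (?t n) i = (if i < n then f (bk Z z i) else bk Z z i)" and n: "n < Z"
   by auto
  have w: "length (f (bk Z (?t n) n)) = Z" using b[OF n] assms(2)[OF n] by simp
  have "bk Z (?t (Suc n)) i = (if i < Suc n then f (bk Z z i) else bk Z z i)" if i: "i < Z" for i
   using bk_putv[OF l n i w] b[OF n] b[OF i] by (auto simp: less_Suc_eq)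
  then show ?case using l by simp
 qed (simp add: assms(1))
 from this[of Z] show "length (allb Z f z) = Z * Z" "i < Z ==> bk Z (allb Z f z) i = f (bk Z z i)"
  by (simp_all add: allb_def)
qed

lemma viewok_vr: "length z = Z * Z ==> 0 < Z ==> viewok Z z 0 Z"
 by (auto simp: viewok_def)

lemma bk_putv_vr:
 assumes "length z = Z * Z" "length w = Z" "i < Z"
 shows "bk Z (putv z 0 Z w) i = (bk Z z i)[0 := w ! i]"
proof (rule nth_equalityI)
 fix j assume "j < length (bk Z (putv z 0 Z w) i)"
 then have j: "j < Z" by simp
 have l: "bo Z i + j < length z" using bo_less[OF j] assms(1) by simp
 have b: "bo Z i = i * Z" using assms by (simp add: bo_def)
 have q: "(i * Z + j = 0 + Z * q) \<longleftrightarrow> i = q \<and> j = 0" for q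
  using digits_eq[OF j, of 0 i q] j by (simp add: mult.commute)
 have ex: "(\<exists>q<length w. bo Z i + j = 0 + Z * q) \<longleftrightarrow> j = 0"
  unfolding b assms(2) q using assms(3) by auto
 show "bk Z (putv z 0 Z w) i ! j = (bk Z z i)[0 := w ! i] ! j"
  unfolding bk_nth[OF j] nth_putv[OF l] ex using j by (cases j) (auto simp: bk_nth b)
qed simp

lemma bk_upd:
 assumes "length z = Z * Z" "i < Z" "i' < Z"
 shows "bk Z (z[i * Z := v]) i' = (if i' = i then (bk Z z i)[0 := v] else bk Z z i')"
proof (rule nth_equalityI)
 fix j assume "j < length (bk Z (z[i * Z := v]) i')"
 then have j: "j < Z" by simp
 have l: "bo Z i' + j < length z" using bo_less[OF j] assms(1) by simp
 have b: "bo Z i = i * Z" "bo Z i' = i' * Z" using assms by (simp_all add: bo_def)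
 have "i' * Z + j = i * Z \<longleftrightarrow> i' = i \<and> j = 0" using digits_eq[OF j, of 0 i' i] j by simp
 then show "bk Z (z[i * Z := v]) i' ! j = (if i' = i then (bk Z z i)[0 := v] else bk Z z i') ! j"
  using l j unfolding bk_nth[OF j] b by (cases j) (auto simp: nth_list_update_if bk_nth b)
qed simp

lemma vr_upd:
 assumes "length z = Z * Z" "i < Z"
 shows "vr Z (z[i * Z := v]) = (vr Z z)[i := v]"
proof (rule nth_equalityI)
 fix j assume "j < length (vr Z (z[i * Z := v]))"
 then have j: "j < Z" by simp
 have "Z * j < length z" using j assms by simp
 moreover have "Z * j = i * Z \<longleftrightarrow> j = i" using j by (simp add: mult.commute)
 ultimately show "vr Z (z[i * Z := v]) ! j = (vr Z z)[i := v] ! j" using j by (simp add: vr_nth nth_list_update_if)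
qed simp

text \<open>Compressed blocks with arbitrary free bits: preserved by whatever is written into the
  virtual block, and enough to recover the original.\<close>

definition Inv :: "nat \<Rightarrow> (bool list \<Rightarrow> bool list) \<Rightarrow> bool list \<Rightarrow> bool list \<Rightarrow> bool" where
 "Inv Z f z0 z \<longleftrightarrow> length z = Z * Z \<and> (\<forall>i<Z. \<exists>fb. bk Z z i = (f (bk Z z0 i))[0 := fb])"

lemma Inv_vr:
 assumes "Inv Z f z0 z" "length w = Z"
 shows "Inv Z f z0 (putv z 0 Z w)"
 unfolding Inv_def
proof (intro conjI allI impI)
 show "length (putv z 0 Z w) = Z * Z" using assms(1) by (simp add: Inv_def)
 fix i assume i: "i < Z"
 obtain fb where "bk Z z i = (f (bk Z z0 i))[0 := fb]" using assms(1) i by (auto simp: Inv_def)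
 then have "bk Z (putv z 0 Z w) i = (f (bk Z z0 i))[0 := w ! i]"
  using bk_putv_vr[OF _ assms(2) i, of z] assms(1) by (simp add: Inv_def)
 then show "\<exists>fb. bk Z (putv z 0 Z w) i = (f (bk Z z0 i))[0 := fb]" by (rule exI)
qed

lemma Inv_upd:
 assumes "Inv Z f z0 z" "i < Z"
 shows "Inv Z f z0 (z[i * Z := v])"
 unfolding Inv_def
proof (intro conjI allI impI)
 show "length (z[i * Z := v]) = Z * Z" using assms(1) by (simp add: Inv_def)
 fix i' assume i: "i' < Z"
 obtain fb where "bk Z z i' = (f (bk Z z0 i'))[0 := fb]" using assms(1) i by (auto simp: Inv_def)
 then have "bk Z (z[i * Z := v]) i' = (f (bk Z z0 i'))[0 := if i' = i then v else fb]"
  using bk_upd[OF _ assms(2) i, of z v] assms(1) by (cases "i' = i") (simp_all add: Inv_def)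
 then show "\<exists>fb. bk Z (z[i * Z := v]) i' = (f (bk Z z0 i'))[0 := fb]" by (rule exI)
qed

lemma Inv_allb:
 assumes "length z = Z * Z" "\<And>i. i < Z ==> length (f (bk Z z i)) = Z"
 shows "Inv Z f z (allb Z f z)"
 unfolding Inv_def using bk_allb[of z Z f, OF assms] by (metis list_update_id)

lemma Inv_undo:
 assumes "Inv Z f z0 z" "length z0 = Z * Z" "\<And>i fb. i < Z ==> g ((f (bk Z z0 i))[0 := fb]) = bk Z z0 i"
 shows "allb Z g z = z0"
proof (rule blocks_eq)
 have l: "length z = Z * Z" and b: "\<And>i. i < Z ==> \<exists>fb. bk Z z i = (f (bk Z z0 i))[0 := fb]" using assms(1) by (auto simp: Inv_def)
 have g: "g (bk Z z i) = bk Z z0 i" if "i < Z" for i using b[OF that] assms(3)[OF that] by auto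
 then have lg: "length (g (bk Z z i)) = Z" if "i < Z" for i using that by simp
 show "length (allb Z g z) = Z * Z" by (rule bk_allb(1)[of z Z g, OF l lg])
 show "bk Z (allb Z g z) i = bk Z z0 i" if "i < Z" for i using bk_allb(2)[of z Z g i, OF l lg that] g[OF that] by simp
qed (use assms in simp)

text \<open>Binary increment with the carry as running value. An overflow wraps around to zero, so
  iteration runs through all strings.\<close>

definition inc :: "nat \<Rightarrow> bool list \<Rightarrow> bool list" where
 "inc Z z = snd (itr (\<lambda>i v z. if v \<noteq> 0 then (of_bool (z ! i), z[i := \<not> z ! i]) else (0, z)) 1 z Z)"

lemma getf_Suc: "getf z off (Suc w) = getf z off w + of_bool (z ! (off + w)) * 2 ^ w"
 by (simp add: getf_def)

lemma inc_props:
 assumes "length z = Z"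
 shows "length (inc Z z) = Z" "getf (inc Z z) 0 Z = (getf z 0 Z + 1) mod 2 ^ Z"
proof -
 let ?t = "\<lambda>n. itr (\<lambda>i v z. if v \<noteq> 0 then (of_bool (z ! i), z[i := \<not> z ! i]) else (0, z)) 1 z n"
 have *: "n \<le> Z ==> length (snd (?t n)) = Z \<and> fst (?t n) \<le> 1 \<and> getf (snd (?t n)) 0 n + fst (?t n) * 2 ^ n = getf z 0 n + 1 \<and>
   (\<forall>j\<ge>n. snd (?t n) ! j = z ! j)" for n
 proof (induction n)
  case 0
  then show ?case by (simp add: getf_def assms)
 next
  case (Suc n)
  obtain v w where vw: "?t n = (v, w)" by fastforce
  have h: "length w = Z" "v \<le> 1" "getf w 0 n + v * 2 ^ n = getf z 0 n + 1" "\<And>j. n \<le> j ==> w ! j = z ! j" and n: "n < Z"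
   using Suc vw by auto
  show ?case
  proof (cases "v = 0")
   case True
   then have "?t (Suc n) = (0, w)" unfolding itr.simps vw fst_conv snd_conv by simp
   then show ?thesis using h True by (simp add: getf_Suc)
  next
   case False
   then have v: "v = 1" using h(2) by simp
   have t: "?t (Suc n) = (of_bool (z ! n), w[n := \<not> z ! n])" using False h(4)[of n] unfolding itr.simps vw fst_conv snd_conv by simp
   have g: "getf (w[n := y]) 0 n = getf w 0 n" for y by (rule getf_cong) simp
   have nn: "w[n := \<not> z ! n] ! n = (\<not> z ! n)" using h(1) n by simp
   have "getf (w[n := \<not> z ! n]) 0 (Suc n) + of_bool (z ! n) * 2 ^ Suc n = getf z 0 (Suc n) + 1"
    using h(3) v nn by (cases "z ! n") (simp_all add: getf_Suc g)
   then show ?thesis unfolding t using h by simp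
  qed
 qed
 from *[of Z] have h: "length (inc Z z) = Z" "getf (inc Z z) 0 Z + fst (?t Z) * 2 ^ Z = getf z 0 Z + 1" by (auto simp: inc_def)
 show "length (inc Z z) = Z" by (rule h)
 have "(getf z 0 Z + 1) mod 2 ^ Z = getf (inc Z z) 0 Z mod 2 ^ Z" unfolding h(2)[symmetric] by simp
 then show "getf (inc Z z) 0 Z = (getf z 0 Z + 1) mod 2 ^ Z" using getf_less[of "inc Z z" 0 Z] by simp
qed

lemma inc_reaches:
 assumes "length z = Z" "length w = Z"
 shows "\<exists>n. (inc Z ^^ n) z = w"
proof -
 have *: "length ((inc Z ^^ n) z) = Z \<and> getf ((inc Z ^^ n) z) 0 Z = (getf z 0 Z + n) mod 2 ^ Z" for n
 proof (induction n)
  case 0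
  then show ?case using assms getf_less[of z 0 Z] by simp
 next
  case (Suc n)
  then show ?case using inc_props[of "(inc Z ^^ n) z" Z] by (simp add: mod_Suc_eq)
 qed
 \<comment> \<open>Count up to the overflow, then on from zero to the value of
   \<open>w\<close>.\<close>
 define n where "n = 2 ^ Z - getf z 0 Z + getf w 0 Z"
 have "getf z 0 Z + n = getf w 0 Z + 2 ^ Z" using getf_less[of z 0 Z] by (simp add: n_def)
 then have g: "getf ((inc Z ^^ n) z) 0 Z = getf w 0 Z" using *[of n] getf_less[of w 0 Z] by simp
 have "(inc Z ^^ n) z = w"
 proof (rule nth_equalityI)
  fix i assume "i < length ((inc Z ^^ n) z)"
  then have "i < Z" using * by simp
  then show "(inc Z ^^ n) z ! i = w ! i" using bit_getf[of "(inc Z ^^ n) z" 0 Z i] bit_getf[of w 0 Z i] g by simp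
 qed (use * assms in simp)
 then show ?thesis by blast
qed

section \<open>Programs on the array of blocks\<close>

context comp begin

abbreviation "Zb \<equiv> (\<lambda>n. Zx n * Zx n)"
abbreviation "BP \<equiv> cp {(0, 1)} Zb"
abbreviation "BF \<equiv> cf {(0, 1)} Zb"

interpretation bc: cat "{(0, 1)}" Zb by unfold_locales simp

lemma sub_cf:
 assumes "CF 0 (\<lambda>x e z. F x z)" "BF k BA" "BF k SD"
  "\<And>x e z. length z = Zb (length x) ==> 1 \<le> SD x e z \<and> (\<forall>i<Zx (length x). BA x e z + SD x e z * i < Zb (length x))"
 shows "BF k (\<lambda>x e z. F x (view (Zx (length x)) z (BA x e z) (SD x e z)))"
proof (rule cp_cong[OF cp_sub[OF assms]])
 fix x z :: "bool list" and e assume l: "length z = Zb (length x)"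
 have "viewok (Zx (length x)) z (BA x e z) (SD x e z)" using assms(4)[OF l, of e] l by (simp add: viewok_def)
 then show "(F x (view (Zx (length x)) z (BA x e z) (SD x e z)), z) =
  (fst (F x (view (Zx (length x)) z (BA x e z) (SD x e z)), view (Zx (length x)) z (BA x e z) (SD x e z)),
   putv z (BA x e z) (SD x e z) (snd (F x (view (Zx (length x)) z (BA x e z) (SD x e z)), view (Zx (length x)) z (BA x e z) (SD x e z))))"
  by (simp add: putv_view)
qed

lemma bf_Z: "BF k (\<lambda>x e z. Zx (length x))"
proof (rule sub_cf[where F = "\<lambda>x z. Zx (length x)" and BA = "\<lambda>x e z. 0" and SD = "\<lambda>x e z. 1"])
 fix x z :: "bool list" and e :: "nat \<Rightarrow> nat" assume "length z = Zb (length x)"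
 have "i < Zb (length x)" if "i < Zx (length x)" for i using bo_less[OF that, of "Zx (length x)"] by (simp add: bo_def)
 then show "(1::nat) \<le> 1 \<and> (\<forall>i<Zx (length x). 0 + 1 * i < Zb (length x))" by simp
qed (intro Zc bc.cf_const)+

interpretation bt: cat_tape "{(0, 1)}" Zb
 by unfold_locales (use bc.cf_mult[OF bf_Z bf_Z] Zpos in auto)

lemma bf_bo: "BF k J ==> BF k (\<lambda>x e z. bo (Zx (length x)) (J x e z))"
 unfolding bo_def by (intro bc.cf_if bc.cb_less bc.cf_mult bf_Z bc.cf_const)

lemma bf_bk:
 assumes "CF 0 (\<lambda>x e z. F x z)" "BF k J"
 shows "BF k (\<lambda>x e z. F x (bk (Zx (length x)) z (J x e z)))"
 unfolding bk_def by (rule sub_cf[OF assms(1) bf_bo[OF assms(2)] bc.cf_const]) (simp add: bo_less)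

lemma bf_vr:
 assumes "CF 0 (\<lambda>x e z. F x z)"
 shows "BF k (\<lambda>x e z. F x (vr (Zx (length x)) z))"
 unfolding vr_def by (rule sub_cf[OF assms bc.cf_const bf_Z]) (use Zpos in \<open>auto simp: Suc_le_eq\<close>)

lemma bp_allb:
 assumes "CP 0 (\<lambda>x e z. (0, f x z))"
 shows "BP k (\<lambda>x e z. (0, allb (Zx (length x)) (f x) z))"
proof -
 let ?G = "\<lambda>x i v e z. (0 :: nat, putv z (bo (Zx (length x)) i) 1 (f x (bk (Zx (length x)) z i)))"
 have z: "fst (itr (\<lambda>i v z. ?G x i v e z) 0 z n) = 0" for x e z n by (cases n) simp_all
 have "BP k (\<lambda>x e z. itr (\<lambda>i v z. ?G x i v e z) 0 z (Zx (length x)))"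
 proof (rule cp_iter[where G = ?G and I = "\<lambda>x e z. 0"])
  show "BP (Suc (Suc (Suc k))) (\<lambda>x e z. ?G x (e 0) (e 1) (\<lambda>i. e (i + 3)) z)"
  proof -
   have v: "BF (Suc (Suc (Suc k))) (\<lambda>x e z. e 0)" by (rule bc.cf_v) simp
   have c: "BF (Suc (Suc (Suc k))) (\<lambda>x e z. 1)" by (rule bc.cf_const)
   show ?thesis using cp_sub[OF assms bf_bo[OF v] c] by (simp add: bk_def bo_less)
  qed
  show "\<exists>K'. \<forall>x e z i. (\<forall>j<k. e j \<le> pb K x) \<longrightarrow> length z = Zb (length x) \<longrightarrow> i \<le> Zx (length x) \<longrightarrow>
    fst (itr (\<lambda>i v z. ?G x i v e z) 0 z i) \<le> pb K' x" for K unfolding z by simp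
 qed (intro bf_Z bc.cf_const)+
 then show ?thesis
 proof (rule cp_cong)
  fix x e z
  show "(0, allb (Zx (length x)) (f x) z) = itr (\<lambda>i v z. ?G x i v e z) 0 z (Zx (length x))"
   unfolding allb_def prod_eq_iff fst_conv snd_conv z by simp
 qed
qed

definition cmg :: "bool list \<Rightarrow> bool list \<Rightarrow> bool list" where "cmg x z = (if I.good x z then z else I.cmp x z)"
definition exg :: "bool list \<Rightarrow> bool list \<Rightarrow> bool" where "exg x z \<longleftrightarrow> (\<exists>i<Zx (length x). I.good x (bk (Zx (length x)) z i))"
definition res1 :: "bool list \<Rightarrow> bool list \<Rightarrow> bool" where
 "res1 x z = I.ans x (s0x x) (bk (Zx (length x)) z (lst (Zx (length x)) (\<lambda>i. I.good x (bk (Zx (length x)) z i))))"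
definition stepv :: "bool list \<Rightarrow> bool list \<Rightarrow> bool list" where
 "stepv x z = putv z 0 (Zx (length x)) (inc (Zx (length x)) (vr (Zx (length x)) z))"

lemma bp_phase1: "BP k (\<lambda>x e z. if exg x z then (0, z) else (1, allb (Zx (length x)) (cmg x) z))"
proof -
 have "CP 0 (\<lambda>x e z. (0, cmg x z))" by (rule cp_cong[OF cp_cmp]) (simp add: cmg_def)
 then have a: "BP k (\<lambda>x e z. (0, allb (Zx (length x)) (cmg x) z))" by (rule bp_allb)
 have b: "BF k (\<lambda>x e z. 1)" by (rule bc.cf_const)
 have "BP k (\<lambda>x e z. (1, allb (Zx (length x)) (cmg x) z))" using bc.cp_seq[OF a b] by simp
 moreover have "bc.CB k (\<lambda>x e z. exg x z)"
  unfolding exg_def by (intro bc.cb_ex bf_Z bf_bk[where F = "\<lambda>x z. of_bool (I.good x z)"] cb_good bc.cf_v) simp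
 ultimately show ?thesis by (intro bc.cp_ifb bc.cf_const)
qed

lemma bp_res1: "BF k (\<lambda>x e z. of_bool (res1 x z))"
 unfolding res1_def
 by (intro bf_bk[where F = "\<lambda>x z. of_bool (I.ans x (s0x x) z)"] cb_ans bc.cf_lst bf_Z bf_bk[where F = "\<lambda>x z. of_bool (I.good x z)"] cb_good bc.cf_v) simp

lemma bp_flag: "BF k (\<lambda>x e z. of_bool (\<not> I.good x (vr (Zx (length x)) z)))"
 by (intro bc.cb_not bf_vr[where F = "\<lambda>x z. of_bool (I.good x z)"] cb_good)

lemma cp_inc: "CP 0 (\<lambda>x e z. (0, inc (Zx (length x)) z))"
proof -
 let ?G = "\<lambda>x i v e z. if v \<noteq> 0 then (of_bool (i < Zx (length x) \<and> z ! i), z[i := \<not> (i < Zx (length x) \<and> z ! i)]) else (0 :: nat, z)"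
 let ?G' = "\<lambda>i v z. if v \<noteq> 0 then (of_bool (z ! i), z[i := \<not> z ! i]) else (0 :: nat, z)"
 have b: "fst (itr (\<lambda>i v z. ?G x i v e z) 1 z n) \<le> 1" for x e z n by (induction n) auto
 have e: "n \<le> Zx (length x) ==> itr (\<lambda>i v z. ?G x i v e z) 1 z n = itr ?G' 1 z n" for x e z n by (induction n) auto
 have "CP 0 (\<lambda>x e z. itr (\<lambda>i v z. ?G x i v e z) 1 z (Zx (length x)))"
 proof (rule cp_iter[where G = ?G and I = "\<lambda>x e z. 1"])
  show "CP (Suc (Suc (Suc 0))) (\<lambda>x e z. ?G x (e 0) (e 1) (\<lambda>i. e (i + 3)) z)"
   by (intro cp_ifb cp_upd cb_not cb_eq cb_read cf_const cf_v) simp_all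
  fix K
  show "\<exists>K'. \<forall>x e z i. (\<forall>j<0. e j \<le> pb K x) \<longrightarrow> length z = Zx (length x) \<longrightarrow> i \<le> Zx (length x) \<longrightarrow>
    fst (itr (\<lambda>i v z. ?G x i v e z) 1 z i) \<le> pb K' x" using order_trans[OF b pb_ge1] by blast
 qed (intro cf_const Zc)+
 from cp_seq[OF this cf_const[of 0 0]] show ?thesis
 proof (rule cp_cong)
  fix x z :: "bool list" and e assume "length z = Zx (length x)"
  show "(0, inc (Zx (length x)) z) = (0, snd (itr (\<lambda>i v z. ?G x i v e z) 1 z (Zx (length x))))"
   unfolding e[OF order_refl] inc_def by (rule refl)
 qed
qed

lemma bp_stepv: "BP k (\<lambda>x e z. (of_bool (\<not> I.good x (vr (Zx (length x)) (stepv x z))), stepv x z))"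
proof -
 have "BP k (\<lambda>x e z. (0, stepv x z))"
 proof -
  have c: "BF k (\<lambda>x e z. 0)" by (rule bc.cf_const)
  show ?thesis using cp_sub[OF cp_inc c bf_Z[of k]] Zpos by (simp add: stepv_def vr_def Suc_le_eq)
 qed
 from bc.cp_seq[OF this bp_flag] show ?thesis by simp
qed

lemma bp_finish: "BP k (\<lambda>x e z. (of_bool (I.ans x (s0x x) (vr (Zx (length x)) z)), allb (Zx (length x)) (I.dcm x) z))"
proof (rule bc.cp_let[where F = "\<lambda>x e z. of_bool (I.ans x (s0x x) (vr (Zx (length x)) z))" and H = "\<lambda>x v e z. (v, allb (Zx (length x)) (I.dcm x) z)"])
 show "BF k (\<lambda>x e z. of_bool (I.ans x (s0x x) (vr (Zx (length x)) z)))"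
  by (intro bf_vr[where F = "\<lambda>x z. of_bool (I.ans x (s0x x) z)"] cb_ans)
 show "BP (Suc k) (\<lambda>x e z. (e 0, allb (Zx (length x)) (I.dcm x) z))"
 proof -
  have a: "BP (Suc k) (\<lambda>x e z. (0, allb (Zx (length x)) (I.dcm x) z))" by (rule bp_allb[OF cp_dcm])
  have b: "BF (Suc k) (\<lambda>x e z. e 0)" by (rule bc.cf_v) simp
  show ?thesis using bc.cp_seq[OF a b] by simp
 qed
qed

lemma bp_setv: "BP (Suc (Suc (Suc 0))) (\<lambda>x e z. (0, z[e (Suc 0) * Zx (length x) := (e 0 \<noteq> 0)]))"
 by (intro bt.cp_write bc.cf_mult bf_Z bc.cb_nz bc.cf_v) simp_all

end

section \<open>The complete algorithm, deterministic and randomized\<close>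

lemma bt_RB:
 assumes "bt B x r a (s\<lparr>rhd := Suc (rhd s)\<rparr>) n s'" "read_rand r (rhd s)"
  shows "bt B x r (Ite RB a b) s (n + 1) s'"
 using assms unfolding bt_def by (auto simp: tadv_def intro!: bs_IteT intro: exI[of _ "Suc _"])

lemma bt_RB':
 assumes "bt B x r b (s\<lparr>rhd := Suc (rhd s)\<rparr>) n s'" "\<not> read_rand r (rhd s)"
  shows "bt B x r (Ite RB a b) s (n + 1) s'"
 using assms unfolding bt_def by (auto simp: tadv_def intro!: bs_IteF intro: exI[of _ "Suc _"])

lemma bt_le: "bt B x r c s n s' ==> n \<le> n' ==> bt B x r c s n' s'"
 using bt_mono[of B x r c s n s' B n'] by simp

lemma ES_zero: "ES ba sd (Suc k) (0 ## e) T h = ES ba sd k e T h"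
 by (simp add: ES_def env_regs_zero)

lemma env_reg2 [simp]: "env_regs ba sd (Suc 0) (v ## e) 2 = v"
 by (simp add: env_regs_def push_def)

context comp begin

text \<open>The answer was taken from a block that is good or, in the randomized version, is the
  random string \<open>w\<close>. What the answer means is thus left to facts about good blocks
  alone.\<close>

definition outcome :: "bool list \<Rightarrow> bool \<Rightarrow> bool \<Rightarrow> bool list \<Rightarrow> bool" where
 "outcome x res dt w \<longleftrightarrow> (\<exists>z. length z = Zx (length x) \<and> (I.good x z \<or> (\<not> dt \<and> z = w)) \<and> (res \<longleftrightarrow> I.ans x (s0x x) z))"

text \<open>The loop part \<open>Lp\<close> writes the virtual block into the free bits of the compressed blocks.\<close>

lemma main_prog:
 assumes nr: "dt \<longrightarrow> no_rand Lp"
  and lp: "\<And>x r T z0. length z0 = Zb (length x) ==> viewok (length z0) T 0 1 ==> \<not> exg x z0 ==>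
   \<exists>z' h n. (dt \<or> n \<le> pb KL x) \<and> Inv (Zx (length x)) (cmg x) z0 z' \<and> (I.good x (vr (Zx (length x)) z') \<or> (\<not> dt \<and> vr (Zx (length x)) z' = w x r)) \<and>
    bt (pb KL x) x r Lp (ES 0 1 1 (1 ## (\<lambda>_. 0)) (putv T 0 1 (allb (Zx (length x)) (cmg x) z0)) 0) n (ES 0 1 1 (1 ## (\<lambda>_. 0)) (putv T 0 1 z') h)"
 shows "\<exists>P K. (dt \<longrightarrow> no_rand P) \<and> (\<forall>x r T. Zb (length x) \<le> length T \<longrightarrow>
  (\<exists>t s'. bs (pb K x) x r P (pinit T) t s' \<and> (dt \<or> t \<le> pb K x) \<and> tape s' = T \<and> outcome x (regs s' 0 \<noteq> 0) dt (w x r)))"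
proof -
 obtain PA where PA: "no_rand PA" "\<And>K. \<exists>K'. progr {(0, 1)} Zb 0 (\<lambda>x e z. if exg x z then (0, z) else (1, allb (Zx (length x)) (cmg x) z)) PA K K'"
  using cp_elim[OF bp_phase1] by blast
 obtain PR where PR: "no_rand PR" "\<And>K. \<exists>K'. progr {(0, 1)} Zb 1 (\<lambda>x e z. (of_bool (res1 x z), z)) PR K K'"
  using cp_elim[OF bp_res1] by blast
 obtain PD where PD: "no_rand PD" "\<And>K. \<exists>K'. progr {(0, 1)} Zb 1 (\<lambda>x e z. (of_bool (I.ans x (s0x x) (vr (Zx (length x)) z)), allb (Zx (length x)) (I.dcm x) z)) PD K K'"
  using cp_elim[OF bp_finish] by blast
 obtain KA where KA: "progr {(0, 1)} Zb 0 (\<lambda>x e z. if exg x z then (0, z) else (1, allb (Zx (length x)) (cmg x) z)) PA 0 KA" using PA by blast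
 obtain KR where KR: "progr {(0, 1)} Zb 1 (\<lambda>x e z. (of_bool (res1 x z), z)) PR 0 KR" using PR by blast
 obtain KD where KD: "progr {(0, 1)} Zb 1 (\<lambda>x e z. (of_bool (I.ans x (s0x x) (vr (Zx (length x)) z)), allb (Zx (length x)) (I.dcm x) z)) PD 0 KD" using PD by blast
 have pol: "pol (\<lambda>x. (1 + (pb KA x + (pb KR x + (pb KL x + pb KD x + 1) + 1) + 1) + 1) + 2 + 1)"
  by (intro pol_intros)
 then obtain K where K: "\<And>x. (1 + (pb KA x + (pb KR x + (pb KL x + pb KD x + 1) + 1) + 1) + 1) + 2 + 1 \<le> pb K x" unfolding pol_def by blast
 \<comment> \<open>\<open>Inc 1\<close> sets the stride to 1. Register 2 receives the flag that no
   block is good, register 3 the answer; only at the very end is the answer copied to register 0,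
   which until then is the base of the view.\<close>
 let ?P = "(Inc 1 ;; (PA ;; Ite (NZ 2) (Lp ;; PD) PR)) ;; Ite (NZ 3) (Inc 0) Skip"
 have "(\<exists>t s'. bs (pb K x) x r ?P (pinit T) t s' \<and> (dt \<or> t \<le> pb K x) \<and> tape s' = T \<and> outcome x (regs s' 0 \<noteq> 0) dt (w x r))"
  if Tl: "Zb (length x) \<le> length T" for x r T
 proof -
  let ?Z = "Zx (length x)" let ?B = "pb K x"
  have Bs: "pb KA x \<le> ?B" "pb KR x \<le> ?B" "pb KL x \<le> ?B" "pb KD x \<le> ?B" "1 < ?B" using K[of x] by linarith+
  define z0 where "z0 = view (Zb (length x)) T 0 1"
  have zl: "length z0 = Zb (length x)" by (simp add: z0_def)
  have vo: "viewok (length z0) T 0 1" using Tl by (simp add: zl viewok_def)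
  have T: "putv T 0 1 z0 = T" using putv_view[OF vo] by (simp add: z0_def)
  have p1: "1 \<le> pb 0 x" "0 \<le> pb 0 x" by (simp_all add: pb_def)
  have s1: "bt ?B x r (Inc 1) (pinit T) 1 (ES 0 1 0 (\<lambda>_. 0) (putv T 0 1 z0) 0)"
   unfolding T using Bs(5) by (intro bt_line') (auto simp: pinit_def intro!: pst_eqI simp: fun_eq_iff env_regs_def)
  note pr = progr_bt[where ba = 0 and sd = 1 and \<Lambda> = "{(0, 1)}", OF _ insertI1 p1(2) p1(1)]
  have sf: "\<exists>n h v f. bt ?B x r (Inc 1 ;; (PA ;; Ite (NZ 2) (Lp ;; PD) PR)) (pinit T) n (ES 0 1 2 (of_bool v ## f ## (\<lambda>_. 0)) T h) \<and>
   (dt \<or> n + 3 \<le> ?B) \<and> outcome x v dt (w x r)"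
  proof (cases "exg x z0")
   case True
   have sA: "bt ?B x r PA (ES 0 1 0 (\<lambda>_. 0) (putv T 0 1 z0) 0) (pb KA x) (ES 0 1 (Suc 0) (0 ## (\<lambda>_. 0)) (putv T 0 1 z0) 0)"
    using pr[OF KA _ vo _ Bs(1) order_refl, of "\<lambda>_. 0" r 0] zl True by simp
   have sR: "bt ?B x r PR (ES 0 1 (Suc 0) (0 ## (\<lambda>_. 0)) (putv T 0 1 z0) 0) (pb KR x) (ES 0 1 (Suc (Suc 0)) (of_bool (res1 x z0) ## 0 ## (\<lambda>_. 0)) (putv T 0 1 z0) 0)"
    using pr[OF KR _ vo _ Bs(2) order_refl, of "0 ## (\<lambda>_. 0)" r 0] zl by (simp add: push_def)
   have "bt ?B x r (Ite (NZ 2) (Lp ;; PD) PR) (ES 0 1 (Suc 0) (0 ## (\<lambda>_. 0)) (putv T 0 1 z0) 0) (pb KR x + 1) (ES 0 1 (Suc (Suc 0)) (of_bool (res1 x z0) ## 0 ## (\<lambda>_. 0)) (putv T 0 1 z0) 0)"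
    by (rule bt_Ite[OF _ _ sR]) simp_all
   from bt_Sq[OF s1 bt_Sq[OF sA this]]
   have "bt ?B x r (Inc 1 ;; (PA ;; Ite (NZ 2) (Lp ;; PD) PR)) (pinit T) (1 + (pb KA x + (pb KR x + 1) + 1) + 1) (ES 0 1 2 (of_bool (res1 x z0) ## 0 ## (\<lambda>_. 0)) T 0)"
    unfolding T by (simp add: numeral_2_eq_2)
   moreover have "1 + (pb KA x + (pb KR x + 1) + 1) + 1 + 3 \<le> ?B" using K[of x] by linarith
   moreover have "outcome x (res1 x z0) dt (w x r)"
   proof -
    let ?i = "lst ?Z (\<lambda>i. I.good x (bk ?Z z0 i))"
    have "?i < ?Z"
    proof (rule ccontr)
     assume "\<not> ?i < ?Z"
     then show False using True lst_props[of ?Z "\<lambda>i. I.good x (bk ?Z z0 i)"] by (auto simp: exg_def)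
    qed
    then have "I.good x (bk ?Z z0 ?i)" using lst_props[of ?Z "\<lambda>i. I.good x (bk ?Z z0 i)"] by blast
    then show ?thesis unfolding outcome_def res1_def by (intro exI[of _ "bk ?Z z0 ?i"]) simp
   qed
   ultimately show ?thesis by (intro exI conjI disjI2)
  next
   case False
   let ?c = "allb ?Z (cmg x) z0"
   obtain z' h n where L: "dt \<or> n \<le> pb KL x" "Inv ?Z (cmg x) z0 z'" "I.good x (vr ?Z z') \<or> (\<not> dt \<and> vr ?Z z' = w x r)"
    "bt (pb KL x) x r Lp (ES 0 1 1 (1 ## (\<lambda>_. 0)) (putv T 0 1 ?c) 0) n (ES 0 1 1 (1 ## (\<lambda>_. 0)) (putv T 0 1 z') h)"
    using lp[OF zl vo False, of r] by blast
   have zl': "length z' = Zb (length x)" using L(2) by (simp add: Inv_def)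
   \<comment> \<open>No original block was good, so each was compressed, and decompression inverts
     this for every value of its free bit.\<close>
   have und: "allb ?Z (I.dcm x) z' = z0"
   proof (rule Inv_undo[OF L(2) zl])
    fix i fb assume "i < ?Z"
    then have ng: "\<not> I.good x (bk ?Z z0 i)" using False by (auto simp: exg_def)
    have "length (bk ?Z z0 i) = I.ZL x" by (simp add: ZL)
    from I.dcm_cmp(2)[OF this ng] ng show "I.dcm x ((cmg x (bk ?Z z0 i))[0 := fb]) = bk ?Z z0 i" by (simp add: cmg_def)
   qed
   have sA: "bt ?B x r PA (ES 0 1 0 (\<lambda>_. 0) (putv T 0 1 z0) 0) (pb KA x) (ES 0 1 (Suc 0) (1 ## (\<lambda>_. 0)) (putv T 0 1 ?c) 0)"
    using pr[OF KA _ vo _ Bs(1) order_refl, of "\<lambda>_. 0" r 0] zl False by simp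
   have sL: "bt ?B x r Lp (ES 0 1 (Suc 0) (1 ## (\<lambda>_. 0)) (putv T 0 1 ?c) 0) n (ES 0 1 (Suc 0) (1 ## (\<lambda>_. 0)) (putv T 0 1 z') h)"
    using bt_mono[OF L(4) Bs(3) order_refl] by simp
   have vo': "viewok (length z') T 0 1" using vo zl zl' by simp
   have sD: "bt ?B x r PD (ES 0 1 (Suc 0) (1 ## (\<lambda>_. 0)) (putv T 0 1 z') h) (pb KD x)
     (ES 0 1 (Suc (Suc 0)) (of_bool (I.ans x (s0x x) (vr ?Z z')) ## 1 ## (\<lambda>_. 0)) (putv T 0 1 z0) h)"
    using pr[OF KD _ vo' _ Bs(4) order_refl, of "1 ## (\<lambda>_. 0)" r h] zl' p1 by (simp add: push_def und)
   have "bt ?B x r (Ite (NZ 2) (Lp ;; PD) PR) (ES 0 1 (Suc 0) (1 ## (\<lambda>_. 0)) (putv T 0 1 ?c) 0) (n + pb KD x + 1 + 1)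
     (ES 0 1 (Suc (Suc 0)) (of_bool (I.ans x (s0x x) (vr ?Z z')) ## 1 ## (\<lambda>_. 0)) (putv T 0 1 z0) h)"
    by (rule bt_Ite[OF _ bt_Sq[OF sL sD]]) simp_all
   from bt_Sq[OF s1 bt_Sq[OF sA this]]
   have "bt ?B x r (Inc 1 ;; (PA ;; Ite (NZ 2) (Lp ;; PD) PR)) (pinit T) (1 + (pb KA x + (n + pb KD x + 1 + 1) + 1) + 1)
     (ES 0 1 2 (of_bool (I.ans x (s0x x) (vr ?Z z')) ## 1 ## (\<lambda>_. 0)) T h)"
    unfolding T by (simp add: numeral_2_eq_2)
   moreover have "dt \<or> 1 + (pb KA x + (n + pb KD x + 1 + 1) + 1) + 1 + 3 \<le> ?B" using K[of x] L(1) pb_ge1[of KR x] by linarith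
   moreover have "outcome x (I.ans x (s0x x) (vr ?Z z')) dt (w x r)"
    unfolding outcome_def using L(3) by (intro exI[of _ "vr ?Z z'"]) simp
   ultimately show ?thesis by (intro exI conjI)
  qed
  then obtain n h v f where s2: "bt ?B x r (Inc 1 ;; (PA ;; Ite (NZ 2) (Lp ;; PD) PR)) (pinit T) n (ES 0 1 2 (of_bool v ## f ## (\<lambda>_. 0)) T h)"
   "dt \<or> n + 3 \<le> ?B" "outcome x v dt (w x r)" by blast
  let ?s = "ES 0 1 2 (of_bool v ## f ## (\<lambda>_. 0)) T h"
  let ?e = "if v then ?s\<lparr>regs := (regs ?s)(0 := 1)\<rparr> else ?s"
  have r3: "regs ?s 3 = of_bool v" "regs ?s 0 = 0" by (simp_all add: env_regs_def push_def)
  have "bt ?B x r (Ite (NZ 3) (Inc 0) Skip) ?s (1 + 1) ?e"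
   by (rule bt_Ite) (use r3 Bs(5) in \<open>auto intro!: bt_line' split: if_splits\<close>)
  from bt_Sq[OF s2(1) this] obtain t where t: "t \<le> n + (1 + 1) + 1" "bs ?B x r ?P (pinit T) t ?e" by (auto simp: bt_def)
  have "tape ?e = T" by simp
  moreover have "(regs ?e 0 \<noteq> 0) = v" using r3 by simp
  ultimately show ?thesis using t s2(2,3) by (intro exI[of _ t] exI[of _ ?e]) auto
 qed
 moreover have "dt \<longrightarrow> no_rand ?P" using nr PA(1) PR(1) PD(1) by simp
 ultimately show ?thesis by blast
qed

lemma length_cmg: "length z = Zx (length x) ==> length (cmg x z) = Zx (length x)"
 using I.dcm_cmp(1)[of z x] by (simp add: cmg_def ZL)

lemma Inv_start: "length z0 = Zb (length x) ==> Inv (Zx (length x)) (cmg x) z0 (allb (Zx (length x)) (cmg x) z0)"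
 by (rule Inv_allb) (simp_all add: length_cmg)

text \<open>The search may run through exponentially many values of the virtual block. The registers
  stay polynomial all the same, and \<open>CL\<close> bounds space, not time.\<close>

theorem det_prog:
 assumes good: "\<And>x. \<exists>z. length z = Zx (length x) \<and> I.good x z"
 shows "\<exists>P K. no_rand P \<and> (\<forall>x r T. Zb (length x) \<le> length T \<longrightarrow>
  (\<exists>t s'. bs (pb K x) x r P (pinit T) t s' \<and> tape s' = T \<and> outcome x (regs s' 0 \<noteq> 0) True []))"
proof -
 obtain PG where PG: "no_rand PG" "\<And>K. \<exists>K'. progr {(0, 1)} Zb 1 (\<lambda>x e z. (of_bool (\<not> I.good x (vr (Zx (length x)) z)), z)) PG K K'"
  using cp_elim[OF bp_flag] by blast
 obtain PB where PB: "no_rand PB" "\<And>K. \<exists>K'. progr {(0, 1)} Zb 2 (\<lambda>x e z. (of_bool (\<not> I.good x (vr (Zx (length x)) (stepv x z))), stepv x z)) PB K K'"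
  using cp_elim[OF bp_stepv] by blast
 obtain KG where KG: "progr {(0, 1)} Zb 1 (\<lambda>x e z. (of_bool (\<not> I.good x (vr (Zx (length x)) z)), z)) PG 0 KG" using PG by blast
 obtain KB where KB: "progr {(0, 1)} Zb 2 (\<lambda>x e z. (of_bool (\<not> I.good x (vr (Zx (length x)) (stepv x z))), stepv x z)) PB 0 KB" using PB by blast
 have pol: "pol (\<lambda>x. pb KG x + pb KB x + 2)" by (intro pol_intros)
 then obtain KL where KL: "\<And>x. pb KG x + pb KB x + 2 \<le> pb KL x" unfolding pol_def by blast
 let ?L = "PG ;; Wh (NZ 3) (PB ;; (clr 3 ;; mov 4 3))"
 have "\<exists>P K. (True \<longrightarrow> no_rand P) \<and> (\<forall>x r T. Zb (length x) \<le> length T \<longrightarrow>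
  (\<exists>t s'. bs (pb K x) x r P (pinit T) t s' \<and> (True \<or> t \<le> pb K x) \<and> tape s' = T \<and> outcome x (regs s' 0 \<noteq> 0) True []))"
 proof (rule main_prog[where Lp = ?L and KL = KL and w = "\<lambda>x r. []"])
  show "True \<longrightarrow> no_rand ?L" using PG(1) PB(1) by (simp add: clr_def mov_def)
  fix x r T z0 assume zl: "length z0 = Zb (length x)" and vo: "viewok (length z0) T 0 1" and ng: "\<not> exg x z0"
  let ?Z = "Zx (length x)" let ?B = "pb KL x"
  have Bs: "pb KG x \<le> ?B" "pb KB x \<le> ?B" "2 \<le> ?B" using KL[of x] by linarith+
  define zz where "zz j = (stepv x ^^ j) (allb ?Z (cmg x) z0)" for j
  have inv: "Inv ?Z (cmg x) z0 (zz j)" for j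
  proof (induction j)
   case 0
   then show ?case using Inv_start[OF zl] by (simp add: zz_def)
  next
   case (Suc j)
   have "length (inc ?Z (vr ?Z (zz j))) = ?Z" by (rule inc_props) simp
   from Inv_vr[OF Suc this] show ?case by (simp add: zz_def stepv_def)
  qed
  have zzl: "length (zz j) = Zb (length x)" for j using inv[of j] by (simp add: Inv_def)
  have vs: "vr ?Z (zz j) = (inc ?Z ^^ j) (vr ?Z (zz 0))" for j
  proof (induction j)
   case (Suc j)
   have l: "length (inc ?Z (vr ?Z (zz j))) = ?Z" by (rule inc_props) simp
   have "zz (Suc j) = putv (zz j) 0 ?Z (inc ?Z (vr ?Z (zz j)))" by (simp add: zz_def stepv_def)
   then have "vr ?Z (zz (Suc j)) = inc ?Z (vr ?Z (zz j))"
    using view_putv[of "inc ?Z (vr ?Z (zz j))" "zz j" 0 ?Z] viewok_vr[OF zzl Zpos] l by (simp add: vr_def)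
   then show ?case using Suc by simp
  qed simp
  obtain g where g: "length g = ?Z" "I.good x g" using good by blast
  obtain n where "(inc ?Z ^^ n) (vr ?Z (zz 0)) = g" using inc_reaches[of "vr ?Z (zz 0)" ?Z g] g by auto
  then have ex: "I.good x (vr ?Z (zz n))" using vs[of n] g by simp
  \<comment> \<open>Counting reaches every string, in particular a good one, so the loop has a first
    stop.\<close>
  define N where "N = (LEAST n. I.good x (vr ?Z (zz n)))"
  have N: "I.good x (vr ?Z (zz N))" unfolding N_def using ex by (rule LeastI)
  have Nl: "\<not> I.good x (vr ?Z (zz j))" if "j < N" for j using that unfolding N_def by (rule not_less_Least)
  define fl :: "nat \<Rightarrow> nat" where "fl j = of_bool (\<not> I.good x (vr ?Z (zz j)))" for j
  have fl1: "fl j \<le> 1" for j by (simp add: fl_def)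
  have p1: "1 \<le> pb 0 x" "0 \<le> pb 0 x" by (simp_all add: pb_def)
  note pr = progr_bt[where ba = 0 and sd = 1 and \<Lambda> = "{(0, 1)}", OF _ insertI1 p1(2) p1(1)]
  have vo': "viewok (length (zz j)) T 0 1" for j using vo zl zzl by simp
  let ?f = "\<lambda>j. ES 0 1 2 (fl j ## 1 ## (\<lambda>_. 0)) (putv T 0 1 (zz j)) 0"
  have s1: "bt ?B x r PG (ES 0 1 1 (1 ## (\<lambda>_. 0)) (putv T 0 1 (zz 0)) 0) (pb KG x) (?f 0)"
   using pr[OF KG _ vo'[of 0] _ Bs(1) order_refl, of "1 ## (\<lambda>_. 0)" r 0] zzl p1 by (simp add: push_def fl_def numeral_2_eq_2)
  have body: "bt ?B x r (PB ;; (clr 3 ;; mov 4 3)) (?f j) (pb KB x + (3 + 5 + 1) + 1) (?f (Suc j))" if j: "j < N" for j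
  proof -
   let ?s = "ES 0 1 3 (fl (Suc j) ## fl j ## 1 ## (\<lambda>_. 0)) (putv T 0 1 (zz (Suc j))) 0"
   have st: "stepv x (zz j) = zz (Suc j)" by (simp add: zz_def)
   have a: "bt ?B x r PB (?f j) (pb KB x) ?s"
    using pr[OF KB _ vo'[of j] _ Bs(2) order_refl, of "fl j ## 1 ## (\<lambda>_. 0)" r 0] zzl p1 fl1[of j]
    by (simp add: push_def fl_def st less_Suc_eq numeral_3_eq_3 numeral_2_eq_2 split: nat.split)
   have r: "regs ?s 3 = fl j" "regs ?s 4 = fl (Suc j)" by (simp_all add: env_regs_def push_def)
   have b: "bt ?B x r (clr 3) ?s 3 (?s\<lparr>regs := (regs ?s)(3 := 0)\<rparr>)"
    by (rule bt_le[OF bt_clr]) (use r fl1[of j] in simp)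
   let ?s' = "?s\<lparr>regs := (regs ?s)(3 := 0)\<rparr>"
   have r': "regs ?s' 3 = 0" "regs ?s' 4 = fl (Suc j)" using r by simp_all
   have m0: "bt ?B x r (mov 4 3) ?s' 5 (?s'\<lparr>regs := (regs ?s')(4 := 0, 3 := regs ?s' 4 + regs ?s' 3)\<rparr>)"
    by (rule bt_le[OF bt_mov]) (use r' fl1[of "Suc j"] Bs(3) in simp_all)
   have eq: "?s'\<lparr>regs := (regs ?s')(4 := 0, 3 := regs ?s' 4 + regs ?s' 3)\<rparr> = ?f (Suc j)"
    unfolding r' by (rule pst_eqI) (auto simp: fun_eq_iff env_regs_def push_def ES_def split: nat.split)
   have m: "bt ?B x r (mov 4 3) ?s' 5 (?f (Suc j))" using m0 unfolding eq .
   show ?thesis by (rule bt_Sq[OF a bt_Sq[OF b m]])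
  qed
  have "bt ?B x r (Wh (NZ 3) (PB ;; (clr 3 ;; mov 4 3))) (?f 0) (N * ((pb KB x + (3 + 5 + 1) + 1) + 1) + 1) (?f N)"
  proof (rule bt_loop)
   show "regs (?f j) 3 \<noteq> 0" if "j < N" for j using Nl[OF that] by (simp add: env_regs_def push_def fl_def)
   show "regs (?f N) 3 = 0" using N by (simp add: env_regs_def push_def fl_def)
  qed (rule body)
  from bt_Sq[OF s1 this] have "bt ?B x r ?L (ES 0 1 1 (1 ## (\<lambda>_. 0)) (putv T 0 1 (zz 0)) 0) (pb KG x + (N * ((pb KB x + (3 + 5 + 1) + 1) + 1) + 1) + 1) (?f N)" .
  moreover have "?f N = ES 0 1 1 (1 ## (\<lambda>_. 0)) (putv T 0 1 (zz N)) 0"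
   using N ES_zero[of 0 1 1 "1 ## (\<lambda>_. 0)"] by (simp add: fl_def numeral_2_eq_2)
  moreover have "zz 0 = allb ?Z (cmg x) z0" by (simp add: zz_def)
  ultimately show "\<exists>z' h n. (True \<or> n \<le> pb KL x) \<and> Inv ?Z (cmg x) z0 z' \<and> (I.good x (vr ?Z z') \<or> (\<not> True \<and> vr ?Z z' = [])) \<and>
    bt (pb KL x) x r ?L (ES 0 1 1 (1 ## (\<lambda>_. 0)) (putv T 0 1 (allb ?Z (cmg x) z0)) 0) n (ES 0 1 1 (1 ## (\<lambda>_. 0)) (putv T 0 1 z') h)"
   using inv[of N] N by (intro exI[of _ "zz N"] exI[of _ 0] exI[of _ "pb KG x + (N * ((pb KB x + (3 + 5 + 1) + 1) + 1) + 1) + 1"]) simp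
 qed
 then show ?thesis by simp
qed

text \<open>The loop uses its own counter as the index of the cell, and this counter runs down;
  hence the reversed order.\<close>

definition rblk :: "bool list \<Rightarrow> bool list \<Rightarrow> bool list" where
 "rblk x r = map (\<lambda>i. read_rand r (Zx (length x) - 1 - i)) [0..<Zx (length x)]"

theorem rand_prog:
 "\<exists>P K. \<forall>x r T. Zb (length x) \<le> length T \<longrightarrow>
  (\<exists>t s'. bs (pb K x) x r P (pinit T) t s' \<and> t \<le> pb K x \<and> tape s' = T \<and> outcome x (regs s' 0 \<noteq> 0) False (rblk x r))"
proof -
 obtain PZ where PZ: "\<And>K. \<exists>K'. progr {(0, 1)} Zb 1 (\<lambda>x e z. (Zx (length x), z)) PZ K K'"
  using cp_elim[OF bf_Z] by blast
 have bs3: "BP 3 (\<lambda>x e z. (0, z[e (Suc 0) * Zx (length x) := (e 0 \<noteq> 0)]))" unfolding numeral_3_eq_3 by (rule bp_setv)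
 obtain PW where PW: "\<And>K. \<exists>K'. progr {(0, 1)} Zb 3 (\<lambda>x e z. (0, z[e (Suc 0) * Zx (length x) := (e 0 \<noteq> 0)])) PW K K'"
  using cp_elim[OF bs3] by blast
 obtain KZ where KZ: "progr {(0, 1)} Zb 1 (\<lambda>x e z. (Zx (length x), z)) PZ 0 KZ" using PZ by blast
 obtain KW where KW: "progr {(0, 1)} Zb 3 (\<lambda>x e z. (0, z[e (Suc 0) * Zx (length x) := (e 0 \<noteq> 0)])) PW KZ KW" using PW by blast
 have Zle: "Zx (length x) \<le> pb KZ x" for x
  using progr_value[OF KZ, of "\<lambda>_. 0" x "replicate (Zb (length x)) False"] by simp
 have pol: "pol (\<lambda>x. pb KZ x + (pb KZ x * (((1 + 2 + 1) + (pb KW x + 3 + 1) + 1) + 1) + 1) + 1 + 2)" by (intro pol_intros)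
 then obtain KL where KL: "\<And>x. pb KZ x + (pb KZ x * (((1 + 2 + 1) + (pb KW x + 3 + 1) + 1) + 1) + 1) + 1 + 2 \<le> pb KL x" unfolding pol_def by blast
 let ?b = "(Dec 3 ;; Ite RB (Inc 4) Skip) ;; (PW ;; clr 4)"
 let ?L = "PZ ;; Wh (NZ 3) ?b"
 have "\<exists>P K. (False \<longrightarrow> no_rand P) \<and> (\<forall>x r T. Zb (length x) \<le> length T \<longrightarrow>
  (\<exists>t s'. bs (pb K x) x r P (pinit T) t s' \<and> (False \<or> t \<le> pb K x) \<and> tape s' = T \<and> outcome x (regs s' 0 \<noteq> 0) False (rblk x r)))"
 proof (rule main_prog[where Lp = ?L and KL = KL and w = rblk])
  fix x r T z0 assume zl: "length z0 = Zb (length x)" and vo: "viewok (length z0) T 0 1" and ng: "\<not> exg x z0"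
  let ?Z = "Zx (length x)" let ?B = "pb KL x"
  have "pb KW x * 1 \<le> pb KZ x * (((1 + 2 + 1) + (pb KW x + 3 + 1) + 1) + 1)"
   using pb_ge1[of KZ x] mult_le_mono[of 1 "pb KZ x" "pb KW x" "((1 + 2 + 1) + (pb KW x + 3 + 1) + 1) + 1"] by simp
  then have Bs: "pb KZ x \<le> ?B" "pb KW x \<le> ?B" "2 \<le> ?B" using KL[of x] by linarith+
  define zz where "zz = rec_nat (allb ?Z (cmg x) z0) (\<lambda>j z. z[(?Z - Suc j) * ?Z := read_rand r j])"
  have zz: "zz 0 = allb ?Z (cmg x) z0" "zz (Suc j) = (zz j)[(?Z - Suc j) * ?Z := read_rand r j]" for j by (simp_all add: zz_def)
  have inv: "Inv ?Z (cmg x) z0 (zz j)" for j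
  proof (induction j)
   case 0
   then show ?case using Inv_start[OF zl] by (simp add: zz)
  next
   case (Suc j)
   have "?Z - Suc j < ?Z" using Zpos[of "length x"] by simp
   from Inv_upd[OF Suc this] show ?case by (simp add: zz)
  qed
  have zzl: "length (zz j) = Zb (length x)" for j using inv[of j] by (simp add: Inv_def)
  have vs: "j \<le> ?Z ==> \<forall>i<?Z. ?Z - j \<le> i \<longrightarrow> vr ?Z (zz j) ! i = read_rand r (?Z - 1 - i)" for j
  proof (induction j)
   case (Suc j)
   have i: "?Z - Suc j < ?Z" using Zpos[of "length x"] by simp
   have e: "?Z - 1 - (?Z - Suc j) = j" using Suc.prems by simp
   have v: "vr ?Z (zz (Suc j)) = (vr ?Z (zz j))[?Z - Suc j := read_rand r j]" unfolding zz(2) by (rule vr_upd[OF zzl i])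
   show ?case
   proof (intro allI impI)
    fix i assume i: "i < ?Z" "?Z - Suc j \<le> i"
    show "vr ?Z (zz (Suc j)) ! i = read_rand r (?Z - 1 - i)"
    proof (cases "i = ?Z - Suc j")
     case True
     then show ?thesis unfolding v using e i by simp
    next
     case False
     then have "?Z - j \<le> i" using i by linarith
     then show ?thesis unfolding v using False Suc i by simp
    qed
   qed
  qed simp
  have vZ: "vr ?Z (zz ?Z) = rblk x r"
   by (rule nth_equalityI) (use vs[of ?Z] in \<open>simp_all add: rblk_def\<close>)
  have p1: "1 \<le> pb K x" "0 \<le> pb K x" for K by (rule pb_ge1) simp
  note pr = progr_bt[where ba = 0 and sd = 1 and \<Lambda> = "{(0, 1)}", OF _ insertI1 p1(2) p1(1)]
  have vo': "viewok (length (zz j)) T 0 1" for j using vo zl zzl by simp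
  let ?f = "\<lambda>j. ES 0 1 2 ((?Z - j) ## 1 ## (\<lambda>_. 0)) (putv T 0 1 (zz j)) j"
  have s1: "bt ?B x r PZ (ES 0 1 1 (1 ## (\<lambda>_. 0)) (putv T 0 1 (zz 0)) 0) (pb KZ x) (?f 0)"
   using pr[OF KZ _ vo'[of 0] _ Bs(1) order_refl, of "1 ## (\<lambda>_. 0)" r 0] zzl p1 by (simp add: push_def numeral_2_eq_2)
  have body: "bt ?B x r ?b (?f j) ((1 + 2 + 1) + (pb KW x + 3 + 1) + 1) (?f (Suc j))" if j: "j < ?Z" for j
  proof -
   define v :: nat where "v = of_bool (read_rand r j)"
   let ?s1 = "ES 0 1 2 ((?Z - Suc j) ## 1 ## (\<lambda>_. 0)) (putv T 0 1 (zz j)) j"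
   let ?s2 = "ES 0 1 3 (v ## (?Z - Suc j) ## 1 ## (\<lambda>_. 0)) (putv T 0 1 (zz j)) (Suc j)"
   let ?s3 = "ES 0 1 3 (v ## (?Z - Suc j) ## 1 ## (\<lambda>_. 0)) (putv T 0 1 (zz (Suc j))) (Suc j)"
   have a: "bt ?B x r (Dec 3) (?f j) 1 ?s1"
    by (rule bt_line') (use j in \<open>auto simp: env_regs_def push_def ES_def fun_eq_iff split: nat.split\<close>)
   have b: "bt ?B x r (Ite RB (Inc 4) Skip) ?s1 (1 + 1) ?s2"
   proof (cases "read_rand r j")
    case True
    have "bt ?B x r (Inc 4) (?s1\<lparr>rhd := Suc (rhd ?s1)\<rparr>) 1 ?s2"
     by (rule bt_line') (use True Bs(3) in \<open>auto simp: v_def env_regs_def push_def ES_def fun_eq_iff split: nat.split\<close>)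
    then show ?thesis by (rule bt_RB) (simp add: True)
   next
    case False
    have "bt ?B x r Skip (?s1\<lparr>rhd := Suc (rhd ?s1)\<rparr>) 1 ?s2"
     by (rule bt_line') (use False in \<open>auto simp: v_def env_regs_def push_def ES_def fun_eq_iff split: nat.split\<close>)
    then show ?thesis by (rule bt_RB') (simp add: False)
   qed
   have zle: "?Z - Suc j \<le> pb KZ x" using Zle[of x] by simp
   have v1: "v \<le> pb KZ x" using pb_ge1[of KZ x] by (simp add: v_def)
   have "bt ?B x r PW ?s2 (pb KW x) (ES 0 1 (Suc 3) (0 ## v ## (?Z - Suc j) ## 1 ## (\<lambda>_. 0)) (putv T 0 1 (zz (Suc j))) (Suc j))"
    using pr[OF KW _ vo'[of j] _ Bs(2) order_refl, of "v ## (?Z - Suc j) ## 1 ## (\<lambda>_. 0)" r "Suc j"] zzl[of j] v1 zle p1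
    by (simp add: push_def zz v_def less_Suc_eq numeral_3_eq_3 split: nat.split)
   then have c: "bt ?B x r PW ?s2 (pb KW x) ?s3" unfolding ES_zero .
   have r4: "regs ?s3 4 = v" by (simp add: env_regs_def push_def)
   have d: "bt ?B x r (clr 4) ?s3 3 (?s3\<lparr>regs := (regs ?s3)(4 := 0)\<rparr>)"
    by (rule bt_le[OF bt_clr]) (use r4 in \<open>simp add: v_def\<close>)
   have eq: "?s3\<lparr>regs := (regs ?s3)(4 := 0)\<rparr> = ?f (Suc j)"
    by (rule pst_eqI) (auto simp: fun_eq_iff env_regs_def push_def ES_def split: nat.split)
   have d': "bt ?B x r (clr 4) ?s3 3 (?f (Suc j))" using d unfolding eq .
   have b': "bt ?B x r (Ite RB (Inc 4) Skip) ?s1 2 ?s2" using b by (rule bt_le) simp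
   show ?thesis by (rule bt_Sq[OF bt_Sq[OF a b'] bt_Sq[OF c d']])
  qed
  have "bt ?B x r (Wh (NZ 3) ?b) (?f 0) (?Z * (((1 + 2 + 1) + (pb KW x + 3 + 1) + 1) + 1) + 1) (?f ?Z)"
  proof (rule bt_loop)
   show "regs (?f j) 3 \<noteq> 0" if "j < ?Z" for j using that by (simp add: env_regs_def push_def)
   show "regs (?f ?Z) 3 = 0" by (simp add: env_regs_def push_def)
  qed (rule body)
  from bt_Sq[OF s1 this] have m: "bt ?B x r ?L (ES 0 1 1 (1 ## (\<lambda>_. 0)) (putv T 0 1 (zz 0)) 0)
    (pb KZ x + (?Z * (((1 + 2 + 1) + (pb KW x + 3 + 1) + 1) + 1) + 1) + 1) (?f ?Z)" .
  have f: "?f ?Z = ES 0 1 1 (1 ## (\<lambda>_. 0)) (putv T 0 1 (zz ?Z)) ?Z"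
   using ES_zero[of 0 1 1 "1 ## (\<lambda>_. 0)"] by (simp add: numeral_2_eq_2)
  have "?Z * (((1 + 2 + 1) + (pb KW x + 3 + 1) + 1) + 1) \<le> pb KZ x * (((1 + 2 + 1) + (pb KW x + 3 + 1) + 1) + 1)"
   by (rule mult_le_mono1[OF Zle])
  then have le: "pb KZ x + (?Z * (((1 + 2 + 1) + (pb KW x + 3 + 1) + 1) + 1) + 1) + 1 \<le> pb KL x" using KL[of x] by linarith
  show "\<exists>z' h n. (False \<or> n \<le> pb KL x) \<and> Inv ?Z (cmg x) z0 z' \<and> (I.good x (vr ?Z z') \<or> (\<not> False \<and> vr ?Z z' = rblk x r)) \<and>
    bt (pb KL x) x r ?L (ES 0 1 1 (1 ## (\<lambda>_. 0)) (putv T 0 1 (allb ?Z (cmg x) z0)) 0) n (ES 0 1 1 (1 ## (\<lambda>_. 0)) (putv T 0 1 z') h)"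
   using m le inv[of ?Z] vZ unfolding f zz(1)
   by (intro exI[of _ "zz ?Z"] exI[of _ ?Z] exI[of _ "pb KZ x + (?Z * (((1 + 2 + 1) + (pb KW x + 3 + 1) + 1) + 1) + 1) + 1"] conjI disjI2) (assumption | simp)+
 qed simp
 then show ?thesis by simp
qed

end

section \<open>Logarithms and powers of two\<close>

definition lg :: "nat \<Rightarrow> nat" where "lg n = nat \<lceil>log 2 (real n + 2)\<rceil>"
text \<open>A power of two between \<open>n + 2\<close> and \<open>(n + 2) ^ 2\<close>. As
  \<open>2 ^ (a * lg n)\<close> is \<open>uu n ^ a\<close>, widths of fields and polynomial bounds
  are exchanged without rounding.\<close>

definition uu :: "nat \<Rightarrow> nat" where "uu n = 2 ^ lg n"

lemma uu_ge: "n + 2 \<le> uu n"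
proof -
 have "log 2 (real n + 2) \<le> real (lg n)" unfolding lg_def by (rule real_nat_ceiling_ge)
 then have "2 powr (log 2 (real n + 2)) \<le> 2 powr real (lg n)" by (intro powr_mono) auto
 then have "real n + 2 \<le> 2 ^ lg n" by (simp add: powr_realpow)
 then have "real (n + 2) \<le> real (2 ^ lg n)" by simp
 then show ?thesis unfolding uu_def of_nat_le_iff .
qed

lemma less_lg: "i < lg n \<longleftrightarrow> 2 ^ i < n + 2"
proof
 assume "i < lg n"
 then have "int i < \<lceil>log 2 (real n + 2)\<rceil>" by (simp add: lg_def zless_nat_eq_int_zless)
 then have "real i < log 2 (real n + 2)" by (simp add: less_ceiling_iff)
 then have "2 powr real i < 2 powr (log 2 (real n + 2))" by (intro powr_less_mono) auto
 then have "real (2 ^ i) < real (n + 2)" by (simp add: powr_realpow)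
 then show "2 ^ i < n + 2" unfolding of_nat_less_iff .
next
 assume a: "2 ^ i < n + 2"
 show "i < lg n"
 proof (rule ccontr)
  assume "\<not> i < lg n"
  then have "(2::nat) ^ lg n \<le> 2 ^ i" by (intro power_increasing) auto
  with a uu_ge[of n] show False unfolding uu_def by linarith
 qed
qed

lemma lg_le: "lg n \<le> n + 1"
proof (rule ccontr)
 assume "\<not> lg n \<le> n + 1"
 then have "2 ^ (n + 1) < n + 2" using less_lg[of "n + 1" n] by simp
 moreover have "n + 1 < 2 ^ (n + 1)" by (rule less_exp)
 ultimately show False by simp
qed

lemma lg_pos: "0 < lg n" by (simp add: less_lg)

text \<open>The rounded logarithm of \<open>n + 2\<close> is the number of binary digits of
  \<open>n + 1\<close>, counted here by nonzero shifts: a form without real numbers that a program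
  can evaluate.\<close>

lemma lg_sum: "lg n = (\<Sum>i<n + 2. of_bool ((n + 1) div 2 ^ i \<noteq> 0))"
proof -
 have "(\<Sum>i<n + 2. of_bool ((n + 1) div 2 ^ i \<noteq> 0)) = (\<Sum>i<n + 2. of_bool (i < lg n) :: nat)"
  by (intro sum.cong refl) (auto simp: less_lg div_eq_0_iff)
 also have "\<dots> = card {i. i < n + 2 \<and> i < lg n}" by (rule card_lt_sum[symmetric])
 also have "{i. i < n + 2 \<and> i < lg n} = {..<lg n}" using lg_le[of n] by auto
 finally show ?thesis by simp
qed

lemma uu_le: "uu n \<le> (n + 2) ^ 2"
proof -
 have "uu n = 2 * 2 ^ (lg n - 1)" using lg_pos[of n] by (cases "lg n") (simp_all add: uu_def)
 also have "\<dots> \<le> 2 * (n + 2)" using less_lg[of "lg n - 1" n] lg_pos[of n] by simp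
 also have "\<dots> \<le> (n + 2) ^ 2" by (simp add: power2_eq_square)
 finally show ?thesis .
qed

lemma pol_uu: "pol (\<lambda>x. uu (length x))"
 unfolding pol_def pb_def using uu_le by blast

context cat begin

lemma cf_lg: "CF k (\<lambda>x e z. lg (length x))"
 unfolding lg_sum by (intro cf_sum cb_not cb_eq cf_shift cf_add cf_length cf_const cf_v) simp_all

lemma cf_uu: "CF k (\<lambda>x e z. uu (length x))"
 unfolding uu_def by (intro cf_pow2 cf_lg) (fold uu_def, rule pbd_pol[OF pol_uu])

end

lemma getf_upd:
 assumes "p < s" "s \<le> length l"
 shows "getf (l[p := y]) 0 s = getf l 0 s - of_bool (bit (getf l 0 s) p) * 2 ^ p + of_bool y * 2 ^ p"
proof -
 let ?S = "\<lambda>l. \<Sum>i\<in>{..<s} - {p}. of_bool (l ! i) * (2::nat) ^ i"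
 have g: "getf l 0 s = of_bool (l ! p) * 2 ^ p + ?S l" for l
  unfolding getf_def using assms(1) by (subst sum.remove[of "{..<s}" p]) auto
 have "?S (l[p := y]) = ?S l" by (rule sum.cong) auto
 moreover have "l[p := y] ! p = y" using assms by simp
 moreover have "bit (getf l 0 s) p = l ! p" using assms(1) by (simp add: bit_getf)
 ultimately show ?thesis by (simp add: g)
qed

section \<open>Catalytic machines as abstract machines\<close>

fun mc :: "move \<Rightarrow> nat" where "mc MLeft = 0" | "mc MStay = 1" | "mc MRight = 2"
definition mvn :: "nat \<Rightarrow> nat \<Rightarrow> nat \<Rightarrow> nat" where
 "mvn m i b = (if m = 0 then i - 1 else if m = 1 then i else min (Suc i) b)"

lemma mvn_mc: "mvn (mc m) i b = mv m i b" by (cases m) (simp_all add: mvn_def)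
lemma mv_le: "i \<le> b ==> mv m i b \<le> b" by (cases m) auto

definition op :: "nat \<Rightarrow> bool option" where "op a = (if a = 0 then Some False else if a = 1 then Some True else None)"

lemma op_of_bool [simp]: "op (of_bool v) = Some v" by (simp add: op_def)
lemma op_2 [simp]: "op 2 = None" by (simp add: op_def)

definition mk :: "nat \<Rightarrow> nat \<Rightarrow> nat \<Rightarrow> nat \<Rightarrow> nat \<Rightarrow> nat \<Rightarrow> nat \<Rightarrow> nat" where
 "mk X a b c d e f = ((((a * X + b) * X + c) * X + d) * X + e) * X + f"

lemma mk_fields:
 assumes "b < X" "c < X" "d < X" "e < X" "f < X"
 shows "mk X a b c d e f mod X = f" "mk X a b c d e f div X mod X = e" "mk X a b c d e f div X div X mod X = d"
  "mk X a b c d e f div X div X div X mod X = c" "mk X a b c d e f div X div X div X div X mod X = b"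
  "mk X a b c d e f div X div X div X div X div X = a"
proof -
 have d: "(p * X + q) div X = p" "(p * X + q) mod X = q" if "q < X" for p q using that by simp_all
 show "mk X a b c d e f mod X = f" "mk X a b c d e f div X mod X = e" "mk X a b c d e f div X div X mod X = d"
  "mk X a b c d e f div X div X div X mod X = c" "mk X a b c d e f div X div X div X div X mod X = b"
  "mk X a b c d e f div X div X div X div X div X = a"
  unfolding mk_def by (simp_all only: d assms)
qed

lemma mk_mod: "f < X ==> mk X a b c d e f mod X = f" by (simp add: mk_def)

lemma mk_less:
 assumes "a < N" "b < X" "c < X" "d < X" "e < X" "f < X"
 shows "mk X a b c d e f < N * X ^ 5"
proof -
 have st: "p * X + q < m * X" if "p < m" "q < X" for p q m
 proof -
  have "p * X + q < Suc p * X" using that by simp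
  also have "\<dots> \<le> m * X" using that by (intro mult_le_mono1) simp
  finally show ?thesis .
 qed
 have "mk X a b c d e f < N * X * X * X * X * X" unfolding mk_def by (intro st assms)
 then show ?thesis by (simp add: eval_nat_numeral mult.assoc)
qed

text \<open>A configuration without its catalytic tape becomes one number whose digits to base
  \<open>X\<close> are the control state, the input head, the work tape, the work head, the
  catalytic head and the random head. \<open>X\<close> exceeds each of the last five; the contents
  of the work tape are fewer than this because \<open>2 ^ wk n\<close> is \<open>uu n ^ k\<close>.
  \<open>rr\<close> tells whether there are random bits, and thereby rows, at all.\<close>

locale mach =
 fixes M :: cmachine and k :: nat and rr :: bool
 assumes wf: "wf_machine M"
begin

definition X :: "nat \<Rightarrow> nat" where "X n = uu n ^ (k + 2)"
definition wk :: "nat \<Rightarrow> nat" where "wk n = k * lg n"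
definition cn :: "nat \<Rightarrow> nat" where "cn n = (n + 2) ^ k"
definition Rn :: "nat \<Rightarrow> nat" where "Rn n = (if rr then (n + 2) ^ k else 0)"
definition fih :: "nat \<Rightarrow> nat \<Rightarrow> nat" where "fih n u = u div X n div X n div X n div X n mod X n"
definition fwt :: "nat \<Rightarrow> nat \<Rightarrow> nat" where "fwt n u = u div X n div X n div X n mod X n"
definition fwh :: "nat \<Rightarrow> nat \<Rightarrow> nat" where "fwh n u = u div X n div X n mod X n"
definition fch :: "nat \<Rightarrow> nat \<Rightarrow> nat" where "fch n u = u div X n mod X n"
definition frh :: "nat \<Rightarrow> nat \<Rightarrow> nat" where "frh n u = u mod X n"
definition fst' :: "nat \<Rightarrow> nat \<Rightarrow> nat" where "fst' n u = u div X n div X n div X n div X n div X n"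

definition rdi :: "bool list \<Rightarrow> nat \<Rightarrow> nat" where
 "rdi x i = (if 1 \<le> i \<and> i \<le> length x then of_bool (i - 1 < length x \<and> x ! (i - 1)) else 2)"
definition rdw :: "nat \<Rightarrow> nat \<Rightarrow> nat \<Rightarrow> nat" where
 "rdw n w i = (if 1 \<le> i \<and> i \<le> wk n then of_bool (bit w (i - 1)) else 2)"
text \<open>The transition function as a finite table: a state, three symbols with 2 for an
  endmarker, and a bit. This gives the \<open>54 = 3 * 3 * 3 * 2\<close> entries per state in
  \<open>ac\<close>.\<close>

definition ix :: "bool list \<Rightarrow> nat \<Rightarrow> nat \<Rightarrow> bool \<Rightarrow> nat" where
 "ix x u s v = (((fst' (length x) u * 3 + rdi x (fih (length x) u)) * 3 + rdw (length x) (fwt (length x) u) (fwh (length x) u)) * 3 + min s 2) * 2 + of_bool v"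
definition act :: "nat \<Rightarrow> action" where
 "act i = trans M (i div 2 div 3 div 3 div 3) (op (i div 2 div 3 div 3 mod 3)) (op (i div 2 div 3 mod 3)) (op (i div 2 mod 3)) (odd i)"
definition ac :: "(action \<Rightarrow> nat) \<Rightarrow> nat \<Rightarrow> nat" where
 "ac g i = (if i < 54 * nstates M then g (act i) else 0)"

text \<open>The quotients of powers stand for \<open>2 ^ p\<close> with \<open>p\<close> the scanned
  work cell, so writing a bit is a subtraction and an addition. The caps by \<open>Rn\<close> make
  \<open>rp_mono\<close> hold for all numbers, including those that code no configuration.\<close>

definition dnx :: "bool list \<Rightarrow> nat \<Rightarrow> nat \<Rightarrow> bool \<Rightarrow> nat" where
 "dnx x u s v = mk (X (length x)) (ac action.nxt (ix x u s v)) (mvn (ac (\<lambda>a. mc (imove a)) (ix x u s v)) (fih (length x) u) (length x + 1))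
   (if 1 \<le> fwh (length x) u \<and> fwh (length x) u \<le> wk (length x) then
    fwt (length x) u - of_bool (bit (fwt (length x) u) (fwh (length x) u - 1)) * (2 ^ wk (length x) div 2 ^ (wk (length x) - (fwh (length x) u - 1)))
     + of_bool (ac (\<lambda>a. of_bool (wwrite a)) (ix x u s v) \<noteq> 0) * (2 ^ wk (length x) div 2 ^ (wk (length x) - (fwh (length x) u - 1)))
   else fwt (length x) u)
   (mvn (ac (\<lambda>a. mc (wmove a)) (ix x u s v)) (fwh (length x) u) (wk (length x) + 1))
   (mvn (ac (\<lambda>a. mc (cmove a)) (ix x u s v)) (fch (length x) u) (cn (length x) + 1))
   (min (Rn (length x)) (min (Rn (length x)) (frh (length x) u) + ac (\<lambda>a. of_bool (radv a)) (ix x u s v)))"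
definition dwx :: "bool list \<Rightarrow> nat \<Rightarrow> nat \<Rightarrow> bool \<Rightarrow> bool" where
 "dwx x u s v \<longleftrightarrow> ac (\<lambda>a. of_bool (cwrite a)) (ix x u s v) \<noteq> 0"
definition hpx :: "bool list \<Rightarrow> nat \<Rightarrow> nat" where
 "hpx x u = (if 1 \<le> fch (length x) u \<and> fch (length x) u \<le> cn (length x) then fch (length x) u - 1 else cn (length x))"
definition hlx :: "bool list \<Rightarrow> nat \<Rightarrow> nat" where
 "hlx x u = (if fst' (length x) u = acc M then 1 else if fst' (length x) u = rej M then 2 else 0)"
definition rpx :: "bool list \<Rightarrow> nat \<Rightarrow> nat" where "rpx x u = min (Rn (length x)) (frh (length x) u)"

lemma uu2: "2 \<le> uu n" using uu_ge[of n] by simp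

lemma pow_uu: "a \<le> b ==> uu n ^ a \<le> uu n ^ b" using uu2[of n] by (intro power_increasing) auto

lemma cn_uu: "cn n \<le> uu n ^ k" unfolding cn_def by (intro power_mono uu_ge) simp
lemma Rn_uu: "Rn n \<le> uu n ^ k" using cn_uu[of n] by (simp add: Rn_def cn_def)

lemma two_wk: "2 ^ wk n = uu n ^ k"
 unfolding wk_def uu_def power_mult[symmetric] by (simp add: mult.commute)

lemma X_gt: "n + 1 < X n" "uu n ^ k < X n" "cn n + 1 < X n" "wk n + 1 < X n" "Rn n < X n"
proof -
 have u: "2 \<le> uu n" by (rule uu2)
 have p: "1 \<le> uu n ^ k" using u by simp
 have e: "X n = uu n ^ k * (uu n * uu n)" by (simp add: X_def power_add power2_eq_square)
 have "uu n ^ k * 4 \<le> uu n ^ k * (uu n * uu n)" using mult_le_mono[OF u u] by (intro mult_le_mono2) simp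
 then have q: "uu n ^ k * 4 \<le> X n" using e by simp
 have "uu n * 2 \<le> uu n * uu n" using u by (intro mult_le_mono2)
 also have "\<dots> \<le> X n" using p unfolding e by simp
 finally show "n + 1 < X n" using uu_ge[of n] by linarith
 show k: "uu n ^ k < X n" using p q by linarith
 show "cn n + 1 < X n" using cn_uu[of n] p q by linarith
 show "Rn n < X n" using Rn_uu[of n] k by linarith
 have "wk n < 2 ^ wk n" by (rule less_exp)
 then show "wk n + 1 < X n" using p q unfolding two_wk by linarith
qed

lemma rp_mono: "rpx x u \<le> rpx x (dnx x u s v)"
proof -
 have fe: "frh (length x) (dnx x u s v) = dnx x u s v mod X (length x)" by (simp only: frh_def)
 have "dnx x u s v mod X (length x) = min (Rn (length x)) (min (Rn (length x)) (frh (length x) u) + ac (\<lambda>a. of_bool (radv a)) (ix x u s v))"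
  unfolding dnx_def by (rule mk_mod) (use X_gt(5)[of "length x"] in \<open>simp add: min_def\<close>)
 then show ?thesis unfolding rpx_def fe by simp
qed

fun E :: "config \<Rightarrow> nat \<Rightarrow> nat \<times> bool list" where
 "E cfn n = (mk (X n) (st cfn) (ih cfn) (getf (wt cfn) 0 (wk n)) (wh cfn) (ch cfn) (rh cfn), ct cfn)"

definition cok :: "nat \<Rightarrow> config \<Rightarrow> bool" where
 "cok n cfn \<longleftrightarrow> st cfn < nstates M \<and> ih cfn \<le> n + 1 \<and> length (wt cfn) = wk n \<and> wh cfn \<le> wk n + 1 \<and> length (ct cfn) = cn n \<and> ch cfn \<le> cn n + 1 \<and> rh cfn \<le> Rn n"

lemma cok_fields:
 assumes "cok n cfn" and u: "u = fst (E cfn n)"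
 shows "frh n u = rh cfn" "fch n u = ch cfn" "fwh n u = wh cfn" "fwt n u = getf (wt cfn) 0 (wk n)" "fih n u = ih cfn" "fst' n u = st cfn"
  "u < nstates M * X n ^ 5"
proof -
 have w: "getf (wt cfn) 0 (wk n) < X n" using getf_less[of "wt cfn" 0 "wk n"] X_gt(2)[of n] unfolding two_wk by linarith
 have b: "ih cfn < X n" "wh cfn < X n" "ch cfn < X n" "rh cfn < X n" "st cfn < nstates M"
  using assms(1) X_gt[of n] by (auto simp: cok_def)
 note f = mk_fields[OF b(1) w b(2,3,4), of "st cfn"]
 show "frh n u = rh cfn" "fch n u = ch cfn" "fwh n u = wh cfn" "fwt n u = getf (wt cfn) 0 (wk n)" "fih n u = ih cfn" "fst' n u = st cfn"
  unfolding u frh_def fch_def fwh_def fwt_def fih_def fst'_def E.simps fst_conv by (rule f)+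
 show "u < nstates M * X n ^ 5" unfolding u E.simps fst_conv by (rule mk_less[OF b(5,1) w b(2,3,4)])
qed

lemma ac_ix:
 assumes "a < nstates M" "p \<le> 2" "q \<le> 2" "s \<le> (2::nat)"
 shows "ac g ((((a * 3 + p) * 3 + q) * 3 + s) * 2 + of_bool v) = g (trans M a (op p) (op q) (op s) v)"
proof -
 let ?i = "(((a * 3 + p) * 3 + q) * 3 + s) * 2 + of_bool v"
 have "of_bool v < (2::nat)" by simp
 then have 1: "?i div 2 = ((a * 3 + p) * 3 + q) * 3 + s" "odd ?i = v" by auto
 have d: "(y * 3 + z) div 3 = y" "(y * 3 + z) mod 3 = z" if "z \<le> 2" for y z :: nat using that by simp_all
 have "?i < 54 * nstates M" using assms by (cases v) simp_all
 then show ?thesis unfolding ac_def act_def 1 by (simp only: if_True d assms)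
qed

lemma step_nxt:
 assumes c: "cok (length x) cfn" and nh: "\<not> halted M cfn" and f: "f (rh cfn) = read_rand r (rh cfn)"
  and ra: "rh (step M x r cfn) \<le> Rn (length x)"
 shows "acm.nxt (cn (length x)) (hpx x) (rpx x) (dnx x) (dwx x) f (E cfn (length x)) = E (step M x r cfn) (length x)"
  "cok (length x) (step M x r cfn)"
proof -
 let ?n = "length x"
 define u where "u = fst (E cfn ?n)"
 note F = cok_fields[OF c u_def]
 have C: "st cfn < nstates M" "ih cfn \<le> ?n + 1" "length (wt cfn) = wk ?n" "wh cfn \<le> wk ?n + 1" "length (ct cfn) = cn ?n" "ch cfn \<le> cn ?n + 1" "rh cfn \<le> Rn ?n"
  using c by (auto simp: cok_def)
 \<comment> \<open>A step is determined by \<open>c\<close>, \<open>hp\<close>, \<open>rp\<close>,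
   \<open>dn\<close> and \<open>dw\<close>; the other parameters are set to dummies.\<close>
 interpret A: acm 1 "cn ?n" 0 0 "hpx x" "\<lambda>_. 0" "rpx x" "dnx x" "dwx x" by unfold_locales (auto intro: rp_mono)
 define s where "s = (if 1 \<le> ch cfn \<and> ch cfn \<le> cn ?n then of_bool (ct cfn ! (ch cfn - 1)) else 2 :: nat)"
 have sy: "A.sy (ct cfn) (hpx x u) = s" unfolding A.sy_def hpx_def F s_def by auto
 have rp: "rpx x u = rh cfn" unfolding rpx_def F using C(7) by simp
 let ?v = "read_rand r (rh cfn)"
 define a where "a = trans M (st cfn) (read_tape x (ih cfn)) (read_tape (wt cfn) (wh cfn)) (read_tape (ct cfn) (ch cfn)) ?v"
 have o1: "op (rdi x (ih cfn)) = read_tape x (ih cfn)" "rdi x (ih cfn) \<le> 2" by (auto simp: rdi_def read_tape_def)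
 have o2: "op (rdw ?n (getf (wt cfn) 0 (wk ?n)) (wh cfn)) = read_tape (wt cfn) (wh cfn)" "rdw ?n (getf (wt cfn) 0 (wk ?n)) (wh cfn) \<le> 2"
  using C(3) by (auto simp: rdw_def read_tape_def bit_getf)
 have o3: "op s = read_tape (ct cfn) (ch cfn)" "s \<le> 2" using C(5) by (auto simp: s_def read_tape_def)
 have ix: "ix x u s ?v = (((st cfn * 3 + rdi x (ih cfn)) * 3 + rdw ?n (getf (wt cfn) 0 (wk ?n)) (wh cfn)) * 3 + s) * 2 + of_bool ?v"
  unfolding ix_def F using o3(2) by (simp add: min_def)
 have ac: "ac g (ix x u s ?v) = g a" for g
  unfolding ix ac_ix[OF C(1) o1(2) o2(2) o3(2)] o1 o2 o3 a_def by (rule refl)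
 have S: "step M x r cfn = \<lparr> st = action.nxt a, ih = mv (imove a) (ih cfn) (Suc ?n), wt = write_tape (wt cfn) (wh cfn) (wwrite a),
   wh = mv (wmove a) (wh cfn) (Suc (length (wt cfn))), ct = write_tape (ct cfn) (ch cfn) (cwrite a),
   ch = mv (cmove a) (ch cfn) (Suc (length (ct cfn))), rh = (if radv a then Suc (rh cfn) else rh cfn) \<rparr>"
  using nh unfolding step_def a_def by (simp add: Let_def)
 have W: "(if 1 \<le> wh cfn \<and> wh cfn \<le> wk ?n then
    getf (wt cfn) 0 (wk ?n) - of_bool (bit (getf (wt cfn) 0 (wk ?n)) (wh cfn - 1)) * (2 ^ wk ?n div 2 ^ (wk ?n - (wh cfn - 1)))
     + of_bool (of_bool (wwrite a) \<noteq> (0::nat)) * (2 ^ wk ?n div 2 ^ (wk ?n - (wh cfn - 1)))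
   else getf (wt cfn) 0 (wk ?n)) = getf (write_tape (wt cfn) (wh cfn) (wwrite a)) 0 (wk ?n)"
 proof (cases "1 \<le> wh cfn \<and> wh cfn \<le> wk ?n")
  case True
  then have p: "wh cfn - 1 < wk ?n" by linarith
  have "(2::nat) ^ wk ?n div 2 ^ (wk ?n - (wh cfn - 1)) = 2 ^ (wh cfn - 1)" using p by (simp add: power_diff[symmetric] flip: power_diff)
  then show ?thesis using True getf_upd[OF p, of "wt cfn" "wwrite a"] C(3) by (simp add: write_tape_def)
 next
  case False
  then show ?thesis using C(3) by (auto simp: write_tape_def)
 qed
 have R: "min (Rn ?n) (min (Rn ?n) (rh cfn) + of_bool (radv a)) = (if radv a then Suc (rh cfn) else rh cfn)"
  using ra C(7) unfolding S by (cases "radv a") simp_all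
 have N: "dnx x u s ?v = fst (E (step M x r cfn) ?n)"
  unfolding dnx_def ac F mvn_mc W R S by (simp add: C)
 have T: "(ct cfn)[hpx x u := dwx x u s ?v] = write_tape (ct cfn) (ch cfn) (cwrite a)"
  unfolding dwx_def ac hpx_def F write_tape_def using C(5) by (auto simp: list_update_beyond)
 have "E cfn ?n = (u, ct cfn)" by (simp add: u_def)
 then show "A.nxt f (E cfn ?n) = E (step M x r cfn) ?n"
  unfolding A.nxt_def using sy rp f N T by (simp add: S)
 have "action.nxt a < nstates M" using wf by (simp add: wf_machine_def a_def)
 then show "cok ?n (step M x r cfn)"
  using C ra mv_le unfolding cok_def S by (simp add: write_tape_def mv_le)
qed

end

section \<open>Choice of the parameters\<close>

text \<open>\<open>g0\<close> and \<open>g1\<close> are precisions in powers of two: the gap of the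
  acceptance probabilities exceeds \<open>1 / 2 ^ g0\<close>, and at most a fraction
  \<open>1 / 2 ^ g1\<close> of all blocks is not good.\<close>

locale machp = mach +
 fixes g0 g1 :: nat
begin

text \<open>\<open>k + 3\<close> makes room for twice a defect code, as there are at most
  \<open>uu n ^ k\<close> rows; \<open>g1\<close> makes good blocks frequent.\<close>

definition hh :: nat where "hh = k + 3 + g1"
definition qq :: nat where "qq = nstates M + (k + 2) * 5"
text \<open>The solution of \<open>2 * dd = ee + hh\<close>, which is \<open>rowH\<close> for
  \<open>D = uu n ^ dd\<close>. Here \<open>ee\<close> contains \<open>bb\<close>, and
  \<open>bb\<close> contains \<open>dd\<close> once; the factor 2 from the square of
  \<open>D\<close> is what makes the equation solvable.\<close>

definition dd :: nat where "dd = 4 * qq + 5 + 2 * hh + k + g0"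
text \<open>One summand for each factor that \<open>2 ^ b\<close> has to exceed in
  \<open>gap\<close>: 4, \<open>Q\<close>, \<open>R\<close>, \<open>D\<close> and
  \<open>2 ^ g0\<close>.\<close>

definition bb :: nat where "bb = 2 + qq + k + dd + g0"
text \<open>The exponents of the three factors of \<open>tauH\<close>: \<open>1 + qq + bb\<close>
  for the trees, \<open>2 + 2 * qq\<close> for the places within a tree, \<open>hh\<close> for the
  displaced header.\<close>

definition ee :: nat where "ee = 3 * qq + bb + 3 + hh"
definition Qn :: "nat \<Rightarrow> nat" where "Qn n = nstates M * X n ^ 5"
definition Z :: "nat \<Rightarrow> nat" where "Z n = hh * lg n + ee * lg n + Rn n * (bb * lg n) + cn n"
definition s0 :: "nat \<Rightarrow> nat" where "s0 n = mk (X n) (start M) 0 0 0 0 0"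

lemma two_lg: "2 ^ (a * lg n) = uu n ^ a"
 unfolding uu_def power_mult[symmetric] by (simp add: mult.commute)

lemma Qn_uu: "Qn n \<le> uu n ^ qq"
proof -
 have "nstates M \<le> 2 ^ nstates M" by (rule less_imp_le[OF less_exp])
 also have "\<dots> \<le> uu n ^ nstates M" using uu2[of n] by (intro power_mono) auto
 finally have "nstates M * X n ^ 5 \<le> uu n ^ nstates M * X n ^ 5" by (rule mult_le_mono1)
 also have "\<dots> = uu n ^ qq" unfolding qq_def X_def power_add power_mult by (rule refl)
 finally show ?thesis by (simp add: Qn_def)
qed

lemma Qn_pos: "0 < Qn n"
proof -
 have "start M < nstates M" using wf by (simp add: wf_machine_def)
 moreover have "0 < X n" using X_gt(1)[of n] by simp
 ultimately show ?thesis by (simp add: Qn_def)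
qed

lemma uup: "1 \<le> uu n ^ a" using uu2[of n] by simp

lemma two_uu: "2 ^ a \<le> uu n ^ a" using uu2[of n] by (intro power_mono) auto

lemma pow2_uu: "m \<le> 2 ^ a ==> m * uu n ^ b \<le> uu n ^ (a + b)"
proof -
 assume "m \<le> 2 ^ a"
 then have "m \<le> uu n ^ a" using two_uu[of a n] by linarith
 then show ?thesis by (simp add: power_add)
qed

lemma blk_inst: "blk (Qn n) (Rn n) (bb * lg n) (hlx x) (rpx x) (dnx x) (hh * lg n) (ee * lg n) (uu n ^ dd)"
proof (intro blk.intro acm.intro blk_axioms.intro)
 show "1 \<le> hh * lg n" using lg_pos[of n] by (simp add: hh_def Suc_le_eq)
 have "2 * (2 * r + 2) \<le> 8 * w" if "r \<le> w" "1 \<le> w" for r w :: nat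
  using that mult_le_mono2[OF that(1), of 4] mult_le_mono2[OF that(2), of 4] by (simp add: algebra_simps)
 from this[OF Rn_uu uup] have "2 * (2 * Rn n + 2) \<le> 8 * uu n ^ k" .
 also have "\<dots> \<le> uu n ^ (3 + k)" by (rule pow2_uu) simp
 also have "\<dots> \<le> uu n ^ hh" by (rule pow_uu) (simp add: hh_def)
 finally show "2 * (2 * Rn n + 2) \<le> 2 ^ (hh * lg n)" unfolding two_lg .
 have "Qn n * uu n ^ bb \<le> uu n ^ (qq + bb)" unfolding power_add by (rule mult_le_mono1[OF Qn_uu])
 then have "Qn n * uu n ^ bb + 1 \<le> 2 * uu n ^ (qq + bb)" using uup[of n "qq + bb"] by linarith
 also have "\<dots> \<le> uu n ^ (1 + (qq + bb))" by (rule pow2_uu) simp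
 finally have 1: "Qn n * uu n ^ bb + 1 \<le> uu n ^ (1 + (qq + bb))" .
 have "Qn n * Qn n \<le> uu n ^ (qq + qq)" unfolding power_add by (rule mult_le_mono[OF Qn_uu Qn_uu])
 moreover have "Qn n \<le> uu n ^ (qq + qq)" using Qn_uu[of n] pow_uu[of qq "qq + qq" n] by simp
 ultimately have "Qn n * (2 * Qn n + 1) + 1 \<le> 4 * uu n ^ (qq + qq)"
  using uup[of n "qq + qq"] unfolding add_mult_distrib2 mult.left_commute[of _ 2] mult_1_right by linarith
 also have "\<dots> \<le> uu n ^ (2 + (qq + qq))" by (rule pow2_uu) simp
 finally have 2: "Qn n * (2 * Qn n + 1) + 1 \<le> uu n ^ (2 + (qq + qq))" .
 have "(Qn n * uu n ^ bb + 1) * (Qn n * (2 * Qn n + 1) + 1) * uu n ^ hh \<le> uu n ^ (1 + (qq + bb)) * uu n ^ (2 + (qq + qq)) * uu n ^ hh"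
  by (intro mult_le_mono1 mult_le_mono 1 2)
 also have "\<dots> = uu n ^ ((1 + (qq + bb)) + (2 + (qq + qq)) + hh)" by (simp only: power_add)
 also have "\<dots> = uu n ^ ee" unfolding ee_def by (rule arg_cong[where f = "\<lambda>a. uu n ^ a"]) simp
 finally show "(Qn n * 2 ^ (bb * lg n) + 1) * (Qn n * (2 * Qn n + 1) + 1) * 2 ^ (hh * lg n) \<le> 2 ^ (ee * lg n)" unfolding two_lg .
 have "uu n ^ ee * uu n ^ hh = uu n ^ (dd * 2)" unfolding power_add[symmetric] by (rule arg_cong[where f = "\<lambda>a. uu n ^ a"]) (simp add: ee_def bb_def dd_def)
 then show "2 ^ (ee * lg n) * 2 ^ (hh * lg n) \<le> 4 * (uu n ^ dd)\<^sup>2" unfolding two_lg by (simp add: power_mult)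
 show "rpx x u \<le> rpx x (dnx x u s v)" for u s v by (rule rp_mono)
 show "0 < Qn n" by (rule Qn_pos)
qed

lemma gap: "4 * (Qn n * (Rn n * uu n ^ dd)) * 2 ^ g0 \<le> 2 ^ (bb * lg n)"
proof -
 have "4 * (Qn n * (Rn n * uu n ^ dd)) * 2 ^ g0 \<le> 4 * (uu n ^ qq * (uu n ^ k * uu n ^ dd)) * uu n ^ g0"
  by (intro mult_le_mono Qn_uu Rn_uu two_uu order_refl)
 also have "\<dots> = 4 * uu n ^ (qq + (k + dd) + g0)" by (simp only: power_add mult.assoc)
 also have "\<dots> \<le> uu n ^ (2 + (qq + (k + dd) + g0))" by (rule pow2_uu) simp
 also have "\<dots> = 2 ^ (bb * lg n)" unfolding two_lg bb_def by (rule arg_cong[where f = "\<lambda>a. uu n ^ a"]) simp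
 finally show ?thesis .
qed

lemma few: "(2 * Rn n + 1) * 2 ^ g1 < 2 ^ (hh * lg n)"
proof -
 have "(2 * Rn n + 1) * 2 ^ g1 \<le> (4 * uu n ^ k) * uu n ^ g1"
 proof (intro mult_le_mono two_uu)
  have "2 * r + 1 \<le> 4 * w" if "r \<le> w" "1 \<le> w" for r w :: nat using that by linarith
  from this[OF Rn_uu uup] show "2 * Rn n + 1 \<le> 4 * uu n ^ k" .
 qed
 also have "\<dots> = 4 * uu n ^ (k + g1)" by (simp add: power_add)
 also have "\<dots> < 8 * uu n ^ (k + g1)" using uu2[of n] by simp
 also have "\<dots> \<le> uu n ^ (3 + (k + g1))" by (rule pow2_uu) simp
 also have "\<dots> = 2 ^ (hh * lg n)" unfolding two_lg hh_def by (rule arg_cong[where f = "\<lambda>a. uu n ^ a"]) simp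
 finally show ?thesis .
qed

interpretation ct: cat UNIV Z by unfold_locales simp

lemma cX: "ct.CF j (\<lambda>x e z. X (length x))" unfolding X_def by (intro ct.cf_power ct.cf_uu)
lemma cwk: "ct.CF j (\<lambda>x e z. wk (length x))" unfolding wk_def by (intro ct.cf_mult ct.cf_const ct.cf_lg)
lemma ccn: "ct.CF j (\<lambda>x e z. cn (length x))" unfolding cn_def by (intro ct.cf_power ct.cf_add ct.cf_const ct.cf_length)
lemma cRn: "ct.CF j (\<lambda>x e z. Rn (length x))" unfolding Rn_def by (intro ct.cf_if ct.cb_const ct.cf_const ct.cf_power ct.cf_add ct.cf_length)
lemma cuu: "ct.CF j (\<lambda>x e z. uu (length x) ^ a)" by (intro ct.cf_power ct.cf_uu)
lemma clg: "ct.CF j (\<lambda>x e z. a * lg (length x))" by (intro ct.cf_mult ct.cf_const ct.cf_lg)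
lemma c2lg: "ct.CF j (\<lambda>x e z. 2 ^ (a * lg (length x)))" unfolding two_lg by (rule cuu)
lemma c2wk: "ct.CF j (\<lambda>x e z. 2 ^ wk (length x))" unfolding two_wk by (rule cuu)

lemmas ca = ct.cf_add ct.cf_minus ct.cf_mult ct.cf_div ct.cf_mod ct.cf_const cf_Suc ct.cf_length cX cwk ccn cRn

lemma cfields:
 assumes "ct.CF j U"
 shows "ct.CF j (\<lambda>x e z. fih (length x) (U x e z))" "ct.CF j (\<lambda>x e z. fwt (length x) (U x e z))" "ct.CF j (\<lambda>x e z. fwh (length x) (U x e z))"
  "ct.CF j (\<lambda>x e z. fch (length x) (U x e z))" "ct.CF j (\<lambda>x e z. frh (length x) (U x e z))" "ct.CF j (\<lambda>x e z. fst' (length x) (U x e z))"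
 unfolding fih_def fwt_def fwh_def fch_def frh_def fst'_def by (intro ca assms)+

lemma crdi: "ct.CF j U ==> ct.CF j (\<lambda>x e z. rdi x (U x e z))"
 unfolding rdi_def by (intro ct.cf_if ct.cb_conj ct.cb_le ct.cf_inp ca)

lemma crdw: "ct.CF j U ==> ct.CF j V ==> ct.CF j (\<lambda>x e z. rdw (length x) (U x e z) (V x e z))"
 unfolding rdw_def by (intro ct.cf_if ct.cb_conj ct.cb_le ct.cb_bit ca)

lemma cac: "ct.CF j U ==> ct.CF j (\<lambda>x e z. ac g (U x e z))"
 unfolding ac_def by (rule ct.cf_table)

lemma cix:
 assumes "ct.CF j U" "ct.CF j V" "ct.CB j W"
 shows "ct.CF j (\<lambda>x e z. ix x (U x e z) (V x e z) (W x e z))"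
 unfolding ix_def by (intro ca crdi crdw cfields ct.cf_min assms)

lemma cmvn: "ct.CF j A ==> ct.CF j U ==> ct.CF j V ==> ct.CF j (\<lambda>x e z. mvn (A x e z) (U x e z) (V x e z))"
 unfolding mvn_def by (intro ct.cf_if ct.cb_eq ct.cf_min ca)

lemma cdn:
 assumes "ct.CF j U" "ct.CF j V" "ct.CB j W"
 shows "ct.CF j (\<lambda>x e z. dnx x (U x e z) (V x e z) (W x e z))"
 unfolding dnx_def mk_def
 by (intro ca cmvn cac cix cfields assms ct.cf_if ct.cb_conj ct.cb_le ct.cb_not ct.cb_eq ct.cb_bit ct.cf_shift c2wk ct.cf_min)

lemma cdw:
 assumes "ct.CF j U" "ct.CF j V" "ct.CB j W"
 shows "ct.CB j (\<lambda>x e z. dwx x (U x e z) (V x e z) (W x e z))"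
 unfolding dwx_def by (intro ct.cb_not ct.cb_eq cac cix assms ct.cf_const)

lemma Z_inst: "cat_tape UNIV Z"
proof
 have "ct.CF 0 (\<lambda>x e z. hh * lg (length x) + ee * lg (length x) + Rn (length x) * (bb * lg (length x)) + cn (length x))" by (intro ca clg)
 then show "ct.CF 0 (\<lambda>x e z. Z (length x))" by (rule cp_cong) (simp add: Z_def)
 show "0 < Z n" for n using lg_pos[of n] by (simp add: Z_def hh_def)
qed

lemma comp_inst: "comp Z (\<lambda>x. Qn (length x)) (\<lambda>x. cn (length x)) (\<lambda>x. Rn (length x)) (\<lambda>x. bb * lg (length x)) (\<lambda>x. hh * lg (length x))
  (\<lambda>x. ee * lg (length x)) (\<lambda>x. uu (length x) ^ dd) (\<lambda>x. s0 (length x)) hpx hlx rpx dnx dwx"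
proof (intro comp.intro Z_inst comp_axioms.intro)
 show "ct.CF 0 (\<lambda>x e z. Qn (length x))" unfolding Qn_def by (intro ca ct.cf_power)
 show "ct.CF 0 (\<lambda>x e z. s0 (length x))" unfolding s0_def mk_def by (intro ca)
 show "ct.CF (Suc 0) (\<lambda>x e z. hpx x (e 0))" unfolding hpx_def by (intro ct.cf_if ct.cb_conj ct.cb_le ca cfields ct.cf_v) simp_all
 show "ct.CF (Suc 0) (\<lambda>x e z. hlx x (e 0))" unfolding hlx_def by (intro ct.cf_if ct.cb_eq ca cfields ct.cf_v) simp_all
 show "ct.CF (Suc 0) (\<lambda>x e z. rpx x (e 0))" unfolding rpx_def by (intro ct.cf_min ca cfields ct.cf_v) simp_all
 show "ct.CF (Suc (Suc (Suc 0))) (\<lambda>x e z. dnx x (e 0) (e (Suc 0)) (e (Suc (Suc 0)) \<noteq> 0))" by (intro cdn ct.cb_nz ct.cf_v) simp_all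
 show "ct.CB (Suc (Suc (Suc 0))) (\<lambda>x e z. dwx x (e 0) (e (Suc 0)) (e (Suc (Suc 0)) \<noteq> 0))" by (intro cdw ct.cb_nz ct.cf_v) simp_all
 show "Z (length x) = hh * lg (length x) + ee * lg (length x) + Rn (length x) * (bb * lg (length x)) + cn (length x)" for x :: "bool list"
  by (simp add: Z_def)
qed (intro blk_inst ccn cRn clg c2lg cuu)+

end

sublocale machp \<subseteq> C: comp Z "\<lambda>x. Qn (length x)" "\<lambda>x. cn (length x)" "\<lambda>x. Rn (length x)" "\<lambda>x. bb * lg (length x)" "\<lambda>x. hh * lg (length x)"
  "\<lambda>x. ee * lg (length x)" "\<lambda>x. uu (length x) ^ dd" "\<lambda>x. s0 (length x)" hpx hlx rpx dnx dwx
 by (rule comp_inst)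

section \<open>Runs of the machine as paths in the trees\<close>

context machp begin

lemma not_good_card: "card {z. length z = Z (length x) \<and> \<not> C.I.good x z} * 2 ^ g1 \<le> 2 ^ Z (length x)"
 and ex_good: "\<exists>z. length z = Z (length x) \<and> C.I.good x z"
proof -
 let ?n = "length x"
 let ?N = "card {z. length z = Z ?n \<and> \<not> C.I.good x z}"
 have f: "?N * 2 ^ (hh * lg ?n) \<le> (2 * Rn ?n + 1) * 2 ^ Z ?n" using C.I.few_not_good[of x] by (simp add: C.ZL)
 have "?N * 2 ^ g1 * 2 ^ (hh * lg ?n) \<le> (2 * Rn ?n + 1) * 2 ^ Z ?n * 2 ^ g1" using mult_le_mono1[OF f, of "2 ^ g1"] by (simp add: ac_simps)
 also have "\<dots> = ((2 * Rn ?n + 1) * 2 ^ g1) * 2 ^ Z ?n" by (simp only: ac_simps)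
 \<comment> \<open>Because this is strict, a good block exists even for
   \<open>g1 = 0\<close>.\<close>
 also have "\<dots> < 2 ^ (hh * lg ?n) * 2 ^ Z ?n" using few[of ?n] by (intro mult_strict_right_mono) simp_all
 finally have lt: "?N * 2 ^ g1 < 2 ^ Z ?n" by simp
 then show "?N * 2 ^ g1 \<le> 2 ^ Z ?n" by simp
 have "?N * 1 \<le> ?N * 2 ^ g1" by (intro mult_le_mono2) simp
 then have "?N < 2 ^ Z ?n" using lt by linarith
 moreover have "card {z :: bool list. length z = Z ?n} = 2 ^ Z ?n" using card_lists_length_eq[of "UNIV :: bool set" "Z ?n"] by simp
 ultimately have "{z. length z = Z ?n \<and> \<not> C.I.good x z} \<noteq> {z. length z = Z ?n}" by force
 then show "\<exists>z. length z = Z ?n \<and> C.I.good x z" by blast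
qed

text \<open>Built backwards from the halting end, step by step. Where the machine has halted before
  time \<open>T\<close>, the configuration only repeats and adds nothing.\<close>

lemma lead_run:
 assumes t: "length t = cn (length x)" and l: "length l = Rn (length x)"
  and rh: "\<And>i. i \<le> T ==> rh (run M x l (wk (length x)) t i) \<le> Rn (length x)"
  and hT: "halted M (run M x l (wk (length x)) t T)"
 shows "(s0 (length x), t) \<in> C.I.lead x (C.I.sh 0 l) 0 (E (run M x l (wk (length x)) t T) (length x))"
  "cok (length x) (run M x l (wk (length x)) t T)"
proof -
 let ?n = "length x"
 let ?c = "run M x l (wk ?n) t"
 have rs: "?c (Suc i) = step M x l (?c i)" for i by (simp add: run_def)
 have ok0: "cok ?n (?c 0)" using wf t by (simp add: run_def init_def cok_def wf_machine_def)
 have f: "C.I.sh 0 l i = read_rand l i" for i by (simp add: C.I.sh_def read_rand_def)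
 have hs: "step M x l cfn = cfn" if "halted M cfn" for cfn using that by (simp add: step_def)
 have ok: "i \<le> T ==> cok ?n (?c i)" for i
 proof (induction i)
  case (Suc i)
  show ?case
  proof (cases "halted M (?c i)")
   case True
   then show ?thesis using Suc hs by (simp add: run_def)
  next
   case False
   have "rh (step M x l (?c i)) \<le> Rn ?n" using rh[OF Suc.prems] by (simp add: run_def)
   from step_nxt(2)[OF _ False _ this, of "C.I.sh 0 l"] Suc f show ?thesis by (simp add: run_def)
  qed
 qed (rule ok0)
 show "cok ?n (?c T)" by (rule ok) simp
 have "j \<le> T ==> E (?c (T - j)) ?n \<in> C.I.lead x (C.I.sh 0 l) 0 (E (?c T) ?n)" for j
 proof (induction j)
  case 0
  then show ?case using C.I.lead_root by simp
 next
  case (Suc j)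
  let ?i = "T - Suc j"
  have i: "Suc ?i = T - j" using Suc.prems by simp
  have c: "cok ?n (?c ?i)" by (rule ok) simp
  have st: "?c (T - j) = step M x l (?c ?i)" using rs[of ?i] unfolding i .
  have IH: "E (?c (T - j)) ?n \<in> C.I.lead x (C.I.sh 0 l) 0 (E (?c T) ?n)" using Suc by simp
  show ?case
  proof (cases "halted M (?c ?i)")
   case True
   then show ?thesis using IH st hs by simp
  next
   case False
   have r: "rh (step M x l (?c ?i)) \<le> Rn ?n" unfolding st[symmetric] by (rule rh) simp
   note nx = step_nxt(1)[where x = x and cfn = "?c ?i" and r = l and f = "C.I.sh 0 l", OF c False f r]
   define u where "u = fst (E (?c ?i) ?n)"
   note F = cok_fields[OF c u_def]
   have e: "E (?c ?i) ?n = (u, ct (?c ?i))" by (simp add: u_def)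
   have "(u, ct (?c ?i)) \<in> C.I.lead x (C.I.sh 0 l) 0 (E (?c T) ?n)"
   proof (rule C.I.lead_step)
    show "C.I.nxt x (C.I.sh 0 l) (u, ct (?c ?i)) \<in> C.I.lead x (C.I.sh 0 l) 0 (E (?c T) ?n)"
     using IH unfolding st nx[symmetric] e .
    show "hlx x u = 0" using False by (simp add: hlx_def F halted_def)
    show "u < Qn ?n" using F(7) by (simp add: Qn_def)
    show "length (ct (?c ?i)) = cn ?n" using c by (simp add: cok_def)
   qed simp
   then show ?thesis unfolding e .
  qed
 qed
 from this[of T] have "E (?c 0) ?n \<in> C.I.lead x (C.I.sh 0 l) 0 (E (?c T) ?n)" by simp
 moreover have "getf (replicate (wk ?n) False) 0 (wk ?n) = 0" by (simp add: getf_def)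
 ultimately show "(s0 ?n, t) \<in> C.I.lead x (C.I.sh 0 l) 0 (E (?c T) ?n)" by (simp add: run_def init_def s0_def)
qed

text \<open>The roots in \<open>pr\<close> carry the content \<open>t\<close>, so leading from the
  start configuration to such a root says that the run restores \<open>t\<close> and has the outcome
  of the root. A run has only one end, which gives the converse.\<close>

lemma pr_run:
 assumes t: "length t = cn (length x)"
  and rh: "\<And>l i. length l = Rn (length x) ==> i \<le> T ==> rh (run M x l (wk (length x)) t i) \<le> Rn (length x)"
  and hT: "\<And>l. length l = Rn (length x) ==> halted M (run M x l (wk (length x)) t T)"
 shows "C.I.pr x (s0 (length x)) t 1 = real (card {l. length l = Rn (length x) \<and> st (run M x l (wk (length x)) t T) = acc M \<and> ct (run M x l (wk (length x)) t T) = t}) / 2 ^ Rn (length x)"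
  "C.I.pr x (s0 (length x)) t 2 = real (card {l. length l = Rn (length x) \<and> st (run M x l (wk (length x)) t T) \<noteq> acc M \<and> ct (run M x l (wk (length x)) t T) = t}) / 2 ^ Rn (length x)"
proof -
 let ?n = "length x"
 let ?c = "\<lambda>l. run M x l (wk ?n) t T"
 have key: "(\<exists>e<Qn ?n. hlx x e = o1 \<and> (s0 ?n, t) \<in> C.I.lead x (C.I.sh 0 l) 0 (e, t)) \<longleftrightarrow>
   (if st (?c l) = acc M then 1 else 2) = o1 \<and> ct (?c l) = t" if l: "length l = Rn ?n" and o: "o1 \<noteq> 0" for l o1
 proof -
  define u where "u = fst (E (?c l) ?n)"
  note L = lead_run[OF t l rh[OF l] hT[OF l]]
  note F = cok_fields[OF L(2) u_def]
  have e: "E (?c l) ?n = (u, ct (?c l))" by (simp add: u_def)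
  have h: "hlx x u = (if st (?c l) = acc M then 1 else 2)" using hT[OF l] by (auto simp: hlx_def F halted_def)
  have uQ: "u < Qn ?n" using F(7) by (simp add: Qn_def)
  show ?thesis
  proof
   assume "\<exists>e<Qn ?n. hlx x e = o1 \<and> (s0 ?n, t) \<in> C.I.lead x (C.I.sh 0 l) 0 (e, t)"
   then obtain e where "hlx x e = o1" "(s0 ?n, t) \<in> C.I.lead x (C.I.sh 0 l) 0 (e, t)" by blast
   moreover have "(s0 ?n, t) \<in> C.I.lead x (C.I.sh 0 l) 0 (u, ct (?c l))" using L(1) unfolding e .
   ultimately have "(e, t) = (u, ct (?c l))" using o h by (intro C.I.lead_unique) auto
   then show "(if st (?c l) = acc M then 1 else 2) = o1 \<and> ct (?c l) = t" using h \<open>hlx x e = o1\<close> by auto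
  next
   assume "(if st (?c l) = acc M then 1 else 2) = o1 \<and> ct (?c l) = t"
   then show "\<exists>e<Qn ?n. hlx x e = o1 \<and> (s0 ?n, t) \<in> C.I.lead x (C.I.sh 0 l) 0 (e, t)"
    using L(1) h uQ unfolding e by (intro exI[of _ u]) auto
  qed
 qed
 have "{l. length l = Rn ?n \<and> (\<exists>e<Qn ?n. hlx x e = 1 \<and> (s0 ?n, t) \<in> C.I.lead x (C.I.sh 0 l) 0 (e, t))} =
  {l. length l = Rn ?n \<and> st (?c l) = acc M \<and> ct (?c l) = t}" using key[of _ 1] by (intro Collect_cong conj_cong refl) simp
 then show "C.I.pr x (s0 ?n) t 1 = real (card {l. length l = Rn ?n \<and> st (?c l) = acc M \<and> ct (?c l) = t}) / 2 ^ Rn ?n" by (simp add: C.I.pr_def)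
 have "{l. length l = Rn ?n \<and> (\<exists>e<Qn ?n. hlx x e = 2 \<and> (s0 ?n, t) \<in> C.I.lead x (C.I.sh 0 l) 0 (e, t))} =
  {l. length l = Rn ?n \<and> st (?c l) \<noteq> acc M \<and> ct (?c l) = t}" using key[of _ 2] by (intro Collect_cong conj_cong refl) simp
 then show "C.I.pr x (s0 ?n) t 2 = real (card {l. length l = Rn ?n \<and> st (?c l) \<noteq> acc M \<and> ct (?c l) = t}) / 2 ^ Rn ?n" by (simp add: C.I.pr_def)
qed

lemma ans_L:
 assumes g: "C.I.good x z" and gam: "1 < \<gamma> * 2 ^ g0"
  and d: "x \<in> L ==> \<gamma> \<le> C.I.pr x (s0 (length x)) (C.I.tau x z) 1 - C.I.pr x (s0 (length x)) (C.I.tau x z) 2"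
   "x \<notin> L ==> \<gamma> \<le> C.I.pr x (s0 (length x)) (C.I.tau x z) 2 - C.I.pr x (s0 (length x)) (C.I.tau x z) 1"
 shows "C.I.ans x (s0 (length x)) z \<longleftrightarrow> x \<in> L"
proof -
 let ?n = "length x"
 have "real (4 * (Qn ?n * (Rn ?n * uu ?n ^ dd)) * 2 ^ g0) \<le> real (2 ^ (bb * lg ?n))" using gap[of ?n] unfolding of_nat_le_iff .
 then have a: "4 * (real (Qn ?n) * (real (Rn ?n) * real (uu ?n ^ dd))) * 2 ^ g0 \<le> 2 ^ (bb * lg ?n)" by simp
 have ar: "p < \<gamma> * w" if "p * v \<le> w" "1 < \<gamma> * v" "0 < w" "0 < v" for p v w :: real
 proof -
  have "w < (\<gamma> * w) * v" using mult_strict_right_mono[OF that(2,3)] by (simp add: ac_simps)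
  then have "p * v < (\<gamma> * w) * v" using that(1) by linarith
  then show ?thesis using that(4) by simp
 qed
 have gp: "4 * (real (Qn ?n) * (real (Rn ?n) * real (uu ?n ^ dd))) < \<gamma> * 2 ^ (bb * lg ?n)"
  by (rule ar[OF a gam]) simp_all
 show ?thesis using C.I.ans_correct[OF g gp, of "s0 ?n"] d by blast
qed

end

section \<open>Random strings and their prefixes\<close>

lemma finite_bl: "finite {r :: bool list. length r = m \<and> P r}"
 by (rule finite_subset[OF _ finite_lists_length_eq[of "UNIV :: bool set" m]]) auto

lemma card_bl: "card {r :: bool list. length r = m} = 2 ^ m"
 using card_lists_length_eq[of "UNIV :: bool set" m] by simp

lemma card_prefix:
 assumes "R \<le> m"
 shows "card {r :: bool list. length r = m \<and> P (take R r)} = card {l. length l = R \<and> P l} * 2 ^ (m - R)"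
proof -
 let ?A = "{l. length l = R \<and> P l}" let ?B = "{s :: bool list. length s = m - R}"
 have "{r. length r = m \<and> P (take R r)} = (\<lambda>(l, s). l @ s) ` (?A \<times> ?B)"
 proof (intro equalityI subsetI)
  fix r assume "r \<in> {r. length r = m \<and> P (take R r)}"
  then show "r \<in> (\<lambda>(l, s). l @ s) ` (?A \<times> ?B)" using assms by (intro image_eqI[of _ _ "(take R r, drop R r)"]) auto
 qed (use assms in auto)
 moreover have "inj_on (\<lambda>(l, s). l @ s) (?A \<times> ?B)" by (auto simp: inj_on_def)
 ultimately have "card {r. length r = m \<and> P (take R r)} = card (?A \<times> ?B)" by (simp add: card_image)
 then show ?thesis by (simp add: card_cartesian_product card_bl)
qed

lemma prob_prefix:
 assumes "R \<le> m"
 shows "prob_rand m (\<lambda>r. P (take R r)) = real (card {l. length l = R \<and> P l}) / 2 ^ R"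
proof -
 have "(2::real) ^ m = 2 ^ (m - R) * 2 ^ R" using assms by (simp flip: power_add)
 then show ?thesis unfolding prob_rand_def card_prefix[OF assms] by simp
qed

lemma prob_mono:
 assumes "\<And>r. length r = m ==> P r ==> Q r"
 shows "prob_rand m P \<le> prob_rand m Q"
proof -
 have "card {r. length r = m \<and> P r} \<le> card {r. length r = m \<and> Q r}"
  by (rule card_mono[OF finite_bl]) (use assms in auto)
 then show ?thesis by (simp add: prob_rand_def divide_right_mono)
qed

lemma run_Suc: "run M x r s t (Suc i) = step M x r (run M x r s t i)"
 by (simp add: run_def)

lemma run_rh: "rh (run M x r s t i) \<le> i"
proof (induction i)
 case (Suc i)
 have "rh (step M x r cfn) \<le> Suc (rh cfn)" for cfn by (simp add: step_def Let_def)
 from this[of "run M x r s t i"] Suc show ?case unfolding run_Suc by linarith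
qed (simp add: run_def init_def)

lemma read_take: "j < R ==> read_rand r j = read_rand (take R r) j"
 by (simp add: read_rand_def)

text \<open>Before step \<open>i\<close> is completed the random head has moved at most
  \<open>i - 1\<close> times, so only the first \<open>i\<close> bits can have been read.
  Probabilities over exponentially long strings thus reduce to those over \<open>R\<close>
  bits.\<close>

lemma run_take: "i \<le> R ==> run M x r s t i = run M x (take R r) s t i"
proof (induction i)
 case (Suc i)
 let ?c = "run M x (take R r) s t i"
 have "rh ?c < R" using run_rh[of M x "take R r" s t i] Suc.prems by linarith
 then have rd: "read_rand r (rh ?c) = read_rand (take R r) (rh ?c)" by (rule read_take)
 have ih: "run M x r s t i = ?c" by (rule Suc.IH) (use Suc.prems in simp)
 show ?case unfolding run_Suc ih step_def rd by (rule refl)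
qed (simp add: run_def)

section \<open>Resource bounds and membership in the two classes\<close>

lemma work_lg: "work_bound k n = k * lg n"
 by (simp add: work_bound_def lg_def)

text \<open>\<open>m\<close> registers of \<open>w\<close> bits fill the work tape exactly. The
  width leaves room for values up to the \<open>K\<close>-th power of \<open>n + 2\<close>, and the
  same exponent, with 8 as a margin for the cost of scans, also pays for the time and for the array
  of blocks.\<close>

lemma resources:
 fixes K KZ m n :: nat
 assumes "0 < m"
 defines "k' \<equiv> m * (2 * (K + KZ + 8))" and "w \<equiv> 2 * (K + KZ + 8) * lg n"
 shows "work_bound k' n = m * w" "(n + 2) ^ K < 2 ^ w" "(n + 2) ^ KZ \<le> poly_bound k' n"
  "t \<le> (n + 2) ^ K ==> scan_cost m w * Suc t \<le> poly_bound k' n"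
proof -
 let ?J = "K + KZ + 8"
 define p where "p = m * ?J"
 have k': "k' = 2 * p" by (simp add: k'_def p_def)
 have pJ: "?J \<le> p" using assms(1) by (simp add: p_def)
 show "work_bound k' n = m * w" by (simp add: work_lg k'_def w_def)
 have inc: "a \<le> b ==> (n + 2) ^ a \<le> (n + 2) ^ b" for a b by (rule power_increasing) auto
 have "(n + 2) ^ K < (n + 2) ^ (2 * ?J)" by (rule power_strict_increasing) auto
 also have "\<dots> \<le> uu n ^ (2 * ?J)" by (rule power_mono[OF uu_ge]) simp
 also have "\<dots> = 2 ^ w" unfolding uu_def w_def power_mult[symmetric] by (simp add: mult.commute)
 finally show "(n + 2) ^ K < 2 ^ w" .
 show "(n + 2) ^ KZ \<le> poly_bound k' n" unfolding poly_bound_def by (rule inc) (use pJ k' in linarith)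
 assume t: "t \<le> (n + 2) ^ K"
 have mw: "m * w = k' * lg n" by (simp add: k'_def w_def)
 have mk: "m \<le> k'" "1 \<le> k'" using assms(1) by (simp_all add: k'_def)
 have "scan_cost m w = 2 * (k' * lg n) + 2 * m + 4" unfolding scan_cost_def mw by simp
 also have "\<dots> \<le> 2 * (k' * (n + 1)) + 2 * k' + 4 * k'" using mult_le_mono2[OF lg_le[of n], of k'] mk by linarith
 also have "\<dots> \<le> 4 * k' * (n + 2)" by (simp add: algebra_simps)
 finally have 1: "scan_cost m w \<le> 4 * k' * (n + 2)" .
 have "1 \<le> (n + 2) ^ K" by simp
 then have 2: "Suc t \<le> 2 * (n + 2) ^ K" using t by linarith
 have "scan_cost m w * Suc t \<le> (4 * k' * (n + 2)) * (2 * (n + 2) ^ K)" by (rule mult_le_mono[OF 1 2])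
 also have "\<dots> = 2 ^ 4 * p * (n + 2) ^ (K + 1)" by (simp add: k' algebra_simps)
 \<comment> \<open>The constant \<open>p\<close> is absorbed as
   \<open>p \<le> 2 ^ p \<le> (n + 2) ^ p\<close>. Having \<open>k'\<close> twice as large as
   \<open>p\<close> leaves the other half for the remaining exponents.\<close>
 also have "\<dots> \<le> (n + 2) ^ 4 * (n + 2) ^ p * (n + 2) ^ (K + 1)"
 proof (intro mult_le_mono order_refl)
  show "(2::nat) ^ 4 \<le> (n + 2) ^ 4" by (rule power_mono) auto
  have "p \<le> 2 ^ p" by (rule less_imp_le[OF less_exp])
  also have "\<dots> \<le> (n + 2) ^ p" by (rule power_mono) auto
  finally show "p \<le> (n + 2) ^ p" .
 qed
 also have "\<dots> = (n + 2) ^ (4 + p + (K + 1))" by (simp only: power_add)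
 also have "\<dots> \<le> (n + 2) ^ k'" by (rule inc) (use pJ k' in linarith)
 finally show "scan_cost m w * Suc t \<le> poly_bound k' n" by (simp add: poly_bound_def)
qed

context machp begin

lemma Z_poly: "\<exists>KZ. \<forall>n. Z n * Z n \<le> (n + 2) ^ KZ"
proof -
 from spec[OF C.pbd_CF[OF C.Zc, unfolded C.pbd_def], of 0]
 obtain K where K: "\<forall>x e (z :: bool list). (\<forall>i<(0::nat). e i \<le> pb 0 x) \<longrightarrow> length z = Z (length x) \<longrightarrow> Z (length x) \<le> pb K x" by (rule exE)
 have "Z n * Z n \<le> (n + 2) ^ (K + K)" for n
 proof -
  have "Z n \<le> (n + 2) ^ K" using K[THEN spec, of "replicate n False", THEN spec, of "\<lambda>_. 0", THEN spec, of "replicate (Z n) False"] by (simp add: pb_def)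
  from mult_le_mono[OF this this] show ?thesis by (simp add: power_add)
 qed
 then show ?thesis by blast
qed

lemma in_CL:
 assumes ans: "\<And>x z. length z = Z (length x) ==> C.I.good x z ==> C.I.ans x (s0 (length x)) z \<longleftrightarrow> x \<in> L"
 shows "L \<in> CL"
proof -
 obtain P K where P: "no_rand P" and bs: "\<And>x r T. Z (length x) * Z (length x) \<le> length T ==>
  \<exists>t s'. bs (pb K x) x r P (pinit T) t s' \<and> tape s' = T \<and> C.outcome x (regs s' 0 \<noteq> 0) True []"
  using C.det_prog[OF ex_good] by blast
 obtain m0 where "com_below m0 P" using com_below_ex by blast
 then obtain m where m: "com_below m P" "0 < m" using com_below_mono[of m0 P "Suc m0"] by auto
 obtain M' where M': "wf_machine M'" "deterministic M'" and run: "\<And>B x r w T t s' t'. bs B x r P (pinit T) t s' ==> B < 2 ^ w ==>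
   scan_cost m w * Suc t \<le> t' ==> halted M' (run M' x r (m * w) T t') \<and> ct (run M' x r (m * w) T t') = tape s' \<and>
    (st (run M' x r (m * w) T t') = acc M' \<longleftrightarrow> regs s' 0 \<noteq> 0)"
  using compile[OF m] P by blast
 obtain KZ where KZ: "\<And>n. Z n * Z n \<le> (n + 2) ^ KZ" using Z_poly by blast
 let ?k = "m * (2 * (K + KZ + 8))"
 have "\<exists>t. let c = run M' x [] (work_bound ?k (length x)) tau t in halted M' c \<and> ct c = tau \<and> (st c = acc M' \<longleftrightarrow> x \<in> L)"
  if l: "length tau = poly_bound ?k (length x)" for x tau
 proof -
  note rs = resources[OF m(2), where K = K and KZ = KZ and n = "length x"]
  have "Z (length x) * Z (length x) \<le> length tau" using KZ[of "length x"] rs(3) unfolding l by linarith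
  then obtain t s' where b: "bs (pb K x) x [] P (pinit tau) t s'" "tape s' = tau" "C.outcome x (regs s' 0 \<noteq> 0) True []" using bs[of x tau "[]"] by blast
  obtain z where z: "length z = Z (length x)" "C.I.good x z" "(regs s' 0 \<noteq> 0) \<longleftrightarrow> C.I.ans x (s0 (length x)) z"
   using b(3) unfolding C.outcome_def by blast
  have "pb K x < 2 ^ (2 * (K + KZ + 8) * lg (length x))" using rs(2) by (simp add: pb_def)
  from run[OF b(1) this order_refl] b(2) z ans[OF z(1,2)] show ?thesis unfolding rs(1) Let_def by blast
 qed
 then show ?thesis unfolding CL_def using M' by blast
qed

text \<open>The constructed machine always halts in time and always restores its tape. A wrong
  answer requires a random block that is not good, an event of probability at most
  \<open>1 / 2 - eps\<close> by the choice of \<open>g1\<close>.\<close>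

lemma in_BPCLP:
 assumes ans: "\<And>x z. length z = Z (length x) ==> C.I.good x z ==> C.I.ans x (s0 (length x)) z \<longleftrightarrow> x \<in> L"
  and g1: "1 \<le> (1 / 2 - eps) * 2 ^ g1" and delta: "0 \<le> delta"
 shows "L \<in> BPCLP eps delta"
proof -
 obtain P K where bs: "\<And>x r T. Z (length x) * Z (length x) \<le> length T ==>
  \<exists>t s'. bs (pb K x) x r P (pinit T) t s' \<and> t \<le> pb K x \<and> tape s' = T \<and> C.outcome x (regs s' 0 \<noteq> 0) False (C.rblk x r)"
  using C.rand_prog by blast
 obtain m0 where "com_below m0 P" using com_below_ex by blast
 then obtain m where m: "com_below m P" "0 < m" using com_below_mono[of m0 P "Suc m0"] by auto
 obtain M' where M': "wf_machine M'" and run: "\<And>B x r w T t s' t'. bs B x r P (pinit T) t s' ==> B < 2 ^ w ==>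
   scan_cost m w * Suc t \<le> t' ==> halted M' (run M' x r (m * w) T t') \<and> ct (run M' x r (m * w) T t') = tape s' \<and>
    (st (run M' x r (m * w) T t') = acc M' \<longleftrightarrow> regs s' 0 \<noteq> 0)"
  using compile[OF m] by blast
 obtain KZ where KZ: "\<And>n. Z n * Z n \<le> (n + 2) ^ KZ" using Z_poly by blast
 let ?k = "m * (2 * (K + KZ + 8))"
 have "let n = length x; s = work_bound ?k n; T = poly_bound ?k n; m = 2 ^ length tau in
     (\<forall>r. length r = m \<longrightarrow> halted M' (run M' x r s tau T)) \<and>
     prob_rand m (\<lambda>r. st (run M' x r s tau T) = acc M' \<longleftrightarrow> x \<in> L) \<ge> 1/2 + eps \<and>
     prob_rand m (\<lambda>r. ct (run M' x r s tau T) = tau) \<ge> 1 - delta"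
  if l: "length tau = poly_bound ?k (length x)" for x tau
 proof -
  let ?Z = "Z (length x)" let ?m = "2 ^ length tau"
  note rs = resources[OF m(2), where K = K and KZ = KZ and n = "length x"]
  have Zl: "?Z * ?Z \<le> length tau" using KZ[of "length x"] rs(3) unfolding l by linarith
  let ?c = "\<lambda>r. run M' x r (work_bound ?k (length x)) tau (poly_bound ?k (length x))"
  have key: "halted M' (?c r) \<and> ct (?c r) = tau \<and> (C.I.good x (C.rblk x r) \<longrightarrow> (st (?c r) = acc M' \<longleftrightarrow> x \<in> L))" for r
  proof -
   obtain t s' where b: "bs (pb K x) x r P (pinit tau) t s'" "t \<le> pb K x" "tape s' = tau" "C.outcome x (regs s' 0 \<noteq> 0) False (C.rblk x r)"
    using bs[OF Zl, of r] by blast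
   obtain z where z: "length z = ?Z" "C.I.good x z \<or> z = C.rblk x r" "(regs s' 0 \<noteq> 0) \<longleftrightarrow> C.I.ans x (s0 (length x)) z"
    using b(4) unfolding C.outcome_def by blast
   have B: "pb K x < 2 ^ (2 * (K + KZ + 8) * lg (length x))" using rs(2) by (simp add: pb_def)
   have t: "scan_cost m (2 * (K + KZ + 8) * lg (length x)) * Suc t \<le> poly_bound ?k (length x)" using rs(4) b(2) by (simp add: pb_def)
   have r: "halted M' (?c r) \<and> ct (?c r) = tau \<and> (st (?c r) = acc M' \<longleftrightarrow> C.I.ans x (s0 (length x)) z)"
    using run[OF b(1) B t] b(3) z(3) unfolding rs(1) by blast
   have "C.I.good x (C.rblk x r) ==> C.I.ans x (s0 (length x)) z \<longleftrightarrow> x \<in> L" using z(2) ans[OF z(1)] by blast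
   then show ?thesis using r by blast
  qed
  have "?Z \<le> ?Z * ?Z" using C.Zpos[of "length x"] by simp
  then have Zm: "?Z \<le> ?m" using Zl less_exp[of "length tau"] by linarith
  have rb: "C.rblk x r = C.rblk x (take ?Z r)" for r
   unfolding C.rblk_def by (rule map_cong[OF refl]) (simp add: read_rand_def)
  have rv: "C.rblk x r = rev r" if "length r = ?Z" for r
   by (rule nth_equalityI) (use that in \<open>auto simp: C.rblk_def read_rand_def rev_nth\<close>)
  \<comment> \<open>Filling the virtual block in reverse order is a bijection on strings, so good
    blocks are hit with the right frequency.\<close>
  have "{r. length r = ?Z \<and> C.I.good x (C.rblk x r)} = rev ` {z. length z = ?Z \<and> C.I.good x z}"
  proof (intro equalityI subsetI)
   fix r assume "r \<in> {r. length r = ?Z \<and> C.I.good x (C.rblk x r)}"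
   then show "r \<in> rev ` {z. length z = ?Z \<and> C.I.good x z}" using rv[of r] by (intro image_eqI[of _ _ "rev r"]) auto
  qed (use rv in auto)
  then have cg: "card {r. length r = ?Z \<and> C.I.good x (C.rblk x r)} = card {z. length z = ?Z \<and> C.I.good x z}"
   by (simp add: card_image inj_on_def)
  have "card {z. length z = ?Z \<and> C.I.good x z} + card {z. length z = ?Z \<and> \<not> C.I.good x z} =
    card ({z. length z = ?Z \<and> C.I.good x z} \<union> {z. length z = ?Z \<and> \<not> C.I.good x z})"
   by (rule card_Un_disjoint[symmetric]) (auto simp: finite_bl)
  also have "{z. length z = ?Z \<and> C.I.good x z} \<union> {z. length z = ?Z \<and> \<not> C.I.good x z} = {z. length z = ?Z}" by auto
  finally have tot: "card {z. length z = ?Z \<and> C.I.good x z} + card {z. length z = ?Z \<and> \<not> C.I.good x z} = 2 ^ ?Z" by (simp add: card_bl)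
  let ?b = "real (card {z. length z = ?Z \<and> \<not> C.I.good x z})"
  have "real (card {z. length z = ?Z \<and> \<not> C.I.good x z} * 2 ^ g1) \<le> real (2 ^ ?Z)" using not_good_card[of x] unfolding of_nat_le_iff .
  then have b1: "?b * 2 ^ g1 \<le> 2 ^ ?Z" by simp
  have "(2::real) ^ ?Z * 1 \<le> 2 ^ ?Z * ((1 / 2 - eps) * 2 ^ g1)" using g1 by (intro mult_left_mono) auto
  then have "(2::real) ^ ?Z \<le> (2 ^ ?Z * (1 / 2 - eps)) * 2 ^ g1" by (simp only: mult_1_right mult.assoc)
  with b1 have "?b * 2 ^ g1 \<le> (2 ^ ?Z * (1 / 2 - eps)) * 2 ^ g1" by (rule order_trans)
  then have b2: "?b \<le> 2 ^ ?Z * (1 / 2 - eps)" by (rule mult_right_le_imp_le) simp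
  have "real (card {z. length z = ?Z \<and> C.I.good x z}) = 2 ^ ?Z - ?b" using arg_cong[OF tot, of real] by simp
  then have "2 ^ ?Z * (1 / 2 + eps) \<le> real (card {z. length z = ?Z \<and> C.I.good x z})" using b2 by (simp add: algebra_simps)
  then have "1 / 2 + eps \<le> real (card {z. length z = ?Z \<and> C.I.good x z}) / 2 ^ ?Z" by (simp add: field_simps)
  also have "\<dots> = prob_rand ?m (\<lambda>r. C.I.good x (C.rblk x (take ?Z r)))"
   unfolding prob_prefix[OF Zm, of "\<lambda>r. C.I.good x (C.rblk x r)"] cg by (rule refl)
  also have "\<dots> \<le> prob_rand ?m (\<lambda>r. st (?c r) = acc M' \<longleftrightarrow> x \<in> L)"
  proof (rule prob_mono)
   fix r assume "C.I.good x (C.rblk x (take ?Z r))"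
   then have "C.I.good x (C.rblk x r)" unfolding rb[of r, symmetric] .
   then show "(st (?c r) = acc M') = (x \<in> L)" using key[of r] by blast
  qed
  finally have p: "1 / 2 + eps \<le> prob_rand ?m (\<lambda>r. st (?c r) = acc M' \<longleftrightarrow> x \<in> L)" .
  have "prob_rand ?m (\<lambda>r. ct (?c r) = tau) = 1" using key by (simp add: prob_rand_def card_bl)
  then show ?thesis using key p delta unfolding Let_def by simp
 qed
 then show ?thesis unfolding BPCLP_def using M' by blast
qed

end

section \<open>The two inclusions\<close>

lemma rh_det: "deterministic M ==> rh (run M x r s t i) = 0"
proof (induction i)
 case (Suc i)
 have d: "\<not> radv (trans M q a w c v)" for q a w c v using Suc.prems by (cases v) (auto simp: deterministic_def)
 show ?case unfolding run_Suc using Suc d by (simp add: step_def Let_def)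
qed (simp add: run_def init_def)

lemma CL_sub:
 fixes eps delta :: real
 assumes "0 \<le> delta" "2 * eps < 1"
 shows "CL \<subseteq> BPCLP eps delta"
proof
 fix L assume "L \<in> CL"
 then obtain k M where M: "wf_machine M" "deterministic M" and r: "\<And>x tau. length tau = poly_bound k (length x) ==>
   \<exists>t. let c = run M x [] (work_bound k (length x)) tau t in halted M c \<and> ct c = tau \<and> (st c = acc M \<longleftrightarrow> x \<in> L)"
  unfolding CL_def by blast
 obtain g1 where "1 / (1 / 2 - eps) < 2 ^ g1" using real_arch_pow[of 2 "1 / (1 / 2 - eps)"] by auto
 then have g1: "1 \<le> (1 / 2 - eps) * 2 ^ g1" using assms(2) by (simp add: field_simps)
 \<comment> \<open>Without random bits the probabilities are 0 or 1, so the gap is 1 and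
   \<open>g0 = 1\<close> suffices. There are no rows, and the only possible defect is a tour that is
   too long.\<close>
 interpret P: machp M k False 1 g1 by unfold_locales (rule M)
 show "L \<in> BPCLP eps delta"
 proof (rule P.in_BPCLP[OF _ g1 assms(1)])
  fix x z assume "P.C.I.good x z"
  define t where "t = P.C.I.tau x z"
  let ?n = "length x"
  have tl: "length t = P.cn ?n" unfolding t_def by (rule P.C.I.length_tau)
  have R: "P.Rn ?n = 0" by (simp add: P.Rn_def)
  have wk: "P.wk ?n = work_bound k ?n" by (simp add: P.wk_def work_lg)
  obtain T where T: "halted M (run M x [] (P.wk ?n) t T)" "ct (run M x [] (P.wk ?n) t T) = t" "st (run M x [] (P.wk ?n) t T) = acc M \<longleftrightarrow> x \<in> L"
   using r[OF tl[unfolded P.cn_def poly_bound_def[symmetric]]] unfolding wk Let_def by blast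
  have e: "{l :: bool list. length l = 0 \<and> Q l} = (if Q [] then {[]} else {})" for Q by auto
  have h: "halted M (run M x l (P.wk ?n) t T)" if "length l = P.Rn ?n" for l using that T(1) unfolding R by simp
  have z: "rh (run M x l (P.wk ?n) t i) \<le> P.Rn ?n" if "length l = P.Rn ?n" "i \<le> T" for l i unfolding rh_det[OF M(2)] by (rule le0)
  define a1 where "a1 = P.C.I.pr x (P.s0 ?n) t 1"
  define a2 where "a2 = P.C.I.pr x (P.s0 ?n) t 2"
  have "a1 = real (card {l. length l = 0 \<and> st (run M x l (P.wk ?n) t T) = acc M \<and> ct (run M x l (P.wk ?n) t T) = t}) / 2 ^ 0"
   using P.pr_run(1)[OF tl z h, folded a1_def] unfolding R .
  then have p1: "a1 = of_bool (x \<in> L)" unfolding e using T(2,3) by simp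
  have "a2 = real (card {l. length l = 0 \<and> st (run M x l (P.wk ?n) t T) \<noteq> acc M \<and> ct (run M x l (P.wk ?n) t T) = t}) / 2 ^ 0"
   using P.pr_run(2)[OF tl z h, folded a2_def] unfolding R .
  then have p2: "a2 = of_bool (x \<notin> L)" unfolding e using T(2,3) by simp
  have g: "(1::real) < 1 * 2 ^ 1" by simp
  show "P.C.I.ans x (P.s0 ?n) z \<longleftrightarrow> x \<in> L"
   by (rule P.ans_L[OF \<open>P.C.I.good x z\<close> g, folded t_def, folded a1_def a2_def]) (simp_all add: p1 p2)
 qed
qed

text \<open>With \<open>A\<close> the event of a right answer and \<open>C\<close> that of a
  restored tape, the difference of the weights of \<open>A \<inter> C\<close> and
  \<open>C - A\<close> is twice that of \<open>A \<inter> C\<close> minus that of \<open>C\<close>.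
  By the union bound this is at least
  \<open>2 * (1 / 2 + eps) + (1 - delta) - 2 = 2 * eps - delta\<close>. A short tour sees only runs
  that restore the tape, so this is the gap that counting needs.\<close>

lemma BPCLP_sub:
 fixes eps delta :: real
 assumes "delta < 2 * eps"
 shows "BPCLP eps delta \<subseteq> CL"
proof
 fix L assume "L \<in> BPCLP eps delta"
 then obtain k M where M: "wf_machine M" and r: "\<And>x tau. length tau = poly_bound k (length x) ==>
   (\<forall>r. length r = 2 ^ length tau \<longrightarrow> halted M (run M x r (work_bound k (length x)) tau (poly_bound k (length x)))) \<and>
   prob_rand (2 ^ length tau) (\<lambda>r. st (run M x r (work_bound k (length x)) tau (poly_bound k (length x))) = acc M \<longleftrightarrow> x \<in> L) \<ge> 1/2 + eps \<and>
   prob_rand (2 ^ length tau) (\<lambda>r. ct (run M x r (work_bound k (length x)) tau (poly_bound k (length x))) = tau) \<ge> 1 - delta"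
  unfolding BPCLP_def Let_def by blast
 define \<gamma> where "\<gamma> = 2 * eps - delta"
 have \<gamma>: "0 < \<gamma>" using assms by (simp add: \<gamma>_def)
 obtain g0 where "1 / \<gamma> < 2 ^ g0" using real_arch_pow[of 2 "1 / \<gamma>"] by auto
 then have g0: "1 < \<gamma> * 2 ^ g0" using \<gamma> by (simp add: field_simps)
 \<comment> \<open>The deterministic search needs only that some good block exists, hence
   \<open>g1 = 0\<close>.\<close>
 interpret P: machp M k True g0 0 by unfold_locales (rule M)
 show "L \<in> CL"
 proof (rule P.in_CL)
  fix x z assume good: "P.C.I.good x z"
  define t where "t = P.C.I.tau x z"
  let ?n = "length x" let ?T = "poly_bound k ?n" let ?m = "(2::nat) ^ length t"
  have R: "P.Rn ?n = ?T" by (simp add: P.Rn_def poly_bound_def)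
  have tc: "length t = P.cn ?n" unfolding t_def by (rule P.C.I.length_tau)
  have tl: "length t = ?T" unfolding tc by (simp only: P.cn_def poly_bound_def)
  have wk: "P.wk ?n = work_bound k ?n" by (simp add: P.wk_def work_lg)
  have Tm: "?T \<le> ?m" unfolding tl by (rule less_imp_le[OF less_exp])
  let ?c = "\<lambda>l. run M x l (work_bound k ?n) t ?T"
  have tk: "?c r = ?c (take ?T r)" for r by (rule run_take) simp
  \<comment> \<open>The class speaks of strings of length \<open>2 ^ length t\<close>. A string of
    \<open>?T\<close> bits is padded, which a run of \<open>?T\<close> steps cannot notice.\<close>
  have hl: "halted M (?c l)" if l: "length l = ?T" for l
  proof -
   have "?c (l @ replicate (?m - ?T) False) = ?c l" using tk[of "l @ replicate (?m - ?T) False"] l by simp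
   moreover have "length (l @ replicate (?m - ?T) False) = ?m" using l Tm by simp
   then have "halted M (?c (l @ replicate (?m - ?T) False))" using r[OF tl] by blast
   ultimately show ?thesis by (simp only:)
  qed
  define A where "A = {l. length l = ?T \<and> (st (?c l) = acc M \<longleftrightarrow> x \<in> L)}"
  define C where "C = {l. length l = ?T \<and> ct (?c l) = t}"
  have "prob_rand ?m (\<lambda>r. st (?c r) = acc M \<longleftrightarrow> x \<in> L) = prob_rand ?m (\<lambda>r. st (?c (take ?T r)) = acc M \<longleftrightarrow> x \<in> L)" unfolding tk[symmetric] ..
  also have "\<dots> = real (card A) / 2 ^ ?T" unfolding A_def by (rule prob_prefix[OF Tm])
  finally have pA: "1 / 2 + eps \<le> real (card A) / 2 ^ ?T" using r[OF tl] by simp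
  have "prob_rand ?m (\<lambda>r. ct (?c r) = t) = prob_rand ?m (\<lambda>r. ct (?c (take ?T r)) = t)" unfolding tk[symmetric] ..
  also have "\<dots> = real (card C) / 2 ^ ?T" unfolding C_def by (rule prob_prefix[OF Tm])
  finally have pC: "1 - delta \<le> real (card C) / 2 ^ ?T" using r[OF tl] by simp
  have fin: "finite A" "finite C" unfolding A_def C_def by (rule finite_bl)+
  have "card (A \<union> C) \<le> card {l :: bool list. length l = ?T}"
   by (rule card_mono) (use finite_bl[of ?T "\<lambda>_. True"] in \<open>auto simp: A_def C_def\<close>)
  then have u: "card A + card C \<le> 2 ^ ?T + card (A \<inter> C)" using card_Un_Int[OF fin] by (simp add: card_bl)
  have "card ((A \<inter> C) \<union> (C - A)) = card (A \<inter> C) + card (C - A)" by (rule card_Un_disjoint) (use fin in auto)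
  moreover have "(A \<inter> C) \<union> (C - A) = C" by blast
  ultimately have sp: "card C = card (A \<inter> C) + card (C - A)" by (simp only:)
  have ur: "real (card A) + real (card C) \<le> 2 ^ ?T + real (card (A \<inter> C))"
  using u[folded of_nat_le_iff[where 'a = real]] by simp
  have "real (card (A \<inter> C)) - real (card (C - A)) \<ge> 2 * real (card A) + real (card C) - 2 * 2 ^ ?T" using ur sp by simp
  then have "(real (card (A \<inter> C)) - real (card (C - A))) / 2 ^ ?T \<ge> (2 * real (card A) + real (card C) - 2 * 2 ^ ?T) / 2 ^ ?T" by (rule divide_right_mono) simp
  then have df: "\<gamma> \<le> real (card (A \<inter> C)) / 2 ^ ?T - real (card (C - A)) / 2 ^ ?T" using pA pC by (simp add: \<gamma>_def add_divide_distrib diff_divide_distrib)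
  have rb: "rh (run M x l (P.wk ?n) t i) \<le> P.Rn ?n" if "length l = P.Rn ?n" "i \<le> ?T" for l i
   using run_rh[of M x l "P.wk ?n" t i] that(2) unfolding R by (rule order_trans)
  have h: "halted M (run M x l (P.wk ?n) t ?T)" if "length l = P.Rn ?n" for l
   unfolding wk by (rule hl) (use that R in simp)
  define a1 where "a1 = P.C.I.pr x (P.s0 ?n) t 1"
  define a2 where "a2 = P.C.I.pr x (P.s0 ?n) t 2"
  have pr: "a1 = real (card {l. length l = ?T \<and> st (?c l) = acc M \<and> ct (?c l) = t}) / 2 ^ ?T"
   using P.pr_run(1)[OF tc rb h, folded a1_def] unfolding R wk .
  have pr2: "a2 = real (card {l. length l = ?T \<and> st (?c l) \<noteq> acc M \<and> ct (?c l) = t}) / 2 ^ ?T"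
   using P.pr_run(2)[OF tc rb h, folded a2_def] unfolding R wk .
  show "P.C.I.ans x (P.s0 ?n) z \<longleftrightarrow> x \<in> L"
  proof (rule P.ans_L[OF good g0, folded t_def, folded a1_def a2_def])
   assume x: "x \<in> L"
   have "{l. length l = ?T \<and> st (?c l) = acc M \<and> ct (?c l) = t} = A \<inter> C" "{l. length l = ?T \<and> st (?c l) \<noteq> acc M \<and> ct (?c l) = t} = C - A"
    using x by (auto simp: A_def C_def)
   then show "\<gamma> \<le> a1 - a2" unfolding pr pr2 using df by (simp only:)
  next
   assume x: "x \<notin> L"
   have "{l. length l = ?T \<and> st (?c l) \<noteq> acc M \<and> ct (?c l) = t} = A \<inter> C" "{l. length l = ?T \<and> st (?c l) = acc M \<and> ct (?c l) = t} = C - A"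
    using x by (auto simp: A_def C_def)
   then show "\<gamma> \<le> a2 - a1" unfolding pr pr2 using df by (simp only:)
  qed
 qed
qed

theorem theorem4p4:
 fixes eps delta :: real
 assumes "0 \<le> delta" and "delta < 2 * eps" and "2 * eps < 1"
 shows "BPCLP eps delta = CL"
 using CL_sub[OF assms(1,3)] BPCLP_sub[OF assms(2)] by (rule equalityI[rotated])

end
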